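(* Let $X_t$ solve the SDE $dX_t=b(X_t)dt+\sigma(X_t)dB_t$ on $\mathbb R^d$ with $C^3$ coefficients and generator $\mathcal L=\sum_{i,j}a_{ij}\partial_{ij}+\sum_i b_i\partial_i$, $a=\tfrac12\sigma\sigma^T$ (uniformly elliptic on the domain below). Assume $X_t$ is geometrically ergodic with invariant probability measure $\pi$ and Lyapunov function $V:\mathbb R^d\to[1,\infty)$ with $\pi(V^2)<\infty$. Let $D\subset\mathbb R^d$ be a bounded domain with $C^4$ boundary, and let $c_0$ be a $C^3$ function such that (a) $\pi(\mathbf 1_Dc_0)<0$, and (b) $F:=c_0\mathbf 1_D-\pi(\mathbf 1_Dc_0)$ takes values in $[-1,1]$ and has strictly positive asymptotic variance $\sigma^2=\lim_{t\to\infty}\mathrm{Var}_x\big[t^{-1/2}\int_0^tF(X_s)ds\big]>0$. Then there exists $\alpha_0>0$ such that for every $0<\alpha<\alpha_0$, every bounded $C^2$ function $f<0$ and every $C^2$ function $\psi>0$, the Dirichlet problem $\mathcal Lu+\alpha c_0u=f$ in $D$, $u=\psi$ on $\partial D$, admits a strictly positive solution $u$.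
   Context: Geometric ergodicity means: there exist $r\in(0,1)$-type exponential rate constants such that $|\mathbb E_xf(X_t)-\pi(f)|\le Ce^{-\rho t}V(x)$ for all measurable $|f|\le V$. Uniform ellipticity on $D$: $\Lambda_1|\eta|^2\le\sum a_{ij}(x)\eta_i\eta_j\le\Lambda_2|\eta|^2$ for $x\in D$ with $\Lambda_1,\Lambda_2>0$. *)

theory Defs
  imports "HOL-Analysis.Analysis" "HOL-Probability.Probability"
begin

fun Ck_on :: "nat \<Rightarrow> 'a::real_normed_vector set \<Rightarrow> ('a \<Rightarrow> 'b::real_normed_vector) \<Rightarrow> bool" where
  "Ck_on 0 S f = continuous_on S f"
| "Ck_on (Suc k) S f = (f differentiable_on S \<and>
      (\<forall>v. Ck_on k S (\<lambda>x. frechet_derivative f (at x) v)))"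

definition pd :: "'d::finite \<Rightarrow> (real^'d \<Rightarrow> real) \<Rightarrow> real^'d \<Rightarrow> real" where
  "pd i u x = frechet_derivative u (at x) (axis i 1)"

definition diff_mat :: "(real^'d \<Rightarrow> real^'m::finite^'d::finite) \<Rightarrow> real^'d \<Rightarrow> real^'d^'d" where
  "diff_mat \<sigma> x = (1/2) *\<^sub>R (\<sigma> x ** transpose (\<sigma> x))"

definition gen :: "(real^'d \<Rightarrow> real^'m::finite^'d::finite) \<Rightarrow> (real^'d \<Rightarrow> real^'d)
    \<Rightarrow> (real^'d \<Rightarrow> real) \<Rightarrow> real^'d \<Rightarrow> real" where
  "gen \<sigma> b u x = (\<Sum>i\<in>UNIV. \<Sum>j\<in>UNIV. diff_mat \<sigma> x $ i $ j * pd i (pd j u) x)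
                 + (\<Sum>i\<in>UNIV. b x $ i * pd i u x)"

definition uniformly_elliptic_on :: "(real^'d::finite) set \<Rightarrow> (real^'d \<Rightarrow> real^'d^'d) \<Rightarrow> bool" where
  "uniformly_elliptic_on D A \<longleftrightarrow> (\<exists>\<Lambda>1 \<Lambda>2. 0 < \<Lambda>1 \<and> 0 < \<Lambda>2 \<and>
     (\<forall>x\<in>D. \<forall>\<eta>. \<Lambda>1 * (norm \<eta>)\<^sup>2 \<le> (\<Sum>i\<in>UNIV. \<Sum>j\<in>UNIV. A x $ i $ j * \<eta> $ i * \<eta> $ j)
              \<and> (\<Sum>i\<in>UNIV. \<Sum>j\<in>UNIV. A x $ i $ j * \<eta> $ i * \<eta> $ j) \<le> \<Lambda>2 * (norm \<eta>)\<^sup>2))"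

definition nat_filtration :: "'w measure \<Rightarrow> (real \<Rightarrow> 'w \<Rightarrow> 'x::topological_space) \<Rightarrow> real \<Rightarrow> 'w measure" where
  "nat_filtration M Y s = sigma (space M) {Y r -` A \<inter> space M | r A. r \<in> {0..s} \<and> A \<in> sets borel}"

text \<open>(M x, X x) is, for every starting point x, a continuous weak solution of the SDE
  dX = b(X) dt + sigma(X) dB started at x, in the (equivalent) martingale-problem formulation:
  f(X_t) - f(x) - int_0^t Lf(X_r) dr is a martingale for every compactly supported C^2 f.\<close>
definition solves_sde :: "(real^'d \<Rightarrow> real^'m::finite^'d::finite) \<Rightarrow> (real^'d \<Rightarrow> real^'d)
    \<Rightarrow> (real^'d \<Rightarrow> 'w measure) \<Rightarrow> (real^'d \<Rightarrow> real \<Rightarrow> 'w \<Rightarrow> real^'d) \<Rightarrow> bool" where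
  "solves_sde \<sigma> b M X \<longleftrightarrow> (\<forall>x.
     prob_space (M x) \<and>
     (\<forall>t. X x t \<in> borel_measurable (M x)) \<and>
     (\<forall>\<omega>\<in>space (M x). X x 0 \<omega> = x \<and> continuous_on {0..} (\<lambda>t. X x t \<omega>)) \<and>
     (\<forall>f. Ck_on 2 UNIV f \<and> (\<exists>K. compact K \<and> (\<forall>y. y \<notin> K \<longrightarrow> f y = 0)) \<longrightarrow>
        (\<forall>s t. 0 \<le> s \<and> s \<le> t \<longrightarrow>
          (AE \<omega> in M x.
             real_cond_exp (M x) (nat_filtration (M x) (X x) s)
               (\<lambda>\<omega>'. f (X x t \<omega>') - f x - (LINT r:{0..t}|lborel. gen \<sigma> b f (X x r \<omega>'))) \<omega>
             = f (X x s \<omega>) - f x - (LINT r:{0..s}|lborel. gen \<sigma> b f (X x r \<omega>))))))"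

definition invariant_prob :: "(real^'d::finite \<Rightarrow> 'w measure) \<Rightarrow> (real^'d \<Rightarrow> real \<Rightarrow> 'w \<Rightarrow> real^'d)
    \<Rightarrow> (real^'d) measure \<Rightarrow> bool" where
  "invariant_prob M X \<pi> \<longleftrightarrow> prob_space \<pi> \<and> sets \<pi> = sets borel \<and>
     (\<forall>t\<ge>0. \<forall>A\<in>sets borel.
        (\<integral>\<^sup>+ x. emeasure (M x) {\<omega>\<in>space (M x). X x t \<omega> \<in> A} \<partial>\<pi>) = emeasure \<pi> A)"

definition geom_ergodic :: "(real^'d::finite \<Rightarrow> 'w measure) \<Rightarrow> (real^'d \<Rightarrow> real \<Rightarrow> 'w \<Rightarrow> real^'d)
    \<Rightarrow> (real^'d) measure \<Rightarrow> (real^'d \<Rightarrow> real) \<Rightarrow> bool" where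
  "geom_ergodic M X \<pi> V \<longleftrightarrow> (\<exists>C \<rho>. 0 < C \<and> 0 < \<rho> \<and>
     (\<forall>x t f. 0 \<le> t \<and> f \<in> borel_measurable borel \<and> (\<forall>y. \<bar>f y\<bar> \<le> V y) \<longrightarrow>
        \<bar>(\<integral>\<omega>. f (X x t \<omega>) \<partial>M x) - (\<integral>y. f y \<partial>\<pi>)\<bar> \<le> C * exp (- \<rho> * t) * V x))"

definition C4_boundary :: "(real^'d::finite) set \<Rightarrow> bool" where
  "C4_boundary D \<longleftrightarrow> (\<forall>p\<in>frontier D. \<exists>r>0. \<exists>\<rho>::real^'d \<Rightarrow> real.
     Ck_on 4 (ball p r) \<rho> \<and> (\<forall>x\<in>ball p r. frechet_derivative \<rho> (at x) \<noteq> (\<lambda>v. 0)) \<and>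
     D \<inter> ball p r = {x\<in>ball p r. \<rho> x < 0})"

end

theory Submission
  imports Defs
begin

text \<open>
  The second-order part of the generator is written as a sum of second derivatives along finitely many fixed
  directions with positive \<open>C\<^sup>3\<close> weights; replacing derivatives by difference quotients along these directions
  then gives a monotone scheme. If \<open>\<alpha>\<close> is small compared with the inverse of a supersolution of the scheme,
  the zeroth-order term does not destroy the comparison principle, whatever the sign of \<open>c\<^sub>0\<close>. Comparison yields
  discrete solutions that are positive and bounded uniformly in the mesh size, and barriers built from the
  defining functions of the boundary control them near \<open>\<partial>D\<close>. A discrete version of Bernstein's method
  bounds their first and second differences in the interior and, after averaging the data, gives equicontinuity
  of the second differences. A cluster point along the dyadic meshes \<open>2\<^sup>-\<^sup>n\<close> is therefore a \<open>C\<^sup>2\<close> solution;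
  it inherits a positive lower bound from the discrete solutions.
\<close>

section \<open>Monotone difference operators\<close>

text \<open>The discrete equation is imposed at every point of \<open>D\<close>, not on a grid, and
  couples a point only with its translates along the directions. Two difficulties shape the proof. A
  discrete solution is a mere function, so suprema need not be attained, and each maximum principle
  works with a near-maximum or a quantified strict inequality. And bounds on difference quotients
  say nothing about translations off the lattice through a point, so continuity of the limit comes
  from comparing a solution with its own translates.

  The range of \<open>\<alpha>\<close> is fixed before \<open>f\<close> and \<open>\<psi>\<close>:
  if \<open>Lh h S \<le> -1\<close> and \<open>S \<le> Sm\<close> on \<open>D\<close>, then
  \<open>\<bar>\<alpha> * c0 x\<bar> * Sm \<le> 1 / 2\<close> keeps \<open>S\<close> a strict
  supersolution of the full operator. The three derivatives of the coefficients are spent on a bound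
  for third differences, which gives the modulus of second differences. Meshes are dyadic because a
  fixed dyadic step is a whole number of steps of every finer mesh.\<close>

definition fdiff :: "real \<Rightarrow> 'a::real_vector \<Rightarrow> ('a \<Rightarrow> real) \<Rightarrow> 'a \<Rightarrow> real" where
  "fdiff h l u x = (u (x + h *\<^sub>R l) - u x) / h"

definition fdiffs :: "real \<Rightarrow> 'a::real_vector list \<Rightarrow> ('a \<Rightarrow> real) \<Rightarrow> 'a \<Rightarrow> real" where
  "fdiffs h \<alpha> = foldr (fdiff h) \<alpha>"

lemma fdiffs_Nil [simp]: "fdiffs h [] u = u"
  by (simp add: fdiffs_def)

lemma fdiffs_Cons: "fdiffs h (l # \<alpha>) u = fdiff h l (fdiffs h \<alpha> u)"
  by (simp add: fdiffs_def)

lemma fdiffs_append: "fdiffs h (\<alpha> @ \<beta>) u = fdiffs h \<alpha> (fdiffs h \<beta> u)"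
  by (simp add: fdiffs_def)

lemma fdiff_add: "fdiff h l (\<lambda>x. u x + v x) = (\<lambda>x. fdiff h l u x + fdiff h l v x)"
  by (auto simp: fdiff_def fun_eq_iff add_divide_distrib diff_divide_distrib)

lemma fdiff_diff: "fdiff h l (\<lambda>x. u x - v x) = (\<lambda>x. fdiff h l u x - fdiff h l v x)"
  by (auto simp: fdiff_def fun_eq_iff add_divide_distrib diff_divide_distrib)

lemma fdiff_cmult: "fdiff h l (\<lambda>x. k * u x) = (\<lambda>x. k * fdiff h l u x)"
  by (auto simp: fdiff_def fun_eq_iff algebra_simps diff_divide_distrib)

lemma fdiff_sum: "fdiff h l (\<lambda>x. \<Sum>i\<in>I. u i x) = (\<lambda>x. \<Sum>i\<in>I. fdiff h l (u i) x)"
  by (simp add: fdiff_def fun_eq_iff sum_subtractf[symmetric] sum_divide_distrib)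

lemma fdiff_zero [simp]: "fdiff h l (\<lambda>_. 0) = (\<lambda>_. 0)"
  by (simp add: fdiff_def fun_eq_iff)

lemma fdiff_commute: "fdiff h l (fdiff h m u) = fdiff h m (fdiff h l u)"
  by (simp add: fdiff_def fun_eq_iff diff_divide_distrib algebra_simps)

lemma fdiff_fdiffs: "fdiff h l (fdiffs h \<alpha> u) = fdiffs h \<alpha> (fdiff h l u)"
  by (induction \<alpha>) (simp_all add: fdiffs_Cons fdiff_commute)

lemma fdiffs_add: "fdiffs h \<alpha> (\<lambda>x. u x + v x) = (\<lambda>x. fdiffs h \<alpha> u x + fdiffs h \<alpha> v x)"
  by (induction \<alpha>) (simp_all add: fdiffs_Cons fdiff_add)

lemma fdiffs_diff: "fdiffs h \<alpha> (\<lambda>x. u x - v x) = (\<lambda>x. fdiffs h \<alpha> u x - fdiffs h \<alpha> v x)"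
  by (induction \<alpha>) (simp_all add: fdiffs_Cons fdiff_diff)

lemma fdiffs_cmult: "fdiffs h \<alpha> (\<lambda>x. k * u x) = (\<lambda>x. k * fdiffs h \<alpha> u x)"
  by (induction \<alpha>) (simp_all add: fdiffs_Cons fdiff_cmult)

lemma fdiffs_zero [simp]: "fdiffs h \<alpha> (\<lambda>_. 0) = (\<lambda>_. 0)"
  by (induction \<alpha>) (simp_all add: fdiffs_Cons)

text \<open>Discrete Leibniz rule. The factor \<open>h * fdiff h l k x + k x\<close> is the value of
  \<open>k\<close> at the shifted point \<open>x + h *\<^sub>R l\<close>, written so that only
  differences of \<open>k\<close> at \<open>x\<close> occur.\<close>

lemma fdiff_mult:
  assumes "h \<noteq> 0"
  shows "fdiff h l (\<lambda>x. k x * u x) x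
    = fdiff h l k x * u x + (h * fdiff h l k x + k x) * fdiff h l u x"
  using assms by (simp add: fdiff_def field_simps)

text \<open>The mixed difference along \<open>l\<close> and \<open>- l\<close> is minus the centred
  second difference; the minus signs in front of such terms below stem from this.\<close>

lemma fdiff_pair:
  assumes "h \<noteq> 0"
  shows "fdiff h l u x + fdiff h (- l) u x = - (h * fdiff h l (fdiff h (- l) u) x)"
  using assms by (simp add: fdiff_def field_simps)

text \<open>Multi-indices as words over the directions. Orderings are kept apart although
  differences commute, so that a word of length \<open>Suc k\<close> is exactly a letter and a word
  of length \<open>k\<close>; the overcounting changes constants only.\<close>

definition wle :: "'a set \<Rightarrow> nat \<Rightarrow> 'a list set" where
  "wle \<Lambda> k = {\<alpha>. set \<alpha> \<subseteq> \<Lambda> \<and> length \<alpha> \<le> k}"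

definition weq :: "'a set \<Rightarrow> nat \<Rightarrow> 'a list set" where
  "weq \<Lambda> k = {\<alpha>. set \<alpha> \<subseteq> \<Lambda> \<and> length \<alpha> = k}"

lemma finite_wle: "finite \<Lambda> \<Longrightarrow> finite (wle \<Lambda> k)"
  unfolding wle_def by (rule finite_lists_length_le)

lemma finite_weq: "finite \<Lambda> \<Longrightarrow> finite (weq \<Lambda> k)"
  unfolding weq_def by (rule finite_lists_length_eq)

text \<open>With \<open>c\<close> even and \<open>b\<close> odd, pairing \<open>l\<close> with
  \<open>- l\<close> turns the factor \<open>1 / h\<close> in front of \<open>c\<close> into a
  genuine second difference, while the drift terms of the pair add up instead of cancelling.\<close>

locale diff_scheme =
  fixes \<Lambda> :: "'a::euclidean_space set" and c b :: "'a \<Rightarrow> 'a \<Rightarrow> real"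
  assumes fin: "finite \<Lambda>" and neg: "l \<in> \<Lambda> \<Longrightarrow> - l \<in> \<Lambda>"
    and c_neg: "c (- l) x = c l x" and b_neg: "b (- l) x = - b l x"
begin

text \<open>The increment \<open>u (x + h *\<^sub>R l) - u x\<close> carries the weight
  \<open>(c l x + h * b l x) / h\<^sup>2\<close>, positive for small \<open>h\<close> when
  \<open>c\<close> is bounded below and \<open>b\<close> is bounded: this makes the scheme monotone.
  As both \<open>l\<close> and \<open>- l\<close> are summed, the limit along \<open>l\<close> is
  \<open>c / 2\<close> times the second derivative plus \<open>b\<close> times the first.\<close>

definition Lh :: "real \<Rightarrow> ('a \<Rightarrow> real) \<Rightarrow> 'a \<Rightarrow> real" where
  "Lh h u x = (\<Sum>l\<in>\<Lambda>. (c l x / h + b l x) * fdiff h l u x)"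

lemma sum_neg: "(\<Sum>l\<in>\<Lambda>. f (- l)) = (\<Sum>l\<in>\<Lambda>. f l)"
  by (rule sum.reindex_bij_witness[of _ uminus uminus]) (auto intro: neg)

text \<open>Averaging the sum with its image under the change from \<open>l\<close> to
  \<open>- l\<close> removes the singular factor \<open>1 / h\<close>. It is stated for any even
  \<open>k\<close> because it is applied also to differences and to translation increments of
  \<open>c\<close>.\<close>

lemma sum_sym_fdiff:
  assumes "h \<noteq> 0" and k: "\<And>l. k (- l) = k l"
  shows "(\<Sum>l\<in>\<Lambda>. k l / h * fdiff h l u x) = (\<Sum>l\<in>\<Lambda>. - (1/2) * k l * fdiff h l (fdiff h (- l) u) x)"
proof -
  have "(\<Sum>l\<in>\<Lambda>. k l / h * fdiff h l u x)
      = (\<Sum>l\<in>\<Lambda>. k l / h * fdiff h l u x) / 2 + (\<Sum>l\<in>\<Lambda>. k (- l) / h * fdiff h (- l) u x) / 2"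
    unfolding sum_neg[of "\<lambda>l. k l / h * fdiff h l u x"] by simp
  also have "\<dots> = (\<Sum>l\<in>\<Lambda>. k l / (2 * h) * (fdiff h l u x + fdiff h (- l) u x))"
    by (simp add: k sum_divide_distrib sum.distrib[symmetric] distrib_left mult.commute)
  also have "\<dots> = (\<Sum>l\<in>\<Lambda>. - (1/2) * k l * fdiff h l (fdiff h (- l) u) x)"
    by (rule sum.cong) (use assms(1) in \<open>auto simp: fdiff_pair\<close>)
  finally show ?thesis .
qed

lemma Lh_alt:
  assumes "h \<noteq> 0"
  shows "Lh h u x = (\<Sum>l\<in>\<Lambda>. - (1/2) * c l x * fdiff h l (fdiff h (- l) u) x + b l x * fdiff h l u x)"
  unfolding Lh_def sum.distrib sum_sym_fdiff[OF assms, of "\<lambda>l. c l x", OF c_neg, symmetric]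
  by (simp add: distrib_right sum.distrib)

section \<open>Algebra of the operator and its commutators with differences\<close>

lemma Lh_sum: "Lh h (\<lambda>x. \<Sum>i\<in>I. u i x) x = (\<Sum>i\<in>I. Lh h (u i) x)"
  by (simp add: Lh_def fdiff_sum sum_distrib_left sum.swap[of _ I])

lemma Lh_add: "Lh h (\<lambda>x. u x + v x) x = Lh h u x + Lh h v x"
  by (simp add: Lh_def fdiff_add sum.distrib distrib_left)

lemma Lh_diff: "Lh h (\<lambda>x. u x - v x) x = Lh h u x - Lh h v x"
  by (simp add: Lh_def fdiff_diff sum_subtractf right_diff_distrib)

lemma Lh_cmult: "Lh h (\<lambda>x. k * u x) x = k * Lh h u x"
  by (simp add: Lh_def fdiff_cmult sum_distrib_left mult_ac)

text \<open>The Leibniz rule leaves \<open>fdiff h m (c l) x / h\<close> in front of a first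
  difference. Evenness of \<open>c\<close> passes to its differences, so this too becomes a second
  difference: the commutator has order two, with coefficients free of negative powers of
  \<open>h\<close>.\<close>

lemma Lh_fdiff:
  assumes h: "h \<noteq> 0"
  shows "fdiff h m (Lh h u) x - Lh h (fdiff h m u) x =
    (\<Sum>l\<in>\<Lambda>. - (1/2) * fdiff h m (c l) x * fdiff h l (fdiff h (- l) u) x
       + (fdiff h m (c l) x + h * fdiff h m (b l) x) * fdiff h m (fdiff h l u) x
       + fdiff h m (b l) x * fdiff h l u x)"
proof -
  have cb: "fdiff h m (\<lambda>x. c l x / h + b l x) x = fdiff h m (c l) x / h + fdiff h m (b l) x" for l
    by (simp add: fdiff_def add_divide_distrib diff_divide_distrib)
  have sym: "fdiff h m (c (- l)) x = fdiff h m (c l) x" for l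
    by (simp add: fdiff_def c_neg)
  have "fdiff h m (Lh h u) x = (\<Sum>l\<in>\<Lambda>. fdiff h m (\<lambda>x. (c l x / h + b l x) * fdiff h l u x) x)"
    unfolding Lh_def fdiff_sum ..
  also have "\<dots> = (\<Sum>l\<in>\<Lambda>. (fdiff h m (c l) x / h + fdiff h m (b l) x) * fdiff h l u x +
      (h * (fdiff h m (c l) x / h + fdiff h m (b l) x) + (c l x / h + b l x)) * fdiff h m (fdiff h l u) x)"
    unfolding fdiff_mult[OF h] cb ..
  finally have 1: "fdiff h m (Lh h u) x - Lh h (fdiff h m u) x =
     (\<Sum>l\<in>\<Lambda>. (fdiff h m (c l) x / h + fdiff h m (b l) x) * fdiff h l u x +
      (h * (fdiff h m (c l) x / h + fdiff h m (b l) x)) * fdiff h m (fdiff h l u) x)"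
    unfolding Lh_def by (simp add: fdiff_commute[of h _ m] algebra_simps sum.distrib sum_subtractf)
  also have "(\<Sum>l\<in>\<Lambda>. (fdiff h m (c l) x / h + fdiff h m (b l) x) * fdiff h l u x +
      (h * (fdiff h m (c l) x / h + fdiff h m (b l) x)) * fdiff h m (fdiff h l u) x)
    = (\<Sum>l\<in>\<Lambda>. fdiff h m (c l) x / h * fdiff h l u x) +
      (\<Sum>l\<in>\<Lambda>. (fdiff h m (c l) x + h * fdiff h m (b l) x) * fdiff h m (fdiff h l u) x
          + fdiff h m (b l) x * fdiff h l u x)"
    unfolding sum.distrib[symmetric] using h by (intro sum.cong) (auto simp: field_simps)
  also have "(\<Sum>l\<in>\<Lambda>. fdiff h m (c l) x / h * fdiff h l u x)
     = (\<Sum>l\<in>\<Lambda>. - (1/2) * fdiff h m (c l) x * fdiff h l (fdiff h (- l) u) x)"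
    by (rule sum_sym_fdiff[OF h, of "\<lambda>l. fdiff h m (c l) x", OF sym])
  finally show ?thesis
    by (simp only: sum.distrib add.assoc)
qed

text \<open>\<open>j\<close> bounds the order of the differences of \<open>u\<close>, and
  \<open>r\<close> counts the differences that the coefficients can still bear. The identity is
  required everywhere, so that it may be differenced again, the bounds only on
  \<open>Y\<close>.\<close>

definition rep :: "'a set \<Rightarrow> real \<Rightarrow> ('a \<Rightarrow> real) \<Rightarrow> nat \<Rightarrow> nat \<Rightarrow> real \<Rightarrow> ('a \<Rightarrow> real) \<Rightarrow> bool" where
  "rep Y h u r j C g \<longleftrightarrow> (\<exists>\<kappa>. (\<forall>x. g x = (\<Sum>\<beta>\<in>wle \<Lambda> j. \<kappa> \<beta> x * fdiffs h \<beta> u x)) \<and>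
     (\<forall>\<beta>\<in>wle \<Lambda> j. \<forall>\<gamma>\<in>wle \<Lambda> r. \<forall>x\<in>Y. \<bar>fdiffs h \<gamma> (\<kappa> \<beta>) x\<bar> \<le> C))"

lemma rep_add:
  assumes "rep Y h u r j C1 g1" "rep Y h u r j C2 g2"
  shows "rep Y h u r j (C1 + C2) (\<lambda>x. g1 x + g2 x)"
proof -
  obtain k1 where k1: "\<forall>x. g1 x = (\<Sum>\<beta>\<in>wle \<Lambda> j. k1 \<beta> x * fdiffs h \<beta> u x)"
     "\<forall>\<beta>\<in>wle \<Lambda> j. \<forall>\<gamma>\<in>wle \<Lambda> r. \<forall>x\<in>Y. \<bar>fdiffs h \<gamma> (k1 \<beta>) x\<bar> \<le> C1"
    using assms(1) unfolding rep_def by blast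
  obtain k2 where k2: "\<forall>x. g2 x = (\<Sum>\<beta>\<in>wle \<Lambda> j. k2 \<beta> x * fdiffs h \<beta> u x)"
     "\<forall>\<beta>\<in>wle \<Lambda> j. \<forall>\<gamma>\<in>wle \<Lambda> r. \<forall>x\<in>Y. \<bar>fdiffs h \<gamma> (k2 \<beta>) x\<bar> \<le> C2"
    using assms(2) unfolding rep_def by blast
  show ?thesis unfolding rep_def
  proof (intro exI[of _ "\<lambda>\<beta> x. k1 \<beta> x + k2 \<beta> x"] conjI allI ballI)
    show "g1 x + g2 x = (\<Sum>\<beta>\<in>wle \<Lambda> j. (k1 \<beta> x + k2 \<beta> x) * fdiffs h \<beta> u x)" for x
      using k1(1) k2(1) by (simp add: distrib_right sum.distrib)
  next
    fix \<beta> \<gamma> x assume "\<beta> \<in> wle \<Lambda> j" "\<gamma> \<in> wle \<Lambda> r" "x \<in> Y"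
    then have "\<bar>fdiffs h \<gamma> (k1 \<beta>) x\<bar> \<le> C1" "\<bar>fdiffs h \<gamma> (k2 \<beta>) x\<bar> \<le> C2" using k1 k2 by auto
    then show "\<bar>fdiffs h \<gamma> (\<lambda>x. k1 \<beta> x + k2 \<beta> x) x\<bar> \<le> C1 + C2"
      unfolding fdiffs_add by linarith
  qed
qed

lemma rep_sum:
  assumes "finite I" "\<And>i. i \<in> I \<Longrightarrow> rep Y h u r j C (g i)"
  shows "rep Y h u r j (real (card I) * C) (\<lambda>x. \<Sum>i\<in>I. g i x)"
  using assms
proof (induction I rule: finite_induct)
  case empty
  show ?case unfolding rep_def by (rule exI[of _ "\<lambda>_ _. 0"]) simp
next
  case (insert i I)
  have "rep Y h u r j (C + real (card I) * C) (\<lambda>x. g i x + (\<Sum>i\<in>I. g i x))"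
    using insert by (intro rep_add) auto
  then show ?case using insert(1,2) by (simp add: distrib_right)
qed

lemma rep_term:
  assumes "\<beta> \<in> wle \<Lambda> j" "\<And>\<gamma> x. \<gamma> \<in> wle \<Lambda> r \<Longrightarrow> x \<in> Y \<Longrightarrow> \<bar>fdiffs h \<gamma> k x\<bar> \<le> C" "0 \<le> C"
  shows "rep Y h u r j C (\<lambda>x. k x * fdiffs h \<beta> u x)"
  unfolding rep_def
proof (intro exI[of _ "\<lambda>\<beta>'. if \<beta>' = \<beta> then k else (\<lambda>_. 0)"] conjI allI ballI)
  fix x
  have "(\<Sum>\<beta>'\<in>wle \<Lambda> j. (if \<beta>' = \<beta> then k else (\<lambda>_. 0)) x * fdiffs h \<beta>' u x)
      = (\<Sum>\<beta>'\<in>wle \<Lambda> j. if \<beta>' = \<beta> then k x * fdiffs h \<beta>' u x else 0)"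
    by (intro sum.cong) auto
  then show "k x * fdiffs h \<beta> u x = (\<Sum>\<beta>'\<in>wle \<Lambda> j. (if \<beta>' = \<beta> then k else (\<lambda>_. 0)) x * fdiffs h \<beta>' u x)"
    using assms(1) finite_wle[OF fin, of j] by simp
qed (use assms in auto)

lemma fdiffs_fdiff: "fdiffs h \<gamma> (fdiff h l u) = fdiffs h (\<gamma> @ [l]) u"
  by (simp add: fdiffs_append fdiffs_Cons)

lemma wle_snoc: "\<gamma> \<in> wle \<Lambda> r \<Longrightarrow> l \<in> \<Lambda> \<Longrightarrow> \<gamma> @ [l] \<in> wle \<Lambda> (Suc r)"
  by (auto simp: wle_def)

text \<open>One more difference trades one unit of \<open>r\<close> for one unit of
  \<open>j\<close>. By the Leibniz rule each term splits into one with coefficient bound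
  \<open>C\<close> and one with \<open>2 * C\<close>, since the shifted coefficient is
  \<open>h * fdiff h l k + k\<close> and \<open>h \<le> 1\<close>.\<close>

lemma rep_fdiff:
  assumes g: "rep Y h u (Suc r) j C g" and l: "l \<in> \<Lambda>" and h: "0 < h" "h \<le> 1" and C: "0 \<le> C"
  shows "rep Y h u r (Suc j) (real (card (wle \<Lambda> j)) * (3 * C)) (fdiff h l g)"
proof -
  obtain k where k: "\<And>x. g x = (\<Sum>\<beta>\<in>wle \<Lambda> j. k \<beta> x * fdiffs h \<beta> u x)"
     "\<And>\<beta> \<gamma> x. \<beta>\<in>wle \<Lambda> j \<Longrightarrow> \<gamma>\<in>wle \<Lambda> (Suc r) \<Longrightarrow> x\<in>Y \<Longrightarrow> \<bar>fdiffs h \<gamma> (k \<beta>) x\<bar> \<le> C"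
    using g unfolding rep_def by blast
  have h0: "h \<noteq> 0" using h by simp
  have eq: "fdiff h l g = (\<lambda>x. \<Sum>\<beta>\<in>wle \<Lambda> j. fdiff h l (k \<beta>) x * fdiffs h \<beta> u x
      + (h * fdiff h l (k \<beta>) x + k \<beta> x) * fdiffs h (l # \<beta>) u x)"
    unfolding k(1)[abs_def] fdiff_sum fdiffs_Cons by (simp add: fdiff_mult[OF h0])
  have bd: "\<bar>fdiffs h \<gamma> (fdiff h l (k \<beta>)) x\<bar> \<le> C" if "\<beta> \<in> wle \<Lambda> j" "\<gamma> \<in> wle \<Lambda> r" "x \<in> Y" for \<beta> \<gamma> x
    unfolding fdiffs_fdiff using that l by (intro k(2) wle_snoc) auto
  have bd2: "\<bar>fdiffs h \<gamma> (\<lambda>x. h * fdiff h l (k \<beta>) x + k \<beta> x) x\<bar> \<le> 2 * C"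
    if "\<beta> \<in> wle \<Lambda> j" "\<gamma> \<in> wle \<Lambda> r" "x \<in> Y" for \<beta> \<gamma> x
  proof -
    have "\<gamma> \<in> wle \<Lambda> (Suc r)" using that by (auto simp: wle_def)
    then have "\<bar>fdiffs h \<gamma> (k \<beta>) x\<bar> \<le> C" using k(2) that by blast
    moreover have "\<bar>h * fdiffs h \<gamma> (fdiff h l (k \<beta>)) x\<bar> \<le> 1 * C"
      unfolding abs_mult using h bd[OF that] by (intro mult_mono) auto
    ultimately show ?thesis unfolding fdiffs_add fdiffs_cmult by linarith
  qed
  show ?thesis unfolding eq
  proof (intro rep_sum finite_wle fin)
    fix \<beta> assume \<beta>: "\<beta> \<in> wle \<Lambda> j"
    then have m: "\<beta> \<in> wle \<Lambda> (Suc j)" "l # \<beta> \<in> wle \<Lambda> (Suc j)" using l by (auto simp: wle_def)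
    have "rep Y h u r (Suc j) (C + 2 * C) (\<lambda>x. fdiff h l (k \<beta>) x * fdiffs h \<beta> u x
      + (h * fdiff h l (k \<beta>) x + k \<beta> x) * fdiffs h (l # \<beta>) u x)"
      by (intro rep_add rep_term m) (use bd bd2 \<beta> C in auto)
    then show "rep Y h u r (Suc j) (3 * C) (\<lambda>x. fdiff h l (k \<beta>) x * fdiffs h \<beta> u x
      + (h * fdiff h l (k \<beta>) x + k \<beta> x) * fdiffs h (l # \<beta>) u x)" by simp
  qed
qed

lemma rep_commutator:
  assumes coef: "\<And>l \<gamma> x. l \<in> \<Lambda> \<Longrightarrow> \<gamma> \<in> wle \<Lambda> (Suc r) \<Longrightarrow> x \<in> Y \<Longrightarrow>
       \<bar>fdiffs h \<gamma> (c l) x\<bar> \<le> B \<and> \<bar>fdiffs h \<gamma> (b l) x\<bar> \<le> B"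
    and h: "0 < h" "h \<le> 1" and B: "0 \<le> B" and m: "m \<in> \<Lambda>" and \<alpha>: "\<alpha> \<in> wle \<Lambda> k"
  shows "rep Y h u r (k + 2) (real (card \<Lambda>) * (4 * B))
     (\<lambda>x. fdiff h m (Lh h (fdiffs h \<alpha> u)) x - Lh h (fdiff h m (fdiffs h \<alpha> u)) x)"
proof -
  have h0: "h \<noteq> 0" using h by simp
  have cb: "\<bar>fdiffs h \<gamma> (fdiff h m (c l)) x\<bar> \<le> B" "\<bar>fdiffs h \<gamma> (fdiff h m (b l)) x\<bar> \<le> B"
    if "l \<in> \<Lambda>" "\<gamma> \<in> wle \<Lambda> r" "x \<in> Y" for l \<gamma> x
    unfolding fdiffs_fdiff using coef[OF that(1) wle_snoc[OF that(2) m] that(3)] by auto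
  have cb2: "\<bar>fdiffs h \<gamma> (\<lambda>x. fdiff h m (c l) x + h * fdiff h m (b l) x) x\<bar> \<le> 2 * B"
    if "l \<in> \<Lambda>" "\<gamma> \<in> wle \<Lambda> r" "x \<in> Y" for l \<gamma> x
  proof -
    have "\<bar>h * fdiffs h \<gamma> (fdiff h m (b l)) x\<bar> \<le> 1 * B"
      unfolding abs_mult using h cb[OF that] by (intro mult_mono) auto
    then show ?thesis unfolding fdiffs_add fdiffs_cmult using cb[OF that] by linarith
  qed
  have cb3: "\<bar>fdiffs h \<gamma> (\<lambda>x. - (1/2) * fdiff h m (c l) x) x\<bar> \<le> B"
    if "l \<in> \<Lambda>" "\<gamma> \<in> wle \<Lambda> r" "x \<in> Y" for l \<gamma> x
    unfolding fdiffs_cmult using cb(1)[OF that] by simp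
  have "rep Y h u r (k + 2) (real (card \<Lambda>) * (4 * B)) (\<lambda>x. \<Sum>l\<in>\<Lambda>. - (1/2) * fdiff h m (c l) x * fdiffs h (l # - l # \<alpha>) u x
       + (fdiff h m (c l) x + h * fdiff h m (b l) x) * fdiffs h (m # l # \<alpha>) u x
       + fdiff h m (b l) x * fdiffs h (l # \<alpha>) u x)"
  proof (intro rep_sum fin)
    fix l assume l: "l \<in> \<Lambda>"
    then have w: "l # - l # \<alpha> \<in> wle \<Lambda> (k+2)" "m # l # \<alpha> \<in> wle \<Lambda> (k+2)" "l # \<alpha> \<in> wle \<Lambda> (k+2)"
      using \<alpha> m neg by (auto simp: wle_def)
    have "rep Y h u r (k + 2) (B + 2 * B + B) (\<lambda>x. - (1/2) * fdiff h m (c l) x * fdiffs h (l # - l # \<alpha>) u x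
       + (fdiff h m (c l) x + h * fdiff h m (b l) x) * fdiffs h (m # l # \<alpha>) u x
       + fdiff h m (b l) x * fdiffs h (l # \<alpha>) u x)"
      by (intro rep_add rep_term w) (use cb cb2 cb3 l B in auto)
    then show "rep Y h u r (k + 2) (4 * B) (\<lambda>x. - (1/2) * fdiff h m (c l) x * fdiffs h (l # - l # \<alpha>) u x
       + (fdiff h m (c l) x + h * fdiff h m (b l) x) * fdiffs h (m # l # \<alpha>) u x
       + fdiff h m (b l) x * fdiffs h (l # \<alpha>) u x)" by simp
  qed
  then show ?thesis unfolding Lh_fdiff[OF h0] fdiffs_Cons by simp
qed

text \<open>Commuting \<open>Lh\<close> past a word of length \<open>k\<close> costs only
  differences of order at most \<open>k + 1\<close>, one less than the leading term; the
  zeroth-order term \<open>q * u\<close> is counted as part of this error. The remainder can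
  therefore be absorbed by ellipticity, with a constant independent of \<open>h\<close> and
  \<open>u\<close>.\<close>

lemma rep_main:
  assumes coef: "\<And>h l \<gamma> x. 0 < h \<Longrightarrow> h \<le> 1 \<Longrightarrow> l \<in> \<Lambda> \<Longrightarrow> \<gamma> \<in> wle \<Lambda> K \<Longrightarrow> x \<in> Y \<Longrightarrow>
       \<bar>fdiffs h \<gamma> (c l) x\<bar> \<le> B \<and> \<bar>fdiffs h \<gamma> (b l) x\<bar> \<le> B \<and> \<bar>fdiffs h \<gamma> q x\<bar> \<le> B"
    and \<Lambda>: "\<Lambda> \<noteq> {}" and B: "0 \<le> B" and k: "k \<le> K"
  shows "\<exists>C\<ge>0. \<forall>h u. \<forall>\<alpha>\<in>weq \<Lambda> k. 0 < h \<and> h \<le> 1 \<longrightarrow>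
     rep Y h u (K - k) (Suc k) C (\<lambda>x. Lh h (fdiffs h \<alpha> u) x - fdiffs h \<alpha> (\<lambda>x. Lh h u x + q x * u x) x)"
  using k
proof (induction k)
  case 0
  show ?case
  proof (intro exI[of _ B] conjI allI ballI impI)
    fix h :: real and u :: "'a \<Rightarrow> real" and \<alpha> assume \<alpha>: "\<alpha> \<in> weq \<Lambda> 0" and h: "0 < h \<and> h \<le> 1"
    obtain l where l: "l \<in> \<Lambda>" using \<Lambda> by blast
    have "rep Y h u K (Suc 0) B (\<lambda>x. - 1 * q x * fdiffs h [] u x)"
      using coef[OF _ _ l] h B by (intro rep_term) (auto simp: wle_def fdiffs_cmult[of _ _ "-1", simplified])
    then show "rep Y h u (K - 0) (Suc 0) B (\<lambda>x. Lh h (fdiffs h \<alpha> u) x - fdiffs h \<alpha> (\<lambda>x. Lh h u x + q x * u x) x)"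
      using \<alpha> by (simp add: weq_def)
  qed (rule B)
next
  case (Suc k)
  then obtain C where C: "C \<ge> 0" and IH: "\<And>h u \<alpha>. \<alpha>\<in>weq \<Lambda> k \<Longrightarrow> 0 < h \<Longrightarrow> h \<le> 1 \<Longrightarrow>
     rep Y h u (K - k) (Suc k) C (\<lambda>x. Lh h (fdiffs h \<alpha> u) x - fdiffs h \<alpha> (\<lambda>x. Lh h u x + q x * u x) x)"
    by auto
  have Kk: "K - k = Suc (K - Suc k)" using Suc.prems by simp
  let ?C = "real (card (wle \<Lambda> (Suc k))) * (3 * C) + real (card \<Lambda>) * (4 * B)"
  show ?case
  proof (intro exI[of _ ?C] conjI allI ballI impI)
    show "0 \<le> ?C" using B C by simp
  next
    fix h :: real and u :: "'a \<Rightarrow> real" and \<alpha> assume \<alpha>: "\<alpha> \<in> weq \<Lambda> (Suc k)" and h: "0 < h \<and> h \<le> 1"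
    obtain m \<beta> where \<beta>: "\<alpha> = m # \<beta>" "m \<in> \<Lambda>" "\<beta> \<in> weq \<Lambda> k"
      using \<alpha> by (cases \<alpha>) (auto simp: weq_def)
    have \<beta>': "\<beta> \<in> wle \<Lambda> k" using \<beta> by (auto simp: wle_def weq_def)
    let ?g = "\<lambda>x. Lh h u x + q x * u x"
    have 1: "rep Y h u (K - Suc k) (Suc (Suc k)) (real (card (wle \<Lambda> (Suc k))) * (3 * C))
       (fdiff h m (\<lambda>x. Lh h (fdiffs h \<beta> u) x - fdiffs h \<beta> ?g x))"
      by (rule rep_fdiff) (use IH[OF \<beta>(3), of h u] h C \<beta>(2) Kk in auto)
    have 2: "rep Y h (u) (K - Suc k) (k + 2) (real (card \<Lambda>) * (4 * B))
     (\<lambda>x. fdiff h m (Lh h (fdiffs h \<beta> u)) x - Lh h (fdiff h m (fdiffs h \<beta> u)) x)"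
    proof (rule rep_commutator)
      fix l \<gamma> x assume *: "l \<in> \<Lambda>" "\<gamma> \<in> wle \<Lambda> (Suc (K - Suc k))" "x \<in> Y"
      have "\<gamma> \<in> wle \<Lambda> K" using *(2) Suc.prems by (auto simp: wle_def)
      then show "\<bar>fdiffs h \<gamma> (c l) x\<bar> \<le> B \<and> \<bar>fdiffs h \<gamma> (b l) x\<bar> \<le> B" using coef[of h] * h by auto
    qed (use h B \<beta> \<beta>' in auto)
    have 3: "rep Y h u (K - Suc k) (k+2) (real (card \<Lambda>) * (4 * B))
     (\<lambda>x. Lh h (fdiff h m (fdiffs h \<beta> u)) x - fdiff h m (Lh h (fdiffs h \<beta> u)) x)"
    proof -
      obtain k1 where k1: "\<And>x. fdiff h m (Lh h (fdiffs h \<beta> u)) x - Lh h (fdiff h m (fdiffs h \<beta> u)) x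
          = (\<Sum>\<beta>\<in>wle \<Lambda> (k+2). k1 \<beta> x * fdiffs h \<beta> u x)"
        and k2: "\<And>\<beta> \<gamma> x. \<beta>\<in>wle \<Lambda> (k+2) \<Longrightarrow> \<gamma>\<in>wle \<Lambda> (K - Suc k) \<Longrightarrow> x\<in>Y \<Longrightarrow> \<bar>fdiffs h \<gamma> (k1 \<beta>) x\<bar> \<le> real (card \<Lambda>) * (4 * B)"
        using 2 unfolding rep_def by blast
      show ?thesis unfolding rep_def
      proof (intro exI[of _ "\<lambda>\<beta> x. (-1) * k1 \<beta> x"] conjI allI ballI)
        fix x show "Lh h (fdiff h m (fdiffs h \<beta> u)) x - fdiff h m (Lh h (fdiffs h \<beta> u)) x
          = (\<Sum>\<beta>\<in>wle \<Lambda> (k+2). (-1) * k1 \<beta> x * fdiffs h \<beta> u x)"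
          using k1[of x] by (simp add: sum_negf)
      qed (simp only: fdiffs_cmult, use k2 in simp)
    qed
    \<comment> \<open>The two occurrences of \<open>fdiff h m (Lh h (fdiffs h \<beta> u))\<close>
      cancel: the difference of the previous remainder plus the commutator with \<open>m\<close> is
      the remainder of the longer word.\<close>
    have "rep Y h u (K - Suc k) (Suc (Suc k)) ?C (\<lambda>x. fdiff h m (\<lambda>x. Lh h (fdiffs h \<beta> u) x - fdiffs h \<beta> ?g x) x
       + (Lh h (fdiff h m (fdiffs h \<beta> u)) x - fdiff h m (Lh h (fdiffs h \<beta> u)) x))"
      using rep_add[OF 1, of "real (card \<Lambda>) * (4 * B)"] 3 by simp
    then show "rep Y h u (K - Suc k) (Suc (Suc k)) ?C (\<lambda>x. Lh h (fdiffs h \<alpha> u) x - fdiffs h \<alpha> ?g x)"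
      unfolding \<beta>(1) fdiffs_Cons fdiff_diff by simp
  qed
qed

end

section \<open>The discrete Bernstein method\<close>

lemma fdiff_power2:
  "h \<noteq> 0 \<Longrightarrow> fdiff h l (\<lambda>x. (v x)\<^sup>2) x = 2 * v x * fdiff h l v x + h * (fdiff h l v x)\<^sup>2"
  by (simp add: fdiff_def field_simps power2_eq_square)

lemma abs_mult_le_squares:
  fixes a d t :: real
  assumes "0 < t"
  shows "2 * \<bar>a * d\<bar> \<le> a\<^sup>2 / t + t * d\<^sup>2"
proof -
  have "0 \<le> (\<bar>a\<bar> - t * \<bar>d\<bar>)\<^sup>2 / t" using assms by simp
  also have "\<dots> = a\<^sup>2 / t + t * d\<^sup>2 - 2 * \<bar>a * d\<bar>"
    using assms by (simp add: power2_diff power_mult_distrib abs_mult field_simps power2_eq_square)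
  finally show ?thesis by simp
qed

context diff_scheme
begin

text \<open>The discrete counterpart of the squared norm of the \<open>k\<close>-th derivative,
  measured along the directions in \<open>\<Lambda>\<close>.\<close>

definition energy :: "real \<Rightarrow> nat \<Rightarrow> ('a \<Rightarrow> real) \<Rightarrow> 'a \<Rightarrow> real" where
  "energy h k u x = (\<Sum>\<alpha>\<in>weq \<Lambda> k. (fdiffs h \<alpha> u x)\<^sup>2)"

lemma energy_nonneg: "0 \<le> energy h k u x"
  unfolding energy_def by (intro sum_nonneg) auto

lemma energy_0: "energy h 0 u x = (u x)\<^sup>2"
proof -
  have "weq \<Lambda> 0 = {[]}" by (auto simp: weq_def)
  then show ?thesis by (simp add: energy_def)
qed

lemma energy_Suc: "energy h (Suc k) u x = (\<Sum>l\<in>\<Lambda>. \<Sum>\<alpha>\<in>weq \<Lambda> k. (fdiff h l (fdiffs h \<alpha> u) x)\<^sup>2)"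
proof -
  have "weq \<Lambda> (Suc k) = (\<lambda>(l, \<alpha>). l # \<alpha>) ` (\<Lambda> \<times> weq \<Lambda> k)"
    by (auto simp: weq_def image_iff length_Suc_conv)
  moreover have "inj_on (\<lambda>(l, \<alpha>). l # \<alpha>) (\<Lambda> \<times> weq \<Lambda> k)" by (auto simp: inj_on_def)
  ultimately show ?thesis
    unfolding energy_def sum.cartesian_product
    by (simp add: sum.reindex case_prod_unfold fdiffs_Cons)
qed

lemma sum_wle_energy: "(\<Sum>\<alpha>\<in>wle \<Lambda> K. (fdiffs h \<alpha> u x)\<^sup>2) = (\<Sum>j\<le>K. energy h j u x)"
proof -
  have "wle \<Lambda> K = (\<Union>j\<in>{..K}. weq \<Lambda> j)" by (auto simp: wle_def weq_def)
  moreover have "(\<Sum>\<alpha>\<in>(\<Union>j\<in>{..K}. weq \<Lambda> j). (fdiffs h \<alpha> u x)\<^sup>2) = (\<Sum>j\<le>K. energy h j u x)"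
    unfolding energy_def
    by (rule sum.UNION_disjoint) (auto intro: finite_weq[OF fin], auto simp: weq_def)
  ultimately show ?thesis by simp
qed

lemma fdiffs_le_energy:
  assumes "\<alpha> \<in> weq \<Lambda> k"
  shows "(fdiffs h \<alpha> u x)\<^sup>2 \<le> energy h k u x"
  unfolding energy_def by (rule member_le_sum[OF assms _ finite_weq[OF fin]]) simp

lemma Lh_mult:
  assumes h: "h \<noteq> 0"
  shows "Lh h (\<lambda>x. k x * v x) x = k x * Lh h v x + v x * Lh h k x
     + (\<Sum>l\<in>\<Lambda>. (c l x + h * b l x) * (fdiff h l k x * fdiff h l v x))"
  unfolding Lh_def sum_distrib_left sum.distrib[symmetric]
  by (rule sum.cong) (use h in \<open>auto simp: fdiff_mult field_simps\<close>)

text \<open>The sum of weighted squares is the discrete carre du champ of \<open>v\<close>; it is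
  the gain that Bernstein's method exploits.\<close>

lemma Lh_power2:
  assumes h: "h \<noteq> 0"
  shows "Lh h (\<lambda>x. (v x)\<^sup>2) x = 2 * v x * Lh h v x + (\<Sum>l\<in>\<Lambda>. (c l x + h * b l x) * (fdiff h l v x)\<^sup>2)"
  unfolding power2_eq_square Lh_mult[OF h] by simp

text \<open>Young's inequality with a free weight \<open>t\<close>, later taken proportional to the
  cut-off. The additional \<open>h\<close> beside \<open>t\<close> comes from the quadratic term in
  the difference of a square.\<close>

lemma fdiff_energy:
  assumes h: "0 < h" and t: "0 < t" and l: "l \<in> \<Lambda>"
  shows "\<bar>fdiff h l (energy h k u) x\<bar> \<le> energy h k u x / t + (t + h) * energy h (Suc k) u x"
proof -
  have h0: "h \<noteq> 0" using h by simp
  have "fdiff h l (energy h k u) x = (\<Sum>\<alpha>\<in>weq \<Lambda> k. 2 * fdiffs h \<alpha> u x * fdiff h l (fdiffs h \<alpha> u) x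
      + h * (fdiff h l (fdiffs h \<alpha> u) x)\<^sup>2)"
    unfolding energy_def[abs_def] fdiff_sum fdiff_power2[OF h0] ..
  also have "\<bar>\<dots>\<bar> \<le> (\<Sum>\<alpha>\<in>weq \<Lambda> k. (fdiffs h \<alpha> u x)\<^sup>2 / t + (t + h) * (fdiff h l (fdiffs h \<alpha> u) x)\<^sup>2)"
  proof (rule order_trans[OF sum_abs], rule sum_mono)
    fix \<alpha>
    show "\<bar>2 * fdiffs h \<alpha> u x * fdiff h l (fdiffs h \<alpha> u) x + h * (fdiff h l (fdiffs h \<alpha> u) x)\<^sup>2\<bar>
       \<le> (fdiffs h \<alpha> u x)\<^sup>2 / t + (t + h) * (fdiff h l (fdiffs h \<alpha> u) x)\<^sup>2"
      using abs_mult_le_squares[OF t, of "fdiffs h \<alpha> u x" "fdiff h l (fdiffs h \<alpha> u) x"] h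
      by (auto simp: abs_mult distrib_right intro!: order_trans[OF abs_triangle_ineq])
  qed
  also have "\<dots> = energy h k u x / t + (t + h) * (\<Sum>\<alpha>\<in>weq \<Lambda> k. (fdiff h l (fdiffs h \<alpha> u) x)\<^sup>2)"
    by (simp add: sum.distrib sum_divide_distrib sum_distrib_left energy_def)
  also have "\<dots> \<le> energy h k u x / t + (t + h) * energy h (Suc k) u x"
  proof -
    have "(\<Sum>\<alpha>\<in>weq \<Lambda> k. (fdiff h l (fdiffs h \<alpha> u) x)\<^sup>2) \<le> energy h (Suc k) u x"
      unfolding energy_Suc by (rule member_le_sum[OF l _ fin]) (auto intro: sum_nonneg)
    then show ?thesis using h t by (simp add: mult_left_mono)
  qed
  finally show ?thesis .
qed

text \<open>Applying \<open>Lh\<close> to the squares produces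
  \<open>\<theta> / 2 * energy h (Suc k) u x\<close>. The remainder from \<open>rep_main\<close>
  also contains differences of order \<open>k + 1\<close>, but only linearly and multiplied by a
  difference of order \<open>k\<close>, so Young's inequality charges them against half of this
  gain. The condition \<open>h * B \<le> \<theta> / 2\<close> keeps the weights
  \<open>c l x + h * b l x\<close> above \<open>\<theta> / 2\<close>.\<close>

lemma energy_ineq:
  assumes coef: "\<And>h l \<gamma> x. 0 < h \<Longrightarrow> h \<le> 1 \<Longrightarrow> l \<in> \<Lambda> \<Longrightarrow> \<gamma> \<in> wle \<Lambda> K \<Longrightarrow> x \<in> Y \<Longrightarrow>
       \<bar>fdiffs h \<gamma> (c l) x\<bar> \<le> B \<and> \<bar>fdiffs h \<gamma> (b l) x\<bar> \<le> B \<and> \<bar>fdiffs h \<gamma> q x\<bar> \<le> B"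
    and ell: "\<And>l x. l \<in> \<Lambda> \<Longrightarrow> x \<in> Y \<Longrightarrow> \<theta> \<le> c l x" and \<theta>: "0 < \<theta>"
    and \<Lambda>: "\<Lambda> \<noteq> {}" and B: "0 < B" and k: "k \<le> K"
  shows "\<exists>C\<ge>0. \<forall>h u. \<forall>x\<in>Y. 0 < h \<and> h \<le> 1 \<and> h * B \<le> \<theta> / 2 \<longrightarrow>
     Lh h (energy h k u) x \<ge> \<theta> / 4 * energy h (Suc k) u x
       - C * ((\<Sum>j\<le>k. energy h j u x) + (\<Sum>\<alpha>\<in>weq \<Lambda> k. (fdiffs h \<alpha> (\<lambda>x. Lh h u x + q x * u x) x)\<^sup>2))"
proof -
  obtain C where C: "C \<ge> 0" and R: "\<And>h u \<alpha>. \<alpha>\<in>weq \<Lambda> k \<Longrightarrow> 0 < h \<Longrightarrow> h \<le> 1 \<Longrightarrow>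
     rep Y h u (K - k) (Suc k) C (\<lambda>x. Lh h (fdiffs h \<alpha> u) x - fdiffs h \<alpha> (\<lambda>x. Lh h u x + q x * u x) x)"
    using rep_main[of K Y B q k, OF coef \<Lambda> less_imp_le[OF B] k] by blast
  define Nk where "Nk = real (card (weq \<Lambda> k))"
  define N where "N = real (card (wle \<Lambda> (Suc k)))"
  \<comment> \<open>Every word of length \<open>k\<close> spends \<open>\<epsilon>\<close> times the
    energy of order \<open>k + 1\<close>; over the \<open>Nk\<close> words this amounts to at most
    \<open>\<theta> / 4\<close>.\<close>
  define \<epsilon> where "\<epsilon> = \<theta> / (4 * (Nk + 1))"
  have Nk: "Nk \<ge> 0" and N: "N \<ge> 0" by (auto simp: Nk_def N_def)
  have \<epsilon>: "\<epsilon> > 0" using \<theta> Nk by (simp add: \<epsilon>_def)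
  have N\<epsilon>: "Nk * \<epsilon> \<le> \<theta> / 4"
  proof -
    have "Nk * \<epsilon> \<le> (Nk + 1) * \<epsilon>" using \<epsilon> by (simp add: mult_right_mono)
    also have "\<dots> = \<theta> / 4" using Nk by (simp add: \<epsilon>_def field_simps)
    finally show ?thesis .
  qed
  let ?C = "1 + N * C\<^sup>2 / \<epsilon> + \<theta> / 4"
  show ?thesis
  proof (intro exI[of _ ?C] conjI allI ballI impI)
    show "0 \<le> ?C" using N \<epsilon> \<theta> by simp
  next
    fix h :: real and u :: "'a \<Rightarrow> real" and x
    assume x: "x \<in> Y" and hh: "0 < h \<and> h \<le> 1 \<and> h * B \<le> \<theta> / 2"
    let ?g = "\<lambda>x. Lh h u x + q x * u x"
    let ?G = "\<Sum>\<alpha>\<in>weq \<Lambda> k. (fdiffs h \<alpha> ?g x)\<^sup>2"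
    let ?E = "\<Sum>j\<le>k. energy h j u x"
    have h0: "h \<noteq> 0" and h: "0 < h" "h \<le> 1" using hh by auto
    have p: "\<theta> / 2 \<le> c l x + h * b l x" if l: "l \<in> \<Lambda>" for l
    proof -
      have "\<bar>b l x\<bar> \<le> B" using coef[OF h l, of "[]" x] x by (auto simp: wle_def)
      then have "\<bar>h * b l x\<bar> \<le> h * B" using h by (simp add: abs_mult)
      then show ?thesis using ell[OF l x] hh by linarith
    qed
    have main: "2 * (fdiffs h \<alpha> u x * Lh h (fdiffs h \<alpha> u) x) \<ge>
        - ((fdiffs h \<alpha> u x)\<^sup>2 + (fdiffs h \<alpha> ?g x)\<^sup>2 + N * C\<^sup>2 / \<epsilon> * (fdiffs h \<alpha> u x)\<^sup>2
           + \<epsilon> * (?E + energy h (Suc k) u x))" if \<alpha>: "\<alpha> \<in> weq \<Lambda> k" for \<alpha>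
    proof -
      let ?a = "fdiffs h \<alpha> u x"
      obtain \<kappa> where \<kappa>: "\<And>x. Lh h (fdiffs h \<alpha> u) x - fdiffs h \<alpha> ?g x
            = (\<Sum>\<beta>\<in>wle \<Lambda> (Suc k). \<kappa> \<beta> x * fdiffs h \<beta> u x)"
        and kb: "\<And>\<beta> \<gamma> x. \<beta>\<in>wle \<Lambda> (Suc k) \<Longrightarrow> \<gamma>\<in>wle \<Lambda> (K - k) \<Longrightarrow> x\<in>Y \<Longrightarrow> \<bar>fdiffs h \<gamma> (\<kappa> \<beta>) x\<bar> \<le> C"
        using R[OF \<alpha> h, of u] unfolding rep_def by blast
      have kb': "\<bar>\<kappa> \<beta> x\<bar> \<le> C" if "\<beta>\<in>wle \<Lambda> (Suc k)" for \<beta>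
        using kb[OF that, of "[]" x] x by (simp add: wle_def)
      have 1: "Lh h (fdiffs h \<alpha> u) x = fdiffs h \<alpha> ?g x + (\<Sum>\<beta>\<in>wle \<Lambda> (Suc k). \<kappa> \<beta> x * fdiffs h \<beta> u x)"
        using \<kappa>[of x] by simp
      \<comment> \<open>Young's inequality term by term: the small weight \<open>\<epsilon>\<close>
        falls on the differences of order up to \<open>k + 1\<close>, the large factor
        \<open>C\<^sup>2 / \<epsilon>\<close> on the lower-order square
        \<open>?a\<^sup>2\<close>.\<close>
      have "\<bar>2 * (?a * (\<Sum>\<beta>\<in>wle \<Lambda> (Suc k). \<kappa> \<beta> x * fdiffs h \<beta> u x))\<bar>
          \<le> (\<Sum>\<beta>\<in>wle \<Lambda> (Suc k). C\<^sup>2 / \<epsilon> * ?a\<^sup>2 + \<epsilon> * (fdiffs h \<beta> u x)\<^sup>2)"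
        unfolding sum_distrib_left
      proof (rule order_trans[OF sum_abs], rule sum_mono)
        fix \<beta> assume \<beta>: "\<beta> \<in> wle \<Lambda> (Suc k)"
        have "\<bar>2 * (?a * (\<kappa> \<beta> x * fdiffs h \<beta> u x))\<bar> = 2 * \<bar>(?a * \<kappa> \<beta> x) * fdiffs h \<beta> u x\<bar>"
          by (simp add: abs_mult)
        also have "\<dots> \<le> (?a * \<kappa> \<beta> x)\<^sup>2 / \<epsilon> + \<epsilon> * (fdiffs h \<beta> u x)\<^sup>2"
          by (rule abs_mult_le_squares[OF \<epsilon>])
        also have "(?a * \<kappa> \<beta> x)\<^sup>2 \<le> ?a\<^sup>2 * C\<^sup>2"
          unfolding power_mult_distrib
          using kb'[OF \<beta>] C by (intro mult_left_mono abs_le_square_iff[THEN iffD1]) auto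
        finally show "\<bar>2 * (?a * (\<kappa> \<beta> x * fdiffs h \<beta> u x))\<bar> \<le> C\<^sup>2 / \<epsilon> * ?a\<^sup>2 + \<epsilon> * (fdiffs h \<beta> u x)\<^sup>2"
          using \<epsilon> by (simp add: divide_right_mono mult.commute)
      qed
      also have "\<dots> = N * C\<^sup>2 / \<epsilon> * ?a\<^sup>2 + \<epsilon> * (?E + energy h (Suc k) u x)"
        by (simp add: sum.distrib N_def sum_distrib_left[symmetric] sum_wle_energy)
      finally have 2: "\<bar>2 * (?a * (\<Sum>\<beta>\<in>wle \<Lambda> (Suc k). \<kappa> \<beta> x * fdiffs h \<beta> u x))\<bar>
          \<le> N * C\<^sup>2 / \<epsilon> * ?a\<^sup>2 + \<epsilon> * (?E + energy h (Suc k) u x)" .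
      have 3: "\<bar>2 * (?a * fdiffs h \<alpha> ?g x)\<bar> \<le> ?a\<^sup>2 + (fdiffs h \<alpha> ?g x)\<^sup>2"
        using abs_mult_le_squares[of 1 ?a "fdiffs h \<alpha> ?g x"] by (simp add: abs_mult)
      show ?thesis using 2 3 unfolding 1 distrib_left by linarith
    qed
    have "Lh h (energy h k u) x = (\<Sum>\<alpha>\<in>weq \<Lambda> k. 2 * fdiffs h \<alpha> u x * Lh h (fdiffs h \<alpha> u) x
        + (\<Sum>l\<in>\<Lambda>. (c l x + h * b l x) * (fdiff h l (fdiffs h \<alpha> u) x)\<^sup>2))"
      unfolding energy_def[abs_def] Lh_sum Lh_power2[OF h0] ..
    also have "\<dots> \<ge> (\<Sum>\<alpha>\<in>weq \<Lambda> k. - ((fdiffs h \<alpha> u x)\<^sup>2 + (fdiffs h \<alpha> ?g x)\<^sup>2 + N * C\<^sup>2 / \<epsilon> * (fdiffs h \<alpha> u x)\<^sup>2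
           + \<epsilon> * (?E + energy h (Suc k) u x)) + (\<Sum>l\<in>\<Lambda>. \<theta> / 2 * (fdiff h l (fdiffs h \<alpha> u) x)\<^sup>2))"
      by (intro sum_mono add_mono mult_right_mono p) (use main in \<open>auto simp: mult.assoc\<close>)
    also have "(\<Sum>\<alpha>\<in>weq \<Lambda> k. - ((fdiffs h \<alpha> u x)\<^sup>2 + (fdiffs h \<alpha> ?g x)\<^sup>2 + N * C\<^sup>2 / \<epsilon> * (fdiffs h \<alpha> u x)\<^sup>2
           + \<epsilon> * (?E + energy h (Suc k) u x)) + (\<Sum>l\<in>\<Lambda>. \<theta> / 2 * (fdiff h l (fdiffs h \<alpha> u) x)\<^sup>2))
       = - (energy h k u x + ?G + N * C\<^sup>2 / \<epsilon> * energy h k u x + Nk * \<epsilon> * (?E + energy h (Suc k) u x))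
         + \<theta> / 2 * energy h (Suc k) u x"
    proof -
      have "(\<Sum>\<alpha>\<in>weq \<Lambda> k. \<Sum>l\<in>\<Lambda>. \<theta> / 2 * (fdiff h l (fdiffs h \<alpha> u) x)\<^sup>2) = \<theta> / 2 * energy h (Suc k) u x"
        unfolding energy_Suc by (subst sum.swap) (simp only: sum_distrib_left)
      moreover have "(\<Sum>\<alpha>\<in>weq \<Lambda> k. N * C\<^sup>2 / \<epsilon> * (fdiffs h \<alpha> u x)\<^sup>2) = N * C\<^sup>2 / \<epsilon> * energy h k u x"
        unfolding energy_def by (simp only: sum_distrib_left)
      ultimately show ?thesis
        by (simp only: sum.distrib sum_negf sum_constant energy_def[of h k] Nk_def mult.assoc)
    qed
    finally have 4: "Lh h (energy h k u) x \<ge> - (energy h k u x + ?G + N * C\<^sup>2 / \<epsilon> * energy h k u x + Nk * \<epsilon> * (?E + energy h (Suc k) u x))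
         + \<theta> / 2 * energy h (Suc k) u x" .
    have E: "energy h k u x \<le> ?E" by (rule member_le_sum) (auto simp: energy_nonneg)
    have E0: "0 \<le> ?E" by (intro sum_nonneg energy_nonneg)
    have G0: "0 \<le> ?G" by (intro sum_nonneg) auto
    have "Nk * \<epsilon> * (?E + energy h (Suc k) u x) \<le> \<theta> / 4 * (?E + energy h (Suc k) u x)"
      by (intro mult_right_mono N\<epsilon>) (use E0 energy_nonneg in auto)
    moreover have "N * C\<^sup>2 / \<epsilon> * energy h k u x \<le> N * C\<^sup>2 / \<epsilon> * (?E + ?G)"
      using E G0 N \<epsilon> by (intro mult_left_mono) auto
    moreover have "\<theta> / 4 * ?E \<le> \<theta> / 4 * (?E + ?G)" using \<theta> G0 by (intro mult_left_mono) auto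
    ultimately show "Lh h (energy h k u) x \<ge> \<theta> / 4 * energy h (Suc k) u x - ?C * (?E + ?G)"
      using 4 E unfolding distrib_right distrib_left by linarith
  qed
qed

end

section \<open>The cut-off argument and interior bounds up to order \<open>K\<close>\<close>

context diff_scheme
begin

text \<open>The one-step estimate is the discrete Bernstein method: the auxiliary function
  \<open>P\<^sup>2 p + m q\<close> with the cut-off \<open>P = R\<^sup>2 - |x - z|\<^sup>2\<close> is examined near a point where its supremum is almost attained.
  Where \<open>P\<close> is of the order of the mesh size the trivial bound on \<open>h\<^sup>2 p\<close> replaces the differential inequality.\<close>

lemma one_step:
  fixes \<theta> C B R R' :: real
  assumes \<theta>: "0 < \<theta>" and C: "0 \<le> C" and R: "0 < R'" "R' < R" and B: "0 \<le> B"
    and bd0: "\<forall>l\<in>\<Lambda>. \<forall>x\<in>Y. \<bar>c l x\<bar> \<le> B \<and> \<bar>b l x\<bar> \<le> B"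
  shows "\<exists>C'\<ge>0. \<forall>h z p q r S. 0 < h \<and> h \<le> 1 \<and> ball z R \<subseteq> Y \<and> 0 < S \<and>
     (\<forall>x\<in>ball z R. 0 \<le> p x \<and> 0 \<le> r x \<and> 0 \<le> q x \<and> q x \<le> S \<and> h\<^sup>2 * p x \<le> C * S \<and>
        Lh h p x \<ge> \<theta> * r x - C * p x - C * S \<and> Lh h q x \<ge> \<theta> * p x - C * S \<and>
        (\<forall>l\<in>\<Lambda>. 0 \<le> c l x + h * b l x) \<and>
        (\<forall>l\<in>\<Lambda>. \<forall>t>0. \<bar>fdiff h l p x\<bar> \<le> p x / t + (t + h) * r x)) \<longrightarrow>
     (\<forall>x\<in>ball z R'. p x \<le> C' * S)"
proof -
  have bd: "\<bar>c l x\<bar> \<le> B \<and> \<bar>b l x\<bar> \<le> B" if "l \<in> \<Lambda>" "x \<in> Y" for l x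
    using bd0 that by blast
  define \<rho> where "\<rho> = (if \<Lambda> = {} then 0 else Max (norm ` \<Lambda>))"
  have \<rho>: "norm l \<le> \<rho>" if "l \<in> \<Lambda>" for l
    using that fin by (auto simp: \<rho>_def)
  have \<rho>0: "0 \<le> \<rho>"
  proof (cases "\<Lambda> = {}")
    case False
    then obtain l where "l \<in> \<Lambda>" by blast
    then show ?thesis using \<rho>[of l] norm_ge_zero[of l] by linarith
  qed (simp add: \<rho>_def)
  define n where "n = real (card \<Lambda>)"
  have n: "0 \<le> n" by (simp add: n_def)
  have R0: "0 < R" using R by simp
  \<comment> \<open>On the ball, \<open>K0\<close> bounds the first differences of the cut-off
    \<open>P\<close>, \<open>K1 * P\<close> those of \<open>P\<^sup>2\<close> at points with
    \<open>h \<le> P\<close>, \<open>K2\<close> bounds \<open>Lh\<close> applied to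
    \<open>P\<^sup>2\<close>, and \<open>K3\<close> collects the weights in the cross term.\<close>
  define K0 where "K0 = 2 * R * \<rho> + \<rho>\<^sup>2"
  have K0: "0 \<le> K0" using R0 \<rho>0 by (simp add: K0_def)
  define K1 where "K1 = 2 * K0 + K0\<^sup>2"
  have K1: "0 \<le> K1" using K0 by (simp add: K1_def)
  define K2 where "K2 = 2 * R\<^sup>2 * (n * (B * \<rho>\<^sup>2 + B * K0)) + n * (2 * B * K0\<^sup>2)"
  have K2: "0 \<le> K2" using K0 n B by (simp add: K2_def)
  define K3 where "K3 = n * (2 * B * K1)"
  have K3: "0 \<le> K3" using K1 n B by (simp add: K3_def)
  \<comment> \<open>\<open>\<epsilon>\<close> and \<open>1 / M\<close> together keep the cross term
    below the gain \<open>\<theta> * P\<^sup>2 * r\<close>. Moreover \<open>K0 < M\<close> ensures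
    that all neighbours of a point with \<open>P \<ge> M * h\<close> lie in the ball.\<close>
  define \<epsilon> where "\<epsilon> = \<theta> / (2 * (K3 + 1))"
  have \<epsilon>: "0 < \<epsilon>" using \<theta> K3 by (simp add: \<epsilon>_def)
  define M where "M = 1 + K0 + 1 / \<epsilon>"
  have M: "1 \<le> M" "K0 < M" "1 / M \<le> \<epsilon>" "0 < M"
  proof -
    show "1 \<le> M" "K0 < M" "0 < M" using K0 \<epsilon> by (auto simp: M_def add_pos_pos add_nonneg_pos)
    then have "1 / \<epsilon> \<le> M" "0 < M" using K0 by (auto simp: M_def)
    then show "1 / M \<le> \<epsilon>" using \<epsilon> by (simp add: field_simps)
  qed
  have K3\<epsilon>: "K3 * (\<epsilon> + 1 / M) \<le> \<theta>"
  proof -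
    have "K3 * (\<epsilon> + 1 / M) \<le> (K3 + 1) * (\<epsilon> + \<epsilon>)" using K3 M \<epsilon> by (intro mult_mono) auto
    also have "\<dots> = 2 * (K3 + 1) * \<epsilon>" by (simp add: algebra_simps)
    also have "\<dots> = \<theta>"
    proof -
      have "K3 + 1 \<noteq> 0" using K3 by linarith
      then show ?thesis unfolding \<epsilon>_def by (simp add: field_simps)
    qed
    finally show ?thesis .
  qed
  \<comment> \<open>Large enough for the gain \<open>m * \<theta> * p\<close> from
    \<open>m * Lh h q\<close> to outweigh every other term in \<open>p\<close> and to leave one
    \<open>p\<close> over.\<close>
  define m where "m = (C * R ^ 4 + K2 + K3 / \<epsilon> + 1) / \<theta>"
  have m: "0 \<le> m" using \<theta> C K2 K3 \<epsilon> by (simp add: m_def)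
  have m\<theta>: "m * \<theta> = C * R ^ 4 + K2 + K3 / \<epsilon> + 1" using \<theta> by (simp add: m_def)
  \<comment> \<open>Bound for \<open>P\<^sup>2 * p + m * q\<close> in units of \<open>S\<close>: the
    first summand serves points with \<open>P < M * h\<close>, the second the other points,
    \<open>m\<close> the term with \<open>q\<close>, and the final \<open>1\<close> pays for using a
    near-maximum.\<close>
  define W where "W = M\<^sup>2 * C + R ^ 4 * (1 + C * (R ^ 4 + m)) + m + 1"
  have W: "0 \<le> W" using C m by (simp add: W_def)
  define d where "d = (R\<^sup>2 - R'\<^sup>2)\<^sup>2"
  have d: "0 < d"
  proof -
    have "R'\<^sup>2 < R\<^sup>2" using R by (intro power_strict_mono) auto
    then show ?thesis by (simp add: d_def)
  qed
  show ?thesis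
  proof (intro exI[of _ "W / d"] conjI allI impI)
    show "0 \<le> W / d" using W d by simp
  next
    fix h :: real and z p q r and S :: real
    assume asm: "0 < h \<and> h \<le> 1 \<and> ball z R \<subseteq> Y \<and> 0 < S \<and>
     (\<forall>x\<in>ball z R. 0 \<le> p x \<and> 0 \<le> r x \<and> 0 \<le> q x \<and> q x \<le> S \<and> h\<^sup>2 * p x \<le> C * S \<and>
        Lh h p x \<ge> \<theta> * r x - C * p x - C * S \<and> Lh h q x \<ge> \<theta> * p x - C * S \<and>
        (\<forall>l\<in>\<Lambda>. 0 \<le> c l x + h * b l x) \<and>
        (\<forall>l\<in>\<Lambda>. \<forall>t>0. \<bar>fdiff h l p x\<bar> \<le> p x / t + (t + h) * r x))"
    then have h: "0 < h" "h \<le> 1" and Y: "ball z R \<subseteq> Y" and S: "0 < S" by auto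
    have h0: "h \<noteq> 0" using h by simp
    have H: "0 \<le> p x" "0 \<le> r x" "0 \<le> q x" "q x \<le> S" "h\<^sup>2 * p x \<le> C * S"
        "Lh h p x \<ge> \<theta> * r x - C * p x - C * S" "Lh h q x \<ge> \<theta> * p x - C * S"
      if "x \<in> ball z R" for x using asm that by auto
    have Hp: "0 \<le> c l x + h * b l x" if "x \<in> ball z R" "l \<in> \<Lambda>" for x l using asm that by auto
    have Hd: "\<bar>fdiff h l p x\<bar> \<le> p x / t + (t + h) * r x" if "x \<in> ball z R" "l \<in> \<Lambda>" "0 < t" for x l t
      using asm that by auto
    define P where "P x = R\<^sup>2 - (norm (x - z))\<^sup>2" for x
    have P0: "0 < P x" "P x \<le> R\<^sup>2" if "x \<in> ball z R" for x
    proof -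
      have "norm (x - z) < R" using that by (simp add: dist_norm norm_minus_commute)
      then have "(norm (x - z))\<^sup>2 < R\<^sup>2" by (intro power_strict_mono) auto
      then show "0 < P x" "P x \<le> R\<^sup>2" by (auto simp: P_def)
    qed
    have P4: "(P x)\<^sup>2 \<le> R ^ 4" if "x \<in> ball z R" for x
    proof -
      have "(P x)\<^sup>2 \<le> (R\<^sup>2)\<^sup>2" using P0[OF that] by (intro power_mono) auto
      then show ?thesis by simp
    qed
    define w where "w x = (P x)\<^sup>2 * p x + m * q x" for x
    have dP: "fdiff h l P x = - (2 * ((x - z) \<bullet> l) + h * (norm l)\<^sup>2)" for l x
    proof -
      have "(norm (x + h *\<^sub>R l - z))\<^sup>2 = (norm (x - z))\<^sup>2 + 2 * h * ((x - z) \<bullet> l) + h\<^sup>2 * (norm l)\<^sup>2"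
        unfolding power2_norm_eq_inner
        by (simp add: inner_simps inner_commute algebra_simps power2_eq_square)
      then show ?thesis using h0 by (simp add: fdiff_def P_def field_simps power2_eq_square)
    qed
    have ddP: "fdiff h l (fdiff h (- l) P) x = 2 * (norm l)\<^sup>2" for l x
      unfolding dP[abs_def] using h0
      by (simp add: fdiff_def power2_norm_eq_inner inner_simps field_simps)
    have dP_bd: "\<bar>fdiff h l P x\<bar> \<le> K0" if "x \<in> ball z R" "l \<in> \<Lambda>" for x l
    proof -
      have nx: "norm (x - z) \<le> R" using that by (simp add: dist_norm norm_minus_commute less_imp_le)
      have "\<bar>(x - z) \<bullet> l\<bar> \<le> norm (x - z) * norm l" by (rule Cauchy_Schwarz_ineq2)
      also have "\<dots> \<le> R * \<rho>" using nx \<rho>[OF that(2)] R0 by (intro mult_mono) auto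
      finally have 1: "\<bar>(x - z) \<bullet> l\<bar> \<le> R * \<rho>" .
      have "h * (norm l)\<^sup>2 \<le> 1 * \<rho>\<^sup>2" using h \<rho>[OF that(2)] by (intro mult_mono power_mono) auto
      moreover have "0 \<le> h * (norm l)\<^sup>2" using h by simp
      ultimately show ?thesis unfolding dP K0_def using 1 by linarith
    qed
    \<comment> \<open>This bound degenerates as \<open>h\<close> tends to 0; it only ensures that
      the supremum of \<open>w\<close> is finite.\<close>
    have bdd: "w x \<le> R ^ 4 * (C * S / h\<^sup>2) + m * S" if "x \<in> ball z R" for x
    proof -
      have "p x \<le> C * S / h\<^sup>2" using H(5)[OF that] h by (simp add: field_simps)
      then have "(P x)\<^sup>2 * p x \<le> R ^ 4 * (C * S / h\<^sup>2)" using P4[OF that] H(1)[OF that]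
        by (intro mult_mono) auto
      moreover have "m * q x \<le> m * S" using H[OF that] m by (intro mult_left_mono) auto
      ultimately show ?thesis by (simp add: w_def)
    qed
    have bdd': "bdd_above (w ` ball z R)" using bdd by (intro bdd_aboveI[of _ "R ^ 4 * (C * S / h\<^sup>2) + m * S"]) auto
    define s where "s = (SUP x\<in>ball z R. w x)"
    have ws: "w x \<le> s" if "x \<in> ball z R" for x unfolding s_def using that bdd' by (rule cSUP_upper)
    \<comment> \<open>The supremum of \<open>w\<close> need not be attained. At a point within
      \<open>\<tau>\<close> of it the increments of \<open>w\<close> are at most
      \<open>\<tau>\<close>, and the factor \<open>h\<^sup>2\<close> in \<open>\<tau>\<close>
      compensates the \<open>1 / h\<^sup>2\<close> in the operator, so that
      \<open>Lh h w \<le> S\<close> there.\<close>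
    define \<tau> where "\<tau> = min S (S * h\<^sup>2 / (2 * B * n + 1))"
    have \<tau>: "0 < \<tau>" "\<tau> \<le> S" using S h B n by (auto simp: \<tau>_def add_nonneg_pos)
    have \<tau>2: "n * (2 * B) * \<tau> \<le> S * h\<^sup>2"
    proof -
      have "n * (2 * B) * \<tau> \<le> (2 * B * n + 1) * (S * h\<^sup>2 / (2 * B * n + 1))"
        using S h B n \<tau> by (intro mult_mono) (auto simp: \<tau>_def)
      also have "\<dots> = S * h\<^sup>2" using B n by (simp add: add_nonneg_pos less_imp_neq[symmetric])
      finally show ?thesis .
    qed
    have "\<exists>x0\<in>ball z R. s - \<tau> < w x0"
    proof (rule ccontr)
      assume "\<not> ?thesis"
      then have "s \<le> s - \<tau>" unfolding s_def using R0
        by (intro cSUP_least) (auto simp: not_less)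
      then show False using \<tau> by simp
    qed
    then obtain x0 where x0: "x0 \<in> ball z R" "s - \<tau> < w x0" by blast
    have wx0: "w x0 \<le> (W - 1) * S"
    proof (cases "P x0 < M * h")
      case True
      have "(P x0)\<^sup>2 * p x0 \<le> (M * h)\<^sup>2 * p x0"
        using True P0[OF x0(1)] H(1)[OF x0(1)] by (intro mult_right_mono power_mono) auto
      also have "\<dots> = M\<^sup>2 * (h\<^sup>2 * p x0)" by (simp add: power_mult_distrib)
      also have "\<dots> \<le> M\<^sup>2 * (C * S)" using H(5)[OF x0(1)] by (intro mult_left_mono) auto
      finally have 1: "(P x0)\<^sup>2 * p x0 \<le> M\<^sup>2 * C * S" by simp
      have 2: "m * q x0 \<le> m * S" using H[OF x0(1)] m by (intro mult_left_mono) auto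
      have 3: "0 \<le> R ^ 4 * (1 + C * (R ^ 4 + m)) * S" using C m S by simp
      show ?thesis unfolding w_def W_def using 1 2 3 by (simp add: distrib_right)
    next
      case False
      then have PM: "M * h \<le> P x0" by simp
      note x = x0(1)
      have nb: "x0 + h *\<^sub>R l \<in> ball z R" if l: "l \<in> \<Lambda>" for l
      proof -
        have "P (x0 + h *\<^sub>R l) = P x0 + h * fdiff h l P x0" using h0 by (simp add: fdiff_def)
        moreover have "h * fdiff h l P x0 \<ge> - (h * K0)"
          using mult_left_mono[of "- K0" "fdiff h l P x0" h] dP_bd[OF x l] h by (simp add: abs_le_iff)
        moreover have "h * K0 < M * h" using M(2) h by simp
        ultimately have "0 < P (x0 + h *\<^sub>R l)" using PM by linarith
        then have "(norm (x0 + h *\<^sub>R l - z))\<^sup>2 < R\<^sup>2" by (simp add: P_def)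
        then have "norm (x0 + h *\<^sub>R l - z) < R" using R0 by (simp add: power_less_imp_less_base)
        then show ?thesis by (simp add: dist_norm norm_minus_commute)
      qed
      have cb: "\<bar>c l x0 + h * b l x0\<bar> \<le> 2 * B" if l: "l \<in> \<Lambda>" for l
      proof -
        have "\<bar>c l x0\<bar> \<le> B" "\<bar>b l x0\<bar> \<le> B" using bd[OF l] x Y by auto
        moreover have "\<bar>h * b l x0\<bar> \<le> 1 * B" unfolding abs_mult using calculation h by (intro mult_mono) auto
        ultimately show ?thesis by linarith
      qed
      have up: "Lh h w x0 \<le> S"
      proof -
        have "Lh h w x0 = (\<Sum>l\<in>\<Lambda>. (c l x0 + h * b l x0) * (w (x0 + h *\<^sub>R l) - w x0) / h\<^sup>2)"
          unfolding Lh_def using h0 by (intro sum.cong) (auto simp: fdiff_def field_simps power2_eq_square)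
        also have "\<dots> \<le> (\<Sum>l\<in>\<Lambda>. 2 * B * \<tau> / h\<^sup>2)"
        proof (rule sum_mono, rule divide_right_mono)
          fix l assume l: "l \<in> \<Lambda>"
          have "(c l x0 + h * b l x0) * (w (x0 + h *\<^sub>R l) - w x0) \<le> (c l x0 + h * b l x0) * \<tau>"
            using ws[OF nb[OF l]] x0(2) Hp[OF x l] by (intro mult_left_mono) auto
          also have "\<dots> \<le> 2 * B * \<tau>" using cb[OF l] \<tau> by (intro mult_right_mono) auto
          finally show "(c l x0 + h * b l x0) * (w (x0 + h *\<^sub>R l) - w x0) \<le> 2 * B * \<tau>" .
        qed simp
        also have "\<dots> \<le> S" using \<tau>2 h by (simp add: n_def[symmetric] field_simps)
        finally show ?thesis .
      qed
      have LP: "\<bar>Lh h P x0\<bar> \<le> n * (B * \<rho>\<^sup>2 + B * K0)"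
      proof -
        have "\<bar>Lh h P x0\<bar> \<le> (\<Sum>l\<in>\<Lambda>. B * \<rho>\<^sup>2 + B * K0)"
          unfolding Lh_alt[OF h0] ddP
        proof (rule order_trans[OF sum_abs], rule sum_mono)
          fix l assume l: "l \<in> \<Lambda>"
          have cl: "\<bar>c l x0\<bar> \<le> B" "\<bar>b l x0\<bar> \<le> B" using bd[OF l] x Y by auto
          have "\<bar>c l x0\<bar> * (norm l)\<^sup>2 \<le> B * \<rho>\<^sup>2"
            using cl \<rho>[OF l] B by (intro mult_mono power_mono) auto
          moreover have "\<bar>b l x0\<bar> * \<bar>fdiff h l P x0\<bar> \<le> B * K0"
            using cl dP_bd[OF x l] B by (intro mult_mono) auto
          ultimately show "\<bar>- (1 / 2) * c l x0 * (2 * (norm l)\<^sup>2) + b l x0 * fdiff h l P x0\<bar> \<le> B * \<rho>\<^sup>2 + B * K0"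
            by (intro order_trans[OF abs_triangle_ineq]) (simp add: abs_mult)
        qed
        then show ?thesis by (simp add: n_def)
      qed
      have L\<zeta>: "\<bar>Lh h (\<lambda>x. (P x)\<^sup>2) x0\<bar> \<le> K2"
      proof -
        have "\<bar>2 * P x0 * Lh h P x0\<bar> \<le> 2 * R\<^sup>2 * (n * (B * \<rho>\<^sup>2 + B * K0))"
          unfolding abs_mult using P0[OF x] LP by (intro mult_mono) auto
        moreover have "\<bar>\<Sum>l\<in>\<Lambda>. (c l x0 + h * b l x0) * (fdiff h l P x0)\<^sup>2\<bar> \<le> (\<Sum>l\<in>\<Lambda>. 2 * B * K0\<^sup>2)"
        proof (rule order_trans[OF sum_abs], rule sum_mono)
          fix l assume l: "l \<in> \<Lambda>"
          have "(fdiff h l P x0)\<^sup>2 \<le> K0\<^sup>2" using dP_bd[OF x l] K0 by (simp add: abs_le_square_iff[symmetric])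
          then show "\<bar>(c l x0 + h * b l x0) * (fdiff h l P x0)\<^sup>2\<bar> \<le> 2 * B * K0\<^sup>2"
            unfolding abs_mult using cb[OF l] B by (intro mult_mono) auto
        qed
        ultimately show ?thesis unfolding Lh_power2[OF h0] K2_def by (simp add: n_def)
      qed
      have d\<zeta>: "\<bar>fdiff h l (\<lambda>x. (P x)\<^sup>2) x0\<bar> \<le> K1 * P x0" if l: "l \<in> \<Lambda>" for l
      proof -
        have hP: "h \<le> P x0" using PM h mult_right_mono[OF M(1), of h] by linarith
        have "\<bar>2 * P x0 * fdiff h l P x0\<bar> \<le> 2 * P x0 * K0"
          unfolding abs_mult using dP_bd[OF x l] P0[OF x] by (intro mult_mono) auto
        moreover have "\<bar>h * (fdiff h l P x0)\<^sup>2\<bar> \<le> P x0 * K0\<^sup>2"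
        proof -
          have "(fdiff h l P x0)\<^sup>2 \<le> K0\<^sup>2" using dP_bd[OF x l] K0 by (simp add: abs_le_square_iff[symmetric])
          then show ?thesis unfolding abs_mult using hP h by (intro mult_mono) auto
        qed
        ultimately show ?thesis unfolding fdiff_power2[OF h0] K1_def
          by (simp add: algebra_simps)
      qed
      have cross: "\<bar>\<Sum>l\<in>\<Lambda>. (c l x0 + h * b l x0) * (fdiff h l (\<lambda>x. (P x)\<^sup>2) x0 * fdiff h l p x0)\<bar>
           \<le> K3 / \<epsilon> * p x0 + \<theta> * ((P x0)\<^sup>2 * r x0)"
      proof -
        have "\<bar>\<Sum>l\<in>\<Lambda>. (c l x0 + h * b l x0) * (fdiff h l (\<lambda>x. (P x)\<^sup>2) x0 * fdiff h l p x0)\<bar>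
            \<le> (\<Sum>l\<in>\<Lambda>. 2 * B * (K1 * P x0 * (p x0 / (\<epsilon> * P x0) + (\<epsilon> * P x0 + h) * r x0)))"
        proof (rule order_trans[OF sum_abs], rule sum_mono)
          fix l assume l: "l \<in> \<Lambda>"
          \<comment> \<open>The weight is proportional to the cut-off: the factor \<open>P\<close>
            from the difference of \<open>P\<^sup>2\<close> cancels the denominator, and in front of
            \<open>r\<close> a multiple of \<open>P\<^sup>2\<close> appears, once
            \<open>h \<le> P / M\<close> is used for the term with \<open>h\<close>.\<close>
          have "\<bar>fdiff h l p x0\<bar> \<le> p x0 / (\<epsilon> * P x0) + (\<epsilon> * P x0 + h) * r x0"
            using Hd[OF x l, of "\<epsilon> * P x0"] \<epsilon> P0[OF x] by simp
          then show "\<bar>(c l x0 + h * b l x0) * (fdiff h l (\<lambda>x. (P x)\<^sup>2) x0 * fdiff h l p x0)\<bar>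
            \<le> 2 * B * (K1 * P x0 * (p x0 / (\<epsilon> * P x0) + (\<epsilon> * P x0 + h) * r x0))"
            unfolding abs_mult using cb[OF l] d\<zeta>[OF l] B K1 P0[OF x] by (intro mult_mono) auto
        qed
        also have "\<dots> = K3 * (P x0 * (p x0 / (\<epsilon> * P x0) + (\<epsilon> * P x0 + h) * r x0))"
          by (simp add: K3_def n_def)
        also have "P x0 * (p x0 / (\<epsilon> * P x0) + (\<epsilon> * P x0 + h) * r x0)
            = p x0 / \<epsilon> + (\<epsilon> * (P x0)\<^sup>2 + h * P x0) * r x0"
          using P0[OF x] \<epsilon> by (simp add: field_simps power2_eq_square)
        also have "K3 * (p x0 / \<epsilon> + (\<epsilon> * (P x0)\<^sup>2 + h * P x0) * r x0)
            \<le> K3 * (p x0 / \<epsilon> + (\<epsilon> * (P x0)\<^sup>2 + 1 / M * (P x0)\<^sup>2) * r x0)"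
        proof -
          have "h \<le> 1 / M * P x0" using PM M(4) by (simp add: field_simps)
          then have "h * P x0 \<le> 1 / M * (P x0)\<^sup>2"
            using P0[OF x] mult_right_mono[of h "1 / M * P x0" "P x0"] by (simp add: power2_eq_square)
          then show ?thesis using K3 H(2)[OF x] by (intro mult_left_mono add_mono mult_right_mono) auto
        qed
        also have "\<dots> = K3 / \<epsilon> * p x0 + K3 * (\<epsilon> + 1 / M) * ((P x0)\<^sup>2 * r x0)"
          by (simp add: algebra_simps)
        also have "\<dots> \<le> K3 / \<epsilon> * p x0 + \<theta> * ((P x0)\<^sup>2 * r x0)"
          using mult_right_mono[OF K3\<epsilon>, of "(P x0)\<^sup>2 * r x0"] H(2)[OF x] by simp
        finally show ?thesis .
      qed
      have L: "Lh h w x0 = (P x0)\<^sup>2 * Lh h p x0 + p x0 * Lh h (\<lambda>x. (P x)\<^sup>2) x0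
         + (\<Sum>l\<in>\<Lambda>. (c l x0 + h * b l x0) * (fdiff h l (\<lambda>x. (P x)\<^sup>2) x0 * fdiff h l p x0)) + m * Lh h q x0"
        unfolding w_def[abs_def] Lh_add Lh_cmult Lh_mult[OF h0] ..
      have 1: "(P x0)\<^sup>2 * Lh h p x0 \<ge> (P x0)\<^sup>2 * (\<theta> * r x0 - C * p x0 - C * S)"
        using H(6)[OF x] by (intro mult_left_mono) auto
      have 2: "(P x0)\<^sup>2 * (C * p x0 + C * S) \<le> R ^ 4 * (C * p x0 + C * S)"
        using P4[OF x] C H(1)[OF x] S by (intro mult_right_mono) auto
      have 3: "p x0 * Lh h (\<lambda>x. (P x)\<^sup>2) x0 \<ge> - (p x0 * K2)"
        using mult_left_mono[of "- K2" "Lh h (\<lambda>x. (P x)\<^sup>2) x0" "p x0"] L\<zeta> H(1)[OF x] by (simp add: abs_le_iff)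
      have 4: "m * Lh h q x0 \<ge> m * (\<theta> * p x0 - C * S)"
        using H(7)[OF x] m by (intro mult_left_mono) auto
      have 5: "m * (\<theta> * p x0 - C * S) = (C * R ^ 4 + K2 + K3 / \<epsilon> + 1) * p x0 - m * C * S"
        unfolding m\<theta>[symmetric] by (simp add: algebra_simps)
      have "p x0 \<le> Lh h w x0 + C * S * (R ^ 4 + m)"
        using 1 2 3 4 cross unfolding L 5 by (simp add: algebra_simps)
      then have "p x0 \<le> (1 + C * (R ^ 4 + m)) * S" using up by (simp add: algebra_simps)
      then have "(P x0)\<^sup>2 * p x0 \<le> R ^ 4 * ((1 + C * (R ^ 4 + m)) * S)"
        using P4[OF x] H(1)[OF x] by (intro mult_mono) auto
      moreover have "m * q x0 \<le> m * S" using H[OF x] m by (intro mult_left_mono) auto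
      moreover have "0 \<le> M\<^sup>2 * C * S" using C S by simp
      ultimately show ?thesis unfolding w_def W_def by (simp add: algebra_simps)
    qed
    have sW: "s \<le> W * S" using wx0 x0(2) \<tau>(2) by (simp add: algebra_simps)
    show "\<forall>x\<in>ball z R'. p x \<le> W / d * S"
    proof
      fix x assume xR': "x \<in> ball z R'"
      then have x: "x \<in> ball z R" using R by simp
      have "norm (x - z) \<le> R'" using xR' by (simp add: dist_norm norm_minus_commute less_imp_le)
      then have "(norm (x - z))\<^sup>2 \<le> R'\<^sup>2" by (intro power_mono) auto
      then have "R\<^sup>2 - R'\<^sup>2 \<le> P x" by (simp add: P_def)
      moreover have "0 \<le> R\<^sup>2 - R'\<^sup>2" using R by (simp add: power_mono)
      ultimately have "d \<le> (P x)\<^sup>2" unfolding d_def by (intro power_mono) auto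
      then have "d * p x \<le> (P x)\<^sup>2 * p x" using H(1)[OF x] by (rule mult_right_mono)
      also have "\<dots> \<le> w x" using H(3)[OF x] m by (simp add: w_def)
      also have "\<dots> \<le> W * S" using ws[OF x] sW by simp
      finally show "p x \<le> W / d * S" using d by (simp add: field_simps)
    qed
  qed
qed

text \<open>Induction on the order. The bound for \<open>energy h k\<close> on a slightly larger
  ball lets this energy play the part of \<open>q\<close> in \<open>one_step\<close>, with the
  energies of the next two orders as \<open>p\<close> and \<open>r\<close>. No boundary values
  enter, and the constants are uniform in \<open>h\<close>, \<open>z\<close> and
  \<open>u\<close>.\<close>

lemma interior_estimate:
  assumes coef: "\<And>h l \<gamma> x. 0 < h \<Longrightarrow> h \<le> 1 \<Longrightarrow> l \<in> \<Lambda> \<Longrightarrow> \<gamma> \<in> wle \<Lambda> K \<Longrightarrow> x \<in> Y \<Longrightarrow>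
       \<bar>fdiffs h \<gamma> (c l) x\<bar> \<le> B \<and> \<bar>fdiffs h \<gamma> (b l) x\<bar> \<le> B \<and> \<bar>fdiffs h \<gamma> q x\<bar> \<le> B"
    and ell: "\<And>l x. l \<in> \<Lambda> \<Longrightarrow> x \<in> Y \<Longrightarrow> \<theta> \<le> c l x" and \<theta>: "0 < \<theta>"
    and \<Lambda>: "\<Lambda> \<noteq> {}" and B: "0 < B" and k: "k \<le> K" and R: "0 < R'" "R' < R"
  shows "\<exists>C\<ge>0. \<exists>h0>0. \<forall>h z u S. 0 < h \<and> h < h0 \<and> ball z R \<subseteq> Y \<and> 0 < S \<and>
     (\<forall>x\<in>ball z R. (u x)\<^sup>2 \<le> S \<and>
        (\<forall>j\<le>k. (\<Sum>\<alpha>\<in>weq \<Lambda> j. (fdiffs h \<alpha> (\<lambda>x. Lh h u x + q x * u x) x)\<^sup>2) \<le> S)) \<longrightarrow>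
     (\<forall>x\<in>ball z R'. \<forall>j\<le>k. energy h j u x \<le> C * S)"
  using k R
proof (induction k arbitrary: R')
  case 0
  show ?case
    by (rule exI[of _ 1], simp, rule exI[of _ 1]) (use 0 in \<open>auto simp: energy_0\<close>)
next
  case (Suc k)
  \<comment> \<open>The previous order is bounded on radius \<open>R1\<close>, the one-step estimate
    runs on radius \<open>R2\<close>. The gap contains the neighbours
    \<open>x + h *\<^sub>R l\<close>, which are needed for the trivial bound on
    \<open>h\<^sup>2 * energy h (Suc k) u x\<close>.\<close>
  define R1 where "R1 = (R' + R) / 2"
  define R2 where "R2 = (R' + R1) / 2"
  have RR: "0 < R1" "R1 < R" "R' < R1" "R' < R2" "R2 < R1" "0 < R2" using Suc.prems by (auto simp: R1_def R2_def field_simps)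
  define n where "n = real (card \<Lambda>)"
  define \<rho> where "\<rho> = Max (norm ` \<Lambda>)"
  have \<rho>: "norm l \<le> \<rho>" if "l \<in> \<Lambda>" for l
    using that fin by (auto simp: \<rho>_def)
  have \<rho>0: "0 \<le> \<rho>" proof -
    obtain l where "l \<in> \<Lambda>" using \<Lambda> by blast
    then show ?thesis using \<rho>[of l] norm_ge_zero[of l] by linarith
  qed
  have "k \<le> K" using Suc.prems by simp
  obtain C1 h1 where C1: "C1 \<ge> 0" and h1: "h1 > 0"
    and IH: "\<forall>h z u S. 0 < h \<and> h < h1 \<and> ball z R \<subseteq> Y \<and> 0 < S \<and>
     (\<forall>x\<in>ball z R. (u x)\<^sup>2 \<le> S \<and>
        (\<forall>j\<le>k. (\<Sum>\<alpha>\<in>weq \<Lambda> j. (fdiffs h \<alpha> (\<lambda>x. Lh h u x + q x * u x) x)\<^sup>2) \<le> S)) \<longrightarrow>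
     (\<forall>x\<in>ball z R1. \<forall>j\<le>k. energy h j u x \<le> C1 * S)"
    using Suc.IH[OF \<open>k \<le> K\<close> RR(1,2)] by (elim exE conjE) (rule that)
  obtain Ca where Ca: "Ca \<ge> 0" and Ea: "\<And>h u x. x \<in> Y \<Longrightarrow> 0 < h \<Longrightarrow> h \<le> 1 \<Longrightarrow> h * B \<le> \<theta> / 2 \<Longrightarrow>
     Lh h (energy h k u) x \<ge> \<theta> / 4 * energy h (Suc k) u x
       - Ca * ((\<Sum>j\<le>k. energy h j u x) + (\<Sum>\<alpha>\<in>weq \<Lambda> k. (fdiffs h \<alpha> (\<lambda>x. Lh h u x + q x * u x) x)\<^sup>2))"
    using energy_ineq[of K Y B q \<theta> k, OF coef ell \<theta> \<Lambda> B \<open>k \<le> K\<close>] by blast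
  obtain Cb where Cb: "Cb \<ge> 0" and Eb: "\<And>h u x. x \<in> Y \<Longrightarrow> 0 < h \<Longrightarrow> h \<le> 1 \<Longrightarrow> h * B \<le> \<theta> / 2 \<Longrightarrow>
     Lh h (energy h (Suc k) u) x \<ge> \<theta> / 4 * energy h (Suc (Suc k)) u x
       - Cb * ((\<Sum>j\<le>Suc k. energy h j u x) + (\<Sum>\<alpha>\<in>weq \<Lambda> (Suc k). (fdiffs h \<alpha> (\<lambda>x. Lh h u x + q x * u x) x)\<^sup>2))"
    using energy_ineq[of K Y B q \<theta> "Suc k", OF coef ell \<theta> \<Lambda> B Suc.prems(1)] by blast
  \<comment> \<open>\<open>real k + 2\<close> counts the \<open>k + 1\<close> energies of order up
    to \<open>k\<close> and the data term. \<open>4 * n\<close> comes from bounding the square of an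
    increment by twice the two squares, for each of the \<open>n\<close> directions.\<close>
  define D where "D = (Ca + Cb) * (real k + 2) + 4 * n"
  have D: "0 \<le> D" using Ca Cb by (simp add: D_def n_def)
  have bd: "\<bar>c l x\<bar> \<le> B \<and> \<bar>b l x\<bar> \<le> B" if "l \<in> \<Lambda>" "x \<in> Y" for l x
    using coef[of 1 l "[]" x] that by (simp add: wle_def)
  then have bd0: "\<forall>l\<in>\<Lambda>. \<forall>x\<in>Y. \<bar>c l x\<bar> \<le> B \<and> \<bar>b l x\<bar> \<le> B" by blast
  have \<theta>4: "0 < \<theta> / 4" using \<theta> by simp
  obtain C2 where C2: "C2 \<ge> 0" and one: "\<forall>h z p q r S. 0 < h \<and> h \<le> 1 \<and> ball z R2 \<subseteq> Y \<and> 0 < S \<and>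
     (\<forall>x\<in>ball z R2. 0 \<le> p x \<and> 0 \<le> r x \<and> 0 \<le> q x \<and> q x \<le> S \<and> h\<^sup>2 * p x \<le> D * S \<and>
        Lh h p x \<ge> \<theta> / 4 * r x - D * p x - D * S \<and> Lh h q x \<ge> \<theta> / 4 * p x - D * S \<and>
        (\<forall>l\<in>\<Lambda>. 0 \<le> c l x + h * b l x) \<and>
        (\<forall>l\<in>\<Lambda>. \<forall>t>0. \<bar>fdiff h l p x\<bar> \<le> p x / t + (t + h) * r x)) \<longrightarrow>
     (\<forall>x\<in>ball z R'. p x \<le> C2 * S)"
    using one_step[of "\<theta> / 4" D R' R2 B Y, OF \<theta>4 D Suc.prems(2) RR(4) less_imp_le[OF B] bd0] by (elim exE conjE) (rule that)
  define h0 where "h0 = Min {h1, 1, \<theta> / (2 * B), (R1 - R2) / (\<rho> + 1)}"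
  have h0: "0 < h0" using h1 \<theta> B RR \<rho>0 by (auto simp: h0_def)
  have h0': "h < h1" "h \<le> 1" "h * B \<le> \<theta> / 2" "h * \<rho> < R1 - R2" if "h < h0" "0 < h" for h
  proof -
    have a: "h < h1" "h < 1" "h < \<theta> / (2 * B)" "h < (R1 - R2) / (\<rho> + 1)" using that by (auto simp: h0_def)
    then show "h < h1" "h \<le> 1" by auto
    show "h * B \<le> \<theta> / 2" using a(3) B by (simp add: field_simps)
    have "h * (\<rho> + 1) < R1 - R2" using a(4) \<rho>0 by (simp add: field_simps)
    then show "h * \<rho> < R1 - R2" using that by (simp add: distrib_left)
  qed
  define C3 where "C3 = C1 + 1"
  have C23: "0 \<le> C3 + C2 * C3" using C1 C2 by (simp add: C3_def)
  show ?case
  proof (rule exI[of _ "C3 + C2 * C3"], rule conjI[OF C23], rule exI[of _ h0], intro conjI allI impI ballI)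
    show "0 < h0" by (rule h0)
  next
    fix h z u S x j
    let ?g = "\<lambda>x. Lh h u x + q x * u x"
    let ?G = "\<lambda>j x. (\<Sum>\<alpha>\<in>weq \<Lambda> j. (fdiffs h \<alpha> ?g x)\<^sup>2)"
    assume asm: "0 < h \<and> h < h0 \<and> ball z R \<subseteq> Y \<and> 0 < S \<and>
       (\<forall>x\<in>ball z R. (u x)\<^sup>2 \<le> S \<and> (\<forall>j\<le>Suc k. ?G j x \<le> S))"
      and x: "x \<in> ball z R'" and j: "j \<le> Suc k"
    then have h: "0 < h" "h < h0" and Y: "ball z R \<subseteq> Y" and S: "0 < S" by auto
    note hh = h0'[OF h(2,1)]
    have h0: "h \<noteq> 0" using h by simp
    have G: "?G j x \<le> S" if "j \<le> Suc k" "x \<in> ball z R" for j x using asm that by blast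
    have low: "energy h j u x \<le> C1 * S" if x: "x \<in> ball z R1" and j: "j \<le> k" for j x
    proof -
      have "\<forall>x\<in>ball z R. (u x)\<^sup>2 \<le> S \<and> (\<forall>j\<le>k. ?G j x \<le> S)" using asm by simp
      with h(1) hh(1) Y S have "0 < h \<and> h < h1 \<and> ball z R \<subseteq> Y \<and> 0 < S \<and>
        (\<forall>x\<in>ball z R. (u x)\<^sup>2 \<le> S \<and> (\<forall>j\<le>k. ?G j x \<le> S))" by (intro conjI)
      then have "\<forall>x\<in>ball z R1. \<forall>j\<le>k. energy h j u x \<le> C1 * S"
        by (rule IH[THEN spec, THEN spec, THEN spec, THEN spec, THEN mp])
      then show ?thesis using x j by blast
    qed
    have C13: "C1 * S \<le> C3 * S" "S \<le> C3 * S" "0 < C3 * S" using S C1 by (auto simp: C3_def distrib_right add_nonneg_pos)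
    have "\<forall>x\<in>ball z R'. energy h (Suc k) u x \<le> C2 * (C3 * S)"
    proof (rule one[THEN spec, THEN spec, THEN spec, THEN spec, THEN spec, THEN spec, THEN mp,
           of h z "C3 * S" "energy h (Suc k) u" "energy h (Suc (Suc k)) u" "energy h k u"], intro conjI)
      show "ball z R2 \<subseteq> Y" using Y RR by (meson dual_order.trans less_imp_le subset_ball)
    next
      show "\<forall>x\<in>ball z R2. 0 \<le> energy h (Suc k) u x \<and> 0 \<le> energy h (Suc (Suc k)) u x \<and> 0 \<le> energy h k u x \<and>
        energy h k u x \<le> C3 * S \<and> h\<^sup>2 * energy h (Suc k) u x \<le> D * (C3 * S) \<and>
        Lh h (energy h (Suc k) u) x \<ge> \<theta> / 4 * energy h (Suc (Suc k)) u x - D * energy h (Suc k) u x - D * (C3 * S) \<and>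
        Lh h (energy h k u) x \<ge> \<theta> / 4 * energy h (Suc k) u x - D * (C3 * S) \<and>
        (\<forall>l\<in>\<Lambda>. 0 \<le> c l x + h * b l x) \<and>
        (\<forall>l\<in>\<Lambda>. \<forall>t>0. \<bar>fdiff h l (energy h (Suc k) u) x\<bar> \<le> energy h (Suc k) u x / t + (t + h) * energy h (Suc (Suc k)) u x)"
      proof
        fix x assume x: "x \<in> ball z R2"
        then have x1: "x \<in> ball z R1" and xR: "x \<in> ball z R" using RR by auto
        then have xY: "x \<in> Y" using Y by blast
        have s1: "(\<Sum>j\<le>k. energy h j u x) \<le> (real k + 1) * (C3 * S)"
        proof -
          have "(\<Sum>j\<le>k. energy h j u x) \<le> (\<Sum>j\<le>k. C3 * S)"
            by (rule sum_mono) (use low[OF x1] C13 in force)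
          then show ?thesis by (simp add: distrib_right)
        qed
        have q1: "energy h k u x \<le> C3 * S" using low[OF x1] C13 by force
        have q2: "h\<^sup>2 * energy h (Suc k) u x \<le> D * (C3 * S)"
        proof -
          have "h\<^sup>2 * energy h (Suc k) u x = (\<Sum>l\<in>\<Lambda>. \<Sum>\<alpha>\<in>weq \<Lambda> k. (fdiffs h \<alpha> u (x + h *\<^sub>R l) - fdiffs h \<alpha> u x)\<^sup>2)"
            unfolding energy_Suc sum_distrib_left using h0 by (simp add: fdiff_def power_divide)
          also have "\<dots> \<le> (\<Sum>l\<in>\<Lambda>. \<Sum>\<alpha>\<in>weq \<Lambda> k. 2 * (fdiffs h \<alpha> u (x + h *\<^sub>R l))\<^sup>2 + 2 * (fdiffs h \<alpha> u x)\<^sup>2)"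
          proof (intro sum_mono)
            fix l \<alpha>
            have "0 \<le> (fdiffs h \<alpha> u (x + h *\<^sub>R l) + fdiffs h \<alpha> u x)\<^sup>2" by simp
            then show "(fdiffs h \<alpha> u (x + h *\<^sub>R l) - fdiffs h \<alpha> u x)\<^sup>2
               \<le> 2 * (fdiffs h \<alpha> u (x + h *\<^sub>R l))\<^sup>2 + 2 * (fdiffs h \<alpha> u x)\<^sup>2"
              unfolding power2_sum power2_diff by linarith
          qed
          also have "\<dots> = (\<Sum>l\<in>\<Lambda>. 2 * energy h k u (x + h *\<^sub>R l) + 2 * energy h k u x)"
            by (simp add: sum.distrib energy_def sum_distrib_left)
          also have "\<dots> \<le> (\<Sum>l\<in>\<Lambda>. 4 * (C3 * S))"
          proof (rule sum_mono)
            fix l assume l: "l \<in> \<Lambda>"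
            have "dist z (x + h *\<^sub>R l) \<le> dist z x + norm (h *\<^sub>R l)"
              using dist_triangle[of z "x + h *\<^sub>R l" x] by (simp add: dist_norm)
            also have "norm (h *\<^sub>R l) \<le> h * \<rho>" using h \<rho>[OF l] by simp
            also have "dist z x + h * \<rho> < R1" using x hh(4) by simp
            finally have "x + h *\<^sub>R l \<in> ball z R1" by simp
            then have "energy h k u (x + h *\<^sub>R l) \<le> C3 * S" using low C13 by force
            then show "2 * energy h k u (x + h *\<^sub>R l) + 2 * energy h k u x \<le> 4 * (C3 * S)" using q1 by linarith
          qed
          also have "\<dots> = 4 * n * (C3 * S)" by (simp add: n_def)
          also have "\<dots> \<le> D * (C3 * S)" using C13 Ca Cb by (intro mult_right_mono) (auto simp: D_def)
          finally show ?thesis .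
        qed
        have Dab: "Ca * (real k + 2) \<le> D" "Cb * (real k + 2) \<le> D" "Cb \<le> D"
        proof -
          have "0 \<le> Ca * (real k + 2)" "0 \<le> Cb * (real k + 2)" "0 \<le> n" "Cb * 1 \<le> Cb * (real k + 2)"
            using Ca Cb mult_left_mono[of 1 "real k + 2" Cb] by (auto simp: n_def)
          then show "Ca * (real k + 2) \<le> D" "Cb * (real k + 2) \<le> D" "Cb \<le> D"
            unfolding D_def distrib_right by linarith+
        qed
        have q3: "Lh h (energy h (Suc k) u) x \<ge> \<theta> / 4 * energy h (Suc (Suc k)) u x - D * energy h (Suc k) u x - D * (C3 * S)"
        proof -
          have "Cb * ((\<Sum>j\<le>Suc k. energy h j u x) + ?G (Suc k) x)
              = Cb * ((\<Sum>j\<le>k. energy h j u x) + ?G (Suc k) x) + Cb * energy h (Suc k) u x"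
            by (simp add: algebra_simps)
          also have "\<dots> \<le> Cb * ((real k + 2) * (C3 * S)) + D * energy h (Suc k) u x"
            using s1 G[OF _ xR, of "Suc k"] C13 Cb Dab energy_nonneg
            by (intro add_mono mult_left_mono mult_right_mono) (auto simp: distrib_right)
          also have "Cb * ((real k + 2) * (C3 * S)) \<le> D * (C3 * S)"
            using mult_right_mono[OF Dab(2), of "C3 * S"] C13 by (simp only: mult.assoc less_imp_le)
          finally show ?thesis using Eb[OF xY h(1) hh(2,3), of u] by linarith
        qed
        have q4: "Lh h (energy h k u) x \<ge> \<theta> / 4 * energy h (Suc k) u x - D * (C3 * S)"
        proof -
          have "Ca * ((\<Sum>j\<le>k. energy h j u x) + ?G k x) \<le> Ca * ((real k + 2) * (C3 * S))"
            using s1 G[OF _ xR, of k] C13 Ca by (intro mult_left_mono) (auto simp: distrib_right)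
          also have "\<dots> \<le> D * (C3 * S)"
            using mult_right_mono[OF Dab(1), of "C3 * S"] C13 by (simp only: mult.assoc less_imp_le)
          finally show ?thesis using Ea[OF xY h(1) hh(2,3), of u] by linarith
        qed
        have q5: "0 \<le> c l x + h * b l x" if l: "l \<in> \<Lambda>" for l
        proof -
          have "\<bar>h * b l x\<bar> \<le> h * B" using bd[OF l xY] h by (simp add: abs_mult)
          then show ?thesis using ell[OF l xY] hh(3) \<theta> by linarith
        qed
        show "0 \<le> energy h (Suc k) u x \<and> 0 \<le> energy h (Suc (Suc k)) u x \<and> 0 \<le> energy h k u x \<and>
          energy h k u x \<le> C3 * S \<and> h\<^sup>2 * energy h (Suc k) u x \<le> D * (C3 * S) \<and>
          Lh h (energy h (Suc k) u) x \<ge> \<theta> / 4 * energy h (Suc (Suc k)) u x - D * energy h (Suc k) u x - D * (C3 * S) \<and>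
          Lh h (energy h k u) x \<ge> \<theta> / 4 * energy h (Suc k) u x - D * (C3 * S) \<and>
          (\<forall>l\<in>\<Lambda>. 0 \<le> c l x + h * b l x) \<and>
          (\<forall>l\<in>\<Lambda>. \<forall>t>0. \<bar>fdiff h l (energy h (Suc k) u) x\<bar> \<le> energy h (Suc k) u x / t + (t + h) * energy h (Suc (Suc k)) u x)"
          using energy_nonneg q1 q2 q3 q4 q5 fdiff_energy[OF h(1)] by blast
      qed
    qed (use h hh C13 in auto)
    then have top: "energy h (Suc k) u x \<le> C2 * (C3 * S)" using x by blast
    have pos: "0 \<le> C2 * (C3 * S)" using C2 C13 by simp
    have x1: "x \<in> ball z R1" using x RR by auto
    show "energy h j u x \<le> (C3 + C2 * C3) * S"
    proof (cases "j \<le> k")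
      case True
      then show ?thesis using low[OF x1 True] pos C13 by (simp add: algebra_simps)
    next
      case False
      then have "j = Suc k" using j by simp
      then show ?thesis using top C13 by (simp add: algebra_simps)
    qed
  qed
qed

end

section \<open>Comparison and discrete existence\<close>

context diff_scheme
begin

abbreviation pw :: "real \<Rightarrow> 'a \<Rightarrow> 'a \<Rightarrow> real" where
  "pw h l x \<equiv> c l x + h * b l x"

lemma Lh_weights:
  assumes "h \<noteq> 0"
  shows "Lh h u x = (\<Sum>l\<in>\<Lambda>. pw h l x * (u (x + h *\<^sub>R l) - u x)) / h\<^sup>2"
  unfolding Lh_def sum_divide_distrib
  using assms by (intro sum.cong) (auto simp: fdiff_def field_simps power2_eq_square)

text \<open>As the neighbouring values are nonpositive, \<open>Lh h v x\<close> is at most a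
  constant over \<open>h\<^sup>2\<close> times \<open>\<bar>v x\<bar>\<close>. So the strict lower
  bound \<open>\<eta>\<close> keeps \<open>v\<close> away from 0 uniformly on \<open>G\<close>,
  which replaces the attainment of a maximum.\<close>

lemma strict_neg:
  assumes h: "0 < h" and \<eta>: "0 < \<eta>" and Q: "0 \<le> Q" and B: "0 \<le> B"
    and p: "\<And>x l. x \<in> G \<Longrightarrow> l \<in> \<Lambda> \<Longrightarrow> 0 \<le> pw h l x \<and> pw h l x \<le> B"
    and v: "\<And>x. x \<in> G \<Longrightarrow> v x \<le> 0" and nb: "\<And>x l. x \<in> G \<Longrightarrow> l \<in> \<Lambda> \<Longrightarrow> v (x + h *\<^sub>R l) \<le> 0"
    and L: "\<And>x. x \<in> G \<Longrightarrow> Lh h v x \<ge> \<eta> - Q * \<bar>v x\<bar>"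
  shows "\<exists>\<gamma>>0. \<forall>x\<in>G. v x \<le> - \<gamma>"
proof (intro exI[of _ "\<eta> / (Q + real (card \<Lambda>) * B / h\<^sup>2 + 1)"] conjI ballI)
  let ?d = "Q + real (card \<Lambda>) * B / h\<^sup>2 + 1"
  have d: "0 < ?d" using Q B by (simp add: add_nonneg_pos)
  then show "0 < \<eta> / ?d" using \<eta> by simp
  fix x assume x: "x \<in> G"
  have "Lh h v x \<le> (\<Sum>l\<in>\<Lambda>. B * \<bar>v x\<bar>) / h\<^sup>2"
    unfolding Lh_weights[OF less_imp_neq[OF h, symmetric]]
  proof (rule divide_right_mono, rule sum_mono)
    fix l assume l: "l \<in> \<Lambda>"
    have "pw h l x * (v (x + h *\<^sub>R l) - v x) \<le> pw h l x * \<bar>v x\<bar>"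
      using nb[OF x l] p[OF x l] by (intro mult_left_mono) auto
    also have "\<dots> \<le> B * \<bar>v x\<bar>" using p[OF x l] by (intro mult_right_mono) auto
    finally show "pw h l x * (v (x + h *\<^sub>R l) - v x) \<le> B * \<bar>v x\<bar>" .
  qed simp
  also have "\<dots> = real (card \<Lambda>) * B / h\<^sup>2 * \<bar>v x\<bar>" by simp
  finally have "\<eta> \<le> Q * \<bar>v x\<bar> + real (card \<Lambda>) * B / h\<^sup>2 * \<bar>v x\<bar>" using L[OF x] by linarith
  also have "\<dots> \<le> ?d * \<bar>v x\<bar>" by (simp add: distrib_right)
  finally have "\<eta> / ?d \<le> \<bar>v x\<bar>" using d by (simp add: pos_divide_le_eq mult.commute)
  then show "v x \<le> - (\<eta> / ?d)" using v[OF x] by simp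
qed

text \<open>If the supremum \<open>\<rho>\<close> of \<open>w / S\<close> is positive, then
  \<open>w - \<rho> * S\<close> is nonpositive, hence uniformly negative by
  \<open>strict_neg\<close>, and \<open>\<rho>\<close> could be lowered. Dividing by a positive
  supersolution of the full operator is what copes with positive values of \<open>q\<close>. The set
  \<open>G\<close> may be arbitrary.\<close>

lemma comparison:
  assumes h: "0 < h" and \<eta>: "0 < \<eta>" and Q: "0 \<le> Q" and B: "0 \<le> B" and s: "0 < s"
    and p: "\<And>x l. x \<in> G \<Longrightarrow> l \<in> \<Lambda> \<Longrightarrow> 0 \<le> pw h l x \<and> pw h l x \<le> B"
    and q: "\<And>x. x \<in> G \<Longrightarrow> \<bar>q x\<bar> \<le> Q"
    and S: "\<And>x. x \<in> G \<Longrightarrow> s \<le> S x \<and> S x \<le> Sm"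
    and Snb: "\<And>x l. x \<in> G \<Longrightarrow> l \<in> \<Lambda> \<Longrightarrow> 0 \<le> S (x + h *\<^sub>R l)"
    and LS: "\<And>x. x \<in> G \<Longrightarrow> Lh h S x + q x * S x \<le> 0"
    and w: "\<And>x. x \<in> G \<Longrightarrow> w x \<le> W"
    and wnb: "\<And>x l. x \<in> G \<Longrightarrow> l \<in> \<Lambda> \<Longrightarrow> x + h *\<^sub>R l \<notin> G \<Longrightarrow> w (x + h *\<^sub>R l) \<le> 0"
    and Lw: "\<And>x. x \<in> G \<Longrightarrow> Lh h w x + q x * w x \<ge> \<eta>"
    and x: "x \<in> G"
  shows "w x \<le> 0"
proof (rule ccontr)
  assume neg: "\<not> w x \<le> 0"
  define \<rho> where "\<rho> = (SUP x\<in>G. w x / S x)"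
  have S0: "0 < S y" if "y \<in> G" for y using S[OF that] s by linarith
  have "w y / S y \<le> \<bar>W\<bar> / s" if y: "y \<in> G" for y
  proof -
    have "w y / S y \<le> \<bar>W\<bar> / S y" using w[OF y] S0[OF y] by (intro divide_right_mono) auto
    also have "\<dots> \<le> \<bar>W\<bar> / s" using S[OF y] s by (intro divide_left_mono) auto
    finally show ?thesis .
  qed
  then have bdd: "bdd_above ((\<lambda>x. w x / S x) ` G)" by (intro bdd_aboveI[of _ "\<bar>W\<bar> / s"]) auto
  have up: "w y / S y \<le> \<rho>" if "y \<in> G" for y unfolding \<rho>_def by (rule cSUP_upper[OF that bdd])
  have "0 < w x / S x" using neg S0[OF x] by simp
  then have \<rho>: "0 < \<rho>" using up[OF x] by linarith
  define v where "v y = w y - \<rho> * S y" for y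
  have v0: "v y \<le> 0" if "y \<in> G" for y
    using up[OF that] S0[OF that] by (simp add: v_def pos_divide_le_eq)
  have "\<exists>\<gamma>>0. \<forall>x\<in>G. v x \<le> - \<gamma>"
  proof (rule strict_neg[OF h \<eta> Q B p v0])
    fix y l assume y: "y \<in> G" and l: "l \<in> \<Lambda>"
    show "v (y + h *\<^sub>R l) \<le> 0"
    proof (cases "y + h *\<^sub>R l \<in> G")
      case False
      have "0 \<le> \<rho> * S (y + h *\<^sub>R l)" using \<rho> Snb[OF y l] by simp
      then show ?thesis using wnb[OF y l False] by (simp add: v_def)
    qed (rule v0)
  next
    fix y assume y: "y \<in> G"
    have L: "Lh h v y = Lh h w y - \<rho> * Lh h S y" unfolding v_def[abs_def] Lh_diff Lh_cmult ..
    have "\<rho> * (Lh h S y + q y * S y) \<le> 0" using LS[OF y] \<rho> by (simp add: mult_nonneg_nonpos)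
    then have "Lh h v y + q y * v y \<ge> \<eta>" using Lw[OF y] unfolding L v_def by (simp add: algebra_simps)
    moreover have "q y * v y \<le> Q * \<bar>v y\<bar>"
    proof -
      have "q y * v y \<le> \<bar>q y\<bar> * \<bar>v y\<bar>" by (metis abs_ge_self abs_mult)
      also have "\<dots> \<le> Q * \<bar>v y\<bar>" using q[OF y] by (intro mult_right_mono) auto
      finally show ?thesis .
    qed
    ultimately show "Lh h v y \<ge> \<eta> - Q * \<bar>v y\<bar>" by linarith
  qed
  then obtain \<gamma> where \<gamma>: "0 < \<gamma>" "\<And>y. y \<in> G \<Longrightarrow> v y \<le> - \<gamma>" by blast
  have Sm: "0 < Sm" using S[OF x] s by linarith
  \<comment> \<open>\<open>S \<le> Sm\<close> turns the uniform gap \<open>\<gamma>\<close> in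
    \<open>w - \<rho> * S\<close> into a gap \<open>\<gamma> / Sm\<close> in the quotient, which
    contradicts the choice of \<open>\<rho>\<close>.\<close>
  have "\<rho> \<le> \<rho> - \<gamma> / Sm"
    unfolding \<rho>_def[symmetric]
  proof (subst (1) \<rho>_def, rule cSUP_least)
    show "G \<noteq> {}" using x by blast
    fix y assume y: "y \<in> G"
    have "w y \<le> \<rho> * S y - \<gamma>" using \<gamma>(2)[OF y] by (simp add: v_def)
    then have "w y / S y \<le> \<rho> - \<gamma> / S y" using S0[OF y] by (simp add: field_simps)
    moreover have "\<gamma> / Sm \<le> \<gamma> / S y" using S[OF y] S0[OF y] \<gamma> by (intro divide_left_mono) auto
    ultimately show "w y / S y \<le> \<rho> - \<gamma> / Sm" by linarith
  qed
  then show False using \<gamma> Sm by (simp add: divide_le_0_iff)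
qed

text \<open>Monotone Jacobi iteration: \<open>T\<close> solves the equation at \<open>x\<close> for
  the value at \<open>x\<close>, with a positive diagonal \<open>n x\<close> and nonnegative
  weights. The operator annihilates constants, so \<open>f x \<le> q x * \<kappa>\<close> makes
  \<open>\<kappa>\<close> a subsolution. Starting from it, with \<open>\<psi>\<close> outside
  \<open>D\<close>, the iterates increase and stay below \<open>U\<close>; pointwise limits pass
  through the finite sums.\<close>

lemma discrete_existence:
  fixes f \<psi> q U :: "'a \<Rightarrow> real"
  assumes h: "0 < h"
    and p: "\<And>x l. x \<in> D \<Longrightarrow> l \<in> \<Lambda> \<Longrightarrow> 0 \<le> pw h l x"
    and N: "\<And>x. x \<in> D \<Longrightarrow> 0 < (\<Sum>l\<in>\<Lambda>. pw h l x) - h\<^sup>2 * q x"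
    and sub: "\<And>x. x \<in> D \<Longrightarrow> f x \<le> q x * \<kappa>"
    and sup: "\<And>x. x \<in> D \<Longrightarrow> Lh h U x + q x * U x \<le> f x"
    and ordD: "\<And>x. x \<in> D \<Longrightarrow> \<kappa> \<le> U x"
    and ordN: "\<And>x l. x \<in> D \<Longrightarrow> l \<in> \<Lambda> \<Longrightarrow> x + h *\<^sub>R l \<notin> D \<Longrightarrow> \<kappa> \<le> \<psi> (x + h *\<^sub>R l) \<and> \<psi> (x + h *\<^sub>R l) \<le> U (x + h *\<^sub>R l)"
  shows "\<exists>u. (\<forall>x. x \<notin> D \<longrightarrow> u x = \<psi> x) \<and>
    (\<forall>x\<in>D. Lh h u x + q x * u x = f x \<and> \<kappa> \<le> u x \<and> u x \<le> U x)"
proof -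
  define n where "n x = (\<Sum>l\<in>\<Lambda>. pw h l x) - h\<^sup>2 * q x" for x
  define T where "T u x = (if x \<in> D then ((\<Sum>l\<in>\<Lambda>. pw h l x * u (x + h *\<^sub>R l)) - h\<^sup>2 * f x) / n x else \<psi> x)" for u x
  have eqv: "Lh h u x + q x * u x - f x = ((\<Sum>l\<in>\<Lambda>. pw h l x * u (x + h *\<^sub>R l)) - h\<^sup>2 * f x - n x * u x) / h\<^sup>2" for u x
    using h by (simp add: Lh_weights n_def field_simps right_diff_distrib sum_subtractf sum_distrib_left)
  have n0: "0 < n x" if "x \<in> D" for x using N[OF that] by (simp add: n_def)
  have T_mono: "T u x \<le> T v x" if "\<And>y l. y \<in> D \<Longrightarrow> l \<in> \<Lambda> \<Longrightarrow> u (y + h *\<^sub>R l) \<le> v (y + h *\<^sub>R l)" for u v x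
  proof (cases "x \<in> D")
    case True
    have "(\<Sum>l\<in>\<Lambda>. pw h l x * u (x + h *\<^sub>R l)) \<le> (\<Sum>l\<in>\<Lambda>. pw h l x * v (x + h *\<^sub>R l))"
      by (intro sum_mono mult_left_mono that p True)
    then show ?thesis using n0[OF True] True by (simp add: T_def divide_right_mono)
  qed (simp add: T_def)
  define u0 where "u0 x = (if x \<in> D then \<kappa> else \<psi> x)" for x
  define u where "u k = (T ^^ k) u0" for k
  have uS: "u (Suc k) = T (u k)" for k by (simp add: u_def)
  have step0: "u0 x \<le> T u0 x" for x
  proof (cases "x \<in> D")
    case True
    have "n x * \<kappa> \<le> (\<Sum>l\<in>\<Lambda>. pw h l x * \<kappa>) - h\<^sup>2 * f x"
      using mult_left_mono[OF sub[OF True], of "h\<^sup>2"] h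
      by (simp add: n_def sum_distrib_right[symmetric] left_diff_distrib mult.assoc)
    also have "(\<Sum>l\<in>\<Lambda>. pw h l x * \<kappa>) \<le> (\<Sum>l\<in>\<Lambda>. pw h l x * u0 (x + h *\<^sub>R l))"
      by (intro sum_mono mult_left_mono p True) (use ordN[OF True] in \<open>auto simp: u0_def\<close>)
    finally show ?thesis using True n0[OF True] by (simp add: T_def u0_def pos_le_divide_eq mult.commute)
  qed (simp add: u0_def T_def)
  have inc: "u k x \<le> u (Suc k) x" for k x
  proof (induction k arbitrary: x)
    case 0
    then show ?case using step0 by (simp add: u_def)
  next
    case (Suc k)
    show ?case unfolding uS[of "Suc k"] by (subst uS) (rule T_mono, rule Suc)
  qed
  have out: "u k x = \<psi> x" if "x \<notin> D" for k x
    using that by (cases k) (auto simp: u_def u0_def T_def)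
  have up: "u k x \<le> U x" if "x \<in> D" for k x
    using that
  proof (induction k arbitrary: x)
    case 0
    then show ?case using ordD by (simp add: u_def u0_def)
  next
    case (Suc k)
    have "(\<Sum>l\<in>\<Lambda>. pw h l x * u k (x + h *\<^sub>R l)) \<le> (\<Sum>l\<in>\<Lambda>. pw h l x * U (x + h *\<^sub>R l))"
    proof (intro sum_mono mult_left_mono p Suc.prems)
      fix l assume l: "l \<in> \<Lambda>"
      show "u k (x + h *\<^sub>R l) \<le> U (x + h *\<^sub>R l)"
        using Suc.IH[of "x + h *\<^sub>R l"] ordN[OF Suc.prems l] out by (cases "x + h *\<^sub>R l \<in> D") auto
    qed
    moreover have "(\<Sum>l\<in>\<Lambda>. pw h l x * U (x + h *\<^sub>R l)) - h\<^sup>2 * f x - n x * U x \<le> 0"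
    proof -
      have "((\<Sum>l\<in>\<Lambda>. pw h l x * U (x + h *\<^sub>R l)) - h\<^sup>2 * f x - n x * U x) / h\<^sup>2 \<le> 0"
        using sup[OF Suc.prems] eqv[of U x] by linarith
      then show ?thesis using h by (simp only: pos_divide_le_eq zero_less_power mult_zero_left)
    qed
    ultimately show ?case using n0[OF Suc.prems] Suc.prems
      by (simp add: uS T_def pos_divide_le_eq mult.commute)
  qed
  have lo: "\<kappa> \<le> u k x" if "x \<in> D" for k x
  proof (induction k)
    case 0
    then show ?case using that by (simp add: u_def u0_def)
  next
    case (Suc k)
    then show ?case using inc[of k x] by linarith
  qed
  define v where "v x = lim (\<lambda>k. u k x)" for x
  have lim: "(\<lambda>k. u k x) \<longlonglongrightarrow> v x" for x
  proof -
    have "incseq (\<lambda>k. u k x)" using inc by (rule incseq_SucI)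
    moreover have "u k x \<le> (if x \<in> D then U x else \<psi> x)" for k using up out by auto
    ultimately obtain L where "(\<lambda>k. u k x) \<longlonglongrightarrow> L" using incseq_convergent by blast
    then show ?thesis unfolding v_def by (simp add: limI)
  qed
  have Tv: "T v x = v x" for x
  proof -
    have "(\<lambda>k. T (u k) x) \<longlonglongrightarrow> T v x"
    proof (cases "x \<in> D")
      case True
      then show ?thesis using n0[OF True] unfolding T_def
        by (auto intro!: tendsto_intros lim)
    qed (simp add: T_def)
    moreover have "(\<lambda>k. T (u k) x) \<longlonglongrightarrow> v x"
      using LIMSEQ_Suc[OF lim[of x]] unfolding uS .
    ultimately show ?thesis by (rule LIMSEQ_unique)
  qed
  show ?thesis
  proof (intro exI[of _ v] conjI allI ballI impI)
    fix x assume "x \<notin> D"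
    then show "v x = \<psi> x" using Tv[of x] by (simp add: T_def)
  next
    fix x assume x: "x \<in> D"
    have "n x * v x = (\<Sum>l\<in>\<Lambda>. pw h l x * v (x + h *\<^sub>R l)) - h\<^sup>2 * f x"
      using Tv[of x] x n0[OF x] by (simp add: T_def field_simps)
    then show "Lh h v x + q x * v x = f x" using eqv[of v x] by simp
    show "\<kappa> \<le> v x" by (rule LIMSEQ_le_const[OF lim]) (use lo[OF x] in auto)
    show "v x \<le> U x" by (rule LIMSEQ_le_const2[OF lim]) (use up[OF x] in auto)
  qed
qed

end

section \<open>Calculus of repeated directional derivatives\<close>

abbreviation dd :: "'a::real_normed_vector \<Rightarrow> ('a \<Rightarrow> 'b::real_normed_vector) \<Rightarrow> 'a \<Rightarrow> 'b" where
  "dd v f x \<equiv> frechet_derivative f (at x) v"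

definition dds :: "'a::real_normed_vector list \<Rightarrow> ('a \<Rightarrow> real) \<Rightarrow> 'a \<Rightarrow> real" where
  "dds \<alpha> = foldr (\<lambda>v f x. dd v f x) \<alpha>"

lemma dds_Nil [simp]: "dds [] f = f"
  by (simp add: dds_def)

lemma dds_Cons: "dds (l # \<alpha>) f x = dd l (dds \<alpha> f) x"
  by (simp add: dds_def)

lemma dd_cong:
  assumes "open S" "x \<in> S" "\<And>y. y \<in> S \<Longrightarrow> f y = g y"
  shows "dd v f x = dd v g x"
proof -
  have "(f has_derivative F) (at x) \<longleftrightarrow> (g has_derivative F) (at x)" for F
    using assms by (intro iffI; elim has_derivative_transform_within_open[of _ _ _ _ S]) auto
  then show ?thesis by (simp add: frechet_derivative_def)
qed

section \<open>Closure properties of \<open>Ck_on\<close>\<close>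

lemma Ck_on_cong:
  assumes S: "open S"
  shows "(\<And>x. x \<in> S \<Longrightarrow> f x = g x) \<Longrightarrow> Ck_on k S f \<Longrightarrow> Ck_on k S g"
proof (induction k arbitrary: f g)
  case 0
  then show ?case by (simp cong: continuous_on_cong)
next
  case (Suc k)
  have "g differentiable (at x)" if x: "x \<in> S" for x
  proof -
    obtain F where "(f has_derivative F) (at x)"
      using Suc.prems(2) x S by (auto simp: differentiable_on_eq_differentiable_at differentiable_def)
    then have "(g has_derivative F) (at x)" by (rule has_derivative_transform_within_open[OF _ S x Suc.prems(1)])
    then show ?thesis by (rule differentiableI)
  qed
  moreover have "Ck_on k S (dd v g)" for v
    by (rule Suc.IH[of "dd v f"]) (use Suc.prems dd_cong[OF S, of _ f g v] in auto)
  ultimately show ?case using S by (simp add: differentiable_on_eq_differentiable_at)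
qed

text \<open>Lets a proof name the derivative by a formula instead of through
  \<open>frechet_derivative\<close>; products, exponentials and inverses below are inductions on
  \<open>k\<close> by this rule.\<close>

lemma Ck_on_SucI:
  assumes S: "open S" and f: "\<And>x. x \<in> S \<Longrightarrow> (f has_derivative f' x) (at x)"
    and k: "\<And>v. Ck_on k S (\<lambda>x. f' x v)"
  shows "Ck_on (Suc k) S f"
proof -
  have "f' x = frechet_derivative f (at x)" if "x \<in> S" for x
    using f[OF that] by (rule frechet_derivative_at)
  then have "Ck_on k S (dd v f)" for v
    by (intro Ck_on_cong[OF S _ k[of v]]) simp
  moreover have "f differentiable_on S"
    unfolding differentiable_on_def using f by (meson differentiableI has_derivative_at_withinI)
  ultimately show ?thesis by simp
qed

lemma Ck_on_has_derivative:
  assumes "Ck_on (Suc k) S f" "open S" "x \<in> S"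
  shows "(f has_derivative frechet_derivative f (at x)) (at x)"
  using assms by (auto simp: differentiable_on_eq_differentiable_at frechet_derivative_works[symmetric])

lemma Ck_on_dd: "Ck_on (Suc k) S f \<Longrightarrow> Ck_on k S (\<lambda>x. dd v f x)"
  by simp

lemma Ck_on_continuous:
  assumes "Ck_on k S f" "open S"
  shows "continuous_on S f"
  using assms by (cases k) (auto simp: differentiable_imp_continuous_on)

lemma Ck_on_Suc_imp: "Ck_on (Suc k) S f \<Longrightarrow> open S \<Longrightarrow> Ck_on k S f"
proof (induction k arbitrary: f)
  case 0
  then show ?case by (simp add: differentiable_imp_continuous_on)
next
  case (Suc k)
  then show ?case by (auto simp del: Ck_on.simps(2) simp: Ck_on.simps(2)[of "Suc k"] intro!: Ck_on.simps(2)[THEN iffD2])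
qed

lemma Ck_on_le:
  assumes "Ck_on k S f" "open S" "j \<le> k"
  shows "Ck_on j S f"
  using assms(3,1)
proof (induction rule: inc_induct)
  case (step n)
  then show ?case using Ck_on_Suc_imp assms(2) by blast
qed

lemma Ck_on_subset:
  assumes "Ck_on k S f" "T \<subseteq> S"
  shows "Ck_on k T f"
  using assms by (induction k arbitrary: f) (auto intro: continuous_on_subset differentiable_on_subset)

lemma Ck_on_const: "open S \<Longrightarrow> Ck_on k S (\<lambda>x. a)"
proof (induction k arbitrary: a)
  case (Suc k)
  show ?case by (rule Ck_on_SucI[OF Suc.prems, where f' = "\<lambda>_ _. 0"]) (use Suc in auto)
qed simp

lemma Ck_on_bounded_linear:
  assumes "open S" "bounded_linear f"
  shows "Ck_on k S f"
proof (cases k)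
  case 0
  then show ?thesis using assms(2) by (simp add: linear_continuous_on)
next
  case (Suc j)
  show ?thesis unfolding Suc
    by (rule Ck_on_SucI[OF assms(1), where f' = "\<lambda>_. f"])
       (use assms in \<open>auto intro: bounded_linear_imp_has_derivative Ck_on_const\<close>)
qed

lemma Ck_on_linear_comp:
  assumes L: "bounded_linear L" and S: "open S"
  shows "Ck_on k S f \<Longrightarrow> Ck_on k S (\<lambda>x. L (f x))"
proof (induction k arbitrary: f)
  case 0
  then show ?case using L by (auto intro: bounded_linear.continuous_on)
next
  case (Suc k)
  show ?case
    by (rule Ck_on_SucI[OF S, where f' = "\<lambda>x v. L (frechet_derivative f (at x) v)"])
       (use Suc S in \<open>auto simp del: Ck_on.simps(2) intro!: Suc.IH Ck_on_dd
          bounded_linear.has_derivative[OF L] Ck_on_has_derivative\<close>)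
qed

lemma Ck_on_add:
  assumes S: "open S"
  shows "Ck_on k S f \<Longrightarrow> Ck_on k S g \<Longrightarrow> Ck_on k S (\<lambda>x. f x + g x)"
proof (induction k arbitrary: f g)
  case (Suc k)
  show ?case
    by (rule Ck_on_SucI[OF S, where f' = "\<lambda>x v. frechet_derivative f (at x) v + frechet_derivative g (at x) v"])
       (use Suc S in \<open>auto simp del: Ck_on.simps(2) intro!: Suc.IH Ck_on_dd has_derivative_add Ck_on_has_derivative\<close>)
qed (auto intro: continuous_intros)

lemma Ck_on_mult:
  fixes f g :: "'a::real_normed_vector \<Rightarrow> real"
  assumes S: "open S"
  shows "Ck_on k S f \<Longrightarrow> Ck_on k S g \<Longrightarrow> Ck_on k S (\<lambda>x. f x * g x)"
proof (induction k arbitrary: f g)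
  case (Suc k)
  have "Ck_on k S f" "Ck_on k S g" using Suc.prems S by (auto intro: Ck_on_Suc_imp simp del: Ck_on.simps)
  then show ?case
    by (intro Ck_on_SucI[OF S, where f' = "\<lambda>x v. f x * frechet_derivative g (at x) v + frechet_derivative f (at x) v * g x"])
       (use Suc S in \<open>auto simp del: Ck_on.simps(2) intro!: Suc.IH Ck_on_dd Ck_on_add has_derivative_mult Ck_on_has_derivative\<close>)
qed (auto intro: continuous_intros)

lemma Ck_on_sum:
  assumes S: "open S"
  shows "finite I \<Longrightarrow> (\<And>i. i \<in> I \<Longrightarrow> Ck_on k S (f i)) \<Longrightarrow> Ck_on k S (\<lambda>x. \<Sum>i\<in>I. f i x)"
  by (induction I rule: finite_induct) (auto simp del: Ck_on.simps intro!: Ck_on_add Ck_on_const S)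

lemma Ck_on_exp:
  fixes f :: "'a::real_normed_vector \<Rightarrow> real"
  assumes S: "open S"
  shows "Ck_on k S f \<Longrightarrow> Ck_on k S (\<lambda>x. exp (f x))"
proof (induction k)
  case (Suc k)
  have "Ck_on k S f" using Suc.prems S by (auto intro: Ck_on_Suc_imp simp del: Ck_on.simps)
  then show ?case
    by (intro Ck_on_SucI[OF S, where f' = "\<lambda>x v. frechet_derivative f (at x) v * exp (f x)"])
       (use Suc S in \<open>auto simp del: Ck_on.simps(2) intro!: Suc.IH Ck_on_dd Ck_on_mult has_derivative_exp Ck_on_has_derivative\<close>)
qed (auto intro: continuous_intros)

lemma Ck_on_inverse:
  fixes f :: "'a::real_normed_vector \<Rightarrow> real"
  assumes S: "open S" and nz: "\<And>x. x \<in> S \<Longrightarrow> f x \<noteq> 0"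
  shows "Ck_on k S f \<Longrightarrow> Ck_on k S (\<lambda>x. inverse (f x))"
proof (induction k)
  case (Suc k)
  have "Ck_on k S f" using Suc.prems S by (auto intro: Ck_on_Suc_imp simp del: Ck_on.simps)
  then have I: "Ck_on k S (\<lambda>x. inverse (f x))" by (rule Suc.IH)
  show ?case
  proof (rule Ck_on_SucI[OF S, where f' = "\<lambda>x v. -1 * (inverse (f x) * frechet_derivative f (at x) v * inverse (f x))"])
    fix x assume x: "x \<in> S"
    show "((\<lambda>x. inverse (f x)) has_derivative (\<lambda>v. -1 * (inverse (f x) * dd v f x * inverse (f x)))) (at x)"
      using Deriv.has_derivative_inverse[OF nz[OF x] Ck_on_has_derivative[OF Suc.prems S x]] by simp
  next
    fix v show "Ck_on k S (\<lambda>x. -1 * (inverse (f x) * frechet_derivative f (at x) v * inverse (f x)))"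
      using Suc.prems I by (intro Ck_on_mult Ck_on_const S Ck_on_dd)
  qed
qed (auto intro!: continuous_intros simp: nz)

lemma has_derivative_shift_iff:
  fixes f :: "'a::real_normed_vector \<Rightarrow> 'b::real_normed_vector"
  shows "((\<lambda>y. f (y + a)) has_derivative F) (at x) \<longleftrightarrow> (f has_derivative F) (at (x + a))"
proof -
  have 1: "((\<lambda>y. g (y + a)) has_derivative F) (at x)" if "(g has_derivative F) (at (x + a))"
    for g :: "'a \<Rightarrow> 'b" and x a
  proof -
    have "((\<lambda>y. y + a) has_derivative (\<lambda>v. v)) (at x)" by (auto intro!: derivative_eq_intros)
    from has_derivative_compose[OF this that] show ?thesis by simp
  qed
  show ?thesis
  proof
    assume "((\<lambda>y. f (y + a)) has_derivative F) (at x)"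
    then have "((\<lambda>y. f (y + a)) has_derivative F) (at (x + a + - a))" by simp
    from 1[OF this] show "(f has_derivative F) (at (x + a))" by simp
  qed (rule 1)
qed

lemma dd_shift: "dd v (\<lambda>y. f (y + a)) x = dd v f (x + a)"
  unfolding frechet_derivative_def has_derivative_shift_iff ..

lemma dds_shift: "dds \<alpha> (\<lambda>y. f (y + a)) x = dds \<alpha> f (x + a)"
proof (induction \<alpha> arbitrary: x)
  case (Cons l \<alpha>)
  have "dds \<alpha> (\<lambda>y. f (y + a)) = (\<lambda>x. dds \<alpha> f (x + a))" using Cons by blast
  then show ?case by (simp add: dds_Cons dd_shift)
qed simp

lemma Ck_on_shift:
  fixes f :: "'a::real_normed_vector \<Rightarrow> 'b::real_normed_vector"
  assumes "open S"
  shows "Ck_on k S f \<Longrightarrow> Ck_on k {x. x + a \<in> S} (\<lambda>x. f (x + a))"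
proof (induction k arbitrary: f)
  case 0
  then show ?case by (auto intro!: continuous_on_compose2[of S f] continuous_intros)
next
  case (Suc k)
  have "open ((\<lambda>x. x + a) -` S)" by (intro open_vimage assms continuous_intros)
  then have o: "open {x. x + a \<in> S}" by (simp add: vimage_def)
  show ?case
    by (rule Ck_on_SucI[OF o, where f' = "\<lambda>x. frechet_derivative f (at (x + a))"])
       (use Suc Ck_on_has_derivative[OF Suc.prems assms] in \<open>auto simp: has_derivative_shift_iff\<close>)
qed

lemma Ck_on_dds: "Ck_on (length \<alpha> + k) S f \<Longrightarrow> Ck_on k S (dds \<alpha> f)"
proof (induction \<alpha> arbitrary: k)
  case (Cons l \<alpha>)
  then have "Ck_on (Suc k) S (dds \<alpha> f)" using Cons.IH[of "Suc k"] by (simp del: Ck_on.simps)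
  then show ?case using Ck_on_dd[of k S _ l] by (simp add: dds_Cons[abs_def] del: Ck_on.simps)
qed simp

lemma dd_lin_comb:
  fixes f g :: "'a::real_normed_vector \<Rightarrow> real"
  assumes "(f has_derivative frechet_derivative f (at x)) (at x)" "(g has_derivative frechet_derivative g (at x)) (at x)"
  shows "dd v (\<lambda>x. a * f x + b * g x) x = a * dd v f x + b * dd v g x"
proof -
  have "((\<lambda>x. a * f x + b * g x) has_derivative (\<lambda>v. a * dd v f x + b * dd v g x)) (at x)"
    using assms by (auto intro!: derivative_eq_intros)
  then show ?thesis using frechet_derivative_at by metis
qed

lemma dds_lin_comb:
  fixes f g :: "'a::real_normed_vector \<Rightarrow> real"
  assumes S: "open S" and f: "Ck_on (length \<alpha>) S f" and g: "Ck_on (length \<alpha>) S g" and x: "x \<in> S"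
  shows "dds \<alpha> (\<lambda>x. a * f x + b * g x) x = a * dds \<alpha> f x + b * dds \<alpha> g x"
  using f g x
proof (induction \<alpha> arbitrary: x)
  case (Cons l \<alpha>)
  have fg: "Ck_on (length \<alpha> + Suc 0) S f" "Ck_on (length \<alpha> + Suc 0) S g" using Cons.prems by simp_all
  then have fg': "Ck_on (length \<alpha>) S f" "Ck_on (length \<alpha>) S g"
    using Ck_on_Suc_imp[OF _ S] by (auto simp del: Ck_on.simps)
  have D: "(dds \<alpha> f has_derivative frechet_derivative (dds \<alpha> f) (at x)) (at x)"
    "(dds \<alpha> g has_derivative frechet_derivative (dds \<alpha> g) (at x)) (at x)"
    using Ck_on_has_derivative[OF Ck_on_dds[OF fg(1)] S Cons.prems(3)]
      Ck_on_has_derivative[OF Ck_on_dds[OF fg(2)] S Cons.prems(3)] .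
  have "dd l (dds \<alpha> (\<lambda>x. a * f x + b * g x)) x = dd l (\<lambda>x. a * dds \<alpha> f x + b * dds \<alpha> g x) x"
    by (rule dd_cong[OF S Cons.prems(3)]) (rule Cons.IH[OF fg'])
  then show ?case by (simp add: dds_Cons dd_lin_comb[OF D])
qed simp

section \<open>Mean value estimates for iterated differences\<close>

lemma fdiff_mean_value:
  fixes f :: "'a::real_normed_vector \<Rightarrow> real"
  assumes h: "0 < h" and d: "\<And>t. 0 \<le> t \<Longrightarrow> t \<le> h \<Longrightarrow> (f has_derivative frechet_derivative f (at (x + t *\<^sub>R l))) (at (x + t *\<^sub>R l))"
  shows "\<exists>t. 0 \<le> t \<and> t \<le> h \<and> fdiff h l f x = dd l f (x + t *\<^sub>R l)"
proof -
  have "((\<lambda>t. f (x + t *\<^sub>R l)) has_derivative (\<lambda>s. s * dd l f (x + t *\<^sub>R l))) (at t within {0..h})"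
    if t: "0 \<le> t" "t \<le> h" for t
  proof -
    have "((\<lambda>t. x + t *\<^sub>R l) has_derivative (\<lambda>s. s *\<^sub>R l)) (at t within {0..h})"
      by (auto intro!: derivative_eq_intros)
    from has_derivative_compose[OF this d[OF t]]
    have "((\<lambda>t. f (x + t *\<^sub>R l)) has_derivative (\<lambda>s. frechet_derivative f (at (x + t *\<^sub>R l)) (s *\<^sub>R l))) (at t within {0..h})" .
    moreover have "linear (frechet_derivative f (at (x + t *\<^sub>R l)))"
      using d[OF t] has_derivative_linear by blast
    ultimately show ?thesis by (simp add: linear_cmul)
  qed
  then obtain t where "t \<in> {0<..<h}" "f (x + h *\<^sub>R l) - f (x + 0 *\<^sub>R l) = (h - 0) * dd l f (x + t *\<^sub>R l)"
    using mvt_simple[OF h, of "\<lambda>t. f (x + t *\<^sub>R l)" "\<lambda>t s. s * dd l f (x + t *\<^sub>R l)"] by auto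
  then show ?thesis using h by (intro exI[of _ t]) (auto simp: fdiff_def field_simps)
qed

text \<open>The induction replaces the function by its difference along the first letter.
  Differences and derivatives are thereby taken in the same order, so no symmetry of higher
  derivatives enters. The form with centre \<open>a\<close> and radius \<open>B\<close> serves
  boundedness, equicontinuity and consistency alike.\<close>

lemma fdiffs_mean_value:
  fixes f :: "'a::real_normed_vector \<Rightarrow> real"
  assumes h: "0 < h"
  shows "open W \<Longrightarrow> Ck_on (length \<alpha>) W f \<Longrightarrow> (\<And>l. l \<in> set \<alpha> \<Longrightarrow> norm l \<le> \<rho>) \<Longrightarrow>
    (\<And>y. dist x y \<le> h * \<rho> * length \<alpha> \<Longrightarrow> y \<in> W \<and> \<bar>dds \<alpha> f y - a\<bar> \<le> B) \<Longrightarrow>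
    \<bar>fdiffs h \<alpha> f x - a\<bar> \<le> B"
proof (induction \<alpha> arbitrary: f W)
  case Nil
  then show ?case by simp
next
  case (Cons l \<alpha>)
  have l: "norm l \<le> \<rho>" using Cons.prems(3) by simp
  \<comment> \<open>The differenced function is known to be smooth only where both \<open>y\<close>
    and \<open>y + h *\<^sub>R l\<close> lie in \<open>W\<close>.\<close>
  define W' where "W' = W \<inter> {y. y + h *\<^sub>R l \<in> W}"
  have "open ((\<lambda>y. y + h *\<^sub>R l) -` W)" by (intro open_vimage Cons.prems continuous_intros)
  then have oW': "open W'" unfolding W'_def using Cons.prems(1) by (auto simp: vimage_def)
  have f1: "Ck_on (length \<alpha> + Suc 0) W f" using Cons.prems(2) by simp
  have f: "Ck_on (length \<alpha>) W f" using Ck_on_Suc_imp[OF Cons.prems(2)[simplified length_Cons] Cons.prems(1)] .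
  have fW: "Ck_on (length \<alpha>) W' f" using f by (rule Ck_on_subset) (auto simp: W'_def)
  have fW2: "Ck_on (length \<alpha>) W' (\<lambda>x. f (x + h *\<^sub>R l))"
    by (rule Ck_on_subset[OF Ck_on_shift[OF Cons.prems(1) f]]) (auto simp: W'_def)
  have eq: "fdiff h l f = (\<lambda>x. 1 / h * f (x + h *\<^sub>R l) + (- 1 / h) * f x)"
    using h by (simp add: fdiff_def fun_eq_iff field_simps)
  have sf: "fdiffs h (l # \<alpha>) f x = fdiffs h \<alpha> (fdiff h l f) x"
    by (simp add: fdiffs_Cons fdiff_fdiffs)
  show ?case unfolding sf
  proof (rule Cons.IH[OF oW'])
    show "Ck_on (length \<alpha>) W' (fdiff h l f)" unfolding eq
      by (intro Ck_on_add Ck_on_mult Ck_on_const oW' fW fW2)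
  next
    show "norm l' \<le> \<rho>" if "l' \<in> set \<alpha>" for l' using Cons.prems(3) that by simp
  next
    fix y assume y: "dist x y \<le> h * \<rho> * real (length \<alpha>)"
    have in1: "y + t *\<^sub>R l \<in> W \<and> \<bar>dds (l # \<alpha>) f (y + t *\<^sub>R l) - a\<bar> \<le> B" if t: "0 \<le> t" "t \<le> h" for t
    proof (rule Cons.prems(4))
      have "dist x (y + t *\<^sub>R l) \<le> dist x y + norm (t *\<^sub>R l)"
        using dist_triangle[of x "y + t *\<^sub>R l" y] by (simp add: dist_norm)
      also have "norm (t *\<^sub>R l) \<le> h * \<rho>" using t l by (simp add: mult_mono)
      finally show "dist x (y + t *\<^sub>R l) \<le> h * \<rho> * real (length (l # \<alpha>))" using y by (simp add: algebra_simps)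
    qed
    have yW: "y \<in> W'" unfolding W'_def using in1[of 0] in1[of h] h by simp
    have "dds \<alpha> (fdiff h l f) y = 1 / h * dds \<alpha> f (y + h *\<^sub>R l) + (- 1 / h) * dds \<alpha> f y"
      unfolding eq by (subst dds_lin_comb[OF oW' fW2 fW yW]) (simp add: dds_shift)
    also have "\<dots> = fdiff h l (dds \<alpha> f) y" using h by (simp add: fdiff_def field_simps)
    finally have e: "dds \<alpha> (fdiff h l f) y = fdiff h l (dds \<alpha> f) y" .
    obtain t where t: "0 \<le> t" "t \<le> h" "fdiff h l (dds \<alpha> f) y = dd l (dds \<alpha> f) (y + t *\<^sub>R l)"
      using fdiff_mean_value[OF h, of "dds \<alpha> f" y l] Ck_on_has_derivative[OF Ck_on_dds[OF f1] Cons.prems(1)] in1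
      by blast
    show "y \<in> W' \<and> \<bar>dds \<alpha> (fdiff h l f) y - a\<bar> \<le> B"
      using yW in1[OF t(1,2)] t(3) e by (simp add: dds_Cons)
  qed
qed

section \<open>Consistency of the scheme\<close>

lemma finite_norm_bound:
  assumes "finite (\<Lambda> :: 'a::real_normed_vector set)"
  obtains \<rho> where "0 < \<rho>" "\<And>l. l \<in> \<Lambda> \<Longrightarrow> norm l \<le> \<rho>"
proof -
  have "bounded \<Lambda>" using assms by (rule finite_imp_bounded)
  then show thesis using that bounded_pos by blast
qed

lemma fdiffs_shift: "fdiffs h \<alpha> (\<lambda>y. f (y + t)) x = fdiffs h \<alpha> f (x + t)"
proof (induction \<alpha> arbitrary: x)
  case (Cons l \<alpha>)
  have "fdiffs h \<alpha> (\<lambda>y. f (y + t)) = (\<lambda>x. fdiffs h \<alpha> f (x + t))" using Cons by blast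
  then show ?case by (simp add: fdiffs_Cons fdiff_def algebra_simps)
qed simp

lemma Ck_on_dds_continuous:
  assumes "Ck_on k S f" "open S" "length \<alpha> \<le> k"
  shows "continuous_on S (dds \<alpha> f)"
proof -
  have "Ck_on (length \<alpha> + 0) S f" using Ck_on_le[OF assms] by simp
  from Ck_on_dds[OF this] show ?thesis by simp
qed

lemma fdiffs_bounded:
  fixes f :: "'a::euclidean_space \<Rightarrow> real"
  assumes f: "Ck_on k UNIV f" and K: "bounded K" and fin: "finite \<Lambda>"
  shows "\<exists>B>0. \<forall>x\<in>K. \<forall>h. 0 < h \<and> h \<le> 1 \<longrightarrow> (\<forall>\<alpha>\<in>wle \<Lambda> k. \<bar>fdiffs h \<alpha> f x\<bar> \<le> B)"
proof -
  obtain \<rho> where \<rho>: "0 < \<rho>" "\<And>l. l \<in> \<Lambda> \<Longrightarrow> norm l \<le> \<rho>" using finite_norm_bound[OF fin] by blast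
  obtain R where R: "\<And>x. x \<in> K \<Longrightarrow> norm x \<le> R" using K bounded_iff by metis
  define C where "C = cball (0::'a) (R + \<rho> * k)"
  have "bounded (\<Union>\<alpha>\<in>wle \<Lambda> k. dds \<alpha> f ` C)"
  proof (rule bounded_UN[OF finite_wle[OF fin]], rule ballI)
    fix \<alpha> assume "\<alpha> \<in> wle \<Lambda> k"
    then have "continuous_on UNIV (dds \<alpha> f)" by (intro Ck_on_dds_continuous[OF f]) (auto simp: wle_def)
    then have "continuous_on C (dds \<alpha> f)" by (rule continuous_on_subset) simp
    then show "bounded (dds \<alpha> f ` C)" unfolding C_def
      by (intro compact_imp_bounded compact_continuous_image) auto
  qed
  then obtain B where B: "0 < B" "\<And>\<alpha> y. \<alpha> \<in> wle \<Lambda> k \<Longrightarrow> y \<in> C \<Longrightarrow> \<bar>dds \<alpha> f y\<bar> \<le> B"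
    unfolding bounded_pos by auto
  show ?thesis
  proof (intro exI[of _ B] conjI ballI allI impI B)
    fix x :: 'a and h :: real and \<alpha> :: "'a list" assume x: "x \<in> K" and h: "0 < h \<and> h \<le> 1" and \<alpha>: "\<alpha> \<in> wle \<Lambda> k"
    have "\<bar>fdiffs h \<alpha> f x - 0\<bar> \<le> B"
    proof (rule fdiffs_mean_value[of _ UNIV _ _ \<rho>])
      show "Ck_on (length \<alpha>) UNIV f" using Ck_on_le[OF f open_UNIV] \<alpha> by (auto simp: wle_def)
      fix y assume y: "dist x y \<le> h * \<rho> * real (length \<alpha>)"
      also have "h * \<rho> * real (length \<alpha>) \<le> 1 * \<rho> * real k"
        using h \<rho> \<alpha> by (intro mult_mono) (auto simp: wle_def)
      finally have "norm y \<le> R + \<rho> * k" using R[OF x] norm_triangle_ineq[of x "y - x"]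
        by (simp add: dist_norm norm_minus_commute)
      then show "y \<in> UNIV \<and> \<bar>dds \<alpha> f y - 0\<bar> \<le> B" using B(2)[OF \<alpha>] by (simp add: C_def)
    qed (use h \<rho> \<alpha> in \<open>auto simp: wle_def\<close>)
    then show "\<bar>fdiffs h \<alpha> f x\<bar> \<le> B" by simp
  qed
qed

text \<open>\<open>fdiffs_mean_value\<close> is applied to the increment
  \<open>f (y + t) - f y\<close>, whose iterated derivatives are small by uniform continuity on a
  ball containing all points reached.\<close>

lemma fdiffs_equicontinuous:
  fixes f :: "'a::euclidean_space \<Rightarrow> real"
  assumes f: "Ck_on k UNIV f" and K: "bounded K" and fin: "finite \<Lambda>" and \<epsilon>: "0 < \<epsilon>"
  shows "\<exists>\<delta>>0. \<forall>x\<in>K. \<forall>h t. 0 < h \<and> h \<le> 1 \<and> norm t < \<delta> \<longrightarrow>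
    (\<forall>\<alpha>\<in>wle \<Lambda> k. \<bar>fdiffs h \<alpha> f (x + t) - fdiffs h \<alpha> f x\<bar> \<le> \<epsilon>)"
proof -
  obtain \<rho> where \<rho>: "0 < \<rho>" "\<And>l. l \<in> \<Lambda> \<Longrightarrow> norm l \<le> \<rho>" using finite_norm_bound[OF fin] by blast
  obtain R where R: "\<And>x. x \<in> K \<Longrightarrow> norm x \<le> R" using K bounded_iff by metis
  define C where "C = cball (0::'a) (R + \<rho> * k + 1)"
  have "\<forall>\<^sub>F \<delta> in at_right 0. \<forall>\<alpha>\<in>wle \<Lambda> k. \<forall>y\<in>C. \<forall>z\<in>C. dist y z < \<delta> \<longrightarrow> \<bar>dds \<alpha> f y - dds \<alpha> f z\<bar> \<le> \<epsilon>"
  proof (rule eventually_ball_finite[OF finite_wle[OF fin]], rule ballI)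
    fix \<alpha> assume "\<alpha> \<in> wle \<Lambda> k"
    then have "continuous_on UNIV (dds \<alpha> f)" by (intro Ck_on_dds_continuous[OF f]) (auto simp: wle_def)
    then have "continuous_on C (dds \<alpha> f)" by (rule continuous_on_subset) simp
    then have "uniformly_continuous_on C (dds \<alpha> f)" unfolding C_def
      by (intro compact_uniformly_continuous) auto
    then obtain d where d: "0 < d" "\<And>y z. y \<in> C \<Longrightarrow> z \<in> C \<Longrightarrow> dist z y < d \<Longrightarrow> dist (dds \<alpha> f z) (dds \<alpha> f y) < \<epsilon>"
      unfolding uniformly_continuous_on_def using \<epsilon> by metis
    have "\<forall>\<^sub>F \<delta> in at_right 0. \<delta> < d" using d(1) eventually_at_right_less by (metis eventually_at_right_field)
    then show "\<forall>\<^sub>F \<delta> in at_right 0. \<forall>y\<in>C. \<forall>z\<in>C. dist y z < \<delta> \<longrightarrow> \<bar>dds \<alpha> f y - dds \<alpha> f z\<bar> \<le> \<epsilon>"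
    proof (rule eventually_mono, intro ballI impI)
      fix \<delta> y z assume "\<delta> < d" "y \<in> C" "z \<in> C" "dist y z < \<delta>"
      then have "dist (dds \<alpha> f y) (dds \<alpha> f z) < \<epsilon>" by (intro d(2)) auto
      then show "\<bar>dds \<alpha> f y - dds \<alpha> f z\<bar> \<le> \<epsilon>" by (simp add: dist_real_def)
    qed
  qed
  then obtain d0 where d0: "0 < d0" "\<And>\<delta>. 0 < \<delta> \<Longrightarrow> \<delta> < d0 \<Longrightarrow>
      \<forall>\<alpha>\<in>wle \<Lambda> k. \<forall>y\<in>C. \<forall>z\<in>C. dist y z < \<delta> \<longrightarrow> \<bar>dds \<alpha> f y - dds \<alpha> f z\<bar> \<le> \<epsilon>"
    unfolding eventually_at_right_field by auto
  define \<delta> where "\<delta> = min 1 (d0 / 2)"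
  have \<delta>: "0 < \<delta>" "\<delta> \<le> 1" using d0 by (auto simp: \<delta>_def)
  have dC: "\<bar>dds \<alpha> f y - dds \<alpha> f z\<bar> \<le> \<epsilon>" if "\<alpha> \<in> wle \<Lambda> k" "y \<in> C" "z \<in> C" "dist y z < \<delta>" for \<alpha> y z
    using d0(2)[of \<delta>] \<delta> that d0(1) by (auto simp: \<delta>_def)
  show ?thesis
  proof (intro exI[of _ \<delta>] conjI ballI allI impI \<delta>)
    fix x :: 'a and h :: real and \<alpha> :: "'a list" and t :: 'a assume x: "x \<in> K" and h: "0 < h \<and> h \<le> 1 \<and> norm t < \<delta>" and \<alpha>: "\<alpha> \<in> wle \<Lambda> k"
    have f': "Ck_on (length \<alpha>) UNIV f" using Ck_on_le[OF f open_UNIV] \<alpha> by (auto simp: wle_def)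
    have ft: "Ck_on (length \<alpha>) UNIV (\<lambda>y. f (y + t))" using Ck_on_shift[OF open_UNIV f', of t] by simp
    have "\<bar>fdiffs h \<alpha> (\<lambda>y. 1 * f (y + t) + (-1) * f y) x - 0\<bar> \<le> \<epsilon>"
    proof (rule fdiffs_mean_value[of _ UNIV _ _ \<rho>])
      show "Ck_on (length \<alpha>) UNIV (\<lambda>y. 1 * f (y + t) + (-1) * f y)"
        by (intro Ck_on_add Ck_on_mult Ck_on_const open_UNIV ft f')
      fix y assume y: "dist x y \<le> h * \<rho> * real (length \<alpha>)"
      also have "h * \<rho> * real (length \<alpha>) \<le> 1 * \<rho> * real k"
        using h \<rho> \<alpha> by (intro mult_mono) (auto simp: wle_def)
      finally have ny: "norm y \<le> R + \<rho> * k" using R[OF x] norm_triangle_ineq[of x "y - x"]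
        by (simp add: dist_norm norm_minus_commute)
      then have "norm (y + t) \<le> R + \<rho> * k + 1" using h \<delta> norm_triangle_ineq[of y t] by linarith
      then have yt: "y + t \<in> C" "y \<in> C" using ny unfolding C_def mem_cball_0 by linarith+
      have "\<bar>dds \<alpha> f (y + t) - dds \<alpha> f y\<bar> \<le> \<epsilon>" using h
        by (intro dC[OF \<alpha> yt]) (simp add: dist_norm)
      then show "y \<in> UNIV \<and> \<bar>dds \<alpha> (\<lambda>y. 1 * f (y + t) + (-1) * f y) y - 0\<bar> \<le> \<epsilon>"
        unfolding dds_lin_comb[OF open_UNIV ft f' UNIV_I] dds_shift by simp
    qed (use h \<rho> \<alpha> in \<open>auto simp: wle_def\<close>)
    moreover have "fdiffs h \<alpha> (\<lambda>y. 1 * f (y + t) + (-1) * f y) x = fdiffs h \<alpha> f (x + t) - fdiffs h \<alpha> f x"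
      unfolding fdiffs_add fdiffs_cmult fdiffs_shift by simp
    ultimately show "\<bar>fdiffs h \<alpha> f (x + t) - fdiffs h \<alpha> f x\<bar> \<le> \<epsilon>" by simp
  qed
qed

lemma fdiffs_tendsto_dds:
  fixes g :: "'a::euclidean_space \<Rightarrow> real"
  assumes W: "open W" and g: "Ck_on (length \<alpha>) W g" and K: "compact K" "K \<subseteq> W" and \<epsilon>: "0 < \<epsilon>"
  shows "\<forall>\<^sub>F h in at_right 0. \<forall>x\<in>K. \<bar>fdiffs h \<alpha> g x - dds \<alpha> g x\<bar> \<le> \<epsilon>"
proof -
  obtain \<rho> where \<rho>: "0 < \<rho>" "\<And>l. l \<in> set \<alpha> \<Longrightarrow> norm l \<le> \<rho>" using finite_norm_bound[of "set \<alpha>"] by blast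
  obtain r where r: "0 < r" "(\<Union>x\<in>K. ball x r) \<subseteq> W"
    using compact_subset_open_imp_ball_epsilon_subset[OF K(1) W K(2)] by blast
  define C where "C = {x + y | x y. x \<in> K \<and> y \<in> cball 0 (r/2)}"
  have C: "compact C" unfolding C_def by (rule compact_sums[OF K(1) compact_cball])
  have CW: "C \<subseteq> W"
  proof
    fix z assume "z \<in> C"
    then obtain x y where "z = x + y" "x \<in> K" "norm y \<le> r/2" by (auto simp: C_def)
    then have "z \<in> ball x r" using r(1) by (simp add: dist_norm)
    then show "z \<in> W" using r(2) \<open>x \<in> K\<close> by blast
  qed
  have "continuous_on C (dds \<alpha> g)"
    using Ck_on_dds_continuous[OF g W] CW continuous_on_subset by blast
  then have "uniformly_continuous_on C (dds \<alpha> g)" using C by (rule compact_uniformly_continuous)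
  then obtain d where d: "0 < d" "\<And>y z. y \<in> C \<Longrightarrow> z \<in> C \<Longrightarrow> dist z y < d \<Longrightarrow> dist (dds \<alpha> g z) (dds \<alpha> g y) < \<epsilon>"
    unfolding uniformly_continuous_on_def using \<epsilon> by metis
  define h0 where "h0 = min d (r/2) / (\<rho> * length \<alpha> + 1)"
  have den: "0 < \<rho> * length \<alpha> + 1" using \<rho> by (simp add: add_nonneg_pos)
  have h0: "0 < h0" using d r den by (simp add: h0_def)
  have "\<bar>fdiffs h \<alpha> g x - dds \<alpha> g x\<bar> \<le> \<epsilon>" if h: "0 < h" "h < h0" and x: "x \<in> K" for h x
  proof (rule fdiffs_mean_value[of _ W _ _ \<rho>])
    have "h * (\<rho> * length \<alpha> + 1) < min d (r/2)" using h den by (simp add: h0_def pos_less_divide_eq)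
    then have small: "h * \<rho> * length \<alpha> < min d (r/2)" using h by (simp add: algebra_simps)
    fix y assume y: "dist x y \<le> h * \<rho> * real (length \<alpha>)"
    have "y = x + (y - x) \<and> x \<in> K \<and> y - x \<in> cball 0 (r/2)"
      using x y small by (simp add: dist_norm norm_minus_commute)
    then have yC: "y \<in> C" unfolding C_def by blast
    have "x = x + 0 \<and> x \<in> K \<and> 0 \<in> cball (0::'a) (r/2)" using x r(1) by simp
    then have xC: "x \<in> C" unfolding C_def by blast
    have "dist (dds \<alpha> g y) (dds \<alpha> g x) < \<epsilon>" using y small by (intro d(2) xC yC) (simp add: dist_commute)
    then show "y \<in> W \<and> \<bar>dds \<alpha> g y - dds \<alpha> g x\<bar> \<le> \<epsilon>" using yC CW by (auto simp: dist_real_def)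
  qed (use h W g \<rho> in auto)
  then show ?thesis unfolding eventually_at_right_field using h0 by auto
qed

section \<open>The limiting operator\<close>

context diff_scheme
begin

definition limit_op :: "('a \<Rightarrow> real) \<Rightarrow> 'a \<Rightarrow> real" where
  "limit_op g x = (\<Sum>l\<in>\<Lambda>. 1 / 2 * c l x * dd l (\<lambda>y. dd l g y) x + b l x * dd l g x)"

lemma consistency:
  assumes W: "open W" and g: "Ck_on 2 W g" and K: "compact K" "K \<subseteq> W" and \<epsilon>: "0 < \<epsilon>"
    and B: "\<And>x l. x \<in> K \<Longrightarrow> l \<in> \<Lambda> \<Longrightarrow> \<bar>c l x\<bar> \<le> B \<and> \<bar>b l x\<bar> \<le> B"
  shows "\<forall>\<^sub>F h in at_right 0. \<forall>x\<in>K. \<bar>Lh h g x - limit_op g x\<bar> \<le> \<epsilon>"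
proof (cases "K = {} \<or> \<Lambda> = {}")
  case True
  then show ?thesis using \<epsilon> by (auto simp: Lh_def limit_op_def)
next
  case False
  then have "0 \<le> B" using B by fastforce
  define \<epsilon>' where "\<epsilon>' = \<epsilon> / (2 * (card \<Lambda> * B + 1))"
  have cB: "0 \<le> card \<Lambda> * B" using \<open>0 \<le> B\<close> by simp
  have \<epsilon>': "0 < \<epsilon>'" using \<epsilon> cB by (simp add: \<epsilon>'_def add_nonneg_pos)
  have g1: "Ck_on 1 W g" using Ck_on_le[OF g W, of 1] by simp
  have "\<forall>\<^sub>F h in at_right 0. \<forall>l\<in>\<Lambda>. (\<forall>x\<in>K. \<bar>fdiffs h [l, -l] g x - dds [l, -l] g x\<bar> \<le> \<epsilon>')
      \<and> (\<forall>x\<in>K. \<bar>fdiffs h [l] g x - dds [l] g x\<bar> \<le> \<epsilon>')"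
    by (intro eventually_ball_finite[OF fin] ballI eventually_conj fdiffs_tendsto_dds[OF W _ K \<epsilon>'])
       (use g g1 in \<open>simp_all add: numeral_2_eq_2 del: Ck_on.simps\<close>)
  moreover have "\<forall>\<^sub>F h in at_right 0. 0 < (h::real)" by (simp add: eventually_at_right_less)
  ultimately show ?thesis
  proof (eventually_elim, intro ballI)
    fix h x assume H: "\<forall>l\<in>\<Lambda>. (\<forall>x\<in>K. \<bar>fdiffs h [l, -l] g x - dds [l, -l] g x\<bar> \<le> \<epsilon>')
      \<and> (\<forall>x\<in>K. \<bar>fdiffs h [l] g x - dds [l] g x\<bar> \<le> \<epsilon>')" and h: "0 < h" and x: "x \<in> K"
    have xW: "x \<in> W" using x K by blast
    have neg2: "dds [l, -l] g x = - dd l (\<lambda>y. dd l g y) x" for l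
    proof -
      have 1: "dd (- l) g y = (-1) * dd l g y + 0 * dd l g y" if "y \<in> W" for y
      proof -
        have "linear (frechet_derivative g (at y))"
          using Ck_on_has_derivative[of 0 W g y] g1 W that has_derivative_linear by auto
        then show ?thesis by (simp add: linear_neg)
      qed
      have "Ck_on (Suc 0) W (\<lambda>y. dd l g y)" using g by (intro Ck_on_dd) (simp add: numeral_2_eq_2 del: Ck_on.simps)
      note d = Ck_on_has_derivative[OF this W xW]
      have "dd l (\<lambda>y. dd (-l) g y) x = dd l (\<lambda>y. (-1) * dd l g y + 0 * dd l g y) x"
        by (rule dd_cong[OF W xW]) (rule 1)
      also have "\<dots> = - dd l (\<lambda>y. dd l g y) x" unfolding dd_lin_comb[OF d d] by simp
      finally show ?thesis by (simp add: dds_def)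
    qed
    have "\<bar>Lh h g x - limit_op g x\<bar> \<le> (\<Sum>l\<in>\<Lambda>. 2 * B * \<epsilon>')"
      unfolding Lh_alt[OF less_imp_neq[OF h, symmetric]] limit_op_def sum_subtractf[symmetric]
    proof (rule order_trans[OF sum_abs], rule sum_mono)
      fix l assume l: "l \<in> \<Lambda>"
      have e1: "\<bar>fdiff h l (fdiff h (- l) g) x + dd l (\<lambda>y. dd l g y) x\<bar> \<le> \<epsilon>'"
      proof -
        have "\<bar>fdiffs h [l, -l] g x - dds [l, -l] g x\<bar> \<le> \<epsilon>'" using H l x by blast
        then show ?thesis unfolding neg2 by (simp add: fdiffs_Cons)
      qed
      have e2: "\<bar>fdiff h l g x - dd l g x\<bar> \<le> \<epsilon>'"
      proof -
        have "\<bar>fdiffs h [l] g x - dds [l] g x\<bar> \<le> \<epsilon>'" using H l x by blast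
        then show ?thesis by (simp add: fdiffs_Cons dds_Cons)
      qed
      have eq: "- (1/2) * c l x * fdiff h l (fdiff h (- l) g) x + b l x * fdiff h l g x
         - (1/2 * c l x * dd l (\<lambda>y. dd l g y) x + b l x * dd l g x)
         = - (1/2) * (c l x * (fdiff h l (fdiff h (- l) g) x + dd l (\<lambda>y. dd l g y) x))
           + b l x * (fdiff h l g x - dd l g x)"
        by (simp add: algebra_simps)
      have "\<bar>c l x * (fdiff h l (fdiff h (- l) g) x + dd l (\<lambda>y. dd l g y) x)\<bar> \<le> B * \<epsilon>'"
        unfolding abs_mult using B[OF x l] e1 \<open>0 \<le> B\<close> by (intro mult_mono) auto
      moreover have "\<bar>b l x * (fdiff h l g x - dd l g x)\<bar> \<le> B * \<epsilon>'"
        unfolding abs_mult using B[OF x l] e2 \<open>0 \<le> B\<close> by (intro mult_mono) auto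
      ultimately show "\<bar>- (1/2) * c l x * fdiff h l (fdiff h (- l) g) x + b l x * fdiff h l g x
         - (1/2 * c l x * dd l (\<lambda>y. dd l g y) x + b l x * dd l g x)\<bar> \<le> 2 * B * \<epsilon>'"
        unfolding eq by linarith
    qed
    also have "\<dots> = 2 * (card \<Lambda> * B) * \<epsilon>'" by simp
    also have "\<dots> \<le> 2 * (card \<Lambda> * B + 1) * \<epsilon>'" using \<epsilon>' by (intro mult_right_mono) auto
    also have "\<dots> = \<epsilon>" using cB by (simp add: \<epsilon>'_def)
    finally show "\<bar>Lh h g x - limit_op g x\<bar> \<le> \<epsilon>" .
  qed
qed

end

section \<open>Barriers\<close>

text \<open>\<open>Basis \<subseteq> \<Lambda>\<close> supplies a positive weight in every
  coordinate direction and all partial derivatives of the limit. Smoothness is required on the whole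
  space because differences reach beyond \<open>D\<close>, ellipticity only on \<open>D\<close>,
  where the equation is posed.\<close>

locale dirichlet_scheme = diff_scheme \<Lambda> c b
  for \<Lambda> :: "'a::euclidean_space set" and c b :: "'a \<Rightarrow> 'a \<Rightarrow> real" +
  fixes D :: "'a set" and \<theta> :: real
  assumes Basis_sub: "Basis \<subseteq> \<Lambda>"
    and c_C3: "l \<in> \<Lambda> \<Longrightarrow> Ck_on 3 UNIV (c l)" and b_C3: "l \<in> \<Lambda> \<Longrightarrow> Ck_on 3 UNIV (b l)"
    and theta: "0 < \<theta>" and ell: "l \<in> \<Lambda> \<Longrightarrow> x \<in> D \<Longrightarrow> \<theta> \<le> c l x"
    and D_open: "open D" and D_bdd: "bounded D"
    and bdry: "p \<in> frontier D \<Longrightarrow> \<exists>r>0. \<exists>\<rho>::'a \<Rightarrow> real. Ck_on 2 (ball p r) \<rho> \<and> (\<exists>i\<in>Basis. dd i \<rho> p \<noteq> 0)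
       \<and> D \<inter> ball p r = {x \<in> ball p r. \<rho> x < 0}"
begin

lemma Lam_ne: "\<Lambda> \<noteq> {}"
  using Basis_sub nonempty_Basis by blast

lemma ell_closure:
  assumes "l \<in> \<Lambda>" "x \<in> closure D"
  shows "\<theta> \<le> c l x"
proof -
  have "continuous_on UNIV (c l)" using Ck_on_continuous[OF c_C3[OF assms(1)]] by simp
  then have "closed {x. \<theta> \<le> c l x}" by (intro closed_Collect_le continuous_on_const)
  moreover have "D \<subseteq> {x. \<theta> \<le> c l x}" using ell[OF assms(1)] by auto
  ultimately have "closure D \<subseteq> {x. \<theta> \<le> c l x}" by (rule closure_minimal[rotated])
  then show ?thesis using assms(2) by blast
qed

lemma coef_bounds:
  assumes "bounded K"
  shows "\<exists>B>0. \<forall>x\<in>K. \<forall>h. 0 < h \<and> h \<le> 1 \<longrightarrow> (\<forall>\<alpha>\<in>wle \<Lambda> 3. \<forall>l\<in>\<Lambda>.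
     \<bar>fdiffs h \<alpha> (c l) x\<bar> \<le> B \<and> \<bar>fdiffs h \<alpha> (b l) x\<bar> \<le> B)"
proof -
  have "\<exists>B>0. \<forall>x\<in>K. \<forall>h. 0 < h \<and> h \<le> 1 \<longrightarrow> (\<forall>\<alpha>\<in>wle \<Lambda> 3. \<bar>fdiffs h \<alpha> (c l) x\<bar> \<le> B)"
    if "l \<in> \<Lambda>" for l by (rule fdiffs_bounded[OF c_C3[OF that] assms fin])
  then obtain Bc where Bc: "\<And>l x h \<alpha>. l \<in> \<Lambda> \<Longrightarrow> x \<in> K \<Longrightarrow> 0 < h \<Longrightarrow> h \<le> 1 \<Longrightarrow> \<alpha> \<in> wle \<Lambda> 3 \<Longrightarrow>
      \<bar>fdiffs h \<alpha> (c l) x\<bar> \<le> Bc l" by metis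
  have "\<exists>B>0. \<forall>x\<in>K. \<forall>h. 0 < h \<and> h \<le> 1 \<longrightarrow> (\<forall>\<alpha>\<in>wle \<Lambda> 3. \<bar>fdiffs h \<alpha> (b l) x\<bar> \<le> B)"
    if "l \<in> \<Lambda>" for l by (rule fdiffs_bounded[OF b_C3[OF that] assms fin])
  then obtain Bb where Bb: "\<And>l x h \<alpha>. l \<in> \<Lambda> \<Longrightarrow> x \<in> K \<Longrightarrow> 0 < h \<Longrightarrow> h \<le> 1 \<Longrightarrow> \<alpha> \<in> wle \<Lambda> 3 \<Longrightarrow>
      \<bar>fdiffs h \<alpha> (b l) x\<bar> \<le> Bb l" by metis
  define B where "B = (\<Sum>l\<in>\<Lambda>. \<bar>Bc l\<bar> + \<bar>Bb l\<bar>) + 1"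
  have B: "\<bar>Bc l\<bar> + \<bar>Bb l\<bar> \<le> B" if "l \<in> \<Lambda>" for l
    unfolding B_def using member_le_sum[OF that, of "\<lambda>l. \<bar>Bc l\<bar> + \<bar>Bb l\<bar>"] fin by fastforce
  have B0: "0 < B" unfolding B_def by (intro add_nonneg_pos sum_nonneg) auto
  show ?thesis
  proof (intro exI[of _ B] conjI B0 ballI allI impI)
    fix x h \<alpha> l assume *: "x \<in> K" "0 < h \<and> h \<le> (1::real)" "\<alpha> \<in> wle \<Lambda> 3" "l \<in> \<Lambda>"
    show "\<bar>fdiffs h \<alpha> (c l) x\<bar> \<le> B" using Bc[of l x h \<alpha>] B[of l] * by force
    show "\<bar>fdiffs h \<alpha> (b l) x\<bar> \<le> B" using Bb[of l x h \<alpha>] B[of l] * by force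
  qed
qed

lemma coef_bounds0:
  assumes "bounded K"
  shows "\<exists>B>0. \<forall>x\<in>K. \<forall>l\<in>\<Lambda>. \<bar>c l x\<bar> \<le> B \<and> \<bar>b l x\<bar> \<le> B"
proof -
  obtain B where B: "B > 0" "\<forall>x\<in>K. \<forall>h. 0 < h \<and> h \<le> 1 \<longrightarrow> (\<forall>\<alpha>\<in>wle \<Lambda> 3. \<forall>l\<in>\<Lambda>.
     \<bar>fdiffs h \<alpha> (c l) x\<bar> \<le> B \<and> \<bar>fdiffs h \<alpha> (b l) x\<bar> \<le> B)" using coef_bounds[OF assms] by blast
  have "[] \<in> wle \<Lambda> 3" by (simp add: wle_def)
  then show ?thesis using B(1) B(2)[rule_format, of _ 1 "[]"] by (intro exI[of _ B]) auto
qed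

lemma pw_bounds:
  "\<exists>B>0. \<forall>\<^sub>F h in at_right 0. \<forall>x\<in>D. \<forall>l\<in>\<Lambda>. \<theta> / 2 \<le> pw h l x \<and> pw h l x \<le> B"
proof -
  obtain B where B: "B > 0" "\<And>x l. x \<in> D \<Longrightarrow> l \<in> \<Lambda> \<Longrightarrow> \<bar>c l x\<bar> \<le> B \<and> \<bar>b l x\<bar> \<le> B"
    using coef_bounds0[OF D_bdd] by blast
  define h0 where "h0 = min 1 (\<theta> / (2 * B))"
  have h0: "0 < h0" using theta B by (simp add: h0_def)
  have "\<theta> / 2 \<le> pw h l x \<and> pw h l x \<le> 2 * B" if "0 < h" "h < h0" "x \<in> D" "l \<in> \<Lambda>" for h x l
  proof -
    have cb: "\<bar>c l x\<bar> \<le> B" "\<bar>b l x\<bar> \<le> B" using B that by auto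
    have "\<bar>h * b l x\<bar> \<le> h * B" using that cb by (simp add: abs_mult)
    moreover have "h * B \<le> \<theta> / 2" "h * B \<le> B" using that B(1) by (auto simp: h0_def field_simps)
    ultimately show ?thesis using cb ell[OF that(4,3)] by linarith
  qed
  then show ?thesis using B h0 unfolding eventually_at_right_field by (intro exI[of _ "2 * B"]) auto
qed

lemma limit_op_continuous:
  assumes W: "open W" and g: "Ck_on 2 W g"
  shows "continuous_on W (limit_op g)"
proof -
  have g2: "Ck_on 1 W (\<lambda>y. dd l g y)" "Ck_on 0 W (\<lambda>y. dd l (\<lambda>y. dd l g y) y)" for l
    using g by (simp_all add: numeral_2_eq_2)
  have "continuous_on W (\<lambda>y. dd l g y)" "continuous_on W (\<lambda>y. dd l (\<lambda>y. dd l g y) y)" for l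
    using Ck_on_continuous[OF g2(1) W] g2(2) by auto
  moreover have "continuous_on W (c l)" "continuous_on W (b l)" if "l \<in> \<Lambda>" for l
    using Ck_on_continuous[OF c_C3[OF that]] Ck_on_continuous[OF b_C3[OF that]]
    by (auto intro: continuous_on_subset)
  ultimately show ?thesis unfolding limit_op_def[abs_def]
    by (intro continuous_on_sum continuous_on_add continuous_on_mult continuous_on_const) auto
qed

text \<open>The function \<open>- \<rho> - k * \<rho>\<^sup>2\<close> vanishes at \<open>p\<close>
  and is nonnegative in \<open>D\<close> near \<open>p\<close>. As \<open>\<rho> p = 0\<close>, the
  operator maps it at \<open>p\<close> to \<open>- limit_op \<rho> p - k * Q\<close>, and
  \<open>Q > 0\<close> because the gradient of \<open>\<rho>\<close> does not vanish. A large
  multiple then absorbs the contribution of \<open>(x - p) \<bullet> (x - p)\<close>, the term that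
  makes the barrier positive away from \<open>p\<close>.\<close>

lemma frontier_barrier:
  assumes p: "p \<in> frontier D"
  shows "\<exists>r>0. \<exists>g. Ck_on 2 (ball p r) g \<and> g p = 0 \<and> (\<forall>x\<in>D \<inter> ball p r. (norm (x - p))\<^sup>2 \<le> g x)
    \<and> (\<forall>x\<in>ball p r. limit_op g x \<le> -1)"
proof -
  obtain r i and \<rho> :: "'a \<Rightarrow> real" where r: "0 < r" and \<rho>: "Ck_on 2 (ball p r) \<rho>" and i: "i \<in> Basis" "dd i \<rho> p \<noteq> 0"
    and D: "D \<inter> ball p r = {x \<in> ball p r. \<rho> x < 0}"
    using bdry[OF p] by blast
  let ?W = "ball p r"
  have oW: "open ?W" by simp
  have pW: "p \<in> ?W" using r by simp
  have \<rho>cont: "continuous_on ?W \<rho>" using Ck_on_continuous[OF \<rho>] by simp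
  have pD: "p \<notin> D" "p \<in> closure D" using p D_open by (auto simp: frontier_def interior_open)
  have \<rho>p: "\<rho> p = 0"
  proof -
    have "0 \<le> \<rho> p" using pD(1) D pW by force
    moreover have "\<rho> p \<le> 0"
    proof (rule ccontr)
      assume "\<not> \<rho> p \<le> 0"
      moreover have "isCont \<rho> p" using \<rho>cont pW oW continuous_on_eq_continuous_at by blast
      ultimately have "\<forall>\<^sub>F x in at p. 0 < \<rho> x" by (intro order_tendstoD(1)[of \<rho> "\<rho> p"]) (auto simp: isCont_def)
      then obtain d where d: "0 < d" "\<And>x. x \<noteq> p \<Longrightarrow> dist x p < d \<Longrightarrow> 0 < \<rho> x"
        unfolding eventually_at by blast
      obtain y where y: "y \<in> D" "dist y p < min d r"
        using pD(2)[unfolded closure_approachable, rule_format, of "min d r"] d(1) r by auto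
      have yp: "y \<noteq> p" using y(1) pD(1) by blast
      have "0 < \<rho> y" using d(2)[OF yp] y(2) by simp
      moreover have "y \<in> D \<inter> ball p r" using y by (simp add: dist_commute)
      then have "\<rho> y < 0" unfolding D by simp
      ultimately show False by simp
    qed
    ultimately show ?thesis by simp
  qed
  have d\<rho>: "(\<rho> has_derivative frechet_derivative \<rho> (at x)) (at x)" if "x \<in> ?W" for x
    using Ck_on_has_derivative[of 1 ?W \<rho> x] \<rho> that by (simp add: numeral_2_eq_2)
  have dd\<rho>: "((\<lambda>y. dd v \<rho> y) has_derivative frechet_derivative (\<lambda>y. dd v \<rho> y) (at x)) (at x)" if "x \<in> ?W" for x v
    using Ck_on_has_derivative[of 0 ?W "\<lambda>y. dd v \<rho> y" x] \<rho> that by (simp add: numeral_2_eq_2)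
  define Q where "Q = (\<Sum>l\<in>\<Lambda>. c l p * (dd l \<rho> p)\<^sup>2)"
  have Q: "0 < Q"
  proof -
    have "0 < \<theta> * (dd i \<rho> p)\<^sup>2" using theta i by simp
    also have "\<dots> \<le> c i p * (dd i \<rho> p)\<^sup>2"
      using ell_closure[OF _ pD(2), of i] i Basis_sub by (intro mult_right_mono) auto
    also have "\<dots> \<le> Q" unfolding Q_def
      by (rule member_le_sum[OF _ _ fin]) (use i Basis_sub ell_closure[OF _ pD(2)] theta in \<open>force intro!: mult_nonneg_nonneg\<close>)+
    finally show ?thesis .
  qed
  define L0 where "L0 = limit_op \<rho> p"
  \<comment> \<open>\<open>k * Q\<close> exceeds \<open>\<bar>L0\<bar>\<close> by 1, and the factor
    \<open>A\<close> below exceeds the contribution \<open>L2\<close> of the quadratic term by 2. So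
    the value at \<open>p\<close> is at most \<open>-2\<close>, and continuity leaves
    \<open>-1\<close> near \<open>p\<close>.\<close>
  define k where "k = (\<bar>L0\<bar> + 1) / Q"
  have k: "0 < k" using Q by (simp add: k_def add_nonneg_pos)
  have kQ: "k * Q = \<bar>L0\<bar> + 1" using Q by (simp add: k_def)
  define L2 where "L2 = (\<Sum>l\<in>\<Lambda>. c l p * (l \<bullet> l))"
  define A where "A = \<bar>L2\<bar> + 2"
  have A: "0 < A" by (simp add: A_def add_nonneg_pos)
  define g where "g x = A * (- \<rho> x - k * (\<rho> x)\<^sup>2) + (x - p) \<bullet> (x - p)" for x
  have dg: "(g has_derivative (\<lambda>v. A * (- dd v \<rho> x - k * (2 * \<rho> x * dd v \<rho> x)) + 2 * ((x - p) \<bullet> v))) (at x)"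
    if x: "x \<in> ?W" for x
    unfolding g_def[abs_def]
    by (rule derivative_eq_intros d\<rho>[OF x] refl | simp add: inner_commute algebra_simps)+
  have lin: "Ck_on j ?W (\<lambda>x. a * ((x - p) \<bullet> v))" for a v j
  proof -
    have 1: "(\<lambda>x. a * ((x - p) \<bullet> v)) = (\<lambda>x. a * (x \<bullet> v) + - a * (p \<bullet> v))"
      by (simp add: inner_diff_left algebra_simps)
    show ?thesis unfolding 1
      by (intro Ck_on_add Ck_on_mult Ck_on_const oW Ck_on_bounded_linear bounded_linear_inner_left)
  qed
  have \<rho>1: "Ck_on 1 ?W \<rho>" "Ck_on 1 ?W (\<lambda>x. dd v \<rho> x)" for v
    using Ck_on_le[OF \<rho>, of 1] \<rho> by (simp_all add: numeral_2_eq_2)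
  have "Ck_on (Suc 1) ?W g"
  proof (rule Ck_on_SucI[OF oW dg])
    fix v
    have "Ck_on 1 ?W (\<lambda>x. A * (- 1 * dd v \<rho> x + - k * (2 * \<rho> x * dd v \<rho> x)) + 2 * ((x - p) \<bullet> v))"
      by (intro Ck_on_add Ck_on_mult Ck_on_const oW \<rho>1 lin)
    then show "Ck_on 1 ?W (\<lambda>x. A * (- dd v \<rho> x - k * (2 * \<rho> x * dd v \<rho> x)) + 2 * ((x - p) \<bullet> v))"
      by simp
  qed
  then have g2: "Ck_on 2 ?W g" by (simp add: numeral_2_eq_2)
  have ddg: "dd l g x = A * (- dd l \<rho> x - k * (2 * \<rho> x * dd l \<rho> x)) + 2 * ((x - p) \<bullet> l)" if "x \<in> ?W" for x l
    by (simp add: frechet_derivative_at[OF dg[OF that], symmetric])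
  have ddgp: "dd l g p = - A * dd l \<rho> p" for l using ddg[OF pW] \<rho>p by simp
  have dddg: "dd l (\<lambda>y. dd l g y) p = A * (- dd l (\<lambda>y. dd l \<rho> y) p - 2 * k * (dd l \<rho> p)\<^sup>2) + 2 * (l \<bullet> l)" for l
  proof -
    have "dd l (\<lambda>y. dd l g y) p = dd l (\<lambda>x. A * (- dd l \<rho> x - k * (2 * \<rho> x * dd l \<rho> x)) + 2 * ((x - p) \<bullet> l)) p"
      by (rule dd_cong[OF oW pW]) (rule ddg)
    moreover have "((\<lambda>x. A * (- dd l \<rho> x - k * (2 * \<rho> x * dd l \<rho> x)) + 2 * ((x - p) \<bullet> l)) has_derivative
       (\<lambda>v. A * (- dd v (\<lambda>y. dd l \<rho> y) p - k * (2 * (dd v \<rho> p * dd l \<rho> p + \<rho> p * dd v (\<lambda>y. dd l \<rho> y) p))) + 2 * (v \<bullet> l))) (at p)"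
      by (rule derivative_eq_intros d\<rho>[OF pW] dd\<rho>[OF pW] refl | simp add: algebra_simps)+
    ultimately show ?thesis using \<rho>p by (simp add: frechet_derivative_at[symmetric] power2_eq_square)
  qed
  have "limit_op g p = - A * L0 - A * (k * Q) + L2"
  proof -
    have "limit_op g p = (\<Sum>l\<in>\<Lambda>. - A * (1/2 * c l p * dd l (\<lambda>y. dd l \<rho> y) p + b l p * dd l \<rho> p)
        - A * k * (c l p * (dd l \<rho> p)\<^sup>2) + c l p * (l \<bullet> l))"
      unfolding limit_op_def dddg ddgp by (intro sum.cong refl) (simp add: algebra_simps)
    also have "\<dots> = - A * L0 - A * k * Q + L2"
      unfolding L0_def limit_op_def Q_def L2_def sum_distrib_left sum_subtractf[symmetric] sum.distrib[symmetric] ..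
    finally show ?thesis by simp
  qed
  also have "\<dots> \<le> -2"
  proof -
    have "A * (- L0 - (\<bar>L0\<bar> + 1)) \<le> A * (-1)" using A by (intro mult_left_mono) auto
    then show ?thesis unfolding kQ by (simp add: A_def algebra_simps)
  qed
  finally have Lp: "limit_op g p \<le> -2" .
  have "isCont (limit_op g) p" using limit_op_continuous[OF oW g2] pW oW continuous_on_eq_continuous_at by blast
  then have "\<forall>\<^sub>F x in at p. limit_op g x < -1" using Lp by (intro order_tendstoD(2)[of _ "limit_op g p"]) (auto simp: isCont_def)
  then obtain d1 where d1: "0 < d1" "\<And>x. x \<noteq> p \<Longrightarrow> dist x p < d1 \<Longrightarrow> limit_op g x < -1"
    unfolding eventually_at by auto
  have "isCont \<rho> p" using \<rho>cont pW oW continuous_on_eq_continuous_at by blast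
  then have "\<forall>\<^sub>F x in at p. -1/k < \<rho> x" using k \<rho>p by (intro order_tendstoD(1)[of _ "\<rho> p"]) (auto simp: isCont_def)
  then obtain d2 where d2: "0 < d2" "\<And>x. x \<noteq> p \<Longrightarrow> dist x p < d2 \<Longrightarrow> -1/k < \<rho> x"
    unfolding eventually_at by auto
  let ?r = "min r (min d1 d2)"
  show ?thesis
  proof (intro exI[of _ ?r] exI[of _ g] conjI ballI)
    show "0 < ?r" using r d1 d2 by simp
    show "Ck_on 2 (ball p ?r) g" by (rule Ck_on_subset[OF g2]) auto
    show "g p = 0" by (simp add: g_def \<rho>p)
  next
    fix x assume x: "x \<in> D \<inter> ball p ?r"
    then have "x \<in> D \<inter> ball p r" "x \<noteq> p" using pD by auto
    then have 1: "\<rho> x < 0" using D by auto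
    have "-1/k < \<rho> x" using d2(2)[of x] x \<open>x \<noteq> p\<close> by (simp add: dist_commute)
    then have "0 < 1 + k * \<rho> x" using k by (simp add: field_simps)
    then have "0 \<le> (- \<rho> x) * (1 + k * \<rho> x)" using 1 by (intro mult_nonneg_nonneg) auto
    also have "\<dots> = - \<rho> x - k * (\<rho> x)\<^sup>2" by (simp add: algebra_simps power2_eq_square)
    finally have "0 \<le> A * (- \<rho> x - k * (\<rho> x)\<^sup>2)" using A by simp
    then show "(norm (x - p))\<^sup>2 \<le> g x" by (simp add: g_def power2_norm_eq_inner)
  next
    fix x assume "x \<in> ball p ?r"
    then show "limit_op g x \<le> -1" using d1(2)[of x] Lp by (cases "x = p") (auto simp: dist_commute)
  qed
qed

text \<open>The classical choice \<open>A * (K - exp (k * (x \<bullet> i)))\<close>: for large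
  \<open>k\<close> the second derivatives of the exponential, bounded below through ellipticity
  along \<open>i\<close>, beat the drift. Consistency transfers the inequality to the
  scheme.\<close>

lemma supersolution:
  "\<exists>S s Sm. 0 < s \<and> (\<forall>\<^sub>F h in at_right 0. \<forall>x\<in>D. Lh h S x \<le> -1 \<and> s \<le> S x \<and> S x \<le> Sm \<and>
     (\<forall>l\<in>\<Lambda>. s \<le> S (x + h *\<^sub>R l)))"
proof -
  obtain i where i: "i \<in> (Basis :: 'a set)" using nonempty_Basis by blast
  obtain R where R: "0 < R" "\<And>x. x \<in> D \<Longrightarrow> norm x \<le> R" using D_bdd bounded_pos by metis
  obtain \<rho> where \<rho>: "0 < \<rho>" "\<And>l. l \<in> \<Lambda> \<Longrightarrow> norm l \<le> \<rho>" using finite_norm_bound[OF fin] by blast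
  have cD: "compact (closure D)" using D_bdd by simp
  obtain B where B: "B > 0" "\<And>x l. x \<in> closure D \<Longrightarrow> l \<in> \<Lambda> \<Longrightarrow> \<bar>c l x\<bar> \<le> B \<and> \<bar>b l x\<bar> \<le> B"
    using coef_bounds0[OF compact_imp_bounded[OF cD]] by blast
  define B1 where "B1 = card \<Lambda> * (B * \<rho>)"
  have B1: "0 \<le> B1" using B \<rho> by (simp add: B1_def)
  \<comment> \<open>\<open>B1\<close> bounds the drift sum. The choice gives
    \<open>\<theta> * k / 2 - B1 = 1 + \<theta> / 2\<close>, and multiplication by
    \<open>k \<ge> 1\<close> keeps this above 1.\<close>
  define k where "k = 2 * (B1 + 1) / \<theta> + 1"
  have k: "1 \<le> k" "0 < k" using theta B1 by (simp_all add: k_def add_nonneg_pos)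
  have k\<theta>: "1/2 * \<theta> * k\<^sup>2 - k * B1 \<ge> 1"
  proof -
    have "\<theta> * k = 2 * (B1 + 1) + \<theta>" using theta by (simp add: k_def field_simps)
    then have "k * (1/2 * \<theta> * k - B1) = k * (1 + \<theta> / 2)" by (simp add: algebra_simps)
    also have "\<dots> \<ge> 1 * 1" using k theta by (intro mult_mono) auto
    finally show ?thesis by (simp add: algebra_simps power2_eq_square)
  qed
  \<comment> \<open>On \<open>D\<close> the exponential is at least \<open>exp (- (k * R))\<close>,
    so \<open>A\<close> yields \<open>limit_op S x \<le> -2\<close>; one unit is left for the
    consistency error. \<open>K\<close> keeps \<open>S\<close> above \<open>A\<close> at the
    neighbours too, whose norm is at most \<open>R + \<rho>\<close>.\<close>
  define A where "A = 2 * exp (k * R)"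
  have A: "0 < A" by (simp add: A_def)
  define K where "K = 1 + exp (k * (R + \<rho>))"
  define S where "S x = A * (K - exp (k * (x \<bullet> i)))" for x
  have e: "((\<lambda>x. exp (k * (x \<bullet> i))) has_derivative (\<lambda>v. k * (v \<bullet> i) * exp (k * (x \<bullet> i)))) (at x)" for x
    by (auto intro!: derivative_eq_intros)
  have dS: "(S has_derivative (\<lambda>v. - A * k * (v \<bullet> i) * exp (k * (x \<bullet> i)))) (at x)" for x
    unfolding S_def[abs_def] by (rule derivative_eq_intros e refl | simp add: mult.assoc)+
  have ddS: "dd l S x = - A * k * (l \<bullet> i) * exp (k * (x \<bullet> i))" for l x
    using frechet_derivative_at[OF dS] by metis
  have dddS: "dd l (\<lambda>y. dd l S y) x = - A * k\<^sup>2 * (l \<bullet> i)\<^sup>2 * exp (k * (x \<bullet> i))" for l x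
  proof -
    have "((\<lambda>x. - A * k * (l \<bullet> i) * exp (k * (x \<bullet> i))) has_derivative
       (\<lambda>v. - A * k * (l \<bullet> i) * (k * (v \<bullet> i) * exp (k * (x \<bullet> i))))) (at x)"
      by (rule derivative_eq_intros e refl | simp)+
    then show ?thesis unfolding ddS by (simp add: frechet_derivative_at[symmetric] power2_eq_square)
  qed
  have ek: "Ck_on j UNIV (\<lambda>x::'a. exp (k * (x \<bullet> i)))" for j
    by (intro Ck_on_exp Ck_on_mult Ck_on_const open_UNIV Ck_on_bounded_linear bounded_linear_inner_left)
  have "Ck_on 2 UNIV (\<lambda>x. A * (K + -1 * exp (k * (x \<bullet> i))))"
    by (intro Ck_on_add Ck_on_mult Ck_on_const open_UNIV ek)
  then have S2: "Ck_on 2 UNIV S" by (simp add: S_def[abs_def])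
  have LS: "limit_op S x \<le> -2" if x: "x \<in> D" for x
  proof -
    have xc: "x \<in> closure D" using x closure_subset by blast
    let ?e = "exp (k * (x \<bullet> i))"
    have "limit_op S x = - A * ?e * (1/2 * k\<^sup>2 * (\<Sum>l\<in>\<Lambda>. c l x * (l \<bullet> i)\<^sup>2) + k * (\<Sum>l\<in>\<Lambda>. b l x * (l \<bullet> i)))"
      unfolding limit_op_def dddS unfolding ddS distrib_left sum_distrib_left sum.distrib[symmetric]
      by (intro sum.cong refl) (simp add: algebra_simps)
    moreover have "\<theta> \<le> (\<Sum>l\<in>\<Lambda>. c l x * (l \<bullet> i)\<^sup>2)"
    proof -
      have "\<theta> \<le> c i x * (i \<bullet> i)\<^sup>2" using ell[OF _ x, of i] i Basis_sub by auto
      also have "\<dots> \<le> (\<Sum>l\<in>\<Lambda>. c l x * (l \<bullet> i)\<^sup>2)"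
        by (rule member_le_sum[OF _ _ fin]) (use i Basis_sub ell[OF _ x] theta in \<open>force intro!: mult_nonneg_nonneg\<close>)+
      finally show ?thesis .
    qed
    moreover have "- B1 \<le> (\<Sum>l\<in>\<Lambda>. b l x * (l \<bullet> i))"
    proof -
      have "\<bar>\<Sum>l\<in>\<Lambda>. b l x * (l \<bullet> i)\<bar> \<le> (\<Sum>l\<in>\<Lambda>. B * \<rho>)"
      proof (rule order_trans[OF sum_abs], rule sum_mono)
        fix l assume l: "l \<in> \<Lambda>"
        have "\<bar>l \<bullet> i\<bar> \<le> \<rho>" using Basis_le_norm[OF i, of l] \<rho>(2)[OF l] by linarith
        then show "\<bar>b l x * (l \<bullet> i)\<bar> \<le> B * \<rho>" unfolding abs_mult
          using B(2)[OF xc l] B(1) by (intro mult_mono) auto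
      qed
      then show ?thesis by (simp add: B1_def abs_le_iff)
    qed
    ultimately have 0: "\<theta> \<le> (\<Sum>l\<in>\<Lambda>. c l x * (l \<bullet> i)\<^sup>2)" "- B1 \<le> (\<Sum>l\<in>\<Lambda>. b l x * (l \<bullet> i))"
      and 2: "limit_op S x = - (A * ?e) * (1/2 * k\<^sup>2 * (\<Sum>l\<in>\<Lambda>. c l x * (l \<bullet> i)\<^sup>2) + k * (\<Sum>l\<in>\<Lambda>. b l x * (l \<bullet> i)))"
      by simp_all
    have 1: "1/2 * k\<^sup>2 * (\<Sum>l\<in>\<Lambda>. c l x * (l \<bullet> i)\<^sup>2) + k * (\<Sum>l\<in>\<Lambda>. b l x * (l \<bullet> i)) \<ge> 1/2 * k\<^sup>2 * \<theta> + k * (- B1)"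
      by (intro add_mono mult_left_mono 0) (use k in auto)
    have "- (k * R) \<le> k * (x \<bullet> i)"
      using Basis_le_norm[OF i, of x] R(2)[OF x] k mult_left_mono[of "- R" "x \<bullet> i" k] by (simp add: abs_le_iff)
    then have "exp (- (k * R)) \<le> ?e" by simp
    then have "A * exp (- (k * R)) \<le> A * ?e" using A by (intro mult_left_mono) auto
    then have "2 \<le> A * ?e" by (simp add: A_def exp_minus)
    moreover have "1 \<le> 1/2 * k\<^sup>2 * (\<Sum>l\<in>\<Lambda>. c l x * (l \<bullet> i)\<^sup>2) + k * (\<Sum>l\<in>\<Lambda>. b l x * (l \<bullet> i))"
      using 1 k\<theta> by (simp add: algebra_simps)
    ultimately have "2 * 1 \<le> A * ?e * (1/2 * k\<^sup>2 * (\<Sum>l\<in>\<Lambda>. c l x * (l \<bullet> i)\<^sup>2) + k * (\<Sum>l\<in>\<Lambda>. b l x * (l \<bullet> i)))"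
      by (intro mult_mono) auto
    then show ?thesis unfolding 2 by simp
  qed
  have S_low: "A \<le> S x" if "norm x \<le> R + \<rho>" for x
  proof -
    have "k * (x \<bullet> i) \<le> k * (R + \<rho>)"
      using Basis_le_norm[OF i, of x] that k by (intro mult_left_mono) auto
    then have "1 \<le> K - exp (k * (x \<bullet> i))" by (simp add: K_def)
    then show ?thesis using A by (simp add: S_def mult_le_cancel_left1)
  qed
  have S_up: "S x \<le> A * K" for x using A by (simp add: S_def)
  have cons: "\<forall>\<^sub>F h in at_right 0. \<forall>x\<in>closure D. \<bar>Lh h S x - limit_op S x\<bar> \<le> 1"
    by (rule consistency[OF open_UNIV S2 cD]) (use B in auto)
  have h1: "\<forall>\<^sub>F h in at_right (0::real). 0 < h \<and> h < 1"
    unfolding eventually_at_right_field by (intro exI[of _ 1]) auto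
  show ?thesis
  proof (rule exI[of _ S], rule exI[of _ A], rule exI[of _ "A * K"], intro conjI A)
    show "\<forall>\<^sub>F h in at_right 0. \<forall>x\<in>D. Lh h S x \<le> -1 \<and> A \<le> S x \<and> S x \<le> A * K \<and> (\<forall>l\<in>\<Lambda>. A \<le> S (x + h *\<^sub>R l))"
      using cons h1
    proof (eventually_elim, intro ballI conjI S_up)
      fix h x assume H: "\<forall>x\<in>closure D. \<bar>Lh h S x - limit_op S x\<bar> \<le> 1" "0 < h \<and> h < 1" and x: "x \<in> D"
      have "x \<in> closure D" using x closure_subset by blast
      then show "Lh h S x \<le> -1" using LS[OF x] H(1) by (force simp: abs_le_iff)
      show "A \<le> S x" using R(2)[OF x] \<rho> by (intro S_low) auto
      fix l assume l: "l \<in> \<Lambda>"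
      have "norm (h *\<^sub>R l) \<le> 1 * \<rho>" using mult_mono[of h 1 "norm l" \<rho>] H(2) \<rho>(2)[OF l] by simp
      then have "norm (x + h *\<^sub>R l) \<le> R + \<rho>" using R(2)[OF x] norm_triangle_ineq[of x "h *\<^sub>R l"] by linarith
      then show "A \<le> S (x + h *\<^sub>R l)" by (rule S_low)
    qed
  qed
qed

end

section \<open>Discrete solutions near the boundary and in the interior\<close>

context dirichlet_scheme
begin

text \<open>Comparison of \<open>u\<close> with \<open>\<psi> p + \<epsilon> / 2 + M * g\<close> on
  the part of \<open>D\<close> in a small ball, where \<open>g\<close> is the barrier at
  \<open>p\<close>. Since \<open>Lh h u\<close> itself is assumed bounded, the comparison is run
  with zeroth-order coefficient 0. The threshold for \<open>h\<close> is found before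
  \<open>u\<close> is given.\<close>

lemma boundary_upper:
  fixes \<psi> :: "'a \<Rightarrow> real"
  assumes p: "p \<in> frontier D" and \<psi>: "isCont \<psi> p" and \<epsilon>: "0 < \<epsilon>"
  shows "\<exists>\<delta>>0. \<forall>\<^sub>F h in at_right 0. \<forall>u. (\<forall>x. x \<notin> D \<longrightarrow> u x = \<psi> x) \<and>
     (\<forall>x\<in>D. \<bar>Lh h u x\<bar> \<le> F \<and> \<bar>u x\<bar> \<le> B) \<longrightarrow> (\<forall>x\<in>D \<inter> ball p \<delta>. u x \<le> \<psi> p + \<epsilon>)"
proof -
  obtain r g where r: "0 < r" and g: "Ck_on 2 (ball p r) g" "g p = 0"
    and glow: "\<And>x. x \<in> D \<inter> ball p r \<Longrightarrow> (norm (x - p))\<^sup>2 \<le> g x" and LLg: "\<And>x. x \<in> ball p r \<Longrightarrow> limit_op g x \<le> -1"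
    using frontier_barrier[OF p] by blast
  obtain \<rho> where \<rho>: "0 < \<rho>" "\<And>l. l \<in> \<Lambda> \<Longrightarrow> norm l \<le> \<rho>" using finite_norm_bound[OF fin] by blast
  obtain d1 where d1: "0 < d1" "\<And>x. dist x p < d1 \<Longrightarrow> dist (\<psi> x) (\<psi> p) < \<epsilon> / 4"
    using \<psi> \<epsilon> unfolding continuous_at_eps_delta by (metis divide_pos_pos zero_less_numeral)
  define r1 where "r1 = min r d1 / 4"
  have r1: "0 < r1" "2 * r1 < r" "2 * r1 < d1" using r d1 by (auto simp: r1_def)
  \<comment> \<open>The first entry lets \<open>M * Lh h g x \<le> - (M / 2)\<close> beat the bound
    \<open>F\<close> with a margin of 1. The second makes \<open>M * g\<close> exceed
    \<open>u - \<psi> p\<close> at points of \<open>D\<close> at distance at least \<open>r1\<close>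
    from \<open>p\<close>, where \<open>g \<ge> r1\<^sup>2\<close>.\<close>
  define M where "M = max (2 * (F + 1)) ((\<bar>B\<bar> + \<bar>\<psi> p\<bar>) / r1\<^sup>2) + 1"
  have M: "2 * (F + 1) \<le> M" "\<bar>B\<bar> + \<bar>\<psi> p\<bar> \<le> M * r1\<^sup>2" "0 < M"
  proof -
    show "2 * (F + 1) \<le> M" by (simp add: M_def)
    have a: "(\<bar>B\<bar> + \<bar>\<psi> p\<bar>) / r1\<^sup>2 \<le> M" by (simp add: M_def)
    then show "\<bar>B\<bar> + \<bar>\<psi> p\<bar> \<le> M * r1\<^sup>2" using r1 by (simp add: field_simps)
    have "0 \<le> (\<bar>B\<bar> + \<bar>\<psi> p\<bar>) / r1\<^sup>2" by simp
    then show "0 < M" unfolding M_def by linarith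
  qed
  have gcont: "continuous_on (ball p r) g" using Ck_on_continuous[OF g(1)] by simp
  have sub: "cball p (2 * r1) \<subseteq> ball p r" using r1 by auto
  have "uniformly_continuous_on (cball p (2 * r1)) g"
    using gcont sub by (intro compact_uniformly_continuous) (auto intro: continuous_on_subset)
  then obtain d2 where d2: "0 < d2" "\<And>x y. x \<in> cball p (2*r1) \<Longrightarrow> y \<in> cball p (2*r1) \<Longrightarrow> dist y x < d2 \<Longrightarrow> dist (g y) (g x) < \<epsilon> / (4 * M)"
    unfolding uniformly_continuous_on_def using \<epsilon> M by (metis divide_pos_pos zero_less_numeral mult_pos_pos)
  have "isCont g p" using gcont r continuous_on_eq_continuous_at[OF open_ball] centre_in_ball by blast
  then obtain d3 where d3: "0 < d3" "\<And>x. dist x p < d3 \<Longrightarrow> dist (g x) (g p) < \<epsilon> / (2 * M)"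
    unfolding continuous_at_eps_delta using \<epsilon> M by (metis divide_pos_pos zero_less_numeral mult_pos_pos)
  obtain S s Sm where S: "0 < s" and Sev: "\<forall>\<^sub>F h in at_right 0. \<forall>x\<in>D. Lh h S x \<le> -1 \<and> s \<le> S x \<and> S x \<le> Sm \<and>
     (\<forall>l\<in>\<Lambda>. s \<le> S (x + h *\<^sub>R l))" using supersolution by blast
  obtain Bp where Bp: "0 < Bp" and pwev: "\<forall>\<^sub>F h in at_right 0. \<forall>x\<in>D. \<forall>l\<in>\<Lambda>. \<theta> / 2 \<le> pw h l x \<and> pw h l x \<le> Bp"
    using pw_bounds by blast
  obtain Bc where Bc: "\<And>x l. x \<in> cball p r1 \<Longrightarrow> l \<in> \<Lambda> \<Longrightarrow> \<bar>c l x\<bar> \<le> Bc \<and> \<bar>b l x\<bar> \<le> Bc"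
    using coef_bounds0[OF bounded_cball] by blast
  have gev: "\<forall>\<^sub>F h in at_right 0. \<forall>x\<in>cball p r1. \<bar>Lh h g x - limit_op g x\<bar> \<le> 1 / 2"
    by (rule consistency[OF open_ball g(1) compact_cball _ _ Bc]) (use r1 in auto)
  have hev: "\<forall>\<^sub>F h in at_right (0::real). 0 < h \<and> h * \<rho> < r1 \<and> h * \<rho> < d2"
  proof -
    have "0 < min r1 d2 / \<rho>" using r1 d2 \<rho> by simp
    moreover have "0 < h \<and> h * \<rho> < r1 \<and> h * \<rho> < d2" if "0 < h" "h < min r1 d2 / \<rho>" for h
      using that \<rho> by (simp add: pos_less_divide_eq)
    ultimately show ?thesis unfolding eventually_at_right_field by blast
  qed
  define \<delta> where "\<delta> = min r1 d3"
  show ?thesis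
  proof (intro exI[of _ \<delta>] conjI)
    show "0 < \<delta>" using r1 d3 by (simp add: \<delta>_def)
    show "\<forall>\<^sub>F h in at_right 0. \<forall>u. (\<forall>x. x \<notin> D \<longrightarrow> u x = \<psi> x) \<and>
     (\<forall>x\<in>D. \<bar>Lh h u x\<bar> \<le> F \<and> \<bar>u x\<bar> \<le> B) \<longrightarrow> (\<forall>x\<in>D \<inter> ball p \<delta>. u x \<le> \<psi> p + \<epsilon>)"
      using Sev pwev gev hev
    proof (eventually_elim, intro allI impI ballI)
      fix h u x0
      assume Sh: "\<forall>x\<in>D. Lh h S x \<le> -1 \<and> s \<le> S x \<and> S x \<le> Sm \<and> (\<forall>l\<in>\<Lambda>. s \<le> S (x + h *\<^sub>R l))"
        and pwh: "\<forall>x\<in>D. \<forall>l\<in>\<Lambda>. \<theta> / 2 \<le> pw h l x \<and> pw h l x \<le> Bp"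
        and gh: "\<forall>x\<in>cball p r1. \<bar>Lh h g x - limit_op g x\<bar> \<le> 1 / 2"
        and hh: "0 < h \<and> h * \<rho> < r1 \<and> h * \<rho> < d2"
        and u: "(\<forall>x. x \<notin> D \<longrightarrow> u x = \<psi> x) \<and> (\<forall>x\<in>D. \<bar>Lh h u x\<bar> \<le> F \<and> \<bar>u x\<bar> \<le> B)"
        and x0: "x0 \<in> D \<inter> ball p \<delta>"
      define G where "G = D \<inter> ball p r1"
      define w where "w x = u x - ((\<psi> p + \<epsilon> / 2) + M * g x)" for x
      have Lc: "Lh h (\<lambda>x. a) x = 0" for a x by (simp add: Lh_def fdiff_def)
      have g0: "0 \<le> g x" if "x \<in> G" for x
        using glow[of x] that r1 by (auto simp: G_def intro: order_trans[OF zero_le_power2])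
      have xG: "x0 \<in> G" using x0 by (auto simp: G_def \<delta>_def)
      have "w x0 \<le> 0"
      proof (rule comparison[of h 1 0 Bp s G "\<lambda>_. 0" S Sm w "B + \<bar>\<psi> p\<bar>"])
        fix x l assume x: "x \<in> G" and l: "l \<in> \<Lambda>"
        show "0 \<le> pw h l x \<and> pw h l x \<le> Bp" using pwh x l theta by (force simp: G_def)
        show "0 \<le> S (x + h *\<^sub>R l)" using Sh x l S by (force simp: G_def)
        assume out: "x + h *\<^sub>R l \<notin> G"
        let ?y = "x + h *\<^sub>R l"
        have xp: "dist x p < r1" using x by (simp add: G_def dist_commute)
        have dxy: "dist ?y x \<le> h * \<rho>" using \<rho>(2)[OF l] hh by (simp add: dist_norm)
        have yp: "dist ?y p < 2 * r1" using dist_triangle[of ?y p x] dxy xp hh by linarith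
        have yr: "?y \<in> ball p r" using yp r1 by (simp add: dist_commute)
        show "w ?y \<le> 0"
        proof (cases "?y \<in> D")
          case True
          then have "r1 \<le> norm (?y - p)" using out by (simp add: G_def dist_norm norm_minus_commute)
          then have "r1\<^sup>2 \<le> (norm (?y - p))\<^sup>2" using r1 by (intro power_mono) auto
          also have "\<dots> \<le> g ?y" using glow True yr by blast
          finally have "M * r1\<^sup>2 \<le> M * g ?y" using M by (intro mult_left_mono) auto
          moreover have "\<bar>u ?y\<bar> \<le> B" using u True by blast
          ultimately show ?thesis using M(2) \<epsilon> unfolding w_def by linarith
        next
          case False
          then have uy: "u ?y = \<psi> ?y" using u by blast
          have "dist (\<psi> ?y) (\<psi> p) < \<epsilon> / 4" using yp r1 by (intro d1) auto
          \<comment> \<open>Outside \<open>D\<close> the barrier has no sign, but \<open>?y\<close>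
            is within \<open>h * \<rho>\<close> of a point where \<open>g\<close> is nonnegative, so
            uniform continuity limits the loss to \<open>\<epsilon> / 4\<close>. The other
            \<open>\<epsilon> / 4\<close> goes to the oscillation of \<open>\<psi>\<close>.\<close>
          moreover have "dist (g ?y) (g x) < \<epsilon> / (4 * M)"
            using yp xp dxy hh r1 by (intro d2) (auto simp: dist_commute)
          then have "- \<epsilon> / (4 * M) \<le> g ?y" using g0[OF x] by (simp add: dist_real_def abs_less_iff)
          then have "M * (- \<epsilon> / (4 * M)) \<le> M * g ?y" using M by (intro mult_left_mono) auto
          then have "- \<epsilon> / 4 \<le> M * g ?y" using M by simp
          ultimately show ?thesis using \<epsilon> unfolding w_def uy dist_real_def by linarith
        qed
      next
        fix x assume x: "x \<in> G"
        have xD: "x \<in> D" "x \<in> cball p r1" "x \<in> ball p r" using x r1 by (auto simp: G_def)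
        show "s \<le> S x \<and> S x \<le> Sm" "Lh h S x + 0 * S x \<le> 0" using Sh xD by force+
        have "M * g x \<ge> 0" using g0[OF x] M by simp
        moreover have "\<bar>u x\<bar> \<le> B" using u xD by blast
        ultimately show "w x \<le> B + \<bar>\<psi> p\<bar>" using \<epsilon> unfolding w_def by linarith
        have "Lh h w x = Lh h u x - M * Lh h g x"
          unfolding w_def[abs_def] Lh_diff Lh_add Lc Lh_cmult by simp
        moreover have "\<bar>Lh h g x - limit_op g x\<bar> \<le> 1 / 2" using gh xD(2) by blast
        then have "Lh h g x \<le> - (1/2)" using LLg[OF xD(3)] by linarith
        then have "M * Lh h g x \<le> M * - (1/2)" using M by (intro mult_left_mono) auto
        then have "M * Lh h g x \<le> - (M / 2)" by simp
        moreover have "\<bar>Lh h u x\<bar> \<le> F" using u xD by blast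
        then have "- F \<le> Lh h u x" by linarith
        moreover have "F + 1 \<le> M / 2" using M(1) by simp
        ultimately have "1 \<le> Lh h w x" by linarith
        then show "1 \<le> Lh h w x + 0 * w x" by simp
      qed (use hh Bp S xG in auto)
      moreover have "dist (g x0) (g p) < \<epsilon> / (2 * M)" using x0 by (intro d3) (auto simp: \<delta>_def dist_commute)
      then have "g x0 \<le> \<epsilon> / (2 * M)" using g(2) by (simp add: dist_real_def abs_less_iff)
      then have "M * g x0 \<le> M * (\<epsilon> / (2 * M))" using M by (intro mult_left_mono) auto
      then have "M * g x0 \<le> \<epsilon> / 2" using M by simp
      ultimately show "u x0 \<le> \<psi> p + \<epsilon>" unfolding w_def by linarith
    qed
  qed
qed

text \<open>The upper bound is used for \<open>u\<close> and, by linearity, for \<open>- u\<close>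
  with data \<open>- \<psi>\<close>, and made uniform over the frontier by compactness. A point of
  \<open>D\<close> whose \<open>\<delta>\<close>-ball leaves \<open>D\<close> is within
  \<open>\<delta>\<close> of the frontier because balls are connected.\<close>

lemma boundary_estimate:
  fixes \<psi> :: "'a \<Rightarrow> real"
  assumes \<psi>: "continuous_on UNIV \<psi>" and \<epsilon>: "0 < \<epsilon>"
  shows "\<exists>\<delta>>0. \<forall>\<^sub>F h in at_right 0. \<forall>u. (\<forall>x. x \<notin> D \<longrightarrow> u x = \<psi> x) \<and>
     (\<forall>x\<in>D. \<bar>Lh h u x\<bar> \<le> F \<and> \<bar>u x\<bar> \<le> B) \<longrightarrow> (\<forall>x. \<not> ball x \<delta> \<subseteq> D \<longrightarrow> \<bar>u x - \<psi> x\<bar> \<le> \<epsilon>)"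
proof -
  have cont: "isCont \<psi> p" for p using \<psi> continuous_on_eq_continuous_at by blast
  have \<epsilon>2: "0 < \<epsilon> / 2" using \<epsilon> by simp
  have "\<exists>\<delta>>0. (\<forall>x. dist x p < \<delta> \<longrightarrow> \<bar>\<psi> x - \<psi> p\<bar> \<le> \<epsilon> / 2) \<and>
     (\<forall>\<^sub>F h in at_right 0. \<forall>u. (\<forall>x. x \<notin> D \<longrightarrow> u x = \<psi> x) \<and>
     (\<forall>x\<in>D. \<bar>Lh h u x\<bar> \<le> F \<and> \<bar>u x\<bar> \<le> B) \<longrightarrow> (\<forall>x\<in>D \<inter> ball p \<delta>. \<bar>u x - \<psi> p\<bar> \<le> \<epsilon> / 2))"
    if p: "p \<in> frontier D" for p
  proof -
    obtain d1 where d1: "0 < d1" and e1: "\<forall>\<^sub>F h in at_right 0. \<forall>u. (\<forall>x. x \<notin> D \<longrightarrow> u x = \<psi> x) \<and>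
     (\<forall>x\<in>D. \<bar>Lh h u x\<bar> \<le> F \<and> \<bar>u x\<bar> \<le> B) \<longrightarrow> (\<forall>x\<in>D \<inter> ball p d1. u x \<le> \<psi> p + \<epsilon> / 2)"
      using boundary_upper[OF p cont \<epsilon>2] by blast
    have cm: "isCont (\<lambda>x. - \<psi> x) p" by (intro isCont_minus cont)
    obtain d2 where d2: "0 < d2" and e2: "\<forall>\<^sub>F h in at_right 0. \<forall>u. (\<forall>x. x \<notin> D \<longrightarrow> u x = - \<psi> x) \<and>
     (\<forall>x\<in>D. \<bar>Lh h u x\<bar> \<le> F \<and> \<bar>u x\<bar> \<le> B) \<longrightarrow> (\<forall>x\<in>D \<inter> ball p d2. u x \<le> - \<psi> p + \<epsilon> / 2)"
      using boundary_upper[OF p cm \<epsilon>2] by blast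
    obtain d3 where d3: "0 < d3" "\<And>x. dist x p < d3 \<Longrightarrow> dist (\<psi> x) (\<psi> p) < \<epsilon> / 2"
      using cont[of p] \<epsilon>2 unfolding continuous_at_eps_delta by blast
    let ?d = "min d1 (min d2 d3)"
    show ?thesis
    proof (intro exI[of _ ?d] conjI allI impI)
      show "0 < ?d" using d1 d2 d3 by simp
      show "\<bar>\<psi> x - \<psi> p\<bar> \<le> \<epsilon> / 2" if "dist x p < ?d" for x using d3(2)[of x] that by (simp add: dist_real_def)
      show "\<forall>\<^sub>F h in at_right 0. \<forall>u. (\<forall>x. x \<notin> D \<longrightarrow> u x = \<psi> x) \<and>
     (\<forall>x\<in>D. \<bar>Lh h u x\<bar> \<le> F \<and> \<bar>u x\<bar> \<le> B) \<longrightarrow> (\<forall>x\<in>D \<inter> ball p ?d. \<bar>u x - \<psi> p\<bar> \<le> \<epsilon> / 2)"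
        using e1 e2
      proof (eventually_elim, intro allI impI ballI)
        fix h u x
        assume H1: "\<forall>u. (\<forall>x. x \<notin> D \<longrightarrow> u x = \<psi> x) \<and>
     (\<forall>x\<in>D. \<bar>Lh h u x\<bar> \<le> F \<and> \<bar>u x\<bar> \<le> B) \<longrightarrow> (\<forall>x\<in>D \<inter> ball p d1. u x \<le> \<psi> p + \<epsilon> / 2)"
          and H2: "\<forall>u. (\<forall>x. x \<notin> D \<longrightarrow> u x = - \<psi> x) \<and>
     (\<forall>x\<in>D. \<bar>Lh h u x\<bar> \<le> F \<and> \<bar>u x\<bar> \<le> B) \<longrightarrow> (\<forall>x\<in>D \<inter> ball p d2. u x \<le> - \<psi> p + \<epsilon> / 2)"
          and u: "(\<forall>x. x \<notin> D \<longrightarrow> u x = \<psi> x) \<and> (\<forall>x\<in>D. \<bar>Lh h u x\<bar> \<le> F \<and> \<bar>u x\<bar> \<le> B)"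
          and x: "x \<in> D \<inter> ball p ?d"
        have Lm: "Lh h (\<lambda>x. - u x) y = - Lh h u y" for y
          using Lh_cmult[of h "-1" u y] by simp
        have um: "(\<forall>x. x \<notin> D \<longrightarrow> - u x = - \<psi> x) \<and> (\<forall>x\<in>D. \<bar>Lh h (\<lambda>x. - u x) x\<bar> \<le> F \<and> \<bar>- u x\<bar> \<le> B)"
          unfolding Lm using u by simp
        have "u x \<le> \<psi> p + \<epsilon> / 2" using H1[THEN spec, THEN mp, OF u] x by auto
        moreover have "- u x \<le> - \<psi> p + \<epsilon> / 2"
          using H2[THEN spec, of "\<lambda>x. - u x", THEN mp, OF um] x by auto
        ultimately show "\<bar>u x - \<psi> p\<bar> \<le> \<epsilon> / 2" by linarith
      qed
    qed
  qed
  then have "\<forall>p\<in>frontier D. \<exists>\<delta>. 0 < \<delta> \<and> (\<forall>x. dist x p < \<delta> \<longrightarrow> \<bar>\<psi> x - \<psi> p\<bar> \<le> \<epsilon> / 2) \<and>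
     (\<forall>\<^sub>F h in at_right 0. \<forall>u. (\<forall>x. x \<notin> D \<longrightarrow> u x = \<psi> x) \<and>
     (\<forall>x\<in>D. \<bar>Lh h u x\<bar> \<le> F \<and> \<bar>u x\<bar> \<le> B) \<longrightarrow> (\<forall>x\<in>D \<inter> ball p \<delta>. \<bar>u x - \<psi> p\<bar> \<le> \<epsilon> / 2))"
    by (intro ballI)
  from bchoice[OF this] obtain d where d0: "\<forall>p\<in>frontier D. 0 < d p \<and> (\<forall>x. dist x p < d p \<longrightarrow> \<bar>\<psi> x - \<psi> p\<bar> \<le> \<epsilon> / 2) \<and>
     (\<forall>\<^sub>F h in at_right 0. \<forall>u. (\<forall>x. x \<notin> D \<longrightarrow> u x = \<psi> x) \<and>
     (\<forall>x\<in>D. \<bar>Lh h u x\<bar> \<le> F \<and> \<bar>u x\<bar> \<le> B) \<longrightarrow> (\<forall>x\<in>D \<inter> ball p (d p). \<bar>u x - \<psi> p\<bar> \<le> \<epsilon> / 2))" ..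
  have d: "0 < d p" "\<And>x. dist x p < d p \<Longrightarrow> \<bar>\<psi> x - \<psi> p\<bar> \<le> \<epsilon> / 2"
     "\<forall>\<^sub>F h in at_right 0. \<forall>u. (\<forall>x. x \<notin> D \<longrightarrow> u x = \<psi> x) \<and>
     (\<forall>x\<in>D. \<bar>Lh h u x\<bar> \<le> F \<and> \<bar>u x\<bar> \<le> B) \<longrightarrow> (\<forall>x\<in>D \<inter> ball p (d p). \<bar>u x - \<psi> p\<bar> \<le> \<epsilon> / 2)"
    if p: "p \<in> frontier D" for p
    using d0[rule_format, OF p] by (simp_all only: HOL.simp_thms)
  have comp: "compact (frontier D)" using D_bdd by (simp add: compact_frontier_bounded)
  have cover: "frontier D \<subseteq> (\<Union>p\<in>frontier D. ball p (d p / 2))" using d(1) by force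
  obtain P where P: "P \<subseteq> frontier D" "finite P" "frontier D \<subseteq> (\<Union>p\<in>P. ball p (d p / 2))"
    by (rule compactE_image[OF comp _ cover]) auto
  define \<delta> where "\<delta> = Min (insert 1 ((\<lambda>p. d p / 2) ` P))"
  have \<delta>: "0 < \<delta>" "\<And>p. p \<in> P \<Longrightarrow> \<delta> \<le> d p / 2"
  proof -
    show "0 < \<delta>" using P d(1) by (auto simp: \<delta>_def)
    show "\<delta> \<le> d p / 2" if "p \<in> P" for p unfolding \<delta>_def using P(2) that by (intro Min_le) auto
  qed
  have ev: "\<forall>\<^sub>F h in at_right 0. \<forall>p\<in>P. \<forall>u. (\<forall>x. x \<notin> D \<longrightarrow> u x = \<psi> x) \<and>
     (\<forall>x\<in>D. \<bar>Lh h u x\<bar> \<le> F \<and> \<bar>u x\<bar> \<le> B) \<longrightarrow> (\<forall>x\<in>D \<inter> ball p (d p). \<bar>u x - \<psi> p\<bar> \<le> \<epsilon> / 2)"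
    by (rule eventually_ball_finite[OF P(2)]) (use d(3) P(1) in blast)
  show ?thesis
  proof (intro exI[of _ \<delta>] conjI \<delta>)
    show "\<forall>\<^sub>F h in at_right 0. \<forall>u. (\<forall>x. x \<notin> D \<longrightarrow> u x = \<psi> x) \<and>
     (\<forall>x\<in>D. \<bar>Lh h u x\<bar> \<le> F \<and> \<bar>u x\<bar> \<le> B) \<longrightarrow> (\<forall>x. \<not> ball x \<delta> \<subseteq> D \<longrightarrow> \<bar>u x - \<psi> x\<bar> \<le> \<epsilon>)"
      using ev
    proof (eventually_elim, intro allI impI)
      fix h u x
      assume H: "\<forall>p\<in>P. \<forall>u. (\<forall>x. x \<notin> D \<longrightarrow> u x = \<psi> x) \<and>
     (\<forall>x\<in>D. \<bar>Lh h u x\<bar> \<le> F \<and> \<bar>u x\<bar> \<le> B) \<longrightarrow> (\<forall>x\<in>D \<inter> ball p (d p). \<bar>u x - \<psi> p\<bar> \<le> \<epsilon> / 2)"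
        and u: "(\<forall>x. x \<notin> D \<longrightarrow> u x = \<psi> x) \<and> (\<forall>x\<in>D. \<bar>Lh h u x\<bar> \<le> F \<and> \<bar>u x\<bar> \<le> B)"
        and nb: "\<not> ball x \<delta> \<subseteq> D"
      show "\<bar>u x - \<psi> x\<bar> \<le> \<epsilon>"
      proof (cases "x \<in> D")
        case True
        have "ball x \<delta> \<inter> D \<noteq> {}" "ball x \<delta> - D \<noteq> {}" using centre_in_ball[of x \<delta>] True \<delta>(1) nb by blast+
        then have "ball x \<delta> \<inter> frontier D \<noteq> {}" by (intro connected_Int_frontier) auto
        then obtain p' where p': "p' \<in> frontier D" "dist x p' < \<delta>" by auto
        then obtain p where p: "p \<in> P" "dist p p' < d p / 2" using P(3) by auto
        have "dist x p < d p" using dist_triangle[of x p p'] p'(2) \<delta>(2)[OF p(1)] p(2) by (simp add: dist_commute)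
        then have xp: "x \<in> D \<inter> ball p (d p)" "dist x p < d p" using True by (auto simp: dist_commute)
        have "\<bar>u x - \<psi> p\<bar> \<le> \<epsilon> / 2" using H[THEN bspec, OF p(1), THEN spec, THEN mp, OF u] xp(1) by blast
        moreover have "\<bar>\<psi> x - \<psi> p\<bar> \<le> \<epsilon> / 2" using d(2) P(1) p(1) xp(2) by blast
        ultimately show ?thesis by linarith
      next
        case False
        then show ?thesis using u \<epsilon> by auto
      qed
    qed
  qed
qed

text \<open>Adapts \<open>interior_estimate\<close> to an equation that holds on \<open>D\<close>
  only. At most three differences are taken, so at points of the ball of radius
  \<open>3 * r / 4\<close> they see the equation only within \<open>ball z r\<close>, provided that
  \<open>h * \<rho> * 3 < r / 4\<close>.\<close>

lemma interior_estimate_D: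
  assumes q: "Ck_on 3 UNIV q" and k: "k \<le> 3" and r: "0 < r"
  shows "\<exists>C\<ge>0. \<forall>\<^sub>F h in at_right 0. \<forall>z u f S. ball z r \<subseteq> D \<and> 0 < S \<and>
     (\<forall>x\<in>D. Lh h u x + q x * u x = f x \<and> (u x)\<^sup>2 \<le> S \<and>
        (\<forall>j\<le>k. (\<Sum>\<alpha>\<in>weq \<Lambda> j. (fdiffs h \<alpha> f x)\<^sup>2) \<le> S)) \<longrightarrow>
     (\<forall>x\<in>ball z (r/2). \<forall>j\<le>k. energy h j u x \<le> C * S)"
proof -
  obtain \<rho> where \<rho>: "0 < \<rho>" "\<And>l. l \<in> \<Lambda> \<Longrightarrow> norm l \<le> \<rho>" using finite_norm_bound[OF fin] by blast
  obtain B1 where B1: "B1 > 0" "\<forall>x\<in>D. \<forall>h. 0 < h \<and> h \<le> 1 \<longrightarrow> (\<forall>\<alpha>\<in>wle \<Lambda> 3. \<forall>l\<in>\<Lambda>.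
     \<bar>fdiffs h \<alpha> (c l) x\<bar> \<le> B1 \<and> \<bar>fdiffs h \<alpha> (b l) x\<bar> \<le> B1)" using coef_bounds[OF D_bdd] by blast
  obtain B2 where B2: "B2 > 0" "\<forall>x\<in>D. \<forall>h. 0 < h \<and> h \<le> 1 \<longrightarrow> (\<forall>\<alpha>\<in>wle \<Lambda> 3. \<bar>fdiffs h \<alpha> q x\<bar> \<le> B2)"
    using fdiffs_bounded[OF q D_bdd fin] by blast
  have coef: "\<bar>fdiffs h \<gamma> (c l) x\<bar> \<le> max B1 B2 \<and> \<bar>fdiffs h \<gamma> (b l) x\<bar> \<le> max B1 B2 \<and> \<bar>fdiffs h \<gamma> q x\<bar> \<le> max B1 B2"
    if "0 < h" "h \<le> 1" "l \<in> \<Lambda>" "\<gamma> \<in> wle \<Lambda> 3" "x \<in> D" for h l \<gamma> x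
    using B1(2)[rule_format, of x h \<gamma> l] B2(2)[rule_format, of x h \<gamma>] that by auto
  have Bpos: "0 < max B1 B2" using B1 by simp
  have rr: "0 < r/2" "r/2 < 3*r/4" using r by auto
  have "\<exists>C\<ge>0. \<exists>h0>0. \<forall>h z u S. 0 < h \<and> h < h0 \<and> ball z (3*r/4) \<subseteq> D \<and> 0 < S \<and>
     (\<forall>x\<in>ball z (3*r/4). (u x)\<^sup>2 \<le> S \<and>
        (\<forall>j\<le>k. (\<Sum>\<alpha>\<in>weq \<Lambda> j. (fdiffs h \<alpha> (\<lambda>x. Lh h u x + q x * u x) x)\<^sup>2) \<le> S)) \<longrightarrow>
     (\<forall>x\<in>ball z (r/2). \<forall>j\<le>k. energy h j u x \<le> C * S)"
    by (rule interior_estimate[OF _ _ theta Lam_ne Bpos k rr], rule coef, assumption+, rule ell, assumption+)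
  then obtain C h0 where C: "C \<ge> 0" and h0: "h0 > 0" and I: "\<forall>h z u S. 0 < h \<and> h < h0 \<and> ball z (3*r/4) \<subseteq> D \<and> 0 < S \<and>
     (\<forall>x\<in>ball z (3*r/4). (u x)\<^sup>2 \<le> S \<and>
        (\<forall>j\<le>k. (\<Sum>\<alpha>\<in>weq \<Lambda> j. (fdiffs h \<alpha> (\<lambda>x. Lh h u x + q x * u x) x)\<^sup>2) \<le> S)) \<longrightarrow>
     (\<forall>x\<in>ball z (r/2). \<forall>j\<le>k. energy h j u x \<le> C * S)"
    by (elim exE conjE) (rule that)
  have local: "fdiffs h \<alpha> g x = fdiffs h \<alpha> f x"
    if h: "0 < h" and eq: "\<And>y. dist x y \<le> h * \<rho> * length \<alpha> \<Longrightarrow> g y = f y" and \<alpha>: "set \<alpha> \<subseteq> \<Lambda>" for h \<alpha> x and f g :: "'a \<Rightarrow> real"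
    using eq \<alpha>
  proof (induction \<alpha> arbitrary: x)
    case (Cons l \<alpha>)
    have l: "norm (h *\<^sub>R l) \<le> h * \<rho>" using Cons.prems(2) \<rho>(2) h by simp
    have "fdiffs h \<alpha> g (x + h *\<^sub>R l) = fdiffs h \<alpha> f (x + h *\<^sub>R l)"
    proof (rule Cons.IH)
      fix y assume "dist (x + h *\<^sub>R l) y \<le> h * \<rho> * real (length \<alpha>)"
      then have "dist x y \<le> h * \<rho> * real (length (l # \<alpha>))"
        using dist_triangle[of x y "x + h *\<^sub>R l"] l by (simp add: dist_norm algebra_simps)
      then show "g y = f y" by (rule Cons.prems(1))
    qed (use Cons.prems in auto)
    moreover have "fdiffs h \<alpha> g x = fdiffs h \<alpha> f x"
    proof (rule Cons.IH)
      fix y assume "dist x y \<le> h * \<rho> * real (length \<alpha>)"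
      moreover have "0 \<le> h * \<rho>" using h \<rho> by simp
      ultimately have "dist x y \<le> h * \<rho> * real (length (l # \<alpha>))" by (simp add: algebra_simps)
      then show "g y = f y" by (rule Cons.prems(1))
    qed (use Cons.prems in auto)
    ultimately show ?case by (simp add: fdiffs_Cons fdiff_def)
  qed simp
  define h1 where "h1 = min h0 (r / (16 * \<rho>))"
  have h1: "0 < h1" using h0 r \<rho> by (simp add: h1_def)
  have main: "\<forall>x\<in>ball z (r/2). \<forall>j\<le>k. energy h j u x \<le> C * S"
    if h: "0 < h" "h < h1" and z: "ball z r \<subseteq> D" and S: "0 < S" and
     H: "\<forall>x\<in>D. Lh h u x + q x * u x = f x \<and> (u x)\<^sup>2 \<le> S \<and>
        (\<forall>j\<le>k. (\<Sum>\<alpha>\<in>weq \<Lambda> j. (fdiffs h \<alpha> f x)\<^sup>2) \<le> S)" for h z u f S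
  proof (rule I[THEN spec, THEN spec, THEN spec, THEN spec, THEN mp], intro conjI S h(1))
    show "h < h0" using h by (simp add: h1_def)
    have sub: "ball z (3*r/4) \<subseteq> ball z r" using r by auto
    then show "ball z (3*r/4) \<subseteq> D" using z by blast
    have hr: "h * \<rho> * 3 < r/4"
    proof -
      have "h < r / (16 * \<rho>)" using h by (simp add: h1_def)
      then have "16 * (h * \<rho>) < r" using \<rho> by (simp add: field_simps)
      moreover have "0 < h * \<rho>" using h \<rho> by simp
      ultimately show ?thesis by linarith
    qed
    show "\<forall>x\<in>ball z (3*r/4). (u x)\<^sup>2 \<le> S \<and>
        (\<forall>j\<le>k. (\<Sum>\<alpha>\<in>weq \<Lambda> j. (fdiffs h \<alpha> (\<lambda>x. Lh h u x + q x * u x) x)\<^sup>2) \<le> S)"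
    proof (intro ballI conjI allI impI)
      fix x assume x: "x \<in> ball z (3*r/4)"
      then have xD: "x \<in> D" using sub z by blast
      then show "(u x)\<^sup>2 \<le> S" using H by blast
      fix j assume j: "j \<le> k"
      have "(\<Sum>\<alpha>\<in>weq \<Lambda> j. (fdiffs h \<alpha> (\<lambda>x. Lh h u x + q x * u x) x)\<^sup>2) = (\<Sum>\<alpha>\<in>weq \<Lambda> j. (fdiffs h \<alpha> f x)\<^sup>2)"
      proof (rule sum.cong[OF refl], rule arg_cong[where f = "\<lambda>t. t\<^sup>2"], rule local[OF h(1)])
        fix \<alpha> assume \<alpha>: "\<alpha> \<in> weq \<Lambda> j"
        then show "set \<alpha> \<subseteq> \<Lambda>" by (simp add: weq_def)
        fix y assume y: "dist x y \<le> h * \<rho> * real (length \<alpha>)"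
        have "h * \<rho> * real (length \<alpha>) \<le> h * \<rho> * 3" using \<alpha> j k h \<rho> by (intro mult_left_mono) (auto simp: weq_def)
        then have "y \<in> ball z r" using x y hr dist_triangle[of z y x] by simp
        then show "Lh h u y + q y * u y = f y" using H z by blast
      qed
      also have "\<dots> \<le> S" using H xD j by blast
      finally show "(\<Sum>\<alpha>\<in>weq \<Lambda> j. (fdiffs h \<alpha> (\<lambda>x. Lh h u x + q x * u x) x)\<^sup>2) \<le> S" .
    qed
  qed
  show ?thesis
  proof (rule exI[of _ C], rule conjI[OF C], unfold eventually_at_right_field, rule exI[of _ h1], intro conjI h1 allI impI)
    fix h z u f S
    assume "0 < h" "h < h1" and "ball z r \<subseteq> D \<and> 0 < S \<and> (\<forall>x\<in>D. Lh h u x + q x * u x = f x \<and>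
        (u x)\<^sup>2 \<le> S \<and> (\<forall>j\<le>k. (\<Sum>\<alpha>\<in>weq \<Lambda> j. (fdiffs h \<alpha> f x)\<^sup>2) \<le> S))"
    then show "\<forall>x\<in>ball z (r/2). \<forall>j\<le>k. energy h j u x \<le> C * S"
      by (elim conjE) (rule main)
  qed
qed

end

section \<open>The discrete Dirichlet problem\<close>

text \<open>\<open>S\<close> and its bounds are parameters rather than obtained inside, because the
  condition \<open>q_small\<close>, and with it the range of \<open>\<alpha>\<close>, has to be
  expressed through \<open>Sm\<close> before the data are known.\<close>

locale dirichlet_problem = dirichlet_scheme \<Lambda> c b D \<theta>
  for \<Lambda> :: "'a::euclidean_space set" and c b :: "'a \<Rightarrow> 'a \<Rightarrow> real" and D :: "'a set" and \<theta> :: real +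
  fixes q f \<psi> S :: "'a \<Rightarrow> real" and s Sm Fb :: real
  assumes q_C3: "Ck_on 3 UNIV q" and f_C2: "Ck_on 2 UNIV f"
    and f_neg: "f x < 0" and f_bd: "- Fb \<le> f x"
    and psi_cont: "continuous_on UNIV \<psi>" and psi_pos: "0 < \<psi> x"
    and s_pos: "0 < s"
    and S_ev: "\<forall>\<^sub>F h in at_right 0. \<forall>x\<in>D. Lh h S x \<le> -1 \<and> s \<le> S x \<and> S x \<le> Sm \<and>
     (\<forall>l\<in>\<Lambda>. s \<le> S (x + h *\<^sub>R l))"
    and q_small: "x \<in> D \<Longrightarrow> \<bar>q x\<bar> * Sm \<le> 1 / 2"
begin

definition discrete_solution :: "real \<Rightarrow> ('a \<Rightarrow> real) \<Rightarrow> ('a \<Rightarrow> real) \<Rightarrow> bool" where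
  "discrete_solution h f0 u \<longleftrightarrow> (\<forall>x. x \<notin> D \<longrightarrow> u x = \<psi> x) \<and> (\<forall>x\<in>D. Lh h u x + q x * u x = f0 x)"

lemma Fb_pos: "0 < Fb"
  using f_neg f_bd by (metis neg_0_less_iff_less order.strict_trans1 minus_minus)

lemma h_pos_ev: "\<forall>\<^sub>F h in at_right (0::real). 0 < h \<and> h \<le> 1"
  unfolding eventually_at_right_field by (intro exI[of _ 1]) auto

lemma q_bound: "\<exists>Q>0. \<forall>x\<in>D. \<bar>q x\<bar> \<le> Q"
proof -
  obtain B where "B > 0" and B: "\<forall>x\<in>D. \<forall>h. 0 < h \<and> h \<le> 1 \<longrightarrow> (\<forall>\<alpha>\<in>wle \<Lambda> 3. \<bar>fdiffs h \<alpha> q x\<bar> \<le> B)"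
    using fdiffs_bounded[OF q_C3 D_bdd fin] by blast
  have "\<bar>q x\<bar> \<le> B" if "x \<in> D" for x
    using B[rule_format, OF that, of 1 "[]"] by (simp add: wle_def)
  then show ?thesis using \<open>B > 0\<close> by blast
qed

text \<open>Half of the slack in \<open>Lh h S x \<le> -1\<close> pays for the term
  \<open>q x * S x\<close>.\<close>

lemma S_super:
  "\<forall>\<^sub>F h in at_right 0. \<forall>x\<in>D. Lh h S x + q x * S x \<le> - (1/2) \<and> s \<le> S x \<and> S x \<le> Sm \<and>
     (\<forall>l\<in>\<Lambda>. s \<le> S (x + h *\<^sub>R l))"
  using S_ev
proof (eventually_elim, intro ballI)
  fix h x assume "\<forall>x\<in>D. Lh h S x \<le> -1 \<and> s \<le> S x \<and> S x \<le> Sm \<and> (\<forall>l\<in>\<Lambda>. s \<le> S (x + h *\<^sub>R l))" and x: "x \<in> D"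
  then have a: "Lh h S x \<le> -1" "s \<le> S x" "S x \<le> Sm" "\<forall>l\<in>\<Lambda>. s \<le> S (x + h *\<^sub>R l)" by blast+
  have "q x * S x \<le> \<bar>q x\<bar> * Sm"
    using a s_pos by (intro mult_mono) auto
  then have "Lh h S x + q x * S x \<le> - (1/2)" using a(1) q_small[OF x] by linarith
  then show "Lh h S x + q x * S x \<le> - (1/2) \<and> s \<le> S x \<and> S x \<le> Sm \<and> (\<forall>l\<in>\<Lambda>. s \<le> S (x + h *\<^sub>R l))"
    using a by blast
qed

text \<open>The right-hand side is kept variable because averaged data have to be solved for as
  well. For these \<open>\<kappa> = 0\<close> is taken, which admits any \<open>f0 \<le> 0\<close>
  above \<open>- Fb\<close>, whereas a positive \<open>\<kappa>\<close> is the source of the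
  positive lower bound. The upper bound \<open>B\<close> is common to all.\<close>

lemma exists_solution:
  "\<exists>B \<kappa>m. 0 < \<kappa>m \<and> (\<forall>\<^sub>F h in at_right 0. \<forall>f0 \<kappa>. (\<forall>x\<in>D. - Fb \<le> f0 x \<and> f0 x \<le> q x * \<kappa>) \<and> 0 \<le> \<kappa> \<and> \<kappa> \<le> \<kappa>m \<longrightarrow>
     (\<exists>u. discrete_solution h f0 u \<and> (\<forall>x\<in>D. \<kappa> \<le> u x \<and> u x \<le> B)))"
proof -
  obtain \<rho> where \<rho>: "0 < \<rho>" "\<And>l. l \<in> \<Lambda> \<Longrightarrow> norm l \<le> \<rho>" using finite_norm_bound[OF fin] by blast
  obtain R where R: "0 < R" "\<And>x. x \<in> D \<Longrightarrow> norm x \<le> R" using D_bdd bounded_pos by metis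
  obtain Q where Q: "0 < Q" "\<And>x. x \<in> D \<Longrightarrow> \<bar>q x\<bar> \<le> Q" using q_bound by blast
  obtain Bp where pwev: "\<forall>\<^sub>F h in at_right 0. \<forall>x\<in>D. \<forall>l\<in>\<Lambda>. \<theta> / 2 \<le> pw h l x \<and> pw h l x \<le> Bp"
    using pw_bounds by blast
  let ?N = "cball (0::'a) (R + \<rho>)"
  have cN: "compact ?N" "?N \<noteq> {}" using R(1) \<rho>(1) by auto
  have cont: "continuous_on ?N \<psi>" using psi_cont by (rule continuous_on_subset) simp
  obtain x1 where x1: "\<And>y. y \<in> ?N \<Longrightarrow> \<psi> x1 \<le> \<psi> y" using continuous_attains_inf[OF cN cont] by blast
  obtain x2 where x2: "\<And>y. y \<in> ?N \<Longrightarrow> \<psi> y \<le> \<psi> x2" using continuous_attains_sup[OF cN cont] by blast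
  define P where "P = max (\<psi> x1) (\<psi> x2)"
  \<comment> \<open>\<open>2 * Fb\<close> because \<open>S\<close> satisfies the inequality of the
    full operator with \<open>- (1/2)\<close>; \<open>P / s\<close> lifts \<open>M * S\<close> above
    the boundary data and above \<open>\<kappa>\<close>.\<close>
  define M where "M = max (2 * Fb) (P / s)"
  have M: "0 < M" "2 * Fb \<le> M" "P \<le> M * s"
  proof -
    show "2 * Fb \<le> M" by (simp add: M_def)
    then show "0 < M" using Fb_pos by linarith
    have "P / s \<le> M" by (simp add: M_def)
    then show "P \<le> M * s" using s_pos by (simp add: field_simps)
  qed
  \<comment> \<open>Makes the diagonal of the Jacobi iteration positive: the weights add up to at
    least \<open>\<theta> / 2\<close>, while \<open>h\<^sup>2 * q x \<le> h * Q\<close>.\<close>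
  have hq: "\<forall>\<^sub>F h in at_right (0::real). h * Q < \<theta> / 2"
  proof -
    have "0 < \<theta> / (2 * Q)" using Q theta by simp
    moreover have "h * Q < \<theta> / 2" if "h < \<theta> / (2 * Q)" for h
      using that Q by (simp add: field_simps)
    ultimately show ?thesis unfolding eventually_at_right_field by blast
  qed
  show ?thesis
  proof (rule exI[of _ "M * Sm"], rule exI[of _ "\<psi> x1"], rule conjI[OF psi_pos])
    show "\<forall>\<^sub>F h in at_right 0. \<forall>f0 \<kappa>. (\<forall>x\<in>D. - Fb \<le> f0 x \<and> f0 x \<le> q x * \<kappa>) \<and> 0 \<le> \<kappa> \<and> \<kappa> \<le> \<psi> x1 \<longrightarrow>
     (\<exists>u. discrete_solution h f0 u \<and> (\<forall>x\<in>D. \<kappa> \<le> u x \<and> u x \<le> M * Sm))"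
      using S_super pwev hq h_pos_ev
    proof (eventually_elim, intro allI impI)
      fix h f0 \<kappa>
      assume Sh: "\<forall>x\<in>D. Lh h S x + q x * S x \<le> - (1/2) \<and> s \<le> S x \<and> S x \<le> Sm \<and> (\<forall>l\<in>\<Lambda>. s \<le> S (x + h *\<^sub>R l))"
        and pwh: "\<forall>x\<in>D. \<forall>l\<in>\<Lambda>. \<theta> / 2 \<le> pw h l x \<and> pw h l x \<le> Bp"
        and hq: "h * Q < \<theta> / 2" and h: "0 < h \<and> h \<le> 1"
        and f0: "(\<forall>x\<in>D. - Fb \<le> f0 x \<and> f0 x \<le> q x * \<kappa>) \<and> 0 \<le> \<kappa> \<and> \<kappa> \<le> \<psi> x1"
      have \<kappa>P: "\<kappa> \<le> P" using f0 unfolding P_def by (intro max.coboundedI1) blast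
      have "\<exists>u. (\<forall>x. x \<notin> D \<longrightarrow> u x = \<psi> x) \<and>
        (\<forall>x\<in>D. Lh h u x + q x * u x = f0 x \<and> \<kappa> \<le> u x \<and> u x \<le> M * S x)"
      proof (rule discrete_existence)
        show "0 < h" using h by simp
      next
        fix x assume x: "x \<in> D"
        have "\<theta> / 2 \<le> (\<Sum>l\<in>\<Lambda>. pw h l x)"
        proof -
          obtain l0 where l0: "l0 \<in> \<Lambda>" using Lam_ne by blast
          have "\<theta> / 2 \<le> pw h l0 x" using pwh x l0 by blast
          also have "\<dots> \<le> (\<Sum>l\<in>\<Lambda>. pw h l x)"
          proof (rule member_le_sum[OF l0 _ fin])
            fix l assume "l \<in> \<Lambda> - {l0}"
            then have "\<theta> / 2 \<le> pw h l x" using pwh x by blast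
            then show "0 \<le> pw h l x" using theta by linarith
          qed
          finally show ?thesis .
        qed
        moreover have "h\<^sup>2 * q x \<le> h * Q"
        proof -
          have "h * \<bar>q x\<bar> \<le> 1 * Q" using h Q(2)[OF x] by (intro mult_mono) auto
          then have "h * (h * \<bar>q x\<bar>) \<le> h * Q" using h by (intro mult_left_mono) auto
          moreover have "h * (h * q x) \<le> h * (h * \<bar>q x\<bar>)" using h by (intro mult_left_mono) auto
          ultimately show ?thesis by (simp add: power2_eq_square)
        qed
        ultimately show "0 < (\<Sum>l\<in>\<Lambda>. pw h l x) - h\<^sup>2 * q x" using hq by linarith
        show "f0 x \<le> q x * \<kappa>" using f0 x by blast
        have "M * (Lh h S x + q x * S x) \<le> M * (- (1/2))" using Sh x M by (intro mult_left_mono) auto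
        moreover have "Lh h (\<lambda>x. M * S x) x + q x * (M * S x) = M * (Lh h S x + q x * S x)"
          unfolding Lh_cmult by (simp add: algebra_simps)
        moreover have "- Fb \<le> f0 x" using f0 x by blast
        ultimately show "Lh h (\<lambda>x. M * S x) x + q x * (M * S x) \<le> f0 x" using M(2) by simp
        have "M * s \<le> M * S x" using Sh x M by (intro mult_left_mono) auto
        then show "\<kappa> \<le> M * S x" using \<kappa>P M(3) by linarith
      next
        fix x l assume x: "x \<in> D" and l: "l \<in> \<Lambda>"
        have "\<theta> / 2 \<le> pw h l x" using pwh x l by blast
        then show "0 \<le> pw h l x" using theta by linarith
        assume "x + h *\<^sub>R l \<notin> D"
        have "norm (h *\<^sub>R l) \<le> 1 * \<rho>" using mult_mono[of h 1 "norm l" \<rho>] h \<rho>(2)[OF l] by simp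
        then have "norm (x + h *\<^sub>R l) \<le> R + \<rho>" using R(2)[OF x] norm_triangle_ineq[of x "h *\<^sub>R l"] by linarith
        then have N: "x + h *\<^sub>R l \<in> ?N" by (simp only: mem_cball_0)
        have "M * s \<le> M * S (x + h *\<^sub>R l)" using Sh x l M by (intro mult_left_mono) auto
        moreover have "\<psi> (x + h *\<^sub>R l) \<le> P" using x2[OF N] by (simp add: P_def)
        ultimately show "\<kappa> \<le> \<psi> (x + h *\<^sub>R l) \<and> \<psi> (x + h *\<^sub>R l) \<le> M * S (x + h *\<^sub>R l)"
          using f0 x1[OF N] M(3) by auto
      qed
      then obtain u where u: "\<forall>x. x \<notin> D \<longrightarrow> u x = \<psi> x"
          "\<forall>x\<in>D. Lh h u x + q x * u x = f0 x \<and> \<kappa> \<le> u x \<and> u x \<le> M * S x" by blast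
      have "u x \<le> M * Sm" if x: "x \<in> D" for x
      proof -
        have "M * S x \<le> M * Sm" using Sh x M by (intro mult_left_mono) auto
        then show ?thesis using u(2) x by force
      qed
      then show "\<exists>u. discrete_solution h f0 u \<and> (\<forall>x\<in>D. \<kappa> \<le> u x \<and> u x \<le> M * Sm)"
        using u unfolding discrete_solution_def by (intro exI[of _ u]) blast
    qed
  qed
qed

text \<open>Stability in the maximum norm: \<open>w\<close> and \<open>- w\<close> are compared with
  \<open>t * S\<close>, where \<open>t = 4 * \<epsilon> + m / s\<close>. The supersolution
  contributes at least \<open>2 * \<epsilon>\<close>, which leaves the strict margin
  \<open>\<epsilon>\<close> demanded by \<open>comparison\<close>, and \<open>m / s\<close> covers
  the values outside \<open>G\<close>. The bound \<open>W\<close> makes the supremum finite and does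
  not enter the estimate.\<close>

lemma difference_bound:
  "\<forall>\<^sub>F h in at_right 0. \<forall>G w \<epsilon> m W. G \<subseteq> D \<and> 0 < \<epsilon> \<and> 0 \<le> m \<and>
    (\<forall>x\<in>G. \<bar>Lh h w x + q x * w x\<bar> \<le> \<epsilon> \<and> \<bar>w x\<bar> \<le> W) \<and>
    (\<forall>x\<in>G. \<forall>l\<in>\<Lambda>. x + h *\<^sub>R l \<notin> G \<longrightarrow> \<bar>w (x + h *\<^sub>R l)\<bar> \<le> m) \<longrightarrow>
    (\<forall>x\<in>G. \<bar>w x\<bar> \<le> (4 * \<epsilon> + m / s) * Sm)"
proof -
  obtain Q where Q: "0 < Q" "\<And>x. x \<in> D \<Longrightarrow> \<bar>q x\<bar> \<le> Q" using q_bound by blast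
  obtain Bp where Bp: "0 < Bp" and pwev: "\<forall>\<^sub>F h in at_right 0. \<forall>x\<in>D. \<forall>l\<in>\<Lambda>. \<theta> / 2 \<le> pw h l x \<and> pw h l x \<le> Bp"
    using pw_bounds by blast
  show ?thesis
    using S_super pwev h_pos_ev
  proof (eventually_elim, intro allI impI)
    fix h and G :: "'a set" and w and \<epsilon> m W :: real
    assume Sh: "\<forall>x\<in>D. Lh h S x + q x * S x \<le> - (1/2) \<and> s \<le> S x \<and> S x \<le> Sm \<and> (\<forall>l\<in>\<Lambda>. s \<le> S (x + h *\<^sub>R l))"
      and pwh: "\<forall>x\<in>D. \<forall>l\<in>\<Lambda>. \<theta> / 2 \<le> pw h l x \<and> pw h l x \<le> Bp" and h: "0 < h \<and> h \<le> 1"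
      and asm: "G \<subseteq> D \<and> 0 < \<epsilon> \<and> 0 \<le> m \<and>
       (\<forall>x\<in>G. \<bar>Lh h w x + q x * w x\<bar> \<le> \<epsilon> \<and> \<bar>w x\<bar> \<le> W) \<and>
       (\<forall>x\<in>G. \<forall>l\<in>\<Lambda>. x + h *\<^sub>R l \<notin> G \<longrightarrow> \<bar>w (x + h *\<^sub>R l)\<bar> \<le> m)"
    have GD: "x \<in> D" if "x \<in> G" for x using asm that by blast
    have e: "0 < \<epsilon>" "0 \<le> m" using asm by auto
    define t where "t = 4 * \<epsilon> + m / s"
    have t: "0 < t" "4 * \<epsilon> \<le> t" "m \<le> t * s"
    proof -
      have "0 \<le> m / s" using e s_pos by simp
      then show "0 < t" "4 * \<epsilon> \<le> t" using e by (auto simp: t_def)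
      show "m \<le> t * s" using s_pos e by (simp add: t_def distrib_right)
    qed
    have half: "v x \<le> t * Sm" if x: "x \<in> G" and
        v: "\<forall>x\<in>G. - \<epsilon> \<le> Lh h v x + q x * v x \<and> v x \<le> W"
          "\<forall>x\<in>G. \<forall>l\<in>\<Lambda>. x + h *\<^sub>R l \<notin> G \<longrightarrow> v (x + h *\<^sub>R l) \<le> m" for v x
    proof -
      have "v x - t * S x \<le> 0"
      proof (rule comparison[of h \<epsilon> Q Bp s G q S Sm "\<lambda>x. v x - t * S x" W])
        fix y l assume y: "y \<in> G" and l: "l \<in> \<Lambda>"
        have "\<theta> / 2 \<le> pw h l y" "pw h l y \<le> Bp" using pwh GD[OF y] l by blast+
        then show "0 \<le> pw h l y \<and> pw h l y \<le> Bp" using theta by linarith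
        have sl: "s \<le> S (y + h *\<^sub>R l)" using Sh GD[OF y] l by blast
        then show "0 \<le> S (y + h *\<^sub>R l)" using s_pos by linarith
        assume "y + h *\<^sub>R l \<notin> G"
        then have "v (y + h *\<^sub>R l) \<le> m" using v y l by blast
        moreover have "t * s \<le> t * S (y + h *\<^sub>R l)" using sl t by (intro mult_left_mono) auto
        ultimately show "v (y + h *\<^sub>R l) - t * S (y + h *\<^sub>R l) \<le> 0" using t by linarith
      next
        fix y assume y: "y \<in> G"
        have Sy: "Lh h S y + q y * S y \<le> - (1/2)" "s \<le> S y" "S y \<le> Sm" using Sh GD[OF y] by blast+
        show "\<bar>q y\<bar> \<le> Q" using Q(2) GD[OF y] by blast
        show "s \<le> S y \<and> S y \<le> Sm" using Sy by blast
        show "Lh h S y + q y * S y \<le> 0" using Sy by linarith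
        have "0 \<le> t * S y" using t Sy s_pos by simp
        moreover have "v y \<le> W" using v y by blast
        ultimately show "v y - t * S y \<le> W" by linarith
        have "t * (Lh h S y + q y * S y) \<le> t * (- (1/2))" using Sy t by (intro mult_left_mono) auto
        moreover have "Lh h (\<lambda>x. v x - t * S x) y + q y * (v y - t * S y)
            = (Lh h v y + q y * v y) - t * (Lh h S y + q y * S y)"
          unfolding Lh_diff Lh_cmult by (simp add: algebra_simps)
        moreover have "- \<epsilon> \<le> Lh h v y + q y * v y" using v y by blast
        ultimately show "\<epsilon> \<le> Lh h (\<lambda>x. v x - t * S x) y + q y * (v y - t * S y)" using t(2) by simp
      qed (use h e Q Bp s_pos x in auto)
      moreover have "t * S x \<le> t * Sm" using Sh GD[OF x] t by (intro mult_left_mono) auto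
      ultimately show ?thesis by linarith
    qed
    show "\<forall>x\<in>G. \<bar>w x\<bar> \<le> (4 * \<epsilon> + m / s) * Sm"
    proof
      fix x assume x: "x \<in> G"
      have w1: "\<bar>Lh h w x + q x * w x\<bar> \<le> \<epsilon>" "\<bar>w x\<bar> \<le> W" if "x \<in> G" for x using asm that by blast+
      have w2: "\<bar>w (x + h *\<^sub>R l)\<bar> \<le> m" if "x \<in> G" "l \<in> \<Lambda>" "x + h *\<^sub>R l \<notin> G" for x l using asm that by blast
      have "w x \<le> t * Sm"
      proof (rule half[OF x], intro ballI conjI)
        fix y assume "y \<in> G"
        then show "- \<epsilon> \<le> Lh h w y + q y * w y" "w y \<le> W" using w1[of y] by linarith+
      qed (use w2 in force)
      moreover have "- w x \<le> t * Sm"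
      proof (rule half[OF x, of "\<lambda>x. - w x"], intro ballI conjI)
        fix y assume "y \<in> G"
        moreover have "Lh h (\<lambda>x. - w x) y = - Lh h w y" using Lh_cmult[of h "-1" w y] by simp
        ultimately show "- \<epsilon> \<le> Lh h (\<lambda>x. - w x) y + q y * (- w y)" "- w y \<le> W" using w1[of y] by auto
      qed (use w2 in force)
      ultimately show "\<bar>w x\<bar> \<le> (4 * \<epsilon> + m / s) * Sm" unfolding t_def by linarith
    qed
  qed
qed

lemma discrete_solution_boundary:
  assumes \<epsilon>: "0 < \<epsilon>"
  shows "\<exists>\<delta>>0. \<forall>\<^sub>F h in at_right 0. \<forall>u f0. discrete_solution h f0 u \<and> (\<forall>x\<in>D. \<bar>f0 x\<bar> \<le> Fb \<and> \<bar>u x\<bar> \<le> B) \<longrightarrow>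
     (\<forall>x. \<not> ball x \<delta> \<subseteq> D \<longrightarrow> \<bar>u x - \<psi> x\<bar> \<le> \<epsilon>)"
proof -
  obtain Q where Q: "0 < Q" "\<And>x. x \<in> D \<Longrightarrow> \<bar>q x\<bar> \<le> Q" using q_bound by blast
  obtain \<delta> where \<delta>: "0 < \<delta>" and ev: "\<forall>\<^sub>F h in at_right 0. \<forall>u. (\<forall>x. x \<notin> D \<longrightarrow> u x = \<psi> x) \<and>
     (\<forall>x\<in>D. \<bar>Lh h u x\<bar> \<le> Fb + Q * B \<and> \<bar>u x\<bar> \<le> B) \<longrightarrow> (\<forall>x. \<not> ball x \<delta> \<subseteq> D \<longrightarrow> \<bar>u x - \<psi> x\<bar> \<le> \<epsilon>)"
    using boundary_estimate[OF psi_cont \<epsilon>] by blast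
  show ?thesis
  proof (rule exI[of _ \<delta>], rule conjI[OF \<delta>])
    show "\<forall>\<^sub>F h in at_right 0. \<forall>u f0. discrete_solution h f0 u \<and> (\<forall>x\<in>D. \<bar>f0 x\<bar> \<le> Fb \<and> \<bar>u x\<bar> \<le> B) \<longrightarrow>
     (\<forall>x. \<not> ball x \<delta> \<subseteq> D \<longrightarrow> \<bar>u x - \<psi> x\<bar> \<le> \<epsilon>)"
      using ev
    proof (rule eventually_mono, intro allI impI)
      fix h u f0 x
      assume H: "\<forall>u. (\<forall>x. x \<notin> D \<longrightarrow> u x = \<psi> x) \<and>
     (\<forall>x\<in>D. \<bar>Lh h u x\<bar> \<le> Fb + Q * B \<and> \<bar>u x\<bar> \<le> B) \<longrightarrow> (\<forall>x. \<not> ball x \<delta> \<subseteq> D \<longrightarrow> \<bar>u x - \<psi> x\<bar> \<le> \<epsilon>)"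
        and u: "discrete_solution h f0 u \<and> (\<forall>x\<in>D. \<bar>f0 x\<bar> \<le> Fb \<and> \<bar>u x\<bar> \<le> B)" and x: "\<not> ball x \<delta> \<subseteq> D"
      have "(\<forall>x. x \<notin> D \<longrightarrow> u x = \<psi> x) \<and> (\<forall>x\<in>D. \<bar>Lh h u x\<bar> \<le> Fb + Q * B \<and> \<bar>u x\<bar> \<le> B)"
      proof (intro conjI ballI allI impI)
        show "u x = \<psi> x" if "x \<notin> D" for x using u that unfolding discrete_solution_def by blast
        fix x assume x: "x \<in> D"
        then show uB: "\<bar>u x\<bar> \<le> B" using u by blast
        have "\<bar>q x * u x\<bar> \<le> Q * B" unfolding abs_mult using Q(2)[OF x] uB Q(1) by (intro mult_mono) auto
        moreover have "Lh h u x + q x * u x = f0 x" "\<bar>f0 x\<bar> \<le> Fb" using u x unfolding discrete_solution_def by blast+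
        ultimately show "\<bar>Lh h u x\<bar> \<le> Fb + Q * B" by linarith
      qed
      from H[THEN spec, THEN mp, OF this] x show "\<bar>u x - \<psi> x\<bar> \<le> \<epsilon>" by blast
    qed
  qed
qed

end

section \<open>Equicontinuity of second differences\<close>

text \<open>A discrete mollifier whose nodes are mesh steps, so that it commutes exactly with
  differences; \<open>avgs\<close> averages over a box spanned by all directions in the
  list.\<close>

definition avg :: "real \<Rightarrow> nat \<Rightarrow> 'a::real_normed_vector \<Rightarrow> ('a \<Rightarrow> real) \<Rightarrow> 'a \<Rightarrow> real" where
  "avg h N l f x = (\<Sum>j<N. f (x + (real j * h) *\<^sub>R l)) / real N"

definition avgs :: "real \<Rightarrow> nat \<Rightarrow> 'a::real_normed_vector list \<Rightarrow> ('a \<Rightarrow> real) \<Rightarrow> 'a \<Rightarrow> real" where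
  "avgs h N L = foldr (avg h N) L"

lemma avgs_Nil [simp]: "avgs h N [] f = f"
  by (simp add: avgs_def)

lemma avgs_Cons: "avgs h N (l # L) f = avg h N l (avgs h N L f)"
  by (simp add: avgs_def)

lemma fdiff_avg: "fdiff h m (avg h N l f) = avg h N l (fdiff h m f)"
proof
  fix x
  have "avg h N l (fdiff h m f) x = ((\<Sum>j<N. f (x + (real j * h) *\<^sub>R l + h *\<^sub>R m)) - (\<Sum>j<N. f (x + (real j * h) *\<^sub>R l))) / h / real N"
    unfolding avg_def fdiff_def sum_subtractf[symmetric] sum_divide_distrib ..
  also have "\<dots> = fdiff h m (avg h N l f) x"
    unfolding avg_def fdiff_def diff_divide_distrib by (simp add: algebra_simps)
  finally show "fdiff h m (avg h N l f) x = avg h N l (fdiff h m f) x" ..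
qed

lemma fdiff_avgs: "fdiff h m (avgs h N L f) = avgs h N L (fdiff h m f)"
  by (induction L) (simp_all add: avgs_Cons fdiff_avg)

lemma fdiffs_avgs: "fdiffs h \<alpha> (avgs h N L f) = avgs h N L (fdiffs h \<alpha> f)"
  by (induction \<alpha>) (simp_all add: fdiffs_Cons fdiff_avgs)

lemma avg_between:
  assumes N: "0 < N" and "\<And>j. j < N \<Longrightarrow> f (x + (real j * h) *\<^sub>R l) \<in> {lo..hi}"
  shows "avg h N l f x \<in> {lo..hi}"
proof -
  have "(\<Sum>j<N. lo) \<le> (\<Sum>j<N. f (x + (real j * h) *\<^sub>R l))" "(\<Sum>j<N. f (x + (real j * h) *\<^sub>R l)) \<le> (\<Sum>j<N. hi)"
    by (intro sum_mono; use assms(2) in force)+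
  then show ?thesis using N by (simp add: avg_def field_simps)
qed

lemma dist_step_le:
  fixes x y l :: "'a::real_normed_vector"
  assumes "0 \<le> a" "a \<le> h * real N" "norm l \<le> \<rho>" "dist (x + a *\<^sub>R l) y \<le> h * real N * \<rho> * real n"
  shows "dist x y \<le> h * real N * \<rho> * real (Suc n)"
proof -
  have "norm (a *\<^sub>R l) \<le> h * real N * \<rho>" using assms by (simp add: mult_mono)
  moreover have "dist x y \<le> norm (a *\<^sub>R l) + dist (x + a *\<^sub>R l) y"
    using dist_triangle[of x y "x + a *\<^sub>R l"] by (simp add: dist_norm)
  ultimately show ?thesis using assms(4) by (simp add: algebra_simps)
qed

lemma avgs_between:
  assumes N: "0 < N" and h: "0 \<le> h" and \<rho>: "\<And>l. l \<in> set L \<Longrightarrow> norm l \<le> \<rho>"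
    and f: "\<And>y. dist x y \<le> h * real N * \<rho> * real (length L) \<Longrightarrow> f y \<in> {lo..hi}"
  shows "avgs h N L f x \<in> {lo..hi}"
  using \<rho> f
proof (induction L arbitrary: x)
  case Nil
  then show ?case by simp
next
  case (Cons l L)
  show ?case unfolding avgs_Cons
  proof (rule avg_between[OF N], rule Cons.IH)
    fix j y assume j: "j < N" and y: "dist (x + (real j * h) *\<^sub>R l) y \<le> h * real N * \<rho> * real (length L)"
    have "dist x y \<le> h * real N * \<rho> * real (Suc (length L))"
      by (rule dist_step_le[OF _ _ _ y]) (use j h Cons.prems(1) in \<open>auto simp: mult.commute mult_left_mono\<close>)
    then show "f y \<in> {lo..hi}" using Cons.prems(2) by simp
  qed (use Cons.prems in auto)
qed

text \<open>In the average along \<open>l\<close> the difference telescopes to one increment over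
  \<open>N\<close> steps, divided by \<open>N * h\<close>; averaging in the other directions
  preserves the bound. One derivative is gained at the price of the inverse side length of the
  box.\<close>

lemma fdiff_avgs_bound:
  assumes N: "0 < N" and h: "0 < h" and \<rho>: "\<And>l. l \<in> set L \<Longrightarrow> norm l \<le> \<rho>" and l: "l \<in> set L"
    and f: "\<And>y. dist x y \<le> h * real N * \<rho> * real (length L) \<Longrightarrow> \<bar>f y\<bar> \<le> A"
  shows "\<bar>fdiff h l (avgs h N L f) x\<bar> \<le> 2 * A / (real N * h)"
  using \<rho> f l
proof (induction L arbitrary: x)
  case Nil
  then show ?case by simp
next
  case (Cons m L)
  show ?case
  proof (cases "l = m")
    case True
    let ?g = "avgs h N L f"
    have gb: "\<bar>?g (x + a *\<^sub>R l)\<bar> \<le> A" if a: "0 \<le> a" "a \<le> h * real N" for a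
    proof -
      have "?g (x + a *\<^sub>R l) \<in> {-A..A}"
      proof (rule avgs_between[OF N])
        fix y assume y: "dist (x + a *\<^sub>R l) y \<le> h * real N * \<rho> * real (length L)"
        have "dist x y \<le> h * real N * \<rho> * real (Suc (length L))"
          by (rule dist_step_le[OF a _ y]) (use Cons.prems(1) True in auto)
        then have "\<bar>f y\<bar> \<le> A" using Cons.prems(2) by simp
        then show "f y \<in> {-A..A}" by (simp add: abs_le_iff)
      qed (use h Cons.prems in auto)
      then show ?thesis by (simp add: abs_le_iff)
    qed
    have "fdiff h l (avg h N l ?g) x = (\<Sum>j<N. ?g (x + (real (Suc j) * h) *\<^sub>R l) - ?g (x + (real j * h) *\<^sub>R l)) / (real N * h)"
      unfolding fdiff_avg unfolding avg_def fdiff_def sum_divide_distrib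
      using h N by (intro sum.cong refl) (simp add: algebra_simps)
    also have "\<dots> = (?g (x + (real N * h) *\<^sub>R l) - ?g (x + (real 0 * h) *\<^sub>R l)) / (real N * h)"
      unfolding sum_lessThan_telescope[of "\<lambda>j. ?g (x + (real j * h) *\<^sub>R l)"] ..
    finally have e: "fdiff h l (avg h N l ?g) x = (?g (x + (real N * h) *\<^sub>R l) - ?g (x + 0 *\<^sub>R l)) / (real N * h)"
      by simp
    have "\<bar>?g (x + (real N * h) *\<^sub>R l) - ?g (x + 0 *\<^sub>R l)\<bar> \<le> 2 * A"
      using gb[of "real N * h"] gb[of 0] h by (simp add: mult.commute)
    then show ?thesis unfolding avgs_Cons True[symmetric] e abs_divide using h N
      by (simp add: divide_right_mono)
  next
    case False
    then have l: "l \<in> set L" using Cons.prems by simp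
    let ?A = "2 * A / (real N * h)"
    have "avg h N m (fdiff h l (avgs h N L f)) x \<in> {-?A..?A}"
    proof (rule avg_between[OF N])
      fix j assume j: "j < N"
      have "\<bar>fdiff h l (avgs h N L f) (x + (real j * h) *\<^sub>R m)\<bar> \<le> ?A"
      proof (rule Cons.IH[OF _ _ l])
        fix y assume y: "dist (x + (real j * h) *\<^sub>R m) y \<le> h * real N * \<rho> * real (length L)"
        have "dist x y \<le> h * real N * \<rho> * real (Suc (length L))"
          by (rule dist_step_le[OF _ _ _ y]) (use j h Cons.prems(1) in \<open>auto simp: mult.commute mult_left_mono\<close>)
        then show "\<bar>f y\<bar> \<le> A" using Cons.prems(2) by simp
      qed (use Cons.prems in auto)
      then show "fdiff h l (avgs h N L f) (x + (real j * h) *\<^sub>R m) \<in> {-?A..?A}" by (simp add: abs_le_iff)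
    qed
    then show ?thesis unfolding avgs_Cons fdiff_avg by (simp add: abs_le_iff)
  qed
qed

lemma uniform_modulus:
  fixes \<phi> :: "'a::euclidean_space \<Rightarrow> real"
  assumes \<phi>: "continuous_on UNIV \<phi>" and K: "bounded K" and \<epsilon>: "0 < \<epsilon>"
  shows "\<forall>\<^sub>F \<tau> in at_right 0. \<forall>x\<in>K. \<forall>t. norm t < \<tau> \<longrightarrow> \<bar>\<phi> (x + t) - \<phi> x\<bar> \<le> \<epsilon>"
proof -
  have "Ck_on 0 UNIV \<phi>" using \<phi> by simp
  from fdiffs_equicontinuous[OF this K finite.emptyI \<epsilon>]
  obtain \<delta> where \<delta>: "0 < \<delta>" "\<forall>x\<in>K. \<forall>h t. 0 < h \<and> h \<le> 1 \<and> norm t < \<delta> \<longrightarrow>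
    (\<forall>\<alpha>\<in>wle {} 0. \<bar>fdiffs h \<alpha> \<phi> (x + t) - fdiffs h \<alpha> \<phi> x\<bar> \<le> \<epsilon>)" by blast
  have "[] \<in> wle {} 0" by (simp add: wle_def)
  then have "\<bar>\<phi> (x + t) - \<phi> x\<bar> \<le> \<epsilon>" if "x \<in> K" "norm t < \<delta>" for x t
    using \<delta>(2)[rule_format, of x 1 t "[]"] that by simp
  then show ?thesis unfolding eventually_at_right_field using \<delta>(1) by (intro exI[of _ \<delta>]) force
qed

context diff_scheme
begin

lemma fdiffs_le_sqrt:
  assumes "\<alpha> \<in> weq \<Lambda> k" "energy h k u x \<le> H\<^sup>2" "0 \<le> H"
  shows "\<bar>fdiffs h \<alpha> u x\<bar> \<le> H"
proof -
  have "(fdiffs h \<alpha> u x)\<^sup>2 \<le> H\<^sup>2" using fdiffs_le_energy[OF assms(1)] assms(2) order_trans by blast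
  then show ?thesis using assms(3) abs_le_square_iff[of "fdiffs h \<alpha> u x" H] by simp
qed

lemma sum_weq_le:
  assumes "\<And>\<alpha>. \<alpha> \<in> weq \<Lambda> j \<Longrightarrow> \<bar>g \<alpha>\<bar> \<le> A" "j \<le> k"
  shows "(\<Sum>\<alpha>\<in>weq \<Lambda> j. (g \<alpha>)\<^sup>2) \<le> real (card (wle \<Lambda> k)) * A\<^sup>2"
proof -
  have "(\<Sum>\<alpha>\<in>weq \<Lambda> j. (g \<alpha>)\<^sup>2) \<le> (\<Sum>\<alpha>\<in>weq \<Lambda> j. A\<^sup>2)"
    by (rule sum_mono) (use assms(1) abs_le_square_iff in force)
  also have "\<dots> = real (card (weq \<Lambda> j)) * A\<^sup>2" by simp
  also have "\<dots> \<le> real (card (wle \<Lambda> k)) * A\<^sup>2"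
  proof (rule mult_right_mono)
    have "weq \<Lambda> j \<subseteq> wle \<Lambda> k" using assms(2) by (auto simp: weq_def wle_def)
    then show "real (card (weq \<Lambda> j)) \<le> real (card (wle \<Lambda> k))"
      by (simp add: card_mono finite_wle[OF fin])
  qed simp
  finally show ?thesis .
qed

end

section \<open>Continuity under arbitrary translations\<close>

context dirichlet_problem
begin

text \<open>The increment \<open>u (x + t) - u x\<close> solves the discrete equation up to
  increments of the coefficients and of \<open>f\<close>, the former multiplied by quantities
  bounded in the interior; near the boundary both values are close to \<open>\<psi>\<close>. Then
  \<open>difference_bound\<close> applies. As \<open>t\<close> is arbitrary, this controls
  \<open>u\<close> across different translates of the lattice.\<close>

lemma translation_modulus:
  assumes B: "0 < B" and K: "bounded K" and \<epsilon>: "0 < \<epsilon>"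
  shows "\<exists>\<tau>>0. \<forall>\<^sub>F h in at_right 0. \<forall>u. discrete_solution h f u \<and> (\<forall>x\<in>D. \<bar>u x\<bar> \<le> B) \<longrightarrow>
     (\<forall>x\<in>K. \<forall>t. norm t < \<tau> \<longrightarrow> \<bar>u (x + t) - u x\<bar> \<le> \<epsilon>)"
proof -
  obtain \<rho> where \<rho>: "0 < \<rho>" "\<And>l. l \<in> \<Lambda> \<Longrightarrow> norm l \<le> \<rho>" using finite_norm_bound[OF fin] by blast
  have "bounded (K \<union> D)" using K D_bdd by simp
  then obtain R where R: "\<And>x. x \<in> K \<union> D \<Longrightarrow> norm x \<le> R" using bounded_iff by metis
  let ?K = "cball (0::'a) (R + \<rho>)"
  obtain Q where Q: "0 < Q" "\<And>x. x \<in> D \<Longrightarrow> \<bar>q x\<bar> \<le> Q" using q_bound by blast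
  \<comment> \<open>Order of the choices: the tolerances \<open>\<epsilon>2\<close> for the equation
    and \<open>m\<close> for the boundary layer come from \<open>\<epsilon>\<close>, the layer width
    \<open>\<delta>\<close> from \<open>m\<close>, the interior bound \<open>H\<close> from
    \<open>\<delta>\<close>, the coefficient tolerance \<open>\<epsilon>3\<close> from
    \<open>H\<close>, and \<open>\<tau>\<close> last.\<close>
  define \<epsilon>2 where "\<epsilon>2 = \<epsilon> / (8 * (\<bar>Sm\<bar> + 1))"
  have \<epsilon>2: "0 < \<epsilon>2" "4 * \<epsilon>2 * \<bar>Sm\<bar> \<le> \<epsilon> / 2"
  proof -
    show p: "0 < \<epsilon>2" using \<epsilon> by (simp add: \<epsilon>2_def add_nonneg_pos)
    have "4 * \<epsilon>2 * \<bar>Sm\<bar> \<le> 4 * \<epsilon>2 * (\<bar>Sm\<bar> + 1)" using p by simp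
    also have "\<dots> = \<epsilon> / 2" by (simp add: \<epsilon>2_def field_simps)
    finally show "4 * \<epsilon>2 * \<bar>Sm\<bar> \<le> \<epsilon> / 2" .
  qed
  define m where "m = min \<epsilon> (\<epsilon> * s / (2 * (\<bar>Sm\<bar> + 1)))"
  have m: "0 < m" "m \<le> \<epsilon>" "m / s * \<bar>Sm\<bar> \<le> \<epsilon> / 2"
  proof -
    show p: "0 < m" using \<epsilon> s_pos by (simp add: m_def add_nonneg_pos)
    show "m \<le> \<epsilon>" by (simp add: m_def)
    have "m \<le> \<epsilon> * s / (2 * (\<bar>Sm\<bar> + 1))" by (simp add: m_def)
    then have "m / s \<le> \<epsilon> / (2 * (\<bar>Sm\<bar> + 1))" using s_pos by (simp add: field_simps)
    then have "m / s * \<bar>Sm\<bar> \<le> \<epsilon> / (2 * (\<bar>Sm\<bar> + 1)) * (\<bar>Sm\<bar> + 1)"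
      using p s_pos \<epsilon> by (intro mult_mono) auto
    also have "\<dots> = \<epsilon> / 2" by (simp add: field_simps)
    finally show "m / s * \<bar>Sm\<bar> \<le> \<epsilon> / 2" .
  qed
  have m3: "0 < m / 3" using m by simp
  obtain \<delta>0 where \<delta>0: "0 < \<delta>0" and bev: "\<forall>\<^sub>F h in at_right 0. \<forall>u f0. discrete_solution h f0 u \<and> (\<forall>x\<in>D. \<bar>f0 x\<bar> \<le> Fb \<and> \<bar>u x\<bar> \<le> B) \<longrightarrow>
     (\<forall>x. \<not> ball x \<delta>0 \<subseteq> D \<longrightarrow> \<bar>u x - \<psi> x\<bar> \<le> m / 3)"
    using discrete_solution_boundary[OF m3] by blast
  \<comment> \<open>Half the width: if \<open>ball x \<delta>\<close> leaves \<open>D\<close>, the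
    balls of radius \<open>\<delta>0\<close> about both \<open>x\<close> and \<open>x + t\<close>
    leave \<open>D\<close>; if it does not, a ball of radius \<open>\<delta> / 2\<close> about
    \<open>x + t\<close> remains inside for interior bounds.\<close>
  define \<delta> where "\<delta> = \<delta>0 / 2"
  have \<delta>: "0 < \<delta>" "0 < \<delta> / 2" using \<delta>0 by (auto simp: \<delta>_def)
  have two_le: "(2::nat) \<le> 3" by simp
  obtain C where C: "C \<ge> 0" and iev: "\<forall>\<^sub>F h in at_right 0. \<forall>z u f S. ball z (\<delta> / 2) \<subseteq> D \<and> 0 < S \<and>
     (\<forall>x\<in>D. Lh h u x + q x * u x = f x \<and> (u x)\<^sup>2 \<le> S \<and>
        (\<forall>j\<le>2. (\<Sum>\<alpha>\<in>weq \<Lambda> j. (fdiffs h \<alpha> f x)\<^sup>2) \<le> S)) \<longrightarrow>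
     (\<forall>x\<in>ball z (\<delta>/2/2). \<forall>j\<le>2. energy h j u x \<le> C * S)"
    using interior_estimate_D[OF q_C3 two_le \<delta>(2)] by (elim exE conjE) (rule that)
  obtain A where A: "0 < A" "\<forall>x\<in>D. \<forall>h. 0 < h \<and> h \<le> 1 \<longrightarrow> (\<forall>\<alpha>\<in>wle \<Lambda> 2. \<bar>fdiffs h \<alpha> f x\<bar> \<le> A)"
    using fdiffs_bounded[OF f_C2 D_bdd fin] by blast
  define Su where "Su = B\<^sup>2 + real (card (wle \<Lambda> 2)) * A\<^sup>2 + 1"
  have Su: "0 < Su" "B\<^sup>2 \<le> Su" "real (card (wle \<Lambda> 2)) * A\<^sup>2 \<le> Su"
    by (auto simp: Su_def add_nonneg_pos)
  define H where "H = sqrt (C * Su)"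
  have H: "0 \<le> H" "C * Su = H\<^sup>2" using C Su by (auto simp: H_def)
  define \<epsilon>3 where "\<epsilon>3 = \<epsilon>2 / (2 * real (card \<Lambda>) * H + 1 + B)"
  have den: "0 < 2 * real (card \<Lambda>) * H + 1 + B" using H B by (simp add: add_nonneg_pos)
  have \<epsilon>3: "0 < \<epsilon>3" "\<epsilon>3 * (2 * real (card \<Lambda>) * H + 1 + B) = \<epsilon>2" using den \<epsilon>2 by (auto simp: \<epsilon>3_def)
  have ccont: "continuous_on UNIV (c l)" "continuous_on UNIV (b l)" if "l \<in> \<Lambda>" for l
    using Ck_on_continuous[OF c_C3[OF that]] Ck_on_continuous[OF b_C3[OF that]] by auto
  have qfcont: "continuous_on UNIV q" "continuous_on UNIV f"
    using Ck_on_continuous[OF q_C3] Ck_on_continuous[OF f_C2] by auto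
  have "\<forall>\<^sub>F \<tau> in at_right 0. (\<forall>l\<in>\<Lambda>. (\<forall>x\<in>D. \<forall>t. norm t < \<tau> \<longrightarrow> \<bar>c l (x + t) - c l x\<bar> \<le> \<epsilon>3) \<and>
        (\<forall>x\<in>D. \<forall>t. norm t < \<tau> \<longrightarrow> \<bar>b l (x + t) - b l x\<bar> \<le> \<epsilon>3)) \<and>
      (\<forall>x\<in>D. \<forall>t. norm t < \<tau> \<longrightarrow> \<bar>q (x + t) - q x\<bar> \<le> \<epsilon>3) \<and>
      (\<forall>x\<in>D. \<forall>t. norm t < \<tau> \<longrightarrow> \<bar>f (x + t) - f x\<bar> \<le> \<epsilon>3) \<and>
      (\<forall>x\<in>?K. \<forall>t. norm t < \<tau> \<longrightarrow> \<bar>\<psi> (x + t) - \<psi> x\<bar> \<le> m / 3) \<and> 0 < \<tau> \<and> \<tau> \<le> \<delta> / 2"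
    using \<delta>(2)
    by (intro eventually_conj eventually_ball_finite[OF fin] ballI uniform_modulus ccont qfcont psi_cont D_bdd bounded_cball \<epsilon>3 m3)
       (auto simp: eventually_at_right_field intro!: exI[of _ "\<delta> / 2"])
  from eventually_happens'[OF trivial_limit_at_right_real this] obtain \<tau> where
    T: "(\<forall>l\<in>\<Lambda>. (\<forall>x\<in>D. \<forall>t. norm t < \<tau> \<longrightarrow> \<bar>c l (x + t) - c l x\<bar> \<le> \<epsilon>3) \<and>
        (\<forall>x\<in>D. \<forall>t. norm t < \<tau> \<longrightarrow> \<bar>b l (x + t) - b l x\<bar> \<le> \<epsilon>3)) \<and>
      (\<forall>x\<in>D. \<forall>t. norm t < \<tau> \<longrightarrow> \<bar>q (x + t) - q x\<bar> \<le> \<epsilon>3) \<and>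
      (\<forall>x\<in>D. \<forall>t. norm t < \<tau> \<longrightarrow> \<bar>f (x + t) - f x\<bar> \<le> \<epsilon>3) \<and>
      (\<forall>x\<in>?K. \<forall>t. norm t < \<tau> \<longrightarrow> \<bar>\<psi> (x + t) - \<psi> x\<bar> \<le> m / 3) \<and> 0 < \<tau> \<and> \<tau> \<le> \<delta> / 2" by (elim exE)
  have \<tau>: "0 < \<tau>" "\<tau> \<le> \<delta> / 2" using T by blast+
  have mod: "\<And>l x t. l \<in> \<Lambda> \<Longrightarrow> x \<in> D \<Longrightarrow> norm t < \<tau> \<Longrightarrow> \<bar>c l (x + t) - c l x\<bar> \<le> \<epsilon>3 \<and> \<bar>b l (x + t) - b l x\<bar> \<le> \<epsilon>3"
      "\<And>x t. x \<in> D \<Longrightarrow> norm t < \<tau> \<Longrightarrow> \<bar>q (x + t) - q x\<bar> \<le> \<epsilon>3"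
      "\<And>x t. x \<in> D \<Longrightarrow> norm t < \<tau> \<Longrightarrow> \<bar>f (x + t) - f x\<bar> \<le> \<epsilon>3"
      "\<And>x t. x \<in> ?K \<Longrightarrow> norm t < \<tau> \<Longrightarrow> \<bar>\<psi> (x + t) - \<psi> x\<bar> \<le> m / 3"
    using T by blast+
  show ?thesis
  proof (rule exI[of _ \<tau>], rule conjI[OF \<tau>(1)])
    show "\<forall>\<^sub>F h in at_right 0. \<forall>u. discrete_solution h f u \<and> (\<forall>x\<in>D. \<bar>u x\<bar> \<le> B) \<longrightarrow>
     (\<forall>x\<in>K. \<forall>t. norm t < \<tau> \<longrightarrow> \<bar>u (x + t) - u x\<bar> \<le> \<epsilon>)"
      using bev iev difference_bound h_pos_ev
    proof (eventually_elim, intro allI impI ballI)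
      fix h u x0 and t :: 'a
      assume bh: "\<forall>u f0. discrete_solution h f0 u \<and> (\<forall>x\<in>D. \<bar>f0 x\<bar> \<le> Fb \<and> \<bar>u x\<bar> \<le> B) \<longrightarrow>
           (\<forall>x. \<not> ball x \<delta>0 \<subseteq> D \<longrightarrow> \<bar>u x - \<psi> x\<bar> \<le> m / 3)"
        and ih: "\<forall>z u f S. ball z (\<delta> / 2) \<subseteq> D \<and> 0 < S \<and>
           (\<forall>x\<in>D. Lh h u x + q x * u x = f x \<and> (u x)\<^sup>2 \<le> S \<and>
              (\<forall>j\<le>2. (\<Sum>\<alpha>\<in>weq \<Lambda> j. (fdiffs h \<alpha> f x)\<^sup>2) \<le> S)) \<longrightarrow>
           (\<forall>x\<in>ball z (\<delta>/2/2). \<forall>j\<le>2. energy h j u x \<le> C * S)"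
        and dh: "\<forall>G w \<epsilon> m W. G \<subseteq> D \<and> 0 < \<epsilon> \<and> 0 \<le> m \<and>
            (\<forall>x\<in>G. \<bar>Lh h w x + q x * w x\<bar> \<le> \<epsilon> \<and> \<bar>w x\<bar> \<le> W) \<and>
            (\<forall>x\<in>G. \<forall>l\<in>\<Lambda>. x + h *\<^sub>R l \<notin> G \<longrightarrow> \<bar>w (x + h *\<^sub>R l)\<bar> \<le> m) \<longrightarrow>
            (\<forall>x\<in>G. \<bar>w x\<bar> \<le> (4 * \<epsilon> + m / s) * Sm)"
        and h: "0 < h \<and> h \<le> 1"
        and u: "discrete_solution h f u \<and> (\<forall>x\<in>D. \<bar>u x\<bar> \<le> B)" and x0: "x0 \<in> K" and t: "norm t < \<tau>"
      have h0: "h \<noteq> 0" using h by simp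
      have uB: "\<bar>u x\<bar> \<le> B" and uL: "Lh h u x + q x * u x = f x" if "x \<in> D" for x
        using u that unfolding discrete_solution_def by blast+
      have fF: "\<bar>f x\<bar> \<le> Fb" for x using f_bd[of x] f_neg[of x] by linarith
      define w where "w x = u (x + t) - u x" for x
      define G where "G = {x. ball x \<delta> \<subseteq> D}"
      have bl: "\<bar>u x - \<psi> x\<bar> \<le> m / 3" if "\<not> ball x \<delta>0 \<subseteq> D" for x
        using bh[THEN spec, THEN spec, of f u, THEN mp] u fF that by blast
      have GD: "x \<in> D" if "x \<in> G" for x using that \<delta>(1) unfolding G_def by (metis centre_in_ball mem_Collect_eq subsetD)
      have layer: "\<bar>w x\<bar> \<le> m" if x: "x \<in> ?K" "x \<notin> G" for x
      proof -
        have nb: "\<not> ball x \<delta> \<subseteq> D" using x by (simp add: G_def)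
        have "ball x \<delta> \<subseteq> ball x \<delta>0" using \<delta>0 by (auto simp: \<delta>_def)
        then have "\<not> ball x \<delta>0 \<subseteq> D" using nb by blast
        then have 1: "\<bar>u x - \<psi> x\<bar> \<le> m / 3" by (rule bl)
        have "ball x \<delta> \<subseteq> ball (x + t) \<delta>0"
        proof
          fix y assume "y \<in> ball x \<delta>"
          then show "y \<in> ball (x + t) \<delta>0"
            using dist_triangle[of "x + t" y x] t \<tau>(2) \<delta>0 by (simp add: \<delta>_def dist_norm)
        qed
        then have "\<not> ball (x + t) \<delta>0 \<subseteq> D" using nb by blast
        then have 2: "\<bar>u (x + t) - \<psi> (x + t)\<bar> \<le> m / 3" by (rule bl)
        have "\<bar>\<psi> (x + t) - \<psi> x\<bar> \<le> m / 3" using mod(4)[OF x(1) t] .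
        then show ?thesis using 1 2 unfolding w_def by linarith
      qed
      have xtD: "x + t \<in> D" and ballxt: "ball (x + t) (\<delta> / 2) \<subseteq> D" if x: "x \<in> G" for x
      proof -
        have "ball (x + t) (\<delta> / 2) \<subseteq> ball x \<delta>"
        proof
          fix y assume "y \<in> ball (x + t) (\<delta> / 2)"
          then show "y \<in> ball x \<delta>"
            using dist_triangle[of x y "x + t"] t \<tau>(2) by (simp add: dist_norm)
        qed
        then show 1: "ball (x + t) (\<delta> / 2) \<subseteq> D" using x by (auto simp: G_def)
        then show "x + t \<in> D" using \<delta> centre_in_ball by blast
      qed
      have inner: "\<bar>Lh h w x + q x * w x\<bar> \<le> \<epsilon>2" if x: "x \<in> G" for x
      proof -
        let ?y = "x + t"
        have xD: "x \<in> D" and yD: "?y \<in> D" using GD[OF x] xtD[OF x] .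
        have "\<forall>y\<in>ball ?y (\<delta>/2/2). \<forall>j\<le>2. energy h j u y \<le> C * Su"
        proof (rule ih[THEN spec, THEN spec, THEN spec, THEN spec, THEN mp, of ?y Su u f], intro conjI ballI allI impI)
          show "ball ?y (\<delta> / 2) \<subseteq> D" by (rule ballxt[OF x])
          fix y assume y: "y \<in> D"
          have "(u y)\<^sup>2 \<le> B\<^sup>2" using uB[OF y] B by (simp add: abs_le_square_iff[symmetric])
          then show "(u y)\<^sup>2 \<le> Su" using Su by linarith
          fix j :: nat assume j: "j \<le> 2"
          have "(\<Sum>\<alpha>\<in>weq \<Lambda> j. (fdiffs h \<alpha> f y)\<^sup>2) \<le> real (card (wle \<Lambda> 2)) * A\<^sup>2"
          proof (rule sum_weq_le[OF _ j])
            fix \<alpha> assume "\<alpha> \<in> weq \<Lambda> j"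
            then have "\<alpha> \<in> wle \<Lambda> 2" using j by (auto simp: weq_def wle_def)
            then show "\<bar>fdiffs h \<alpha> f y\<bar> \<le> A" using A(2) h y by blast
          qed
          then show "(\<Sum>\<alpha>\<in>weq \<Lambda> j. (fdiffs h \<alpha> f y)\<^sup>2) \<le> Su" using Su by linarith
        qed (use Su uL in auto)
        then have enb: "energy h j u ?y \<le> H\<^sup>2" if "j \<le> 2" for j using that \<delta> H by simp
        \<comment> \<open>The increment of \<open>c\<close> appears with a factor
          \<open>1 / h\<close>. Being even in \<open>l\<close>, it can be symmetrised, so that it
          multiplies a bounded second difference instead.\<close>
        define kc where "kc l = c l x - c l ?y" for l
        have kcneg: "kc (- l) = kc l" for l by (simp add: kc_def c_neg)
        have "Lh h (\<lambda>x. u (x + t)) x = (\<Sum>l\<in>\<Lambda>. (c l x / h + b l x) * fdiff h l u ?y)"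
          unfolding Lh_def by (simp add: fdiff_def algebra_simps)
        also have "\<dots> = Lh h u ?y + ((\<Sum>l\<in>\<Lambda>. kc l / h * fdiff h l u ?y) + (\<Sum>l\<in>\<Lambda>. (b l x - b l ?y) * fdiff h l u ?y))"
          unfolding Lh_def sum.distrib[symmetric]
          by (intro sum.cong refl) (simp add: kc_def algebra_simps diff_divide_distrib)
        also have "(\<Sum>l\<in>\<Lambda>. kc l / h * fdiff h l u ?y) = (\<Sum>l\<in>\<Lambda>. - (1/2) * kc l * fdiff h l (fdiff h (- l) u) ?y)"
          by (rule sum_sym_fdiff[OF h0, of kc, OF kcneg])
        finally have 1: "Lh h (\<lambda>x. u (x + t)) x = Lh h u ?y
           + (\<Sum>l\<in>\<Lambda>. - (1/2) * kc l * fdiff h l (fdiff h (- l) u) ?y + (b l x - b l ?y) * fdiff h l u ?y)"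
          by (simp only: sum.distrib)
        have 2: "\<bar>\<Sum>l\<in>\<Lambda>. - (1/2) * kc l * fdiff h l (fdiff h (- l) u) ?y + (b l x - b l ?y) * fdiff h l u ?y\<bar>
           \<le> (\<Sum>l\<in>\<Lambda>. 2 * (\<epsilon>3 * H))"
        proof (rule order_trans[OF sum_abs], rule sum_mono)
          fix l assume l: "l \<in> \<Lambda>"
          have kb: "\<bar>kc l\<bar> \<le> \<epsilon>3" "\<bar>b l x - b l ?y\<bar> \<le> \<epsilon>3"
            using mod(1)[OF l xD t] unfolding kc_def by (auto simp: abs_minus_commute)
          have "[l, -l] \<in> weq \<Lambda> 2" "[l] \<in> weq \<Lambda> 1" using l neg by (auto simp: weq_def)
          then have "\<bar>fdiffs h [l, -l] u ?y\<bar> \<le> H" "\<bar>fdiffs h [l] u ?y\<bar> \<le> H"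
            using enb[of 2] enb[of 1] by (auto intro!: fdiffs_le_sqrt H(1))
          then have fb: "\<bar>fdiff h l (fdiff h (- l) u) ?y\<bar> \<le> H" "\<bar>fdiff h l u ?y\<bar> \<le> H"
            by (simp_all add: fdiffs_Cons)
          have "\<bar>kc l * fdiff h l (fdiff h (- l) u) ?y\<bar> \<le> \<epsilon>3 * H"
            unfolding abs_mult using kb fb \<epsilon>3 by (intro mult_mono) auto
          moreover have "\<bar>(b l x - b l ?y) * fdiff h l u ?y\<bar> \<le> \<epsilon>3 * H"
            unfolding abs_mult using kb fb \<epsilon>3 by (intro mult_mono) auto
          ultimately show "\<bar>- (1/2) * kc l * fdiff h l (fdiff h (- l) u) ?y + (b l x - b l ?y) * fdiff h l u ?y\<bar> \<le> 2 * (\<epsilon>3 * H)"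
            unfolding mult.assoc by linarith
        qed
        have "\<bar>(q x - q ?y) * u ?y\<bar> \<le> \<epsilon>3 * B"
          unfolding abs_mult using mod(2)[OF xD t] uB[OF yD] \<epsilon>3 by (intro mult_mono) (auto simp: abs_minus_commute)
        moreover have "\<bar>f ?y - f x\<bar> \<le> \<epsilon>3" using mod(3)[OF xD t] .
        moreover have "Lh h w x + q x * w x = (\<Sum>l\<in>\<Lambda>. - (1/2) * kc l * fdiff h l (fdiff h (- l) u) ?y + (b l x - b l ?y) * fdiff h l u ?y)
           + (q x - q ?y) * u ?y + (f ?y - f x)"
          unfolding w_def[abs_def] Lh_diff 1 uL[OF xD, symmetric] uL[OF yD, symmetric] by (simp add: algebra_simps)
        ultimately have "\<bar>Lh h w x + q x * w x\<bar> \<le> (\<Sum>l\<in>\<Lambda>. 2 * (\<epsilon>3 * H)) + \<epsilon>3 * B + \<epsilon>3"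
          using 2 by linarith
        also have "\<dots> = \<epsilon>2" unfolding \<epsilon>3(2)[symmetric] by (simp add: algebra_simps)
        finally show ?thesis .
      qed
      have "\<forall>x\<in>G. \<bar>w x\<bar> \<le> (4 * \<epsilon>2 + m / s) * Sm"
      proof (rule dh[THEN spec, THEN spec, THEN spec, THEN spec, THEN spec, THEN mp, of G \<epsilon>2 m w "2 * B"], intro conjI ballI impI)
        show "G \<subseteq> D" using GD by blast
        fix x assume x: "x \<in> G"
        show "\<bar>Lh h w x + q x * w x\<bar> \<le> \<epsilon>2" by (rule inner[OF x])
        show "\<bar>w x\<bar> \<le> 2 * B" using uB[OF GD[OF x]] uB[OF xtD[OF x]] unfolding w_def by linarith
        fix l assume l: "l \<in> \<Lambda>" and out: "x + h *\<^sub>R l \<notin> G"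
        have "norm (h *\<^sub>R l) \<le> 1 * \<rho>" using mult_mono[of h 1 "norm l" \<rho>] h \<rho>(2)[OF l] by simp
        then have "norm (x + h *\<^sub>R l) \<le> R + \<rho>" using R[of x] GD[OF x] norm_triangle_ineq[of x "h *\<^sub>R l"] by simp
        then show "\<bar>w (x + h *\<^sub>R l)\<bar> \<le> m" by (intro layer out) (simp only: mem_cball_0)
      qed (use \<epsilon>2 m in auto)
      moreover have "(4 * \<epsilon>2 + m / s) * Sm \<le> \<epsilon>"
      proof -
        have "0 \<le> m / s" using m s_pos by simp
        then have "(4 * \<epsilon>2 + m / s) * Sm \<le> (4 * \<epsilon>2 + m / s) * \<bar>Sm\<bar>" using \<epsilon>2 by (intro mult_left_mono) auto
        then show ?thesis using \<epsilon>2(2) m(3) unfolding distrib_right by linarith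
      qed
      moreover have "x0 \<in> ?K" using R[of x0] x0 \<rho>(1) by simp
      ultimately have "\<bar>w x0\<bar> \<le> \<epsilon>" using layer[of x0] m(2) by (cases "x0 \<in> G") fastforce+
      then show "\<bar>u (x0 + t) - u x0\<bar> \<le> \<epsilon>" by (simp add: w_def)
    qed
  qed
qed

end

section \<open>A common modulus for second differences\<close>

context dirichlet_problem
begin

text \<open>The data \<open>f\<close> is only \<open>C\<^sup>2\<close>, so third differences of the discrete solution are not under control.
  Replacing \<open>f\<close> by its average over a mesh box of side \<open>\<eta>\<close> changes second differences little and makes third differences bounded.\<close>

lemma second_difference_modulus:
  assumes B: "0 < B" and r: "0 < r" and \<epsilon>: "0 < \<epsilon>"
  shows "\<exists>\<tau>>0. \<forall>\<^sub>F h in at_right 0. \<forall>u. discrete_solution h f u \<and> (\<forall>x\<in>D. \<bar>u x\<bar> \<le> B) \<longrightarrow>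
     (\<forall>z. ball z r \<subseteq> D \<longrightarrow> (\<forall>x\<in>ball z (r/4). \<forall>\<alpha>\<in>weq \<Lambda> 2. \<forall>l\<in>\<Lambda>. \<forall>j::nat. real j * h < \<tau> \<longrightarrow>
        \<bar>fdiffs h \<alpha> u (x + (real j * h) *\<^sub>R l) - fdiffs h \<alpha> u x\<bar> \<le> \<epsilon>))"
proof -
  obtain \<rho> where \<rho>: "0 < \<rho>" "\<And>l. l \<in> \<Lambda> \<Longrightarrow> norm l \<le> \<rho>" using finite_norm_bound[OF fin] by blast
  obtain L where L: "set L = \<Lambda>" using finite_list[OF fin] by blast
  define n where "n = real (length L)"
  have n: "0 \<le> n" by (simp add: n_def)
  define k2 where "k2 = real (card (wle \<Lambda> 2))"
  define k3 where "k3 = real (card (wle \<Lambda> 3))"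
  have k23: "0 \<le> k2" "0 \<le> k3" by (auto simp: k2_def k3_def)
  have le23: "(2::nat) \<le> 3" "(3::nat) \<le> 3" by auto
  obtain C2 where C2: "C2 \<ge> 0" and iev2: "\<forall>\<^sub>F h in at_right 0. \<forall>z u f S. ball z r \<subseteq> D \<and> 0 < S \<and>
     (\<forall>x\<in>D. Lh h u x + q x * u x = f x \<and> (u x)\<^sup>2 \<le> S \<and>
        (\<forall>j\<le>2. (\<Sum>\<alpha>\<in>weq \<Lambda> j. (fdiffs h \<alpha> f x)\<^sup>2) \<le> S)) \<longrightarrow>
     (\<forall>x\<in>ball z (r/2). \<forall>j\<le>2. energy h j u x \<le> C2 * S)"
    using interior_estimate_D[OF q_C3 le23(1) r] by (elim exE conjE) (rule that)
  obtain C3 where C3: "C3 \<ge> 0" and iev3: "\<forall>\<^sub>F h in at_right 0. \<forall>z u f S. ball z r \<subseteq> D \<and> 0 < S \<and>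
     (\<forall>x\<in>D. Lh h u x + q x * u x = f x \<and> (u x)\<^sup>2 \<le> S \<and>
        (\<forall>j\<le>3. (\<Sum>\<alpha>\<in>weq \<Lambda> j. (fdiffs h \<alpha> f x)\<^sup>2) \<le> S)) \<longrightarrow>
     (\<forall>x\<in>ball z (r/2). \<forall>j\<le>3. energy h j u x \<le> C3 * S)"
    using interior_estimate_D[OF q_C3 le23(2) r] by (elim exE conjE) (rule that)
  obtain B' \<kappa>m where \<kappa>m: "0 < \<kappa>m" and exev: "\<forall>\<^sub>F h in at_right 0. \<forall>f0 \<kappa>. (\<forall>x\<in>D. - Fb \<le> f0 x \<and> f0 x \<le> q x * \<kappa>) \<and> 0 \<le> \<kappa> \<and> \<kappa> \<le> \<kappa>m \<longrightarrow>
     (\<exists>u. discrete_solution h f0 u \<and> (\<forall>x\<in>D. \<kappa> \<le> u x \<and> u x \<le> B'))"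
    using exists_solution by blast
  \<comment> \<open>With \<open>v\<close> the discrete solution for averaged data,
    \<open>\<sigma>\<close> is the squared size of \<open>u - v\<close> and of its data for which
    the interior estimate keeps the second differences of \<open>u - v\<close> below
    \<open>\<epsilon> / 3\<close>.\<close>
  define \<sigma> where "\<sigma> = (\<epsilon> / 3)\<^sup>2 / (C2 + 1)"
  have \<sigma>: "0 < \<sigma>" "C2 * \<sigma> \<le> (\<epsilon> / 3)\<^sup>2"
  proof -
    show p: "0 < \<sigma>" using \<epsilon> C2 by (simp add: \<sigma>_def add_nonneg_pos)
    have "C2 * \<sigma> \<le> (C2 + 1) * \<sigma>" using p by simp
    also have "\<dots> = (\<epsilon> / 3)\<^sup>2" using C2 by (simp add: \<sigma>_def)
    finally show "C2 * \<sigma> \<le> (\<epsilon> / 3)\<^sup>2" .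
  qed
  \<comment> \<open>One tolerance \<open>e1\<close> for the differences of \<open>f - g\<close>,
    with \<open>g\<close> the averaged data, has to bring both
    \<open>(4 * e1 * \<bar>Sm\<bar>)\<^sup>2\<close>, the squared size of \<open>u - v\<close>, and
    \<open>k2 * e1\<^sup>2\<close>, the sum of the squared data differences, below
    \<open>\<sigma>\<close>.\<close>
  define M where "M = 1 + 4 * \<bar>Sm\<bar> + k2"
  have M: "1 \<le> M" "4 * \<bar>Sm\<bar> \<le> M" "k2 \<le> M" using k23 by (auto simp: M_def)
  define e1 where "e1 = sqrt \<sigma> / M"
  have e1: "0 < e1" "(M * e1)\<^sup>2 = \<sigma>" using \<sigma> M by (auto simp: e1_def)
  have e1k: "k2 * e1\<^sup>2 \<le> \<sigma>"
  proof -
    have "k2 * e1\<^sup>2 \<le> (M * M) * e1\<^sup>2"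
    proof (rule mult_right_mono)
      have "k2 * 1 \<le> M * M" using M k23 by (intro mult_mono) auto
      then show "k2 \<le> M * M" by simp
    qed simp
    also have "\<dots> = (M * e1)\<^sup>2" by (simp add: power2_eq_square)
    finally show ?thesis using e1 by simp
  qed
  have e1S: "(4 * e1 * \<bar>Sm\<bar>)\<^sup>2 \<le> \<sigma>"
  proof -
    have "4 * e1 * \<bar>Sm\<bar> \<le> M * e1" using mult_right_mono[OF M(2), of e1] e1 by (simp add: mult_ac)
    then have "(4 * e1 * \<bar>Sm\<bar>)\<^sup>2 \<le> (M * e1)\<^sup>2" using e1 by (intro power_mono) auto
    then show ?thesis using e1 by simp
  qed
  obtain \<delta> where \<delta>: "0 < \<delta>" and eq: "\<forall>x\<in>D. \<forall>h t. 0 < h \<and> h \<le> 1 \<and> norm t < \<delta> \<longrightarrow>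
    (\<forall>\<alpha>\<in>wle \<Lambda> 2. \<bar>fdiffs h \<alpha> f (x + t) - fdiffs h \<alpha> f x\<bar> \<le> e1)"
    using fdiffs_equicontinuous[OF f_C2 D_bdd fin e1(1)] by blast
  obtain A0 where A0: "0 < A0" "\<forall>x\<in>D. \<forall>h. 0 < h \<and> h \<le> 1 \<longrightarrow> (\<forall>\<alpha>\<in>wle \<Lambda> 2. \<bar>fdiffs h \<alpha> f x\<bar> \<le> A0)"
    using fdiffs_bounded[OF f_C2 D_bdd fin] by blast
  define A where "A = A0 + e1"
  have A: "0 < A" using A0 e1 by (simp add: A_def)
  \<comment> \<open>The nodes of an averaging box with sides up to \<open>2 * \<eta>\<close> mesh
    lengths per direction stay within \<open>\<delta>\<close> of the base point, where differences
    of \<open>f\<close> up to order two vary by at most \<open>e1\<close>.\<close>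
  define \<eta> where "\<eta> = \<delta> / (4 * (\<rho> * n + 1))"
  have den: "0 < 4 * (\<rho> * n + 1)" using \<rho> n by (simp add: add_nonneg_pos)
  have \<eta>: "0 < \<eta>" "2 * \<eta> * \<rho> * n < \<delta>"
  proof -
    show p: "0 < \<eta>" using \<delta> den by (simp add: \<eta>_def)
    have "4 * (\<rho> * n + 1) * \<eta> = \<delta>" using den by (simp add: \<eta>_def)
    moreover have "0 \<le> \<rho> * n * \<eta>" using \<rho> n p by simp
    ultimately show "2 * \<eta> * \<rho> * n < \<delta>" using p by (simp add: algebra_simps)
  qed
  define Sv where "Sv = B'\<^sup>2 + k3 * (A + 2 * A / \<eta>)\<^sup>2 + 1"
  have Sv: "0 < Sv" "B'\<^sup>2 \<le> Sv" "k3 * (A + 2 * A / \<eta>)\<^sup>2 \<le> Sv"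
    using k23 by (auto simp: Sv_def add_nonneg_pos)
  define H where "H = sqrt (C3 * Sv)"
  have H: "0 \<le> H" "C3 * Sv = H\<^sup>2" using C3 Sv by (auto simp: H_def)
  \<comment> \<open>Third differences of \<open>v\<close> are bounded by \<open>H\<close>, so its
    second differences move by at most \<open>\<tau> * H \<le> \<epsilon> / 3\<close>. The second
    entry keeps the path from \<open>x\<close> inside \<open>ball z (r/2)\<close>.\<close>
  define \<tau> where "\<tau> = min (\<epsilon> / (3 * (H + 1))) (r / (4 * \<rho>))"
  have \<tau>: "0 < \<tau>" "\<tau> * H \<le> \<epsilon> / 3" "\<tau> * \<rho> \<le> r / 4"
  proof -
    show p: "0 < \<tau>" using \<epsilon> H r \<rho> by (simp add: \<tau>_def add_nonneg_pos)
    have "\<tau> \<le> \<epsilon> / (3 * (H + 1))" by (simp add: \<tau>_def)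
    then have "\<tau> * (H + 1) \<le> \<epsilon> / 3" using H by (simp add: field_simps)
    then show "\<tau> * H \<le> \<epsilon> / 3" using p by (simp add: algebra_simps)
    have "\<tau> \<le> r / (4 * \<rho>)" by (simp add: \<tau>_def)
    then show "\<tau> * \<rho> \<le> r / 4" using \<rho> by (simp add: field_simps)
  qed
  have hev: "\<forall>\<^sub>F h in at_right (0::real). h < \<eta>"
    using \<eta>(1) unfolding eventually_at_right_field by blast
  show ?thesis
  proof (rule exI[of _ \<tau>], rule conjI[OF \<tau>(1)])
    show "\<forall>\<^sub>F h in at_right 0. \<forall>u. discrete_solution h f u \<and> (\<forall>x\<in>D. \<bar>u x\<bar> \<le> B) \<longrightarrow>
     (\<forall>z. ball z r \<subseteq> D \<longrightarrow> (\<forall>x\<in>ball z (r/4). \<forall>\<alpha>\<in>weq \<Lambda> 2. \<forall>l\<in>\<Lambda>. \<forall>j::nat. real j * h < \<tau> \<longrightarrow>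
        \<bar>fdiffs h \<alpha> u (x + (real j * h) *\<^sub>R l) - fdiffs h \<alpha> u x\<bar> \<le> \<epsilon>))"
      using iev2 iev3 exev difference_bound h_pos_ev hev
    proof (eventually_elim, intro allI impI ballI)
      fix h u z x \<alpha> l and j :: nat
      assume ih2: "\<forall>z u f S. ball z r \<subseteq> D \<and> 0 < S \<and>
           (\<forall>x\<in>D. Lh h u x + q x * u x = f x \<and> (u x)\<^sup>2 \<le> S \<and>
              (\<forall>j\<le>2. (\<Sum>\<alpha>\<in>weq \<Lambda> j. (fdiffs h \<alpha> f x)\<^sup>2) \<le> S)) \<longrightarrow>
           (\<forall>x\<in>ball z (r/2). \<forall>j\<le>2. energy h j u x \<le> C2 * S)"
        and ih3: "\<forall>z u f S. ball z r \<subseteq> D \<and> 0 < S \<and>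
           (\<forall>x\<in>D. Lh h u x + q x * u x = f x \<and> (u x)\<^sup>2 \<le> S \<and>
              (\<forall>j\<le>3. (\<Sum>\<alpha>\<in>weq \<Lambda> j. (fdiffs h \<alpha> f x)\<^sup>2) \<le> S)) \<longrightarrow>
           (\<forall>x\<in>ball z (r/2). \<forall>j\<le>3. energy h j u x \<le> C3 * S)"
        and exh: "\<forall>f0 \<kappa>. (\<forall>x\<in>D. - Fb \<le> f0 x \<and> f0 x \<le> q x * \<kappa>) \<and> 0 \<le> \<kappa> \<and> \<kappa> \<le> \<kappa>m \<longrightarrow>
           (\<exists>u. discrete_solution h f0 u \<and> (\<forall>x\<in>D. \<kappa> \<le> u x \<and> u x \<le> B'))"
        and dh: "\<forall>G w \<epsilon> m W. G \<subseteq> D \<and> 0 < \<epsilon> \<and> 0 \<le> m \<and>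
            (\<forall>x\<in>G. \<bar>Lh h w x + q x * w x\<bar> \<le> \<epsilon> \<and> \<bar>w x\<bar> \<le> W) \<and>
            (\<forall>x\<in>G. \<forall>l\<in>\<Lambda>. x + h *\<^sub>R l \<notin> G \<longrightarrow> \<bar>w (x + h *\<^sub>R l)\<bar> \<le> m) \<longrightarrow>
            (\<forall>x\<in>G. \<bar>w x\<bar> \<le> (4 * \<epsilon> + m / s) * Sm)"
        and h: "0 < h \<and> h \<le> 1" and h\<eta>: "h < \<eta>"
        and u: "discrete_solution h f u \<and> (\<forall>x\<in>D. \<bar>u x\<bar> \<le> B)" and z: "ball z r \<subseteq> D"
        and x: "x \<in> ball z (r/4)" and \<alpha>: "\<alpha> \<in> weq \<Lambda> 2" and l: "l \<in> \<Lambda>" and j: "real j * h < \<tau>"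
      \<comment> \<open>Rounding up gives \<open>\<eta> \<le> real N * h \<le> 2 * \<eta>\<close>:
        the lower bound controls third differences of the average, the upper one its distance from
        \<open>f\<close>.\<close>
      define N where "N = nat \<lceil>\<eta> / h\<rceil>"
      have Nh: "\<eta> \<le> real N * h" "real N * h \<le> 2 * \<eta>" "0 < N"
      proof -
        have 1: "\<eta> / h \<le> real N" unfolding N_def by (rule real_nat_ceiling_ge)
        then show "\<eta> \<le> real N * h" using h by (simp add: field_simps)
        have "real N < \<eta> / h + 1" using \<eta> h unfolding N_def
          by (simp add: ceiling_correct) linarith
        then have "real N * h < \<eta> + h" using h by (simp add: field_simps)
        then show "real N * h \<le> 2 * \<eta>" using h\<eta> by linarith
        have "0 < \<eta> / h" using \<eta> h by simp
        then show "0 < N" using 1 by (metis of_nat_0_less_iff order_less_le_trans)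
      qed
      have rad: "h * real N * \<rho> * real (length L) < \<delta>"
      proof -
        have "(real N * h) * (\<rho> * n) \<le> 2 * \<eta> * (\<rho> * n)" using Nh(2) \<rho> n by (intro mult_right_mono) auto
        then show ?thesis using \<eta>(2) unfolding n_def by (simp add: mult_ac)
      qed
      have \<rho>L: "\<And>l. l \<in> set L \<Longrightarrow> norm l \<le> \<rho>" using \<rho>(2) L by blast
      define g where "g = avgs h N L f"
      have gf: "\<bar>fdiffs h \<beta> g y - fdiffs h \<beta> f y\<bar> \<le> e1" if \<beta>: "\<beta> \<in> wle \<Lambda> 2" and y: "y \<in> D" for \<beta> y
      proof -
        have "avgs h N L (fdiffs h \<beta> f) y \<in> {fdiffs h \<beta> f y - e1 .. fdiffs h \<beta> f y + e1}"
        proof (rule avgs_between[OF Nh(3) _ \<rho>L])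
          fix y' assume "dist y y' \<le> h * real N * \<rho> * real (length L)"
          then have "norm (y' - y) < \<delta>" using rad by (simp add: dist_norm norm_minus_commute)
          then have "\<bar>fdiffs h \<beta> f (y + (y' - y)) - fdiffs h \<beta> f y\<bar> \<le> e1" using eq y h \<beta> by blast
          then show "fdiffs h \<beta> f y' \<in> {fdiffs h \<beta> f y - e1 .. fdiffs h \<beta> f y + e1}"
            by (auto simp: abs_le_iff)
        qed (use h in auto)
        then show ?thesis unfolding g_def fdiffs_avgs by (auto simp: abs_le_iff)
      qed
      have fA: "\<bar>fdiffs h \<beta> f y'\<bar> \<le> A" if \<beta>: "\<beta> \<in> wle \<Lambda> 2" and y: "y \<in> D" and y': "dist y y' < \<delta>" for \<beta> y y'
      proof -
        have "norm (y' - y) < \<delta>" using y' by (simp add: dist_norm norm_minus_commute)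
        then have "\<bar>fdiffs h \<beta> f (y + (y' - y)) - fdiffs h \<beta> f y\<bar> \<le> e1" using eq y h \<beta> by blast
        moreover have "\<bar>fdiffs h \<beta> f y\<bar> \<le> A0" using A0(2) y h \<beta> by blast
        ultimately show ?thesis unfolding A_def by simp
      qed
      have gA: "\<bar>fdiffs h \<beta> g y\<bar> \<le> A + 2 * A / \<eta>" if \<beta>: "\<beta> \<in> weq \<Lambda> i" "i \<le> 3" and y: "y \<in> D" for \<beta> i y
      proof (cases "i \<le> 2")
        case True
        then have b2: "\<beta> \<in> wle \<Lambda> 2" using \<beta> by (auto simp: weq_def wle_def)
        have "\<bar>fdiffs h \<beta> f y\<bar> \<le> A0" using A0(2) y h b2 by blast
        then have "\<bar>fdiffs h \<beta> g y\<bar> \<le> A" using gf[OF b2 y] unfolding A_def by linarith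
        moreover have "0 \<le> 2 * A / \<eta>" using A \<eta> by simp
        ultimately show ?thesis by linarith
      next
        case False
        then obtain l' \<gamma> where b: "\<beta> = l' # \<gamma>" "l' \<in> \<Lambda>" "\<gamma> \<in> wle \<Lambda> 2"
          using \<beta> by (cases \<beta>) (auto simp: weq_def wle_def)
        have "\<bar>fdiff h l' (avgs h N L (fdiffs h \<gamma> f)) y\<bar> \<le> 2 * A / (real N * h)"
        proof (rule fdiff_avgs_bound[OF Nh(3) _ \<rho>L])
          show "\<bar>fdiffs h \<gamma> f y'\<bar> \<le> A" if "dist y y' \<le> h * real N * \<rho> * real (length L)" for y'
            using fA[OF b(3) y] that rad by simp
        qed (use h b L in auto)
        also have "\<dots> \<le> 2 * A / \<eta>" using A \<eta> Nh by (intro divide_left_mono) auto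
        also have "\<dots> \<le> A + 2 * A / \<eta>" using A by simp
        finally show ?thesis unfolding b(1) fdiffs_Cons g_def fdiffs_avgs fdiff_avgs .
      qed
      have g0: "- Fb \<le> g y \<and> g y \<le> 0" for y
      proof -
        have "avgs h N L f y \<in> {- Fb..0}"
          by (rule avgs_between[OF Nh(3) _ \<rho>L]) (use h f_bd f_neg less_imp_le in auto)
        then show ?thesis by (simp add: g_def)
      qed
      \<comment> \<open>Averaging preserves the bounds \<open>- Fb\<close> and 0, so the constant 0
        is a subsolution for the averaged data whatever the sign of \<open>q\<close>.\<close>
      have "(\<forall>x\<in>D. - Fb \<le> g x \<and> g x \<le> q x * 0) \<and> 0 \<le> (0::real) \<and> 0 \<le> \<kappa>m" using g0 \<kappa>m by simp
      from exh[THEN spec, THEN spec, THEN mp, OF this] obtain v where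
        v: "discrete_solution h g v" "\<forall>x\<in>D. 0 \<le> v x \<and> v x \<le> B'" by blast
      have vB: "\<bar>v y\<bar> \<le> B'" if "y \<in> D" for y using v(2) that by fastforce
      have vL: "Lh h v y + q y * v y = g y" if "y \<in> D" for y using v(1) that unfolding discrete_solution_def by blast
      have uL: "Lh h u y + q y * u y = f y" if "y \<in> D" for y using u that unfolding discrete_solution_def by blast
      have uB: "\<bar>u y\<bar> \<le> B" if "y \<in> D" for y using u that by blast
      define d where "d y = u y - v y" for y
      have dL: "Lh h d y + q y * d y = f y - g y" if "y \<in> D" for y
        using uL[OF that] vL[OF that] unfolding d_def[abs_def] Lh_diff by (simp add: algebra_simps)
      have gf0: "\<bar>f y - g y\<bar> \<le> e1" if "y \<in> D" for y
        using gf[of "[]" y] that by (simp add: wle_def abs_minus_commute)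
      \<comment> \<open>Both solutions take the values \<open>\<psi>\<close> outside
        \<open>D\<close>, hence the boundary contribution is 0.\<close>
      have "\<forall>x\<in>D. \<bar>d x\<bar> \<le> (4 * e1 + 0 / s) * Sm"
      proof (rule dh[THEN spec, THEN spec, THEN spec, THEN spec, THEN spec, THEN mp, of D e1 0 d "B + B'"], intro conjI ballI impI)
        fix y assume y: "y \<in> D"
        show "\<bar>Lh h d y + q y * d y\<bar> \<le> e1" unfolding dL[OF y] by (rule gf0[OF y])
        show "\<bar>d y\<bar> \<le> B + B'" using uB[OF y] vB[OF y] unfolding d_def by linarith
        fix l assume "y + h *\<^sub>R l \<notin> D"
        then have "u (y + h *\<^sub>R l) = \<psi> (y + h *\<^sub>R l)" "v (y + h *\<^sub>R l) = \<psi> (y + h *\<^sub>R l)"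
          using u v(1) unfolding discrete_solution_def by blast+
        then show "\<bar>d (y + h *\<^sub>R l)\<bar> \<le> 0" by (simp add: d_def)
      qed (use e1 in auto)
      then have dB0: "\<bar>d y\<bar> \<le> 4 * e1 * Sm" if "y \<in> D" for y using that by simp
      have "4 * e1 * Sm \<le> 4 * e1 * \<bar>Sm\<bar>" using e1(1) by (intro mult_left_mono) auto
      then have dB: "\<bar>d y\<bar> \<le> 4 * e1 * \<bar>Sm\<bar>" if "y \<in> D" for y using dB0[OF that] by linarith
      have "\<forall>y\<in>ball z (r/2). \<forall>j\<le>2. energy h j d y \<le> C2 * \<sigma>"
      proof (rule ih2[THEN spec, THEN spec, THEN spec, THEN spec, THEN mp, of z \<sigma> d "\<lambda>y. f y - g y"], intro conjI ballI allI impI)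
        fix y assume y: "y \<in> D"
        show "Lh h d y + q y * d y = f y - g y" by (rule dL[OF y])
        have "(d y)\<^sup>2 \<le> (4 * e1 * \<bar>Sm\<bar>)\<^sup>2" using dB[OF y] e1 by (intro power2_le_iff_abs_le[THEN iffD2]) auto
        then show "(d y)\<^sup>2 \<le> \<sigma>" using e1S by linarith
        fix i :: nat assume i: "i \<le> 2"
        have "(\<Sum>\<beta>\<in>weq \<Lambda> i. (fdiffs h \<beta> (\<lambda>y. f y - g y) y)\<^sup>2) \<le> real (card (wle \<Lambda> 2)) * e1\<^sup>2"
        proof (rule sum_weq_le[OF _ i])
          fix \<beta> assume "\<beta> \<in> weq \<Lambda> i"
          then have "\<beta> \<in> wle \<Lambda> 2" using i by (auto simp: weq_def wle_def)
          then show "\<bar>fdiffs h \<beta> (\<lambda>y. f y - g y) y\<bar> \<le> e1"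
            unfolding fdiffs_diff using gf y by (simp add: abs_minus_commute)
        qed
        then show "(\<Sum>\<beta>\<in>weq \<Lambda> i. (fdiffs h \<beta> (\<lambda>y. f y - g y) y)\<^sup>2) \<le> \<sigma>" using e1k unfolding k2_def by linarith
      qed (use \<sigma> z in auto)
      then have d2: "\<bar>fdiffs h \<alpha> d y\<bar> \<le> \<epsilon> / 3" if "y \<in> ball z (r/2)" for y
        using that \<sigma>(2) \<epsilon> by (intro fdiffs_le_sqrt[OF \<alpha>]) force+
      have "\<forall>y\<in>ball z (r/2). \<forall>j\<le>3. energy h j v y \<le> C3 * Sv"
      proof (rule ih3[THEN spec, THEN spec, THEN spec, THEN spec, THEN mp, of z Sv v g], intro conjI ballI allI impI)
        fix y assume y: "y \<in> D"
        show "Lh h v y + q y * v y = g y" by (rule vL[OF y])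
        have "(v y)\<^sup>2 \<le> B'\<^sup>2" using vB[OF y] by (intro power2_le_iff_abs_le[THEN iffD2]) auto
        then show "(v y)\<^sup>2 \<le> Sv" using Sv by linarith
        fix i :: nat assume i: "i \<le> 3"
        have "(\<Sum>\<beta>\<in>weq \<Lambda> i. (fdiffs h \<beta> g y)\<^sup>2) \<le> real (card (wle \<Lambda> 3)) * (A + 2 * A / \<eta>)\<^sup>2"
          by (rule sum_weq_le[OF gA[OF _ i y] i])
        then show "(\<Sum>\<beta>\<in>weq \<Lambda> i. (fdiffs h \<beta> g y)\<^sup>2) \<le> Sv" using Sv unfolding k3_def by linarith
      qed (use Sv z in auto)
      then have v3: "\<bar>fdiffs h \<beta> v y\<bar> \<le> H" if "y \<in> ball z (r/2)" "\<beta> \<in> weq \<Lambda> 3" for \<beta> y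
        using that H by (intro fdiffs_le_sqrt[OF that(2)]) auto
      have path: "x + (real i * h) *\<^sub>R l \<in> ball z (r/2)" if i: "i \<le> j" for i
      proof -
        have "real i * h \<le> real j * h" using i h by (intro mult_right_mono) auto
        then have "real i * h \<le> \<tau>" using j by linarith
        then have "norm ((real i * h) *\<^sub>R l) \<le> \<tau> * \<rho>" using h \<rho>(2)[OF l] \<tau>(1) by (simp add: mult_mono)
        then show ?thesis using x \<tau>(3) dist_triangle[of z "x + (real i * h) *\<^sub>R l" x] by (simp add: dist_norm)
      qed
      have la: "l # \<alpha> \<in> weq \<Lambda> 3" using l \<alpha> by (auto simp: weq_def)
      have "fdiffs h \<alpha> v (x + (real j * h) *\<^sub>R l) - fdiffs h \<alpha> v (x + (real 0 * h) *\<^sub>R l)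
          = (\<Sum>i<j. fdiffs h \<alpha> v (x + (real (Suc i) * h) *\<^sub>R l) - fdiffs h \<alpha> v (x + (real i * h) *\<^sub>R l))"
        unfolding sum_lessThan_telescope[of "\<lambda>i. fdiffs h \<alpha> v (x + (real i * h) *\<^sub>R l)"] ..
      also have "\<dots> = (\<Sum>i<j. h * fdiffs h (l # \<alpha>) v (x + (real i * h) *\<^sub>R l))"
      proof (rule sum.cong[OF refl])
        fix i
        have e: "x + (real (Suc i) * h) *\<^sub>R l = x + (real i * h) *\<^sub>R l + h *\<^sub>R l"
          by (simp add: algebra_simps)
        show "fdiffs h \<alpha> v (x + (real (Suc i) * h) *\<^sub>R l) - fdiffs h \<alpha> v (x + (real i * h) *\<^sub>R l)
            = h * fdiffs h (l # \<alpha>) v (x + (real i * h) *\<^sub>R l)"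
          unfolding fdiffs_Cons fdiff_def e using h by simp
      qed
      also have "\<bar>\<dots>\<bar> \<le> (\<Sum>i<j. h * H)"
        by (rule order_trans[OF sum_abs], rule sum_mono) (use h v3[OF path la] in \<open>simp add: abs_mult\<close>)
      also have "\<dots> = real j * h * H" by simp
      also have "\<dots> \<le> \<tau> * H" using j H by (intro mult_right_mono) auto
      also have "\<dots> \<le> \<epsilon> / 3" by (rule \<tau>(2))
      finally have vd: "\<bar>fdiffs h \<alpha> v (x + (real j * h) *\<^sub>R l) - fdiffs h \<alpha> v x\<bar> \<le> \<epsilon> / 3" by simp
      have ud: "fdiffs h \<alpha> u y = fdiffs h \<alpha> v y + fdiffs h \<alpha> d y" for y
        unfolding d_def[abs_def] fdiffs_diff by simp
      have "\<bar>fdiffs h \<alpha> d (x + (real j * h) *\<^sub>R l)\<bar> \<le> \<epsilon> / 3" by (rule d2[OF path]) simp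
      moreover have "\<bar>fdiffs h \<alpha> d x\<bar> \<le> \<epsilon> / 3" using d2[OF path[of 0]] by simp
      ultimately show "\<bar>fdiffs h \<alpha> u (x + (real j * h) *\<^sub>R l) - fdiffs h \<alpha> u x\<bar> \<le> \<epsilon>"
        unfolding ud using vd by linarith
    qed
  qed
qed

end

section \<open>Limits along dyadic meshes\<close>

text \<open>Tychonoff's theorem in a product of compact intervals. The index set is allowed to
  contain all points of the space, too many for a diagonal subsequence, so the limits are taken
  along a filter finer than \<open>sequentially\<close>.\<close>

lemma cluster_filter:
  fixes F :: "nat \<Rightarrow> 'i \<Rightarrow> real"
  assumes bd: "\<And>i. i \<in> I \<Longrightarrow> \<exists>B. \<forall>\<^sub>F n in sequentially. \<bar>F n i\<bar> \<le> B"
  shows "\<exists>G. G \<noteq> bot \<and> G \<le> sequentially \<and> (\<forall>i\<in>I. \<exists>L. ((\<lambda>n. F n i) \<longlongrightarrow> L) G)"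
proof -
  obtain B where B: "\<And>i. i \<in> I \<Longrightarrow> \<forall>\<^sub>F n in sequentially. \<bar>F n i\<bar> \<le> B i" using bd by metis
  \<comment> \<open>Each bound holds only from some \<open>n\<close> on, depending on
    \<open>i\<close>. Cutting off to 0 puts every \<open>F' n\<close> into the compact product and
    alters a coordinate in \<open>I\<close> for finitely many \<open>n\<close> only.\<close>
  define F' where "F' n i = (if i \<in> I \<and> \<bar>F n i\<bar> \<le> B i then F n i else 0)" for n i
  define P where "P = PiE UNIV (\<lambda>i::'i. {- \<bar>B i\<bar>..\<bar>B i\<bar>})"
  have "compactin (product_topology (\<lambda>i::'i. euclidean :: real topology) UNIV) P"
    unfolding P_def by (subst compactin_PiE) (simp add: compactin_euclidean_iff)
  then have comp: "compact P" unfolding euclidean_product_topology compactin_euclidean_iff .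
  have inP: "F' n \<in> P" for n unfolding P_def F'_def by (auto simp: PiE_def abs_le_iff)
  have "filtermap F' sequentially \<noteq> bot" by (simp add: filtermap_bot_iff)
  moreover have "eventually (\<lambda>x. x \<in> P) (filtermap F' sequentially)" using inP by (simp add: eventually_filtermap)
  ultimately obtain x where x: "inf (nhds x) (filtermap F' sequentially) \<noteq> bot"
    using comp unfolding compact_filter by blast
  \<comment> \<open>The pulled-back neighbourhoods of the cluster point, restricted to the tails of
    the sequence; clustering at \<open>x\<close> says precisely that this filter is proper.\<close>
  define G where "G = inf sequentially (filtercomap F' (nhds x))"
  have G: "G \<noteq> bot"
  proof
    assume "G = bot"
    then have "eventually (\<lambda>_. False) (inf sequentially (filtercomap F' (nhds x)))" unfolding G_def by simp
    then obtain Q R where QR: "eventually Q sequentially" "eventually R (filtercomap F' (nhds x))" "\<And>n. Q n \<and> R n \<Longrightarrow> False"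
      unfolding eventually_inf by auto
    obtain R' where R': "eventually R' (nhds x)" "\<And>n. R' (F' n) \<Longrightarrow> R n" using QR(2) unfolding eventually_filtercomap by blast
    have "eventually (\<lambda>y. \<not> R' y) (filtermap F' sequentially)"
      unfolding eventually_filtermap using QR(1) by (rule eventually_mono) (use QR(3) R'(2) in blast)
    then have "eventually (\<lambda>_. False) (inf (nhds x) (filtermap F' sequentially))"
      unfolding eventually_inf using R'(1) by blast
    then show False using x by (simp add: trivial_limit_def)
  qed
  have Gs: "G \<le> sequentially" by (simp add: G_def)
  have F'x: "filterlim F' (nhds x) G"
  proof -
    have "filterlim F' (nhds x) (filtercomap F' (nhds x))" by (rule filterlim_filtercomap)
    then show ?thesis unfolding G_def by (rule filterlim_mono) auto
  qed
  have "((\<lambda>n. F n i) \<longlongrightarrow> x i) G" if i: "i \<in> I" for i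
  proof -
    have "continuous_on UNIV (\<lambda>x::'i \<Rightarrow> real. x i)" by (rule continuous_on_product_coordinates)
    then have "((\<lambda>n. F' n i) \<longlongrightarrow> x i) G"
      by (rule continuous_on_tendsto_compose[OF _ F'x]) auto
    moreover have "\<forall>\<^sub>F n in G. F' n i = F n i"
      using filter_leD[OF Gs B[OF i]] by (rule eventually_mono) (simp add: F'_def i)
    ultimately show ?thesis by (rule Lim_transform_eventually)
  qed
  then show ?thesis using G Gs by blast
qed

section \<open>Differentiability tested along dyadic steps\<close>

lemma dyadic_approx:
  fixes t :: real
  assumes t: "0 < t"
  shows "\<exists>a. a \<longlonglongrightarrow> t \<and> (\<forall>\<^sub>F k in sequentially. 0 < a k \<and> a k \<le> t \<and> (\<exists>m j. a k = real m / 2 ^ j))"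
proof -
  define a where "a k = real (nat \<lfloor>t * 2 ^ k\<rfloor>) / 2 ^ k" for k :: nat
  have bounds: "t - (1/2) ^ k \<le> a k \<and> a k \<le> t" for k
  proof -
    have nn: "0 \<le> \<lfloor>t * 2 ^ k\<rfloor>" using t by simp
    have "real (nat \<lfloor>t * 2 ^ k\<rfloor>) \<le> t * 2 ^ k" "t * 2 ^ k - 1 \<le> real (nat \<lfloor>t * 2 ^ k\<rfloor>)"
      using nn by (simp_all add: of_nat_nat)
    then have "real (nat \<lfloor>t * 2 ^ k\<rfloor>) / 2 ^ k \<le> t * 2 ^ k / 2 ^ k" "(t * 2 ^ k - 1) / 2 ^ k \<le> real (nat \<lfloor>t * 2 ^ k\<rfloor>) / 2 ^ k"
      by (intro divide_right_mono; simp)+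
    moreover have "(t * 2 ^ k - 1) / 2 ^ k = t - (1/2) ^ k" by (simp add: diff_divide_distrib power_one_over)
    ultimately show ?thesis by (simp add: a_def)
  qed
  have l1: "(\<lambda>k. t - (1/2) ^ k) \<longlonglongrightarrow> t - 0" by (intro tendsto_intros LIMSEQ_power_zero) simp
  have lim: "a \<longlonglongrightarrow> t"
  proof (rule tendsto_sandwich)
    show "(\<lambda>k. t - (1/2) ^ k) \<longlonglongrightarrow> t" using l1 by simp
    show "(\<lambda>_::nat. t) \<longlonglongrightarrow> t" by simp
  qed (use bounds in auto)
  have "\<forall>\<^sub>F k in sequentially. 0 < a k" using order_tendstoD(1)[OF lim t] .
  then show ?thesis using lim bounds
    by (intro exI[of _ a] conjI) (auto elim!: eventually_mono simp: a_def)
qed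

text \<open>Only forward steps of dyadic length are tested, those visible on all fine meshes.
  Uniformity in the base point \<open>y\<close> compensates: with \<open>u\<close> continuous it
  gives all step lengths, continuity of \<open>g\<close>, and from these the backward steps.\<close>

definition dyadic_differentiable :: "'a::real_normed_vector set \<Rightarrow> 'a \<Rightarrow> ('a \<Rightarrow> real) \<Rightarrow> ('a \<Rightarrow> real) \<Rightarrow> bool" where
  "dyadic_differentiable W l u g \<longleftrightarrow> (\<forall>x\<in>W. \<forall>\<epsilon>>0. \<exists>r>0. \<forall>y\<in>ball x r. \<forall>m j. let t = real m / 2 ^ j in 0 < t \<and> t < r \<longrightarrow>
     \<bar>u (y + t *\<^sub>R l) - u y - t * g y\<bar> \<le> \<epsilon> * t)"

lemma dyadic_differentiable_real:
  assumes W: "open W" and u: "continuous_on W u" and dy: "dyadic_differentiable W l u g" and x: "x \<in> W" and \<epsilon>: "0 < \<epsilon>"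
  shows "\<exists>r>0. \<forall>y\<in>ball x r. \<forall>t. 0 < t \<and> t < r \<longrightarrow> y \<in> W \<and> y + t *\<^sub>R l \<in> W \<and> \<bar>u (y + t *\<^sub>R l) - u y - t * g y\<bar> \<le> \<epsilon> * t"
proof -
  obtain r1 where r1: "0 < r1" "\<forall>y\<in>ball x r1. \<forall>m j. let t = real m / 2 ^ j in 0 < t \<and> t < r1 \<longrightarrow>
     \<bar>u (y + t *\<^sub>R l) - u y - t * g y\<bar> \<le> \<epsilon> * t"
    using dy x \<epsilon> unfolding dyadic_differentiable_def by blast
  obtain r2 where r2: "0 < r2" "ball x r2 \<subseteq> W" using W x open_contains_ball by blast
  define r where "r = min r1 (r2 / (1 + norm l))"
  have den: "0 < 1 + norm l" by (simp add: add_pos_nonneg)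
  have r: "0 < r" "r \<le> r1" "r * (1 + norm l) \<le> r2"
  proof -
    show "0 < r" "r \<le> r1" using r1 r2 den by (auto simp: r_def)
    have "r \<le> r2 / (1 + norm l)" by (simp add: r_def)
    then show "r * (1 + norm l) \<le> r2" using den by (simp add: pos_le_divide_eq)
  qed
  have inW: "y + t *\<^sub>R l \<in> W" if y: "y \<in> ball x r" and t: "0 \<le> t" "t < r" for y t
  proof -
    have "norm (t *\<^sub>R l) \<le> r * norm l" using t by (simp add: mult_right_mono)
    then have "dist x (y + t *\<^sub>R l) < r + r * norm l"
      using dist_triangle[of x "y + t *\<^sub>R l" y] y by (simp add: dist_norm)
    then have "y + t *\<^sub>R l \<in> ball x r2" using r(3) by (simp add: algebra_simps)
    then show ?thesis using r2 by blast
  qed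
  show ?thesis
  proof (intro exI[of _ r] conjI ballI allI impI r(1))
    fix y t assume y: "y \<in> ball x r" and t: "0 < t \<and> t < r"
    show "y \<in> W" using inW[OF y, of 0] r by simp
    show ytW: "y + t *\<^sub>R l \<in> W" using inW[OF y] t by simp
    obtain a where a: "a \<longlonglongrightarrow> t" "\<forall>\<^sub>F k in sequentially. 0 < a k \<and> a k \<le> t \<and> (\<exists>m j. a k = real m / 2 ^ j)"
      using dyadic_approx t by blast
    have ev: "\<forall>\<^sub>F k in sequentially. \<bar>u (y + a k *\<^sub>R l) - u y - a k * g y\<bar> \<le> \<epsilon> * a k"
      using a(2)
    proof (rule eventually_mono)
      fix k assume *: "0 < a k \<and> a k \<le> t \<and> (\<exists>m j. a k = real m / 2 ^ j)"
      then obtain m j where mj: "a k = real m / 2 ^ j" by blast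
      have "y \<in> ball x r1" using y r by auto
      then show "\<bar>u (y + a k *\<^sub>R l) - u y - a k * g y\<bar> \<le> \<epsilon> * a k"
        using r1(2)[rule_format, of y m j] * t r unfolding mj Let_def by auto
    qed
    have "isCont u (y + t *\<^sub>R l)" using u W ytW continuous_on_eq_continuous_at by blast
    moreover have "(\<lambda>k. y + a k *\<^sub>R l) \<longlonglongrightarrow> y + t *\<^sub>R l" by (intro tendsto_intros a)
    ultimately have "(\<lambda>k. u (y + a k *\<^sub>R l)) \<longlonglongrightarrow> u (y + t *\<^sub>R l)" by (rule isCont_tendsto_compose)
    then have L1: "(\<lambda>k. \<bar>u (y + a k *\<^sub>R l) - u y - a k * g y\<bar>) \<longlonglongrightarrow> \<bar>u (y + t *\<^sub>R l) - u y - t * g y\<bar>"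
      by (intro tendsto_intros a)
    have L2: "(\<lambda>k. \<epsilon> * a k) \<longlonglongrightarrow> \<epsilon> * t" by (intro tendsto_intros a)
    show "\<bar>u (y + t *\<^sub>R l) - u y - t * g y\<bar> \<le> \<epsilon> * t"
      by (rule tendsto_le[OF sequentially_bot L2 L1 ev])
  qed
qed

text \<open>Near \<open>x\<close> the function \<open>g\<close> is uniformly close to the difference
  quotient with one fixed step, and this quotient is continuous there.\<close>

lemma dyadic_differentiable_continuous:
  assumes W: "open W" and u: "continuous_on W u" and dy: "dyadic_differentiable W l u g"
  shows "continuous_on W g"
  unfolding continuous_on_eq_continuous_at[OF W]
proof
  fix x assume x: "x \<in> W"
  show "isCont g x" unfolding continuous_at_eps_delta
  proof (intro allI impI)
    fix \<epsilon> :: real assume \<epsilon>: "0 < \<epsilon>"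
    then have e4: "0 < \<epsilon> / 4" by simp
    obtain r where r: "0 < r" and H: "\<And>y t. y \<in> ball x r \<Longrightarrow> 0 < t \<Longrightarrow> t < r \<Longrightarrow>
        y \<in> W \<and> y + t *\<^sub>R l \<in> W \<and> \<bar>u (y + t *\<^sub>R l) - u y - t * g y\<bar> \<le> \<epsilon> / 4 * t"
      using dyadic_differentiable_real[OF W u dy x e4] by blast
    define t where "t = r / 2"
    have t: "0 < t" "t < r" using r by (auto simp: t_def)
    have Hx: "x + t *\<^sub>R l \<in> W" using H[of x t] r t by simp
    have "isCont u (x + t *\<^sub>R l)" "isCont u x" using u W Hx x continuous_on_eq_continuous_at by blast+
    then have "isCont (\<lambda>y. u (y + t *\<^sub>R l) - u y) x"
      by (intro continuous_intros isCont_o2[of x "\<lambda>y. y + t *\<^sub>R l" u]) auto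
    moreover have "0 < \<epsilon> / 4 * t" using \<epsilon> t by simp
    ultimately obtain d where d: "0 < d" "\<And>y. dist y x < d \<Longrightarrow>
       dist (u (y + t *\<^sub>R l) - u y) (u (x + t *\<^sub>R l) - u x) < \<epsilon> / 4 * t"
      unfolding continuous_at_eps_delta by blast
    show "\<exists>d>0. \<forall>y. dist y x < d \<longrightarrow> dist (g y) (g x) < \<epsilon>"
    proof (intro exI[of _ "min d r"] conjI allI impI)
      fix y assume y: "dist y x < min d r"
      have 1: "\<bar>u (y + t *\<^sub>R l) - u y - t * g y\<bar> \<le> \<epsilon> / 4 * t" using H[of y t] y t by (simp add: dist_commute)
      have 2: "\<bar>u (x + t *\<^sub>R l) - u x - t * g x\<bar> \<le> \<epsilon> / 4 * t" using H[of x t] r t by simp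
      have 3: "\<bar>(u (y + t *\<^sub>R l) - u y) - (u (x + t *\<^sub>R l) - u x)\<bar> < \<epsilon> / 4 * t" using d(2)[of y] y by (simp add: dist_real_def)
      have "\<bar>t * g y - t * g x\<bar> < 3 * (\<epsilon> / 4 * t)" using 1 2 3 by linarith
      also have "\<dots> \<le> t * \<epsilon>" using t \<epsilon> by (simp add: field_simps)
      finally have "t * \<bar>g y - g x\<bar> < t * \<epsilon>" using t by (simp add: right_diff_distrib[symmetric] abs_mult)
      then show "dist (g y) (g x) < \<epsilon>" using t by (simp add: dist_real_def)
    qed (use d r in auto)
  qed
qed

text \<open>A backward step from \<open>x\<close> is a forward step from the displaced point
  \<open>y = x + s *\<^sub>R l\<close>, and \<open>g y\<close> is close to \<open>g x\<close> by
  continuity.\<close>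

lemma dyadic_differentiable_deriv:
  assumes W: "open W" and u: "continuous_on W u" and dy: "dyadic_differentiable W l u g" and x: "x \<in> W"
  shows "((\<lambda>t. u (x + t *\<^sub>R l)) has_real_derivative g x) (at 0)"
  unfolding has_field_derivative_def has_derivative_at_alt
proof (intro conjI bounded_linear_mult_right allI impI)
  fix \<epsilon> :: real assume \<epsilon>: "0 < \<epsilon>"
  then have e2: "0 < \<epsilon> / 2" by simp
  obtain r where r: "0 < r" and H: "\<And>y t. y \<in> ball x r \<Longrightarrow> 0 < t \<Longrightarrow> t < r \<Longrightarrow>
        y \<in> W \<and> y + t *\<^sub>R l \<in> W \<and> \<bar>u (y + t *\<^sub>R l) - u y - t * g y\<bar> \<le> \<epsilon> / 2 * t"
    using dyadic_differentiable_real[OF W u dy x e2] by blast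
  have "isCont g x" using dyadic_differentiable_continuous[OF W u dy] W x continuous_on_eq_continuous_at by blast
  then obtain d where d: "0 < d" "\<And>y. dist y x < d \<Longrightarrow> dist (g y) (g x) < \<epsilon> / 2"
    unfolding continuous_at_eps_delta using e2 by blast
  define \<delta> where "\<delta> = min r (min d r / (1 + norm l))"
  have den: "0 < 1 + norm l" by (simp add: add_pos_nonneg)
  have \<delta>: "0 < \<delta>" "\<delta> \<le> r" "\<delta> * (1 + norm l) \<le> min d r"
  proof -
    show "0 < \<delta>" "\<delta> \<le> r" using r d den by (auto simp: \<delta>_def)
    have "\<delta> \<le> min d r / (1 + norm l)" by (simp add: \<delta>_def)
    then show "\<delta> * (1 + norm l) \<le> min d r" using den by (simp only: pos_le_divide_eq)
  qed
  show "\<exists>d>0. \<forall>s. norm (s - 0) < d \<longrightarrow> norm (u (x + s *\<^sub>R l) - u (x + 0 *\<^sub>R l) - g x * (s - 0)) \<le> \<epsilon> * norm (s - 0)"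
  proof (intro exI[of _ \<delta>] conjI allI impI \<delta>(1))
    fix s :: real assume s: "norm (s - 0) < \<delta>"
    consider "s = 0" | "0 < s" | "s < 0" by linarith
    then have "\<bar>u (x + s *\<^sub>R l) - u x - g x * s\<bar> \<le> \<epsilon> * \<bar>s\<bar>"
    proof cases
      case 2
      have "\<bar>u (x + s *\<^sub>R l) - u x - s * g x\<bar> \<le> \<epsilon> / 2 * s" using H[of x s] 2 s \<delta> r by simp
      moreover have "0 \<le> \<epsilon> / 2 * s" using 2 \<epsilon> by simp
      ultimately show ?thesis using 2 by (simp add: mult.commute)
    next
      case 3
      define y where "y = x + s *\<^sub>R l"
      have "dist y x \<le> \<bar>s\<bar> * norm l" by (simp add: y_def dist_norm)
      also have "\<dots> \<le> \<delta> * norm l" using s by (intro mult_right_mono) auto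
      also have "\<dots> < min d r" using \<delta>(1,3) by (simp add: distrib_left)
      finally have yx: "dist y x < d" "y \<in> ball x r" by (auto simp: dist_commute)
      have yt: "y + (- s) *\<^sub>R l = x" by (simp add: y_def)
      have "\<bar>u (y + (- s) *\<^sub>R l) - u y - (- s) * g y\<bar> \<le> \<epsilon> / 2 * (- s)" using H[OF yx(2), of "- s"] 3 s \<delta> by simp
      then have 1: "\<bar>u x - u y + s * g y\<bar> \<le> \<epsilon> / 2 * (- s)" unfolding yt by simp
      have "\<bar>s * (g y - g x)\<bar> \<le> (- s) * (\<epsilon> / 2)"
        unfolding abs_mult using d(2)[OF yx(1)] 3 by (intro mult_mono) (auto simp: dist_real_def)
      then have 2: "\<bar>s * g y - s * g x\<bar> \<le> (- s) * (\<epsilon> / 2)" by (simp add: right_diff_distrib)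
      have "\<bar>u y - u x - s * g x\<bar> \<le> \<epsilon> / 2 * (- s) + (- s) * (\<epsilon> / 2)" using 1 2 by linarith
      also have "\<dots> = \<epsilon> * \<bar>s\<bar>" using 3 by simp
      finally show ?thesis by (simp add: y_def mult.commute)
    qed simp
    then show "norm (u (x + s *\<^sub>R l) - u (x + 0 *\<^sub>R l) - g x * (s - 0)) \<le> \<epsilon> * norm (s - 0)" by simp
  qed
qed

text \<open>The increment is built up one coordinate at a time; each stage is estimated by the mean
  value inequality for \<open>u (z + s *\<^sub>R j) - s * g j x\<close>, whose derivative in
  \<open>s\<close> is small near \<open>x\<close>.\<close>

lemma has_derivative_continuous_partials:
  fixes u :: "'a::euclidean_space \<Rightarrow> real"
  assumes W: "open W" and x: "x \<in> W"
    and der: "\<And>i y. i \<in> Basis \<Longrightarrow> y \<in> W \<Longrightarrow> ((\<lambda>t. u (y + t *\<^sub>R i)) has_real_derivative g i y) (at 0)"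
    and cont: "\<And>i. i \<in> Basis \<Longrightarrow> continuous_on W (g i)"
  shows "(u has_derivative (\<lambda>v. \<Sum>i\<in>Basis. (v \<bullet> i) * g i x)) (at x)"
  unfolding has_derivative_at_alt
proof (intro conjI allI impI)
  show "bounded_linear (\<lambda>v. \<Sum>i\<in>Basis. (v \<bullet> i) * g i x)"
    by (intro bounded_linear_sum bounded_linear_mult_const bounded_linear_inner_left)
  fix \<epsilon> :: real assume \<epsilon>: "0 < \<epsilon>"
  define n where "n = real DIM('a)"
  have n: "0 < n" by (simp add: n_def)
  define e where "e = \<epsilon> / n"
  have e: "0 < e" using \<epsilon> n by (simp add: e_def)
  obtain r0 where r0: "0 < r0" "ball x r0 \<subseteq> W" using W x open_contains_ball by blast
  have "\<forall>\<^sub>F r in at_right 0. \<forall>i\<in>Basis. \<forall>y\<in>ball x r. \<bar>g i y - g i x\<bar> \<le> e"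
  proof (rule eventually_ball_finite[OF finite_Basis], rule ballI)
    fix i :: 'a assume i: "i \<in> Basis"
    have "isCont (g i) x" using cont[OF i] W x continuous_on_eq_continuous_at by blast
    then obtain d where d: "0 < d" "\<And>y. dist y x < d \<Longrightarrow> dist (g i y) (g i x) < e"
      unfolding continuous_at_eps_delta using e by blast
    have "\<bar>g i y - g i x\<bar> \<le> e" if "r < d" "y \<in> ball x r" for r y
      using d(2)[of y] that by (simp add: dist_real_def dist_commute)
    then show "\<forall>\<^sub>F r in at_right 0. \<forall>y\<in>ball x r. \<bar>g i y - g i x\<bar> \<le> e"
      unfolding eventually_at_right_field using d(1) by blast
  qed
  then obtain r1 where r1: "0 < r1" "\<And>r. 0 < r \<Longrightarrow> r < r1 \<Longrightarrow> \<forall>i\<in>Basis. \<forall>y\<in>ball x r. \<bar>g i y - g i x\<bar> \<le> e"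
    unfolding eventually_at_right_field by blast
  define r where "r = min r0 (r1 / 2)"
  have r: "0 < r" "r \<le> r0" "r < r1" using r0 r1 by (auto simp: r_def)
  have gr: "\<bar>g i y - g i x\<bar> \<le> e" if "i \<in> Basis" "y \<in> ball x r" for i y using r1(2)[OF r(1,3)] that by blast
  have rW: "y \<in> W" if "y \<in> ball x r" for y using that r(2) r0(2) by auto
  show "\<exists>d>0. \<forall>y. norm (y - x) < d \<longrightarrow> norm (u y - u x - (\<Sum>i\<in>Basis. ((y - x) \<bullet> i) * g i x)) \<le> \<epsilon> * norm (y - x)"
  proof (intro exI[of _ "r / n"] conjI allI impI)
    show "0 < r / n" using r n by simp
    fix y assume y: "norm (y - x) < r / n"
    define v where "v = y - x"
    \<comment> \<open>Intermediate points differ from \<open>x\<close> by at most \<open>n\<close>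
      summands of norm at most \<open>norm v\<close> each, which is why the radius \<open>r\<close>
      is divided by the dimension \<open>n\<close>.\<close>
    have nv: "n * norm v < r" using y n by (simp add: v_def field_simps)
    have part: "\<bar>u (x + (\<Sum>i\<in>A. (v \<bullet> i) *\<^sub>R i)) - u x - (\<Sum>i\<in>A. (v \<bullet> i) * g i x)\<bar> \<le> (\<Sum>i\<in>A. e * \<bar>v \<bullet> i\<bar>)"
      if "A \<subseteq> Basis" for A
      using finite_subset[OF that finite_Basis] that
    proof (induction A rule: finite_induct)
      case empty
      then show ?case by simp
    next
      case (insert j A)
      then have j: "j \<in> Basis" by simp
      define z where "z = x + (\<Sum>i\<in>A. (v \<bullet> i) *\<^sub>R i)"
      let ?a = "v \<bullet> j"
      have zs: "z + s *\<^sub>R j \<in> ball x r" if s: "\<bar>s\<bar> \<le> \<bar>?a\<bar>" for s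
      proof -
        have "norm ((\<Sum>i\<in>A. (v \<bullet> i) *\<^sub>R i) + s *\<^sub>R j) \<le> (\<Sum>i\<in>A. norm ((v \<bullet> i) *\<^sub>R i)) + norm (s *\<^sub>R j)"
          by (intro order_trans[OF norm_triangle_ineq] add_mono norm_sum) auto
        also have "\<dots> \<le> (\<Sum>i\<in>A. norm v) + norm v"
        proof (intro add_mono sum_mono)
          fix i assume "i \<in> A"
          then show "norm ((v \<bullet> i) *\<^sub>R i) \<le> norm v"
            using Basis_le_norm[of i v] insert.prems by auto
        next
          show "norm (s *\<^sub>R j) \<le> norm v"
            using s Basis_le_norm[OF j, of v] j by simp
        qed
        also have "\<dots> = real (card (insert j A)) * norm v" using insert by (simp add: algebra_simps)
        also have "\<dots> \<le> n * norm v"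
          unfolding n_def using insert.prems by (intro mult_right_mono) (auto intro!: card_mono)
        finally have *: "norm ((\<Sum>i\<in>A. (v \<bullet> i) *\<^sub>R i) + s *\<^sub>R j) < r" using nv by linarith
        have "x - (z + s *\<^sub>R j) = - ((\<Sum>i\<in>A. (v \<bullet> i) *\<^sub>R i) + s *\<^sub>R j)" by (simp add: z_def)
        then have "dist x (z + s *\<^sub>R j) = norm ((\<Sum>i\<in>A. (v \<bullet> i) *\<^sub>R i) + s *\<^sub>R j)"
          unfolding dist_norm by (simp only: norm_minus_cancel)
        then show ?thesis using * by simp
      qed
      have "norm ((u (z + ?a *\<^sub>R j) - ?a * g j x) - (u (z + 0 *\<^sub>R j) - 0 * g j x)) \<le> e * norm (?a - 0)"
      proof (rule field_differentiable_bound[of "closed_segment 0 ?a" "\<lambda>s. u (z + s *\<^sub>R j) - s * g j x" "\<lambda>s. g j (z + s *\<^sub>R j) - g j x"])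
        fix s assume "s \<in> closed_segment 0 ?a"
        then have s: "\<bar>s\<bar> \<le> \<bar>?a\<bar>" by (auto simp: closed_segment_eq_real_ivl split: if_splits)
        have "((\<lambda>t. u ((z + s *\<^sub>R j) + t *\<^sub>R j)) has_real_derivative g j (z + s *\<^sub>R j)) (at 0)"
          by (rule der[OF j rW[OF zs[OF s]]])
        then have "((\<lambda>t. u (z + (t + s) *\<^sub>R j)) has_real_derivative g j (z + s *\<^sub>R j)) (at 0)"
          by (simp add: scaleR_add_left add_ac)
        then have "((\<lambda>t. u (z + t *\<^sub>R j)) has_real_derivative g j (z + s *\<^sub>R j)) (at (0 + s))"
          using DERIV_shift[of "\<lambda>t. u (z + t *\<^sub>R j)" _ 0 s] by simp
        then have D: "((\<lambda>t. u (z + t *\<^sub>R j)) has_real_derivative g j (z + s *\<^sub>R j)) (at s)" by simp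
        show "((\<lambda>s. u (z + s *\<^sub>R j) - s * g j x) has_real_derivative g j (z + s *\<^sub>R j) - g j x) (at s within closed_segment 0 ?a)"
          by (rule has_field_derivative_at_within) (auto intro!: derivative_eq_intros D)
        show "norm (g j (z + s *\<^sub>R j) - g j x) \<le> e" using gr[OF j zs[OF s]] by simp
      qed auto
      then have 1: "\<bar>u (z + ?a *\<^sub>R j) - u z - ?a * g j x\<bar> \<le> e * \<bar>?a\<bar>" by (simp add: algebra_simps)
      have 2: "\<bar>u z - u x - (\<Sum>i\<in>A. (v \<bullet> i) * g i x)\<bar> \<le> (\<Sum>i\<in>A. e * \<bar>v \<bullet> i\<bar>)"
        unfolding z_def using insert by simp
      have 3: "x + (\<Sum>i\<in>insert j A. (v \<bullet> i) *\<^sub>R i) = z + ?a *\<^sub>R j" using insert by (simp add: z_def add_ac)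
      show ?case unfolding 3 using 1 2 insert by simp
    qed
    have "\<bar>u y - u x - (\<Sum>i\<in>Basis. (v \<bullet> i) * g i x)\<bar> \<le> (\<Sum>i\<in>(Basis::'a set). e * \<bar>v \<bullet> i\<bar>)"
      using part[of Basis] by (simp add: euclidean_representation v_def)
    also have "\<dots> \<le> (\<Sum>i\<in>(Basis::'a set). e * norm v)"
      using e by (intro sum_mono mult_left_mono Basis_le_norm) auto
    also have "\<dots> = \<epsilon> * norm v" using n by (simp add: e_def n_def)
    finally show "norm (u y - u x - (\<Sum>i\<in>Basis. ((y - x) \<bullet> i) * g i x)) \<le> \<epsilon> * norm (y - x)" by (simp add: v_def)
  qed
qed

lemma dd_eq_directional:
  fixes u :: "'a::real_normed_vector \<Rightarrow> real"
  assumes u: "(u has_derivative frechet_derivative u (at x)) (at x)"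
    and d: "((\<lambda>t. u (x + t *\<^sub>R l)) has_real_derivative g) (at 0)"
  shows "dd l u x = g"
proof -
  have "((\<lambda>t. x + t *\<^sub>R l) has_derivative (\<lambda>s. s *\<^sub>R l)) (at 0)" by (auto intro!: derivative_eq_intros)
  moreover have "(u has_derivative frechet_derivative u (at x)) (at (x + 0 *\<^sub>R l))" using u by simp
  ultimately have "((\<lambda>t. u (x + t *\<^sub>R l)) has_derivative (\<lambda>s. frechet_derivative u (at x) (s *\<^sub>R l))) (at 0)"
    by (rule has_derivative_compose)
  moreover have "frechet_derivative u (at x) (s *\<^sub>R l) = dd l u x * s" for s
    using u has_derivative_linear linear_cmul[of "frechet_derivative u (at x)" s l] by fastforce
  ultimately have "((\<lambda>t. u (x + t *\<^sub>R l)) has_real_derivative dd l u x) (at 0)"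
    by (simp add: has_field_derivative_def)
  then show ?thesis using d by (rule DERIV_unique)
qed

lemma Ck_on_2_dyadic:
  fixes u :: "'a::euclidean_space \<Rightarrow> real"
  assumes W: "open W" and \<Lambda>: "Basis \<subseteq> \<Lambda>" and u: "continuous_on W u"
    and g: "\<And>l. l \<in> \<Lambda> \<Longrightarrow> dyadic_differentiable W l u (g l)"
    and G: "\<And>l m. l \<in> \<Lambda> \<Longrightarrow> m \<in> \<Lambda> \<Longrightarrow> dyadic_differentiable W m (g l) (G m l)"
  shows "Ck_on 2 W u"
    and "\<And>x l. x \<in> W \<Longrightarrow> l \<in> \<Lambda> \<Longrightarrow> dd l u x = g l x"
    and "\<And>x l m. x \<in> W \<Longrightarrow> l \<in> \<Lambda> \<Longrightarrow> m \<in> \<Lambda> \<Longrightarrow> dd m (\<lambda>y. dd l u y) x = G m l x"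
proof -
  have gc: "continuous_on W (g l)" if "l \<in> \<Lambda>" for l
    by (rule dyadic_differentiable_continuous[OF W u g[OF that]])
  have Gc: "continuous_on W (G m l)" if "l \<in> \<Lambda>" "m \<in> \<Lambda>" for l m
    by (rule dyadic_differentiable_continuous[OF W gc[OF that(1)] G[OF that]])
  have BL: "i \<in> \<Lambda>" if "i \<in> Basis" for i using that \<Lambda> by blast
  have du: "(u has_derivative (\<lambda>v. \<Sum>i\<in>Basis. (v \<bullet> i) * g i x)) (at x)" if x: "x \<in> W" for x
    by (rule has_derivative_continuous_partials[OF W x dyadic_differentiable_deriv[OF W u g] gc]) (auto intro: BL)
  have dg: "(g l has_derivative (\<lambda>v. \<Sum>i\<in>Basis. (v \<bullet> i) * G i l x)) (at x)" if x: "x \<in> W" and l: "l \<in> \<Lambda>" for x l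
    by (rule has_derivative_continuous_partials[OF W x dyadic_differentiable_deriv[OF W gc[OF l] G[OF l]] Gc[OF l]]) (auto intro: BL)
  have self: "(w has_derivative frechet_derivative w (at x)) (at x)" if "(w has_derivative w') (at x)"
    for w :: "'a \<Rightarrow> real" and w' x
    using that frechet_derivative_at by metis
  show ddu: "dd l u x = g l x" if x: "x \<in> W" and l: "l \<in> \<Lambda>" for x l
    by (rule dd_eq_directional[OF self[OF du[OF x]] dyadic_differentiable_deriv[OF W u g[OF l] x]])
  show "dd m (\<lambda>y. dd l u y) x = G m l x" if x: "x \<in> W" and l: "l \<in> \<Lambda>" and m: "m \<in> \<Lambda>" for x l m
  proof -
    have "dd m (\<lambda>y. dd l u y) x = dd m (g l) x" by (rule dd_cong[OF W x]) (rule ddu[OF _ l])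
    also have "\<dots> = G m l x"
      by (rule dd_eq_directional[OF self[OF dg[OF x l]] dyadic_differentiable_deriv[OF W gc[OF l] G[OF l m] x]])
    finally show ?thesis .
  qed
  have g1: "Ck_on (Suc 0) W (g l)" if l: "l \<in> \<Lambda>" for l
    by (rule Ck_on_SucI[OF W dg[OF _ l]]) (use l BL in \<open>auto intro!: continuous_intros Gc\<close>)
  have "Ck_on (Suc (Suc 0)) W u"
  proof (rule Ck_on_SucI[OF W du])
    fix v show "Ck_on (Suc 0) W (\<lambda>x. \<Sum>i\<in>Basis. (v \<bullet> i) * g i x)"
      by (intro Ck_on_sum[OF W finite_Basis] Ck_on_mult[OF W] Ck_on_const[OF W] g1 BL)
  qed
  then show "Ck_on 2 W u" by (simp add: numeral_2_eq_2)
qed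

text \<open>Telescoping: each of the \<open>k\<close> steps contributes \<open>h\<close> times a
  first difference that is within \<open>e\<close> of the one at the starting point.\<close>

lemma discrete_taylor:
  fixes w :: "'a::real_vector \<Rightarrow> real"
  assumes h: "0 < h" and e: "\<And>i. i < k \<Longrightarrow> \<bar>fdiff h l w (y + (real i * h) *\<^sub>R l) - fdiff h l w y\<bar> \<le> e"
  shows "\<bar>w (y + (real k * h) *\<^sub>R l) - w y - (real k * h) * fdiff h l w y\<bar> \<le> e * (real k * h)"
  using e
proof (induction k)
  case 0
  then show ?case by simp
next
  case (Suc k)
  let ?z = "y + (real k * h) *\<^sub>R l"
  have e1: "y + (real (Suc k) * h) *\<^sub>R l = ?z + h *\<^sub>R l" by (simp add: algebra_simps)
  have 1: "\<bar>w ?z - w y - (real k * h) * fdiff h l w y\<bar> \<le> e * (real k * h)" using Suc by simp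
  have 2: "w (?z + h *\<^sub>R l) = w ?z + h * fdiff h l w ?z" using h by (simp add: fdiff_def)
  have "h * \<bar>fdiff h l w ?z - fdiff h l w y\<bar> \<le> h * e" using Suc.prems[of k] h by (intro mult_left_mono) auto
  then have 3: "\<bar>h * fdiff h l w ?z - h * fdiff h l w y\<bar> \<le> h * e"
    using h by (simp add: right_diff_distrib[symmetric] abs_mult)
  have "\<bar>w (?z + h *\<^sub>R l) - w y - (real k * h) * fdiff h l w y - h * fdiff h l w y\<bar> \<le> e * (real k * h) + h * e"
    unfolding 2 using 1 3 by linarith
  then show ?case unfolding e1 by (simp add: algebra_simps)
qed

lemma filterlim_half_power: "filterlim (\<lambda>n. (1/2::real) ^ n) (at_right 0) sequentially"
  unfolding filterlim_at_right_to_0 filterlim_at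
  by (auto intro!: LIMSEQ_power_zero)

section \<open>Passage to the limit\<close>

context dirichlet_problem
begin

lemma difference_bounds:
  assumes r: "0 < r" and B: "0 < B"
  shows "\<exists>H\<ge>0. \<forall>\<^sub>F h in at_right 0. \<forall>u. discrete_solution h f u \<and> (\<forall>x\<in>D. \<bar>u x\<bar> \<le> B) \<longrightarrow>
     (\<forall>z. ball z r \<subseteq> D \<longrightarrow> (\<forall>x\<in>ball z (r/2). \<forall>\<alpha>\<in>wle \<Lambda> 2. \<bar>fdiffs h \<alpha> u x\<bar> \<le> H))"
proof -
  have two_le: "(2::nat) \<le> 3" by simp
  obtain C where C: "C \<ge> 0" and iev: "\<forall>\<^sub>F h in at_right 0. \<forall>z u f S. ball z r \<subseteq> D \<and> 0 < S \<and>
     (\<forall>x\<in>D. Lh h u x + q x * u x = f x \<and> (u x)\<^sup>2 \<le> S \<and>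
        (\<forall>j\<le>2. (\<Sum>\<alpha>\<in>weq \<Lambda> j. (fdiffs h \<alpha> f x)\<^sup>2) \<le> S)) \<longrightarrow>
     (\<forall>x\<in>ball z (r/2). \<forall>j\<le>2. energy h j u x \<le> C * S)"
    using interior_estimate_D[OF q_C3 two_le r] by (elim exE conjE) (rule that)
  obtain A where A: "0 < A" "\<forall>x\<in>D. \<forall>h. 0 < h \<and> h \<le> 1 \<longrightarrow> (\<forall>\<alpha>\<in>wle \<Lambda> 2. \<bar>fdiffs h \<alpha> f x\<bar> \<le> A)"
    using fdiffs_bounded[OF f_C2 D_bdd fin] by blast
  define Su where "Su = B\<^sup>2 + real (card (wle \<Lambda> 2)) * A\<^sup>2 + 1"
  have Su: "0 < Su" "B\<^sup>2 \<le> Su" "real (card (wle \<Lambda> 2)) * A\<^sup>2 \<le> Su"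
    by (auto simp: Su_def add_nonneg_pos)
  define H where "H = sqrt (C * Su)"
  have H: "0 \<le> H" "C * Su = H\<^sup>2" using C Su by (auto simp: H_def)
  show ?thesis
  proof (rule exI[of _ H], rule conjI[OF H(1)])
    show "\<forall>\<^sub>F h in at_right 0. \<forall>u. discrete_solution h f u \<and> (\<forall>x\<in>D. \<bar>u x\<bar> \<le> B) \<longrightarrow>
     (\<forall>z. ball z r \<subseteq> D \<longrightarrow> (\<forall>x\<in>ball z (r/2). \<forall>\<alpha>\<in>wle \<Lambda> 2. \<bar>fdiffs h \<alpha> u x\<bar> \<le> H))"
      using iev h_pos_ev
    proof (eventually_elim, intro allI impI ballI)
      fix h u z x \<alpha>
      assume ih: "\<forall>z u f S. ball z r \<subseteq> D \<and> 0 < S \<and>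
           (\<forall>x\<in>D. Lh h u x + q x * u x = f x \<and> (u x)\<^sup>2 \<le> S \<and>
              (\<forall>j\<le>2. (\<Sum>\<alpha>\<in>weq \<Lambda> j. (fdiffs h \<alpha> f x)\<^sup>2) \<le> S)) \<longrightarrow>
           (\<forall>x\<in>ball z (r/2). \<forall>j\<le>2. energy h j u x \<le> C * S)"
        and h: "0 < h \<and> h \<le> 1" and u: "discrete_solution h f u \<and> (\<forall>x\<in>D. \<bar>u x\<bar> \<le> B)"
        and z: "ball z r \<subseteq> D" and x: "x \<in> ball z (r/2)" and \<alpha>: "\<alpha> \<in> wle \<Lambda> 2"
      have "\<forall>y\<in>ball z (r/2). \<forall>j\<le>2. energy h j u y \<le> C * Su"
      proof (rule ih[THEN spec, THEN spec, THEN spec, THEN spec, THEN mp, of z Su u f], intro conjI ballI allI impI z Su(1))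
        fix y assume y: "y \<in> D"
        show "Lh h u y + q y * u y = f y" using u y unfolding discrete_solution_def by blast
        have "(u y)\<^sup>2 \<le> B\<^sup>2" using u y by (intro power2_le_iff_abs_le[THEN iffD2]) (use B in auto)
        then show "(u y)\<^sup>2 \<le> Su" using Su by linarith
        fix j :: nat assume j: "j \<le> 2"
        have "(\<Sum>\<alpha>\<in>weq \<Lambda> j. (fdiffs h \<alpha> f y)\<^sup>2) \<le> real (card (wle \<Lambda> 2)) * A\<^sup>2"
        proof (rule sum_weq_le[OF _ j])
          fix \<alpha> assume "\<alpha> \<in> weq \<Lambda> j"
          then have "\<alpha> \<in> wle \<Lambda> 2" using j by (auto simp: weq_def wle_def)
          then show "\<bar>fdiffs h \<alpha> f y\<bar> \<le> A" using A(2) h y by blast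
        qed
        then show "(\<Sum>\<alpha>\<in>weq \<Lambda> j. (fdiffs h \<alpha> f y)\<^sup>2) \<le> Su" using Su by linarith
      qed
      moreover have "\<alpha> \<in> weq \<Lambda> (length \<alpha>)" "length \<alpha> \<le> 2" using \<alpha> by (auto simp: wle_def weq_def)
      ultimately show "\<bar>fdiffs h \<alpha> u x\<bar> \<le> H" using x H by (intro fdiffs_le_sqrt) auto
    qed
  qed
qed

theorem classical_solution:
  "\<exists>u. Ck_on 2 D u \<and> continuous_on (closure D) u \<and> (\<forall>x\<in>D. limit_op u x + q x * u x = f x) \<and>
     (\<forall>x\<in>frontier D. u x = \<psi> x) \<and> (\<forall>x\<in>closure D. 0 < u x)"
proof -
  obtain Q where Q: "0 < Q" "\<And>x. x \<in> D \<Longrightarrow> \<bar>q x\<bar> \<le> Q" using q_bound by blast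
  obtain B \<kappa>m where \<kappa>m: "0 < \<kappa>m" and exev: "\<forall>\<^sub>F h in at_right 0. \<forall>f0 \<kappa>. (\<forall>x\<in>D. - Fb \<le> f0 x \<and> f0 x \<le> q x * \<kappa>) \<and> 0 \<le> \<kappa> \<and> \<kappa> \<le> \<kappa>m \<longrightarrow>
     (\<exists>u. discrete_solution h f0 u \<and> (\<forall>x\<in>D. \<kappa> \<le> u x \<and> u x \<le> B))"
    using exists_solution by blast
  have cD: "compact (closure D)" using D_bdd by simp
  obtain \<phi> where \<phi>: "0 < \<phi>" "\<And>x. x \<in> D \<Longrightarrow> f x \<le> - \<phi>"
  proof (cases "D = {}")
    case True
    then show thesis using that[of 1] by simp
  next
    case False
    have "continuous_on (closure D) f" using Ck_on_continuous[OF f_C2] continuous_on_subset by blast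
    then obtain x1 where "\<And>y. y \<in> closure D \<Longrightarrow> f y \<le> f x1"
      using continuous_attains_sup[OF cD] False by (metis closure_eq_empty)
    then show thesis using that[of "- f x1"] f_neg closure_subset by fastforce
  qed
  \<comment> \<open>By compactness \<open>f\<close> stays below \<open>- \<phi> < 0\<close> on
    \<open>D\<close>, so a constant with \<open>Q * \<kappa> \<le> \<phi>\<close> satisfies
    \<open>f x \<le> q x * \<kappa>\<close> whatever the sign of \<open>q\<close>. This constant is
    the lower bound on \<open>D\<close> that survives in the limit.\<close>
  define \<kappa> where "\<kappa> = min \<kappa>m (\<phi> / Q)"
  have \<kappa>: "0 < \<kappa>" "\<kappa> \<le> \<kappa>m" "Q * \<kappa> \<le> \<phi>"
  proof -
    show "0 < \<kappa>" "\<kappa> \<le> \<kappa>m" using \<kappa>m \<phi> Q by (auto simp: \<kappa>_def)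
    have "\<kappa> \<le> \<phi> / Q" by (simp add: \<kappa>_def)
    then show "Q * \<kappa> \<le> \<phi>" using Q by (simp add: field_simps)
  qed
  have fk: "- Fb \<le> f x \<and> f x \<le> q x * \<kappa>" if x: "x \<in> D" for x
  proof -
    have "- Q * \<kappa> \<le> q x * \<kappa>" using Q(2)[OF x] \<kappa> by (intro mult_right_mono) (auto simp: abs_le_iff)
    then show ?thesis using \<kappa>(3) \<phi>(2)[OF x] f_bd by fastforce
  qed
  define B1 where "B1 = \<bar>B\<bar> + 1"
  have B1: "0 < B1" by (simp add: B1_def)
  define h where "h n = (1/2::real) ^ n" for n
  have h0: "0 < h n" for n by (simp add: h_def)
  have seq: "\<forall>\<^sub>F n in sequentially. P (h n)" if "\<forall>\<^sub>F h in at_right 0. P h" for P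
    using filterlim_half_power that unfolding filterlim_iff h_def by blast
  define good where "good n u \<longleftrightarrow> discrete_solution (h n) f u \<and> (\<forall>x\<in>D. \<kappa> \<le> u x \<and> u x \<le> B)" for n u
  have "\<forall>\<^sub>F h in at_right 0. \<exists>u. discrete_solution h f u \<and> (\<forall>x\<in>D. \<kappa> \<le> u x \<and> u x \<le> B)"
    using exev by (rule eventually_mono) (use fk \<kappa> in force)
  from seq[OF this] have exn: "\<forall>\<^sub>F n in sequentially. \<exists>u. good n u" unfolding good_def .
  \<comment> \<open>For coarse meshes a suitable solution may not exist and \<open>U n\<close> is
    then arbitrary; all facts about it are therefore stated for large \<open>n\<close>.\<close>
  define U where "U n = (SOME u. good n u)" for n
  have Ugood: "\<forall>\<^sub>F n in sequentially. good n (U n)"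
    using exn
  proof (rule eventually_mono)
    show "good n (U n)" if "\<exists>u. good n u" for n
      unfolding U_def by (rule someI_ex[of "good n", OF that])
  qed
  have Usol: "\<forall>\<^sub>F n in sequentially. discrete_solution (h n) f (U n) \<and> (\<forall>x\<in>D. \<bar>U n x\<bar> \<le> B1)"
    using Ugood by (rule eventually_mono) (use \<kappa>(1) in \<open>force simp: good_def B1_def\<close>)
  have trans: "\<forall>\<^sub>F n in sequentially. P n (U n)"
    if "\<forall>\<^sub>F h in at_right 0. \<forall>u. discrete_solution h f u \<and> (\<forall>x\<in>D. \<bar>u x\<bar> \<le> B1) \<longrightarrow> P' h u" "\<And>n u. P' (h n) u \<Longrightarrow> P n u" for P P'
    using seq[OF that(1)] Usol by eventually_elim (use that(2) in blast)
  \<comment> \<open>Values are followed at all points of the space, first and second differences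
    only at points of \<open>D\<close>, where they are eventually bounded.\<close>
  define I where "I = {(x, \<alpha>). \<alpha> = [] \<or> x \<in> D \<and> \<alpha> \<in> wle \<Lambda> 2}"
  have bd: "\<exists>C. \<forall>\<^sub>F n in sequentially. \<bar>fdiffs (h n) (snd i) (U n) (fst i)\<bar> \<le> C" if i: "i \<in> I" for i
  proof -
    obtain x \<alpha> where i_eq: "i = (x, \<alpha>)" by (cases i)
    show ?thesis
    proof (cases "x \<in> D")
      case False
      then have "\<alpha> = []" using i by (simp add: I_def i_eq)
      have "\<forall>\<^sub>F n in sequentially. \<bar>fdiffs (h n) (snd i) (U n) (fst i)\<bar> \<le> \<bar>\<psi> x\<bar>"
        using Usol by (rule eventually_mono) (use False \<open>\<alpha> = []\<close> in \<open>auto simp: i_eq discrete_solution_def\<close>)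
      then show ?thesis by blast
    next
      case True
      then have \<alpha>: "\<alpha> \<in> wle \<Lambda> 2" using i by (auto simp: I_def i_eq wle_def)
      obtain r where r: "0 < r" "ball x r \<subseteq> D" using D_open True open_contains_ball by blast
      obtain H where "0 \<le> H" and Hev: "\<forall>\<^sub>F h in at_right 0. \<forall>u. discrete_solution h f u \<and> (\<forall>x\<in>D. \<bar>u x\<bar> \<le> B1) \<longrightarrow>
         (\<forall>z. ball z r \<subseteq> D \<longrightarrow> (\<forall>x\<in>ball z (r/2). \<forall>\<alpha>\<in>wle \<Lambda> 2. \<bar>fdiffs h \<alpha> u x\<bar> \<le> H))"
        using difference_bounds[OF r(1) B1] by blast
      have "x \<in> ball x (r/2)" using r by simp
      then have "\<forall>\<^sub>F n in sequentially. \<bar>fdiffs (h n) \<alpha> (U n) x\<bar> \<le> H"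
        by (intro trans[OF Hev]) (use r(2) \<alpha> in blast)
      then show ?thesis by (auto simp: i_eq)
    qed
  qed
  obtain G where G: "G \<noteq> bot" "G \<le> sequentially" and
    Glim: "\<forall>i\<in>I. \<exists>L. ((\<lambda>n. fdiffs (h n) (snd i) (U n) (fst i)) \<longlongrightarrow> L) G"
    using cluster_filter[of I "\<lambda>n i. fdiffs (h n) (snd i) (U n) (fst i)", OF bd] by blast
  from bchoice[OF Glim] obtain L where L: "\<forall>i\<in>I. ((\<lambda>n. fdiffs (h n) (snd i) (U n) (fst i)) \<longlongrightarrow> L i) G" by blast
  define u where "u x = L (x, [])" for x
  define g where "g l x = L (x, [l])" for l x
  define GG where "GG m l x = L (x, [m, l])" for m l x
  have lu: "((\<lambda>n. U n x) \<longlongrightarrow> u x) G" for x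
    using L[rule_format, of "(x, [])"] by (simp add: I_def u_def)
  have lg: "((\<lambda>n. fdiff (h n) l (U n) x) \<longlongrightarrow> g l x) G" if "x \<in> D" "l \<in> \<Lambda>" for x l
    using L[rule_format, of "(x, [l])"] that by (simp add: I_def g_def wle_def fdiffs_Cons)
  have lGG: "((\<lambda>n. fdiff (h n) m (fdiff (h n) l (U n)) x) \<longlongrightarrow> GG m l x) G" if "x \<in> D" "l \<in> \<Lambda>" "m \<in> \<Lambda>" for x l m
    using L[rule_format, of "(x, [m, l])"] that by (simp add: I_def GG_def wle_def fdiffs_Cons)
  have evG: "\<forall>\<^sub>F n in G. P n" if "\<forall>\<^sub>F n in sequentially. P n" for P using filter_leD[OF G(2) that] .
  have u_out: "u x = \<psi> x" if x: "x \<notin> D" for x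
  proof -
    have "\<forall>\<^sub>F n in G. \<psi> x = U n x" using evG[OF Usol] by (rule eventually_mono) (use x in \<open>auto simp: discrete_solution_def\<close>)
    then have "((\<lambda>n. U n x) \<longlongrightarrow> \<psi> x) G" by (rule Lim_transform_eventually[OF tendsto_const])
    then show ?thesis using lu tendsto_unique[OF G(1)] by blast
  qed
  have u_low: "\<kappa> \<le> u x" if x: "x \<in> D" for x
  proof (rule tendsto_lowerbound[OF lu _ G(1)])
    show "\<forall>\<^sub>F n in G. \<kappa> \<le> U n x" using evG[OF Ugood] by (rule eventually_mono) (use x in \<open>auto simp: good_def\<close>)
  qed
  have u_cont: "continuous_on (closure D) u"
    unfolding continuous_on_iff
  proof (intro ballI allI impI)
    fix x \<epsilon> assume x: "x \<in> closure D" and \<epsilon>: "0 < (\<epsilon>::real)"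
    have bK: "bounded (closure D)" and e2: "0 < \<epsilon> / 2" using D_bdd \<epsilon> by auto
    obtain \<tau> where \<tau>: "0 < \<tau>" and tev: "\<forall>\<^sub>F h in at_right 0. \<forall>u. discrete_solution h f u \<and> (\<forall>x\<in>D. \<bar>u x\<bar> \<le> B1) \<longrightarrow>
       (\<forall>x\<in>closure D. \<forall>t. norm t < \<tau> \<longrightarrow> \<bar>u (x + t) - u x\<bar> \<le> \<epsilon> / 2)"
      using translation_modulus[OF B1 bK e2] by blast
    have "\<bar>u (x + t) - u x\<bar> \<le> \<epsilon> / 2" if t: "norm t < \<tau>" for t
    proof (rule tendsto_upperbound[OF _ _ G(1)])
      show "((\<lambda>n. \<bar>U n (x + t) - U n x\<bar>) \<longlongrightarrow> \<bar>u (x + t) - u x\<bar>) G" by (intro tendsto_intros lu)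
      show "\<forall>\<^sub>F n in G. \<bar>U n (x + t) - U n x\<bar> \<le> \<epsilon> / 2"
        by (rule evG, rule trans[OF tev]) (use x t in blast)
    qed
    then have "dist (u y) (u x) < \<epsilon>" if "dist y x < \<tau>" for y
      using that \<epsilon> by (auto simp: dist_real_def dist_norm dest!: spec[of _ "y - x"] meta_spec[of _ "y - x"])
    then show "\<exists>d>0. \<forall>x'\<in>closure D. dist x' x < d \<longrightarrow> dist (u x') (u x) < \<epsilon>" using \<tau> by blast
  qed
  \<comment> \<open>A step with denominator \<open>2 ^ j\<close> is a whole number of mesh steps as
    soon as \<open>j \<le> n\<close>, so the discrete Taylor estimate applies without
    rounding.\<close>
  have dyad: "\<exists>k. t = real k * h n" if t: "t = real m / 2 ^ j" and n: "j \<le> n" for t m j n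
  proof -
    have "(2::real) ^ n = 2 ^ j * 2 ^ (n - j)" using n by (simp add: power_add[symmetric])
    then have "t = real (m * 2 ^ (n - j)) * h n" unfolding t h_def by (simp add: field_simps power_one_over)
    then show ?thesis by blast
  qed
  have inner: "\<exists>r>0. (\<forall>y\<in>ball x (r/4). \<forall>t. \<bar>t\<bar> < r / (4 * (norm l + 1)) \<longrightarrow> y \<in> D \<and> y + t *\<^sub>R l \<in> ball x (r/2)) \<and> ball x r \<subseteq> D"
    if x: "x \<in> D" for x l
  proof -
    obtain r where r: "0 < r" "ball x r \<subseteq> D" using D_open x open_contains_ball by blast
    have "y \<in> D \<and> y + t *\<^sub>R l \<in> ball x (r/2)" if y: "y \<in> ball x (r/4)" and t: "\<bar>t\<bar> < r / (4 * (norm l + 1))" for y t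
    proof
      have "y \<in> ball x r" using y r(1) by simp
      then show "y \<in> D" using r(2) by blast
      have "\<bar>t\<bar> * (4 * (norm l + 1)) < r" using t by (simp add: pos_less_divide_eq add_nonneg_pos)
      then have "norm (t *\<^sub>R l) < r / 4" using abs_ge_zero[of t] by (simp add: algebra_simps)
      then show "y + t *\<^sub>R l \<in> ball x (r/2)"
        using y dist_triangle[of x "y + t *\<^sub>R l" y] by (simp add: dist_norm)
    qed
    then show ?thesis using r by blast
  qed
  have dy1: "dyadic_differentiable D l u (g l)" if l: "l \<in> \<Lambda>" for l
    unfolding dyadic_differentiable_def Let_def
  proof (intro ballI allI impI)
    fix x \<epsilon> assume x: "x \<in> D" and \<epsilon>: "0 < (\<epsilon>::real)"
    obtain r where r: "0 < r" and inn: "\<forall>y\<in>ball x (r/4). \<forall>t. \<bar>t\<bar> < r / (4 * (norm l + 1)) \<longrightarrow> y \<in> D \<and> y + t *\<^sub>R l \<in> ball x (r/2)"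
      and rD: "ball x r \<subseteq> D" using inner[OF x] by blast
    obtain H where H: "0 \<le> H" and Hev: "\<forall>\<^sub>F h in at_right 0. \<forall>u. discrete_solution h f u \<and> (\<forall>x\<in>D. \<bar>u x\<bar> \<le> B1) \<longrightarrow>
         (\<forall>z. ball z r \<subseteq> D \<longrightarrow> (\<forall>x\<in>ball z (r/2). \<forall>\<alpha>\<in>wle \<Lambda> 2. \<bar>fdiffs h \<alpha> u x\<bar> \<le> H))"
      using difference_bounds[OF r B1] by blast
    \<comment> \<open>The last entry makes \<open>t * H \<le> \<epsilon>\<close>: with second
      differences bounded by \<open>H\<close>, first differences vary by at most
      \<open>t * H\<close> while the mesh steps cover the step length \<open>t\<close>.\<close>
    define d where "d = min (r/4) (min (r / (4 * (norm l + 1))) (\<epsilon> / (H + 1)))"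
    have d: "0 < d" using r \<epsilon> H by (simp add: d_def add_nonneg_pos)
    have dH: "t * H \<le> \<epsilon>" if t: "0 < t" "t < d" for t
    proof -
      have "t < \<epsilon> / (H + 1)" using t by (simp add: d_def)
      then have "t * (H + 1) < \<epsilon>" using H by (simp add: pos_less_divide_eq)
      then show ?thesis using t by (simp add: distrib_left)
    qed
    show "\<exists>r>0. \<forall>y\<in>ball x r. \<forall>m j. 0 < real m / 2 ^ j \<and> real m / 2 ^ j < r \<longrightarrow>
       \<bar>u (y + (real m / 2 ^ j) *\<^sub>R l) - u y - real m / 2 ^ j * g l y\<bar> \<le> \<epsilon> * (real m / 2 ^ j)"
    proof (intro exI[of _ d] conjI d ballI allI impI)
      fix y m j assume y: "y \<in> ball x d" and t: "0 < real m / 2 ^ j \<and> real m / 2 ^ j < d"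
      define t where "t = real m / 2 ^ j"
      have t0: "0 < t" "t < d" "t < r / (4 * (norm l + 1))" using t by (auto simp: t_def d_def)
      have y4: "y \<in> ball x (r/4)" using y by (simp add: d_def)
      have inn': "y + a *\<^sub>R l \<in> ball x (r/2)" if "0 \<le> a" "a \<le> t" for a using inn y4 that t0 by auto
      have yD: "y \<in> D" using inn[rule_format, OF y4, of 0] t0 by simp
      have e1: "\<forall>\<^sub>F n in sequentially. \<forall>z\<in>ball x (r/2). \<forall>\<alpha>\<in>wle \<Lambda> 2. \<bar>fdiffs (h n) \<alpha> (U n) z\<bar> \<le> H"
        by (rule trans[OF Hev]) (use rD in blast)
      have ev: "\<forall>\<^sub>F n in sequentially. \<bar>U n (y + t *\<^sub>R l) - U n y - t * fdiff (h n) l (U n) y\<bar> \<le> \<epsilon> * t"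
        using e1 eventually_ge_at_top[of j]
      proof (eventually_elim)
        case (elim n)
        note elim(1)
        moreover have "[l, l] \<in> wle \<Lambda> 2" using l by (simp add: wle_def)
        ultimately have ll: "\<bar>fdiff (h n) l (fdiff (h n) l (U n)) z\<bar> \<le> H" if "z \<in> ball x (r/2)" for z
          using that by (force simp: fdiffs_Cons)
        obtain k where k: "t = real k * h n" using dyad[OF t_def] elim by blast
        let ?w = "fdiff (h n) l (U n)"
        have ik: "real i * h n \<le> t" if "i \<le> k" for i using that h0[of n] unfolding k by (simp add: mult_right_mono)
        have "\<bar>?w (y + (real i * h n) *\<^sub>R l) - ?w y\<bar> \<le> t * H" if i: "i < k" for i
        proof -
          have "?w (y + (real i * h n) *\<^sub>R l) - ?w (y + (real 0 * h n) *\<^sub>R l)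
             = (\<Sum>i'<i. ?w (y + (real (Suc i') * h n) *\<^sub>R l) - ?w (y + (real i' * h n) *\<^sub>R l))"
            unfolding sum_lessThan_telescope[of "\<lambda>i. ?w (y + (real i * h n) *\<^sub>R l)"] ..
          also have "\<bar>\<dots>\<bar> \<le> (\<Sum>i'<i. h n * H)"
          proof (rule order_trans[OF sum_abs], rule sum_mono)
            fix i' assume i': "i' \<in> {..<i}"
            let ?z = "y + (real i' * h n) *\<^sub>R l"
            have e: "y + (real (Suc i') * h n) *\<^sub>R l = ?z + h n *\<^sub>R l" by (simp add: algebra_simps)
            have "?z \<in> ball x (r/2)" using i' i ik[of i'] h0[of n] by (intro inn') auto
            then have "h n * \<bar>fdiff (h n) l ?w ?z\<bar> \<le> h n * H" using ll h0[of n] by (intro mult_left_mono) auto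
            moreover have "?w (?z + h n *\<^sub>R l) - ?w ?z = h n * fdiff (h n) l ?w ?z"
              using h0[of n] by (simp add: fdiff_def[of _ _ ?w])
            ultimately show "\<bar>?w (y + (real (Suc i') * h n) *\<^sub>R l) - ?w ?z\<bar> \<le> h n * H"
              unfolding e using h0[of n] by (simp add: abs_mult)
          qed
          also have "\<dots> = real i * h n * H" by simp
          also have "\<dots> \<le> t * H" using ik[of i] i H by (intro mult_right_mono) auto
          finally show ?thesis by simp
        qed
        then have "\<bar>U n (y + (real k * h n) *\<^sub>R l) - U n y - (real k * h n) * ?w y\<bar> \<le> t * H * (real k * h n)"
          by (intro discrete_taylor h0)
        also have "\<dots> \<le> \<epsilon> * (real k * h n)" using dH[OF t0(1,2)] t0(1) unfolding k[symmetric] by (intro mult_right_mono) auto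
        finally show ?case unfolding k .
      qed
      have "\<bar>u (y + t *\<^sub>R l) - u y - t * g l y\<bar> \<le> \<epsilon> * t"
      proof (rule tendsto_upperbound[OF _ evG[OF ev] G(1)])
        show "((\<lambda>n. \<bar>U n (y + t *\<^sub>R l) - U n y - t * fdiff (h n) l (U n) y\<bar>) \<longlongrightarrow> \<bar>u (y + t *\<^sub>R l) - u y - t * g l y\<bar>) G"
          by (intro tendsto_intros lu lg yD l)
      qed
      then show "\<bar>u (y + (real m / 2 ^ j) *\<^sub>R l) - u y - real m / 2 ^ j * g l y\<bar> \<le> \<epsilon> * (real m / 2 ^ j)"
        unfolding t_def .
    qed
  qed
  \<comment> \<open>At this order no bound on third differences of \<open>U n\<close> is at hand;
    the variation of the second differences along the path is controlled by
    \<open>second_difference_modulus\<close>.\<close>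
  have dy2: "dyadic_differentiable D m (g l) (GG m l)" if l: "l \<in> \<Lambda>" and m: "m \<in> \<Lambda>" for l m
    unfolding dyadic_differentiable_def Let_def
  proof (intro ballI allI impI)
    fix x \<epsilon> assume x: "x \<in> D" and \<epsilon>: "0 < (\<epsilon>::real)"
    obtain r where r: "0 < r" and inn: "\<forall>y\<in>ball x (r/4). \<forall>t. \<bar>t\<bar> < r / (4 * (norm m + 1)) \<longrightarrow> y \<in> D \<and> y + t *\<^sub>R m \<in> ball x (r/2)"
      and rD: "ball x r \<subseteq> D" using inner[OF x] by blast
    obtain \<tau> where \<tau>: "0 < \<tau>" and Tev: "\<forall>\<^sub>F h in at_right 0. \<forall>u. discrete_solution h f u \<and> (\<forall>x\<in>D. \<bar>u x\<bar> \<le> B1) \<longrightarrow>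
       (\<forall>z. ball z r \<subseteq> D \<longrightarrow> (\<forall>x\<in>ball z (r/4). \<forall>\<alpha>\<in>weq \<Lambda> 2. \<forall>l\<in>\<Lambda>. \<forall>j::nat. real j * h < \<tau> \<longrightarrow>
        \<bar>fdiffs h \<alpha> u (x + (real j * h) *\<^sub>R l) - fdiffs h \<alpha> u x\<bar> \<le> \<epsilon>))"
      using second_difference_modulus[OF B1 r \<epsilon>] by blast
    define d where "d = min (r/4) (min (r / (4 * (norm m + 1))) \<tau>)"
    have d: "0 < d" using r \<tau> by (simp add: d_def add_nonneg_pos)
    show "\<exists>r>0. \<forall>y\<in>ball x r. \<forall>m' j. 0 < real m' / 2 ^ j \<and> real m' / 2 ^ j < r \<longrightarrow>
       \<bar>g l (y + (real m' / 2 ^ j) *\<^sub>R m) - g l y - real m' / 2 ^ j * GG m l y\<bar> \<le> \<epsilon> * (real m' / 2 ^ j)"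
    proof (intro exI[of _ d] conjI d ballI allI impI)
      fix y m' j assume y: "y \<in> ball x d" and t: "0 < real m' / 2 ^ j \<and> real m' / 2 ^ j < d"
      define t where "t = real m' / 2 ^ j"
      have t0: "0 < t" "t < \<tau>" "t < r / (4 * (norm m + 1))" using t by (auto simp: t_def d_def)
      have y4: "y \<in> ball x (r/4)" using y by (simp add: d_def)
      have yD: "y \<in> D" using inn[rule_format, OF y4, of 0] t0 by simp
      have "y + t *\<^sub>R m \<in> ball x (r/2)" using inn y4 t0 by auto
      then have "y + t *\<^sub>R m \<in> ball x r" using r by simp
      then have ytD: "y + t *\<^sub>R m \<in> D" using rD by blast
      have e1: "\<forall>\<^sub>F n in sequentially. \<forall>\<alpha>\<in>weq \<Lambda> 2. \<forall>l\<in>\<Lambda>. \<forall>j::nat. real j * h n < \<tau> \<longrightarrow>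
            \<bar>fdiffs (h n) \<alpha> (U n) (y + (real j * h n) *\<^sub>R l) - fdiffs (h n) \<alpha> (U n) y\<bar> \<le> \<epsilon>"
        by (rule trans[OF Tev]) (use rD y4 in blast)
      have ev: "\<forall>\<^sub>F n in sequentially. \<bar>fdiff (h n) l (U n) (y + t *\<^sub>R m) - fdiff (h n) l (U n) y - t * fdiff (h n) m (fdiff (h n) l (U n)) y\<bar> \<le> \<epsilon> * t"
        using e1 eventually_ge_at_top[of j]
      proof (eventually_elim)
        case (elim n)
        note elim(1)
        moreover have "[m, l] \<in> weq \<Lambda> 2" using l m by (simp add: weq_def)
        ultimately have ml: "\<bar>fdiff (h n) m (fdiff (h n) l (U n)) (y + (real i * h n) *\<^sub>R m) - fdiff (h n) m (fdiff (h n) l (U n)) y\<bar> \<le> \<epsilon>"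
          if "real i * h n < \<tau>" for i using that m by (force simp: fdiffs_Cons)
        obtain k where k: "t = real k * h n" using dyad[OF t_def] elim by blast
        have ik: "real i * h n < \<tau>" if "i < k" for i
        proof -
          have "real i * h n \<le> real k * h n" using that h0[of n] by (intro mult_right_mono) auto
          then show ?thesis using t0(2) k by linarith
        qed
        have "\<bar>fdiff (h n) l (U n) (y + (real k * h n) *\<^sub>R m) - fdiff (h n) l (U n) y
           - (real k * h n) * fdiff (h n) m (fdiff (h n) l (U n)) y\<bar> \<le> \<epsilon> * (real k * h n)"
          by (rule discrete_taylor[OF h0]) (rule ml[OF ik])
        then show ?case unfolding k .
      qed
      have "\<bar>g l (y + t *\<^sub>R m) - g l y - t * GG m l y\<bar> \<le> \<epsilon> * t"
      proof (rule tendsto_upperbound[OF _ evG[OF ev] G(1)])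
        show "((\<lambda>n. \<bar>fdiff (h n) l (U n) (y + t *\<^sub>R m) - fdiff (h n) l (U n) y - t * fdiff (h n) m (fdiff (h n) l (U n)) y\<bar>)
            \<longlongrightarrow> \<bar>g l (y + t *\<^sub>R m) - g l y - t * GG m l y\<bar>) G"
          by (intro tendsto_intros lg lGG yD ytD l m)
      qed
      then show "\<bar>g l (y + (real m' / 2 ^ j) *\<^sub>R m) - g l y - real m' / 2 ^ j * GG m l y\<bar> \<le> \<epsilon> * (real m' / 2 ^ j)"
        unfolding t_def .
    qed
  qed
  have u_contD: "continuous_on D u" using u_cont closure_subset by (rule continuous_on_subset)
  have C2: "Ck_on 2 D u"
    by (rule Ck_on_2_dyadic(1)[OF D_open Basis_sub u_contD dy1 dy2])
  have ddu: "dd l u x = g l x" if "x \<in> D" "l \<in> \<Lambda>" for x l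
    by (rule Ck_on_2_dyadic(2)[OF D_open Basis_sub u_contD dy1 dy2 that])
  have dddu: "dd m (\<lambda>y. dd l u y) x = GG m l x" if "x \<in> D" "l \<in> \<Lambda>" "m \<in> \<Lambda>" for x l m
    by (rule Ck_on_2_dyadic(3)[OF D_open Basis_sub u_contD dy1 dy2 that])
  have pde: "limit_op u x + q x * u x = f x" if x: "x \<in> D" for x
  proof -
    \<comment> \<open>The scheme yields the limits of the mixed differences along \<open>l\<close>
      and \<open>- l\<close>, which are minus the second derivatives along \<open>l\<close>.\<close>
    have neg2: "GG l (- l) x = - GG l l x" if l: "l \<in> \<Lambda>" for l
    proof -
      note nl = neg[OF l]
      have C2u: "Ck_on (Suc (Suc 0)) D u" using C2 by (simp add: numeral_2_eq_2)
      have 1: "dd (- l) u y = (-1) * dd l u y + 0 * dd l u y" if "y \<in> D" for y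
      proof -
        have "linear (frechet_derivative u (at y))"
          using Ck_on_has_derivative[OF C2u D_open that] has_derivative_linear by blast
        then show ?thesis by (simp add: linear_neg)
      qed
      note d = Ck_on_has_derivative[OF Ck_on_dd[OF C2u] D_open x]
      have "dd l (\<lambda>y. dd (- l) u y) x = dd l (\<lambda>y. (-1) * dd l u y + 0 * dd l u y) x"
        by (rule dd_cong[OF D_open x]) (rule 1)
      also have "\<dots> = - dd l (\<lambda>y. dd l u y) x" unfolding dd_lin_comb[OF d d] by simp
      finally show ?thesis unfolding dddu[OF x nl l] dddu[OF x l l] .
    qed
    have "((\<lambda>n. Lh (h n) (U n) x + q x * U n x) \<longlongrightarrow>
        (\<Sum>l\<in>\<Lambda>. - (1/2) * c l x * GG l (- l) x + b l x * g l x) + q x * u x) G"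
      unfolding Lh_alt[OF less_imp_neq[OF h0, symmetric]]
      by (intro tendsto_intros lu lg lGG x neg)
    moreover have "(\<Sum>l\<in>\<Lambda>. - (1/2) * c l x * GG l (- l) x + b l x * g l x) = limit_op u x"
      unfolding limit_op_def by (intro sum.cong refl) (simp add: neg2 ddu dddu x)
    moreover have "\<forall>\<^sub>F n in G. f x = Lh (h n) (U n) x + q x * U n x"
      using evG[OF Usol] by (rule eventually_mono) (use x in \<open>auto simp: discrete_solution_def\<close>)
    then have "((\<lambda>n. Lh (h n) (U n) x + q x * U n x) \<longlongrightarrow> f x) G"
      by (rule Lim_transform_eventually[OF tendsto_const])
    ultimately show ?thesis using tendsto_unique[OF G(1)] by metis
  qed
  have front: "u x = \<psi> x" if "x \<in> frontier D" for x
    using that D_open by (intro u_out) (auto simp: frontier_def interior_open)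
  have "0 < u x" if "x \<in> closure D" for x
    using u_low[of x] u_out[of x] psi_pos[of x] \<kappa>(1) by (cases "x \<in> D") auto
  then show ?thesis using C2 u_cont pde front by blast
qed

end

section \<open>Elliptic matrix fields as sums of rank-one matrices\<close>

definition qform :: "('d::finite \<Rightarrow> 'd \<Rightarrow> real) \<Rightarrow> ('d \<Rightarrow> real) \<Rightarrow> real" where
  "qform Q \<eta> = (\<Sum>i\<in>UNIV. \<Sum>j\<in>UNIV. Q i j * \<eta> i * \<eta> j)"

lemma sum_of_bool_mult:
  fixes g :: "'d::finite \<Rightarrow> real"
  shows "(\<Sum>i\<in>UNIV. of_bool (i = p) * g i) = g p" "(\<Sum>i\<in>UNIV. of_bool (p = i) * g i) = g p"
  by (simp_all add: of_bool_def if_distrib[of "\<lambda>x. x * _"] cong: if_cong)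

text \<open>A quadratic polynomial in \<open>t\<close>. It is affine when the pivot
  \<open>Q p p\<close> vanishes, which excludes a nonzero slope for a nonnegative form, and is
  minimised by completing the square when the pivot is positive.\<close>

lemma qform_shift:
  assumes sym: "\<And>i j. Q i j = Q j i"
  shows "qform Q (\<lambda>i. \<eta> i + t * of_bool (i = p)) = qform Q \<eta> + 2 * t * (\<Sum>j\<in>UNIV. Q p j * \<eta> j) + t\<^sup>2 * Q p p"
proof -
  have "qform Q (\<lambda>i. \<eta> i + t * of_bool (i = p)) = (\<Sum>i\<in>UNIV. \<Sum>j\<in>UNIV. Q i j * \<eta> i * \<eta> j
      + of_bool (i = p) * (t * (Q i j * \<eta> j)) + of_bool (j = p) * (t * (Q i j * \<eta> i))
      + of_bool (i = p) * (of_bool (j = p) * (t\<^sup>2 * Q i j)))"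
    unfolding qform_def by (intro sum.cong refl) (simp add: algebra_simps power2_eq_square)
  also have "\<dots> = qform Q \<eta> + (\<Sum>j\<in>UNIV. t * (Q p j * \<eta> j)) + (\<Sum>i\<in>UNIV. t * (Q i p * \<eta> i)) + t\<^sup>2 * Q p p"
    by (simp only: sum.distrib qform_def sum_distrib_left[symmetric] sum_of_bool_mult)
  also have "(\<Sum>i\<in>UNIV. t * (Q i p * \<eta> i)) = (\<Sum>j\<in>UNIV. t * (Q p j * \<eta> j))" by (simp add: sym)
  finally show ?thesis by (simp add: sum_distrib_left[symmetric])
qed

text \<open>Cholesky elimination, with \<open>S\<close> the set of rows that may still be nonzero. A
  zero pivot forces its row to vanish; a positive pivot is split off as a square, and the Schur
  complement \<open>Q'\<close> stays positive semidefinite with smaller support.\<close>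

lemma psd_sum_of_squares:
  fixes Q :: "'d::finite \<Rightarrow> 'd \<Rightarrow> real"
  assumes "finite S" and "\<And>i j. Q i j = Q j i" and "\<And>\<eta>. 0 \<le> qform Q \<eta>" and "\<And>i j. i \<notin> S \<Longrightarrow> Q i j = 0"
  shows "\<exists>s. \<forall>i j. Q i j = (\<Sum>k\<in>S. s k i * s k j)"
  using assms
proof (induction S arbitrary: Q rule: finite_induct)
  case empty
  then show ?case by simp
next
  case (insert p S)
  note sym = insert.prems(1) and psd = insert.prems(2) and supp = insert.prems(3)
  have expand: "0 \<le> qform Q \<eta> + 2 * t * (\<Sum>j\<in>UNIV. Q p j * \<eta> j) + t\<^sup>2 * Q p p" for \<eta> t
    using psd[of "\<lambda>i. \<eta> i + t * of_bool (i = p)"] qform_shift[of Q, OF sym] by simp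
  show ?case
  proof (cases "Q p p = 0")
    case True
    have "Q p j = 0" for j
    proof (rule ccontr)
      assume ne: "Q p j \<noteq> 0"
      define \<eta> where "\<eta> i = (of_bool (i = j) :: real)" for i
      have s: "(\<Sum>i\<in>UNIV. Q p i * \<eta> i) = Q p j"
        using sum_of_bool_mult(1)[of j "\<lambda>i. Q p i"] by (simp add: \<eta>_def mult.commute)
      have "0 \<le> qform Q \<eta> + 2 * (- (qform Q \<eta> + 1) / (2 * Q p j)) * Q p j + 0"
        using expand[of \<eta> "- (qform Q \<eta> + 1) / (2 * Q p j)"] True s by simp
      moreover have "2 * (- (qform Q \<eta> + 1) / (2 * Q p j)) * Q p j = - (qform Q \<eta> + 1)"
        using ne by (simp add: field_simps)
      ultimately show False by linarith
    qed
    then have "Q i j = 0" if "i \<notin> S" for i j using supp that by (cases "i = p") auto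
    then obtain s where s: "\<forall>i j. Q i j = (\<Sum>k\<in>S. s k i * s k j)" using insert.IH[OF sym psd] by blast
    have "Q i j = (\<Sum>k\<in>insert p S. (s(p := \<lambda>_. 0)) k i * (s(p := \<lambda>_. 0)) k j)" for i j
    proof -
      have "(\<Sum>k\<in>S. (s(p := \<lambda>_. 0)) k i * (s(p := \<lambda>_. 0)) k j) = (\<Sum>k\<in>S. s k i * s k j)"
        using insert(2) by (intro sum.cong) auto
      then show ?thesis using s insert(1,2) by simp
    qed
    then show ?thesis by blast
  next
    case False
    have "0 \<le> Q p p"
      using expand[of "\<lambda>_. 0" 1] by (simp add: qform_def)
    then have pos: "0 < Q p p" using False by simp
    define Q' where "Q' i j = Q i j - Q p i * Q p j / Q p p" for i j
    have sym': "Q' i j = Q' j i" for i j using sym by (simp add: Q'_def mult.commute)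
    have psd': "0 \<le> qform Q' \<eta>" for \<eta>
    proof -
      let ?b = "\<Sum>j\<in>UNIV. Q p j * \<eta> j"
      have "qform Q' \<eta> = qform Q \<eta> - (\<Sum>i\<in>UNIV. \<Sum>j\<in>UNIV. (Q p i * \<eta> i) * (Q p j * \<eta> j)) / Q p p"
        unfolding qform_def Q'_def sum_divide_distrib sum_subtractf[symmetric]
        by (intro sum.cong refl) (simp add: algebra_simps)
      also have "(\<Sum>i\<in>UNIV. \<Sum>j\<in>UNIV. (Q p i * \<eta> i) * (Q p j * \<eta> j)) = ?b * ?b"
        by (simp add: sum_product)
      finally have "qform Q' \<eta> = qform Q \<eta> + 2 * (- ?b / Q p p) * ?b + (- ?b / Q p p)\<^sup>2 * Q p p"
        using pos by (simp add: power2_eq_square field_simps)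
      then show ?thesis using expand[of \<eta> "- ?b / Q p p"] by simp
    qed
    have supp': "Q' i j = 0" if "i \<notin> S" for i j
    proof (cases "i = p")
      case True
      then show ?thesis using pos by (simp add: Q'_def)
    next
      case False
      then have "Q i j = 0" "Q p i = 0" using supp that sym[of p i] by auto
      then show ?thesis by (simp add: Q'_def)
    qed
    obtain s where s: "\<forall>i j. Q' i j = (\<Sum>k\<in>S. s k i * s k j)" using insert.IH[OF sym' psd' supp'] by blast
    define v where "v i = Q p i / sqrt (Q p p)" for i
    have "Q i j = (\<Sum>k\<in>insert p S. (s(p := v)) k i * (s(p := v)) k j)" for i j
    proof -
      have "(\<Sum>k\<in>S. (s(p := v)) k i * (s(p := v)) k j) = (\<Sum>k\<in>S. s k i * s k j)"
        using insert(2) by (intro sum.cong) auto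
      moreover have "v i * v j = Q p i * Q p j / Q p p" using pos by (simp add: v_def)
      moreover have "Q i j = Q' i j + Q p i * Q p j / Q p p" by (simp add: Q'_def)
      ultimately show ?thesis using s insert(1,2) by simp
    qed
    then show ?thesis by blast
  qed
qed

section \<open>A smooth partition of unity by Gaussians\<close>

lemma Ck_on_diff_sq:
  fixes p :: "'a::euclidean_space"
  shows "Ck_on k UNIV (\<lambda>x. (x - p) \<bullet> (x - p))"
proof -
  have 1: "(\<lambda>x. (x - p) \<bullet> (x - p)) = (\<lambda>x. \<Sum>i\<in>Basis. (x \<bullet> i + - (p \<bullet> i)) * (x \<bullet> i + - (p \<bullet> i)))"
    by (subst euclidean_inner) (simp add: inner_diff_left)
  show ?thesis unfolding 1
    by (intro Ck_on_sum Ck_on_mult Ck_on_add Ck_on_const open_UNIV finite_Basis Ck_on_bounded_linear bounded_linear_inner_left)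
qed

text \<open>Gaussians centred at a finite net, divided by their sum, take the place of bump
  functions. For large \<open>\<kappa>\<close> the centres far from \<open>x\<close> carry so little
  weight that the bound \<open>2 * M\<close> on the oscillation of \<open>A i\<close> over
  \<open>K\<close> costs only \<open>\<tau> / 2\<close>; near centres cost \<open>\<tau> / 2\<close>
  by uniform continuity.\<close>

lemma gaussian_partition:
  fixes K :: "'a::euclidean_space set"
  assumes K: "compact K" "K \<noteq> {}" and A: "\<And>i. i \<in> I \<Longrightarrow> continuous_on K (A i)" and I: "finite I" and \<tau>: "0 < \<tau>"
  shows "\<exists>P \<xi>. finite P \<and> P \<subseteq> K \<and> (\<forall>p. Ck_on k UNIV (\<xi> p)) \<and> (\<forall>p x. 0 \<le> \<xi> p x) \<and> (\<forall>x. (\<Sum>p\<in>P. \<xi> p x) = (1::real)) \<and>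
     (\<forall>i\<in>I. \<forall>x\<in>K. \<bar>\<Sum>p\<in>P. \<xi> p x * (A i x - A i p)\<bar> \<le> \<tau>)"
proof -
  have t2: "0 < \<tau> / 2" using \<tau> by simp
  have "\<forall>\<^sub>F r in at_right 0. \<forall>i\<in>I. \<forall>x\<in>K. \<forall>y\<in>K. dist x y < r \<longrightarrow> \<bar>A i x - A i y\<bar> \<le> \<tau> / 2"
  proof (rule eventually_ball_finite[OF I], rule ballI)
    fix i assume "i \<in> I"
    then have "uniformly_continuous_on K (A i)" using compact_uniformly_continuous[OF A K(1)] by blast
    then obtain d where d: "0 < d" "\<forall>x\<in>K. \<forall>x'\<in>K. dist x' x < d \<longrightarrow> dist (A i x') (A i x) < \<tau> / 2"
      unfolding uniformly_continuous_on_def using t2 by blast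
    have "\<bar>A i x - A i y\<bar> \<le> \<tau> / 2" if "r < d" "x \<in> K" "y \<in> K" "dist x y < r" for r x y
      using d(2)[rule_format, of y x] that by (simp add: dist_real_def)
    then show "\<forall>\<^sub>F r in at_right 0. \<forall>x\<in>K. \<forall>y\<in>K. dist x y < r \<longrightarrow> \<bar>A i x - A i y\<bar> \<le> \<tau> / 2"
      unfolding eventually_at_right_field using d(1) by blast
  qed
  moreover have "\<forall>\<^sub>F r in at_right (0::real). 0 < r" by (simp add: eventually_at_right_less)
  ultimately have "\<forall>\<^sub>F r in at_right 0. 0 < r \<and> (\<forall>i\<in>I. \<forall>x\<in>K. \<forall>y\<in>K. dist x y < r \<longrightarrow> \<bar>A i x - A i y\<bar> \<le> \<tau> / 2)"
    by eventually_elim blast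
  from eventually_happens'[OF trivial_limit_at_right_real this] obtain r where
    r: "0 < r" and Ar: "\<And>i x y. i \<in> I \<Longrightarrow> x \<in> K \<Longrightarrow> y \<in> K \<Longrightarrow> dist x y < r \<Longrightarrow> \<bar>A i x - A i y\<bar> \<le> \<tau> / 2" by blast
  have "bounded (\<Union>i\<in>I. A i ` K)"
    using I A K(1) by (intro bounded_UN ballI compact_imp_bounded compact_continuous_image)
  then obtain M where M: "0 < M" "\<And>i x. i \<in> I \<Longrightarrow> x \<in> K \<Longrightarrow> \<bar>A i x\<bar> \<le> M"
    unfolding bounded_pos by auto
  have cover: "K \<subseteq> (\<Union>p\<in>K. ball p (r / 2))" using r by force
  obtain P where P: "P \<subseteq> K" "finite P" "K \<subseteq> (\<Union>p\<in>P. ball p (r / 2))"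
    by (rule compactE_image[OF K(1) _ cover]) auto
  have Pne: "P \<noteq> {}" using P(3) K(2) by auto
  define n where "n = real (card P)"
  have n: "0 < n" using P(2) Pne by (simp add: n_def card_gt_0_iff)
  \<comment> \<open>Some centre lies within \<open>r / 2\<close> of \<open>x\<close>, so one at
    distance at least \<open>r\<close> has relative weight at most
    \<open>exp (- \<kappa> * r\<^sup>2 + \<kappa> * (r / 2)\<^sup>2)\<close>, which is below
    \<open>exp (- (\<kappa> * (r\<^sup>2 / 2)))\<close>. The required \<open>\<kappa>\<close> comes
    from \<open>exp (- y) \<le> 1 / y\<close>.\<close>
  have "\<exists>\<kappa>>0. n * exp (- (\<kappa> * (r\<^sup>2 / 2))) * (2 * M) \<le> \<tau> / 2"
  proof (intro exI[of _ "4 * n * M / (\<tau> * (r\<^sup>2 / 2))"] conjI)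
    let ?y = "4 * n * M / (\<tau> * (r\<^sup>2 / 2)) * (r\<^sup>2 / 2)"
    show "0 < 4 * n * M / (\<tau> * (r\<^sup>2 / 2))" using n M \<tau> r by simp
    have y: "?y = 4 * n * M / \<tau>" using r by simp
    have y0: "0 < 4 * n * M / \<tau>" using n M \<tau> by simp
    have inv_exp: "exp (- y) \<le> 1 / y" if "0 < y" for y :: real
    proof -
      have "y \<le> exp y" using exp_ge_add_one_self[of y] by linarith
      then show ?thesis using that by (simp add: exp_minus inverse_eq_divide frac_le)
    qed
    have "exp (- (4 * n * M / \<tau>)) \<le> 1 / (4 * n * M / \<tau>)" by (rule inv_exp[OF y0])
    then have "n * exp (- (4 * n * M / \<tau>)) * (2 * M) \<le> n * (1 / (4 * n * M / \<tau>)) * (2 * M)"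
      using n M by (intro mult_right_mono mult_left_mono) auto
    also have "\<dots> = \<tau> / 2" using n M \<tau> by (simp add: field_simps)
    finally show "n * exp (- ?y) * (2 * M) \<le> \<tau> / 2" unfolding y .
  qed
  then obtain \<kappa> where \<kappa>: "0 < \<kappa>" "n * exp (- (\<kappa> * (r\<^sup>2 / 2))) * (2 * M) \<le> \<tau> / 2" by blast
  define \<phi> where "\<phi> p x = exp (- \<kappa> * ((x - p) \<bullet> (x - p)))" for p x :: 'a
  define Z where "Z x = (\<Sum>p\<in>P. \<phi> p x)" for x
  have \<phi>0: "0 < \<phi> p x" for p x by (simp add: \<phi>_def)
  have Z0: "0 < Z x" for x unfolding Z_def using P(2) Pne \<phi>0 by (intro sum_pos) auto
  define \<xi> where "\<xi> p x = \<phi> p x * inverse (Z x)" for p x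
  have \<phi>C: "Ck_on k UNIV (\<phi> p)" for p
    unfolding \<phi>_def[abs_def] by (intro Ck_on_exp Ck_on_mult Ck_on_const open_UNIV Ck_on_diff_sq)
  have ZC: "Ck_on k UNIV Z" unfolding Z_def[abs_def] by (intro Ck_on_sum open_UNIV P(2) \<phi>C)
  have \<xi>C: "Ck_on k UNIV (\<xi> p)" for p
    unfolding \<xi>_def[abs_def] using Z0 by (intro Ck_on_mult Ck_on_inverse open_UNIV \<phi>C ZC) (simp add: less_imp_neq[symmetric])
  have \<xi>0: "0 \<le> \<xi> p x" for p x using \<phi>0[of p x] Z0[of x] by (simp add: \<xi>_def)
  have \<xi>1: "(\<Sum>p\<in>P. \<xi> p x) = 1" for x
    using Z0[of x] by (simp add: \<xi>_def sum_distrib_right[symmetric] Z_def[symmetric])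
  have bound: "\<bar>\<Sum>p\<in>P. \<xi> p x * (A i x - A i p)\<bar> \<le> \<tau>" if i: "i \<in> I" and x: "x \<in> K" for i x
  proof -
    obtain p0 where p0: "p0 \<in> P" "dist p0 x < r / 2" using P(3) x by auto
    have sq: "(x - p) \<bullet> (x - p) = (dist x p)\<^sup>2" for p by (simp add: dist_norm power2_norm_eq_inner)
    have "\<bar>\<Sum>p\<in>P. \<xi> p x * (A i x - A i p)\<bar> \<le> (\<Sum>p\<in>P. \<xi> p x * (\<tau> / 2) + exp (- (\<kappa> * (r\<^sup>2 / 2))) * (2 * M))"
    proof (rule order_trans[OF sum_abs], rule sum_mono)
      fix p assume p: "p \<in> P"
      then have pK: "p \<in> K" using P by blast
      show "\<bar>\<xi> p x * (A i x - A i p)\<bar> \<le> \<xi> p x * (\<tau> / 2) + exp (- (\<kappa> * (r\<^sup>2 / 2))) * (2 * M)"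
      proof (cases "dist x p < r")
        case True
        have "\<bar>\<xi> p x * (A i x - A i p)\<bar> \<le> \<xi> p x * (\<tau> / 2)"
          unfolding abs_mult using Ar[OF i x pK True] \<xi>0[of p x] by (intro mult_mono) auto
        moreover have "0 \<le> exp (- (\<kappa> * (r\<^sup>2 / 2))) * (2 * M)" using M by simp
        ultimately show ?thesis by linarith
      next
        case False
        have "\<phi> p x \<le> exp (- \<kappa> * r\<^sup>2)"
          unfolding \<phi>_def sq using False \<kappa> r by (simp add: power_mono)
        moreover have "exp (- \<kappa> * (r / 2)\<^sup>2) \<le> Z x"
        proof -
          have "exp (- \<kappa> * (r / 2)\<^sup>2) \<le> \<phi> p0 x"
            unfolding \<phi>_def sq using p0 \<kappa> by (simp add: power_mono dist_commute less_imp_le)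
          also have "\<dots> \<le> Z x" unfolding Z_def using p0 P(2) \<phi>0 by (intro member_le_sum) (auto intro: less_imp_le)
          finally show ?thesis .
        qed
        ultimately have "\<xi> p x \<le> exp (- \<kappa> * r\<^sup>2) / exp (- \<kappa> * (r / 2)\<^sup>2)"
          unfolding \<xi>_def divide_inverse[symmetric] by (intro frac_le) (auto simp: \<phi>0 less_imp_le)
        also have "\<dots> = exp (- \<kappa> * r\<^sup>2 - (- \<kappa> * (r / 2)\<^sup>2))" by (simp only: exp_diff)
        also have "\<dots> \<le> exp (- (\<kappa> * (r\<^sup>2 / 2)))" using \<kappa> by (simp add: power_divide field_simps)
        finally have c: "\<xi> p x \<le> exp (- (\<kappa> * (r\<^sup>2 / 2)))" .
        have "\<bar>A i x - A i p\<bar> \<le> 2 * M" using M(2)[OF i x] M(2)[OF i pK] by linarith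
        then have "\<bar>\<xi> p x * (A i x - A i p)\<bar> \<le> exp (- (\<kappa> * (r\<^sup>2 / 2))) * (2 * M)"
          unfolding abs_mult using c \<xi>0[of p x] by (intro mult_mono) auto
        moreover have "0 \<le> \<xi> p x * (\<tau> / 2)" using \<xi>0[of p x] \<tau> by simp
        ultimately show ?thesis by linarith
      qed
    qed
    also have "\<dots> = \<tau> / 2 + n * exp (- (\<kappa> * (r\<^sup>2 / 2))) * (2 * M)"
      unfolding sum.distrib sum_distrib_right[symmetric] \<xi>1 by (simp add: n_def)
    also have "\<dots> \<le> \<tau>" using \<kappa>(2) by linarith
    finally show ?thesis .
  qed
  show ?thesis
    using P(1,2) \<xi>C \<xi>0 \<xi>1 bound by (intro exI[of _ P] exI[of _ \<xi>]) blast
qed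

text \<open>Writing a matrix field as a combination of rank-one matrices with fixed directions and positive smooth weights
  is what allows a monotone difference scheme.\<close>

lemma rank_one_decomposition:
  fixes A :: "real^'d::finite \<Rightarrow> 'd \<Rightarrow> 'd \<Rightarrow> real"
  assumes A: "\<And>i j. Ck_on k UNIV (\<lambda>x. A x i j)" and sym: "\<And>x i j. A x i j = A x j i"
    and K: "compact K" "K \<noteq> {}" and \<mu>: "0 < \<mu>"
    and ell: "\<And>x \<eta>. x \<in> K \<Longrightarrow> \<mu> * (\<Sum>i\<in>UNIV. (\<eta> i)\<^sup>2) \<le> qform (A x) \<eta>"
  shows "\<exists>(J :: ('d \<times> 'd \<times> bool + (real^'d) \<times> 'd) set) v w w0. finite J \<and> 0 < w0 \<and> (\<forall>j\<in>J. Ck_on k UNIV (w j)) \<and>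
     (\<forall>j\<in>J. \<forall>x\<in>K. w0 \<le> w j x) \<and> (\<forall>x\<in>K. \<forall>a b. A x a b = (\<Sum>j\<in>J. w j x * (v j $ a * v j $ b))) \<and>
     (\<forall>i. \<exists>j\<in>J. v j = axis i 1)"
proof -
  define d where "d = real CARD('d)"
  have d: "0 < d" by (simp add: d_def)
  \<comment> \<open>The vectors \<open>(axis i 1 + axis j 1) / 2\<close> and
    \<open>(axis i 1 - axis j 1) / 2\<close>, over all ordered pairs and with weight
    \<open>\<epsilon>\<close> each, have rank-one matrices that add up to
    \<open>d * \<epsilon>\<close> times the identity. This part \<open>\<mu>\<close> of
    \<open>A\<close> is reserved for absorbing the small remainder \<open>E\<close>.\<close>
  define \<epsilon> where "\<epsilon> = \<mu> / d"
  have \<epsilon>: "0 < \<epsilon>" "d * \<epsilon> = \<mu>" using \<mu> d by (auto simp: \<epsilon>_def)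
  have cont: "continuous_on K (\<lambda>x. A x (fst ij) (snd ij))" for ij
    using Ck_on_continuous[OF A open_UNIV] continuous_on_subset by blast
  have e4: "0 < \<epsilon> / 4" using \<epsilon> by simp
  obtain P \<xi> where P: "finite P" "P \<subseteq> K" and \<xi>C: "\<And>p. Ck_on k UNIV (\<xi> p)" and \<xi>0: "\<And>p x. 0 \<le> \<xi> p x"
    and \<xi>1: "\<And>x. (\<Sum>p\<in>P. \<xi> p x) = (1::real)"
    and \<xi>A: "\<And>ij x. x \<in> K \<Longrightarrow> \<bar>\<Sum>p\<in>P. \<xi> p x * (A x (fst ij) (snd ij) - A p (fst ij) (snd ij))\<bar> \<le> \<epsilon> / 4"
    using gaussian_partition[OF K, of "UNIV :: ('d \<times> 'd) set" "\<lambda>ij x. A x (fst ij) (snd ij)" "\<epsilon> / 4" k, OF cont finite e4]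
    by (elim exE conjE) (rule that, auto)
  have "\<exists>s. \<forall>i j. A p i j - \<mu> * of_bool (i = j) = (\<Sum>k\<in>(UNIV::'d set). s k i * s k j)" if p: "p \<in> P" for p
  proof (rule psd_sum_of_squares[of UNIV "\<lambda>i j. A p i j - \<mu> * of_bool (i = j)"])
    show "0 \<le> qform (\<lambda>i j. A p i j - \<mu> * of_bool (i = j)) \<eta>" for \<eta>
    proof -
      have "qform (\<lambda>i j. A p i j - \<mu> * of_bool (i = j)) \<eta>
         = qform (A p) \<eta> - (\<Sum>i\<in>UNIV. \<Sum>j\<in>UNIV. of_bool (i = j) * (\<mu> * (\<eta> i * \<eta> j)))"
        unfolding qform_def sum_subtractf[symmetric] by (intro sum.cong refl) (simp add: algebra_simps)
      also have "(\<Sum>i\<in>UNIV. \<Sum>j\<in>UNIV. of_bool (i = j) * (\<mu> * (\<eta> i * \<eta> j))) = \<mu> * (\<Sum>i\<in>UNIV. (\<eta> i)\<^sup>2)"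
        by (simp only: sum_of_bool_mult sum_distrib_left[symmetric] power2_eq_square)
      finally show ?thesis using ell[of p \<eta>] p P by auto
    qed
  qed (auto simp: sym)
  then have "\<forall>p\<in>P. \<exists>s. \<forall>i j. A p i j - \<mu> * of_bool (i = j) = (\<Sum>k\<in>(UNIV::'d set). s k i * s k j)" ..
  from bchoice[OF this] obtain s where
    s0: "\<forall>p\<in>P. \<forall>i j. A p i j - \<mu> * of_bool (i = j) = (\<Sum>k\<in>(UNIV::'d set). s p k i * s p k j)" ..
  have s: "A p i j = \<mu> * of_bool (i = j) + (\<Sum>k\<in>(UNIV::'d set). s p k i * s p k j)" if "p \<in> P" for p i j
    using s0[rule_format, OF that, of i j] by linarith
  define T where "T i j = (\<Sum>p\<in>P. \<Sum>k\<in>UNIV. s p k i * s p k j)" for i j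
  define Tm where "Tm = (\<Sum>i\<in>UNIV. \<Sum>j\<in>UNIV. \<bar>T i j\<bar>)"
  have Tm: "\<bar>T i j\<bar> \<le> Tm" for i j
  proof -
    have "\<bar>T i j\<bar> \<le> (\<Sum>j\<in>UNIV. \<bar>T i j\<bar>)" by (rule member_le_sum) auto
    also have "\<dots> \<le> Tm" unfolding Tm_def by (rule member_le_sum) (auto intro: sum_nonneg)
    finally show ?thesis .
  qed
  then have Tm0: "0 \<le> Tm" by (meson abs_ge_zero order_trans)
  \<comment> \<open>Of the weights only \<open>0 \<le> \<xi> p x\<close> is known. Adding
    \<open>e'\<close> to each makes them uniformly positive, at the cost of subtracting
    \<open>e' * T i j\<close> from the remainder \<open>E\<close>.\<close>
  define e' where "e' = \<epsilon> / (4 * (Tm + 1))"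
  have e': "0 < e'" "e' * \<bar>T i j\<bar> \<le> \<epsilon> / 4" for i j
  proof -
    show p: "0 < e'" using \<epsilon> Tm0 by (simp add: e'_def)
    have "e' * \<bar>T i j\<bar> \<le> e' * (Tm + 1)" using Tm[of i j] p by (intro mult_left_mono) auto
    also have "\<dots> = \<epsilon> / 4" using Tm0 by (simp add: e'_def field_simps)
    finally show "e' * \<bar>T i j\<bar> \<le> \<epsilon> / 4" .
  qed
  define E where "E x i j = (\<Sum>p\<in>P. \<xi> p x * (A x i j - A p i j)) - e' * T i j" for x i j
  have E_bd: "\<bar>E x i j\<bar> \<le> \<epsilon> / 2" if "x \<in> K" for x i j
  proof -
    have "\<bar>\<Sum>p\<in>P. \<xi> p x * (A x i j - A p i j)\<bar> \<le> \<epsilon> / 4" using \<xi>A[OF that, of "(i, j)"] by simp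
    moreover have "\<bar>e' * T i j\<bar> \<le> \<epsilon> / 4" using e'(1) e'(2)[of i j] by (simp add: abs_mult)
    ultimately show ?thesis unfolding E_def by linarith
  qed
  have T_sym: "T i j = T j i" for i j by (simp add: T_def mult.commute)
  have E_sym: "E x i j = E x j i" for x i j by (simp add: E_def sym[of _ i j] T_sym[of i j])
  have EC: "Ck_on k UNIV (\<lambda>x. E x i j)" for i j
  proof -
    have "Ck_on k UNIV (\<lambda>x. (\<Sum>p\<in>P. \<xi> p x * (A x i j + - A p i j)) + - (e' * T i j))"
      by (intro Ck_on_add Ck_on_sum Ck_on_mult Ck_on_const open_UNIV P(1) \<xi>C A)
    then show ?thesis by (simp add: E_def[abs_def])
  qed
  have decomp: "A x i j = \<mu> * of_bool (i = j) + E x i j + (\<Sum>p\<in>P. \<Sum>k\<in>UNIV. (\<xi> p x + e') * (s p k i * s p k j))" for x i j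
  proof -
    have "A x i j = (\<Sum>p\<in>P. \<xi> p x * A x i j)" by (simp add: sum_distrib_right[symmetric] \<xi>1)
    also have "\<dots> = (\<Sum>p\<in>P. \<xi> p x * (A x i j - A p i j)) + (\<Sum>p\<in>P. \<xi> p x * A p i j)"
      by (simp add: sum.distrib[symmetric] algebra_simps)
    also have "(\<Sum>p\<in>P. \<xi> p x * A p i j) = (\<Sum>p\<in>P. \<xi> p x * (\<mu> * of_bool (i = j)) + \<xi> p x * (\<Sum>k\<in>UNIV. s p k i * s p k j))"
      by (intro sum.cong refl) (simp only: s distrib_left)
    also have "\<dots> = \<mu> * of_bool (i = j) + (\<Sum>p\<in>P. \<xi> p x * (\<Sum>k\<in>UNIV. s p k i * s p k j))"
      by (simp only: sum.distrib sum_distrib_right[symmetric] \<xi>1 mult_1)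
    finally have "A x i j = \<mu> * of_bool (i = j) + E x i j + (e' * T i j + (\<Sum>p\<in>P. \<xi> p x * (\<Sum>k\<in>UNIV. s p k i * s p k j)))"
      unfolding E_def by simp
    also have "e' * T i j + (\<Sum>p\<in>P. \<xi> p x * (\<Sum>k\<in>UNIV. s p k i * s p k j)) = (\<Sum>p\<in>P. \<Sum>k\<in>UNIV. (\<xi> p x + e') * (s p k i * s p k j))"
      unfolding T_def by (simp add: sum_distrib_left sum.distrib[symmetric] algebra_simps)
    finally show ?thesis .
  qed
  \<comment> \<open>\<open>Inl (i, j, t)\<close> carries the absorbing directions with weights
    \<open>\<epsilon>\<close> plus or minus \<open>E x i j\<close>: their diagonal products give the
    identity, their mixed products give \<open>E\<close>. For \<open>i = j\<close> they are the
    basis vector (\<open>True\<close>) and the zero vector (\<open>False\<close>), which contributes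
    nothing. \<open>Inr (p, k)\<close> carries the squares of the matrix frozen at \<open>p\<close>,
    reduced by \<open>\<mu>\<close> times the identity.\<close>
  define v where "v z = (case z of Inl (i, j, t) \<Rightarrow> (1/2) *\<^sub>R (axis i 1 + (if t then 1 else -1) *\<^sub>R axis j 1)
     | Inr (p, k) \<Rightarrow> (\<chi> a. s p k a))" for z :: "'d \<times> 'd \<times> bool + (real^'d) \<times> 'd"
  define w where "w z x = (case z of Inl (i, j, t) \<Rightarrow> \<epsilon> + (if t then 1 else -1) * E x i j | Inr (p, k) \<Rightarrow> \<xi> p x + e')"
    for z :: "'d \<times> 'd \<times> bool + (real^'d) \<times> 'd" and x
  define J where "J = ((UNIV :: ('d \<times> 'd \<times> bool) set) <+> (P \<times> (UNIV :: 'd set)))"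
  have main: "A x a b = (\<Sum>z\<in>J. w z x * (v z $ a * v z $ b))" for x a b
  proof -
    have cross: "(\<Sum>t\<in>(UNIV::bool set). w (Inl (i, j, t)) x * (v (Inl (i, j, t)) $ a * v (Inl (i, j, t)) $ b))
       = of_bool (i = a) * (of_bool (i = b) * (\<epsilon> / 2)) + of_bool (j = a) * (of_bool (j = b) * (\<epsilon> / 2))
         + of_bool (i = a) * (of_bool (j = b) * (E x i j / 2)) + of_bool (j = a) * (of_bool (i = b) * (E x i j / 2))" for i j
      by (simp add: UNIV_bool w_def v_def axis_def field_simps)
    have "(\<Sum>z\<in>(UNIV :: ('d \<times> 'd \<times> bool) set). w (Inl z) x * (v (Inl z) $ a * v (Inl z) $ b))
       = (\<Sum>i\<in>UNIV. \<Sum>j\<in>UNIV. \<Sum>t\<in>(UNIV::bool set). w (Inl (i, j, t)) x * (v (Inl (i, j, t)) $ a * v (Inl (i, j, t)) $ b))"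
      by (simp add: sum.cartesian_product UNIV_Times_UNIV[symmetric] case_prod_unfold del: UNIV_Times_UNIV)
    also have "\<dots> = \<mu> * of_bool (a = b) + E x a b"
      unfolding cross sum.distrib
      by (simp only: sum_distrib_left[symmetric] sum_of_bool_mult sum_constant)
        (simp add: E_sym[of x b a] \<epsilon>(2)[symmetric] d_def)
    finally have 1: "(\<Sum>z\<in>(UNIV :: ('d \<times> 'd \<times> bool) set). w (Inl z) x * (v (Inl z) $ a * v (Inl z) $ b)) = \<mu> * of_bool (a = b) + E x a b" .
    have 2: "(\<Sum>z\<in>P \<times> UNIV. w (Inr z) x * (v (Inr z) $ a * v (Inr z) $ b)) = (\<Sum>p\<in>P. \<Sum>k\<in>UNIV. (\<xi> p x + e') * (s p k a * s p k b))"
      unfolding sum.cartesian_product by (intro sum.cong refl) (auto simp: w_def v_def)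
    show ?thesis unfolding J_def using P(1) decomp[of x a b] 1 2 by (subst sum.Plus) auto
  qed
  show ?thesis
  proof (rule exI[of _ J], rule exI[of _ v], rule exI[of _ w], rule exI[of _ "min (\<epsilon> / 2) e'"], intro conjI ballI allI main)
    show "finite J" using P(1) by (simp add: J_def)
    show "0 < min (\<epsilon> / 2) e'" using \<epsilon> e' by simp
  next
    fix z assume "z \<in> J"
    have "Ck_on k UNIV (w (Inl (i, j, t)))" for i j t
    proof -
      have "w (Inl (i, j, t)) = (\<lambda>x. \<epsilon> + (if t then 1 else -1) * E x i j)" by (rule ext) (simp add: w_def)
      moreover have "Ck_on k UNIV (\<lambda>x. \<epsilon> + (if t then 1 else -1) * E x i j)"
        by (intro Ck_on_add Ck_on_mult Ck_on_const open_UNIV EC)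
      ultimately show ?thesis by simp
    qed
    moreover have "Ck_on k UNIV (w (Inr (p, k')))" for p k'
      unfolding w_def[abs_def] by (simp del: Ck_on.simps) (intro Ck_on_add Ck_on_const open_UNIV \<xi>C)
    ultimately show "Ck_on k UNIV (w z)" by (cases z) auto
    fix x assume x: "x \<in> K"
    have "min (\<epsilon> / 2) e' \<le> w (Inl (i, j, t)) x" for i j t
      using E_bd[OF x, of i j] by (auto simp: w_def)
    moreover have "min (\<epsilon> / 2) e' \<le> w (Inr (p, k')) x" for p k'
      using \<xi>0[of p x] by (auto simp: w_def)
    ultimately show "min (\<epsilon> / 2) e' \<le> w z x" by (cases z) auto
  next
    fix i show "\<exists>z\<in>J. v z = axis i 1"
      by (rule bexI[of _ "Inl (i, i, True)"]) (auto simp: v_def J_def scaleR_2[symmetric])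
  qed
qed

section \<open>The Dirichlet problem for the generator\<close>

lemma dd_linear:
  assumes "Ck_on (Suc k) S u" "open S" "x \<in> S"
  shows "linear (\<lambda>v. dd v u x)"
  using has_derivative_linear[OF Ck_on_has_derivative[OF assms]] .

lemma dd_eq_sum_pd:
  fixes u :: "real^'d::finite \<Rightarrow> real"
  assumes "Ck_on (Suc k) S u" "open S" "x \<in> S"
  shows "dd l u x = (\<Sum>i\<in>UNIV. l $ i * pd i u x)"
proof -
  have "dd l u x = dd (\<Sum>i\<in>UNIV. (l $ i) *\<^sub>R axis i 1) u x"
    by (simp add: basis_expansion scalar_mult_eq_scaleR[symmetric])
  also have "\<dots> = (\<Sum>i\<in>UNIV. l $ i * pd i u x)"
    using dd_linear[OF assms] by (simp add: linear_sum linear_cmul pd_def)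
  finally show ?thesis .
qed

lemma symmetric_scheme:
  fixes A :: "real^'d::finite \<Rightarrow> 'd \<Rightarrow> 'd \<Rightarrow> real" and b :: "real^'d \<Rightarrow> real^'d"
  assumes A: "\<And>i j. Ck_on k UNIV (\<lambda>x. A x i j)" and sym: "\<And>x i j. A x i j = A x j i"
    and b: "\<And>i. Ck_on k UNIV (\<lambda>x. b x $ i)"
    and K: "compact K" "K \<noteq> {}" and \<mu>: "0 < \<mu>"
    and ell: "\<And>x \<eta>. x \<in> K \<Longrightarrow> \<mu> * (\<Sum>i\<in>UNIV. (\<eta> i)\<^sup>2) \<le> qform (A x) \<eta>"
  shows "\<exists>\<Lambda> cc bb \<theta>. diff_scheme \<Lambda> cc bb \<and> Basis \<subseteq> \<Lambda> \<and> 0 < \<theta> \<and>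
    (\<forall>l. Ck_on k UNIV (cc l) \<and> Ck_on k UNIV (bb l)) \<and> (\<forall>l\<in>\<Lambda>. \<forall>x\<in>K. \<theta> \<le> cc l x) \<and>
    (\<forall>x\<in>K. (\<forall>i j. A x i j = (\<Sum>l\<in>\<Lambda>. 1 / 2 * cc l x * (l $ i * l $ j))) \<and> (\<forall>i. b x $ i = (\<Sum>l\<in>\<Lambda>. bb l x * l $ i)))"
proof -
  obtain J :: "('d \<times> 'd \<times> bool + (real^'d) \<times> 'd) set" and v w w0 where
    J: "finite J" "0 < w0" "\<forall>j\<in>J. Ck_on k UNIV (w j)" "\<forall>j\<in>J. \<forall>x\<in>K. w0 \<le> w j x"
     "\<forall>x\<in>K. \<forall>a b. A x a b = (\<Sum>j\<in>J. w j x * (v j $ a * v j $ b))" "\<forall>i. \<exists>j\<in>J. v j = axis i 1"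
  proof -
    have "\<exists>J v w w0. finite (J :: ('d \<times> 'd \<times> bool + (real^'d) \<times> 'd) set) \<and> 0 < w0 \<and>
      (\<forall>j\<in>J. Ck_on k UNIV (w j)) \<and> (\<forall>j\<in>J. \<forall>x\<in>K. w0 \<le> w j x) \<and>
      (\<forall>x\<in>K. \<forall>a b. A x a b = (\<Sum>j\<in>J. w j x * (v j $ a * v j $ b))) \<and> (\<forall>i. \<exists>j\<in>J. v j = axis i 1)"
      by (rule rank_one_decomposition[OF A sym K \<mu>]) (rule ell)
    then show thesis by (elim exE conjE) (rule that)
  qed
  define \<Lambda> where "\<Lambda> = v ` J \<union> (\<lambda>j. - v j) ` J"
  \<comment> \<open>Different indices may give equal or opposite vectors, so the weights of all
    \<open>j\<close> with \<open>v j = l\<close> or \<open>- v j = l\<close> are added. This makes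
    \<open>cc\<close> even, and the factor \<open>1 / 2\<close> in the limiting operator compensates
    for counting both signs.\<close>
  define cc where "cc l x = (\<Sum>j\<in>J. w j x * (of_bool (v j = l) + of_bool (- v j = l)))" for l x
  \<comment> \<open>Half of each drift component sits on \<open>axis i 1\<close> and minus half on
    \<open>- axis i 1\<close>, the odd distribution that the scheme requires.\<close>
  define bb where "bb l x = (\<Sum>i\<in>UNIV. b x $ i * (1/2 * (of_bool (axis i 1 = l) - of_bool (- axis i 1 = l))))" for l :: "real^'d" and x
  have fin: "finite \<Lambda>" using J(1) by (simp add: \<Lambda>_def)
  have ax: "axis i 1 \<in> \<Lambda>" "- axis i 1 \<in> \<Lambda>" for i
  proof -
    obtain j where j: "j \<in> J" "v j = axis i 1" using J(6) by blast
    have "v j \<in> \<Lambda>" "- v j \<in> \<Lambda>" using j(1) by (auto simp: \<Lambda>_def)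
    then show "axis i 1 \<in> \<Lambda>" "- axis i 1 \<in> \<Lambda>" unfolding j(2) .
  qed
  have neg_eq: "(- a = - l) = (a = l)" "(a = - l) = (- a = l)" for a l :: "real^'d"
    by (metis minus_minus)+
  have scheme: "diff_scheme \<Lambda> cc bb"
  proof
    show "finite \<Lambda>" by (rule fin)
    show "- l \<in> \<Lambda>" if "l \<in> \<Lambda>" for l using that by (auto simp: \<Lambda>_def)
    show "cc (- l) x = cc l x" for l x unfolding cc_def neg_eq by (simp add: add.commute)
    show "bb (- l) x = - bb l x" for l x
      unfolding bb_def neg_eq sum_negf[symmetric] by (intro sum.cong refl) simp
  qed
  have B: "Basis \<subseteq> \<Lambda>" using ax by (auto simp: Basis_vec_def)
  have C: "Ck_on k UNIV (cc l)" "Ck_on k UNIV (bb l)" for l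
  proof -
    show "Ck_on k UNIV (cc l)" unfolding cc_def[abs_def] using J(1,3)
      by (intro Ck_on_sum Ck_on_mult Ck_on_const open_UNIV) auto
    show "Ck_on k UNIV (bb l)" unfolding bb_def[abs_def]
      by (intro Ck_on_sum Ck_on_mult Ck_on_const open_UNIV b finite)
  qed
  have low: "w0 \<le> cc l x" if l: "l \<in> \<Lambda>" and x: "x \<in> K" for l x
  proof -
    obtain j where j: "j \<in> J" "v j = l \<or> - v j = l" using l by (auto simp: \<Lambda>_def)
    have wn: "0 \<le> w i x" if "i \<in> J" for i using J(2,4) that x by (meson less_imp_le order_trans)
    have "w0 \<le> w j x" using J(4) j x by blast
    also have "\<dots> \<le> w j x * (of_bool (v j = l) + of_bool (- v j = l))"
      using j(2) wn[OF j(1)] by (auto simp: of_bool_def)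
    also have "\<dots> \<le> cc l x" unfolding cc_def
      by (rule member_le_sum[OF j(1) _ J(1)]) (use wn in auto)
    finally show ?thesis .
  qed
  have delta: "(\<Sum>l\<in>\<Lambda>. of_bool (a = l) * g l) = g a" if "a \<in> \<Lambda>" for a and g :: "real^'d \<Rightarrow> real"
  proof -
    have "(\<Sum>l\<in>\<Lambda>. of_bool (a = l) * g l) = (\<Sum>l\<in>\<Lambda>. if a = l then g l else 0)" by (intro sum.cong) auto
    then show ?thesis using fin that by simp
  qed
  have csum: "(\<Sum>l\<in>\<Lambda>. cc l x * g l) = (\<Sum>j\<in>J. w j x * (g (v j) + g (- v j)))" for g x
  proof -
    have "(\<Sum>l\<in>\<Lambda>. cc l x * g l) = (\<Sum>j\<in>J. \<Sum>l\<in>\<Lambda>. w j x * (of_bool (v j = l) * g l + of_bool (- v j = l) * g l))"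
      unfolding cc_def sum_distrib_right by (subst sum.swap) (simp add: algebra_simps)
    also have "\<dots> = (\<Sum>j\<in>J. w j x * (g (v j) + g (- v j)))"
    proof (intro sum.cong refl)
      fix j assume "j \<in> J"
      then have "v j \<in> \<Lambda>" "- v j \<in> \<Lambda>" by (auto simp: \<Lambda>_def)
      then show "(\<Sum>l\<in>\<Lambda>. w j x * (of_bool (v j = l) * g l + of_bool (- v j = l) * g l)) = w j x * (g (v j) + g (- v j))"
        unfolding sum_distrib_left[symmetric] sum.distrib by (simp only: delta)
    qed
    finally show ?thesis .
  qed
  have bsum: "(\<Sum>l\<in>\<Lambda>. bb l x * g l) = (\<Sum>i\<in>UNIV. b x $ i * (1/2 * (g (axis i 1) - g (- axis i 1))))" for g x
  proof -
    have "(\<Sum>l\<in>\<Lambda>. bb l x * g l) = (\<Sum>i\<in>UNIV. \<Sum>l\<in>\<Lambda>. b x $ i * (1/2 * (of_bool (axis i 1 = l) * g l - of_bool (- axis i 1 = l) * g l)))"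
      unfolding bb_def sum_distrib_right by (subst sum.swap) (simp add: algebra_simps)
    also have "\<dots> = (\<Sum>i\<in>UNIV. b x $ i * (1/2 * (g (axis i 1) - g (- axis i 1))))"
      unfolding sum_distrib_left[symmetric] sum_subtractf by (simp only: delta ax)
    finally show ?thesis .
  qed
  have "A x i j = (\<Sum>l\<in>\<Lambda>. 1 / 2 * cc l x * (l $ i * l $ j))" if "x \<in> K" for x i j
  proof -
    have "(\<Sum>l\<in>\<Lambda>. 1 / 2 * cc l x * (l $ i * l $ j)) = (\<Sum>l\<in>\<Lambda>. cc l x * (1 / 2 * (l $ i * l $ j)))"
      by (simp add: mult_ac)
    also have "\<dots> = A x i j" unfolding csum using J(5) that by simp
    finally show ?thesis ..
  qed
  moreover have "b x $ i = (\<Sum>l\<in>\<Lambda>. bb l x * l $ i)" for x i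
  proof -
    have "(\<Sum>l\<in>\<Lambda>. bb l x * l $ i) = (\<Sum>j\<in>UNIV. of_bool (j = i) * (b x $ j))"
      unfolding bsum by (intro sum.cong refl) (simp add: axis_def of_bool_def)
    then show ?thesis by (simp only: sum_of_bool_mult)
  qed
  ultimately show ?thesis using scheme B J(2) C low
    by (intro exI[of _ \<Lambda>] exI[of _ cc] exI[of _ bb] exI[of _ w0]) blast
qed

theorem theorem2p7:
  fixes \<sigma> :: "real^'d::finite \<Rightarrow> real^'m::finite^'d"
    and b :: "real^'d \<Rightarrow> real^'d"
    and M :: "real^'d \<Rightarrow> 'w measure"
    and X :: "real^'d \<Rightarrow> real \<Rightarrow> 'w \<Rightarrow> real^'d"
    and \<pi> :: "(real^'d) measure"
    and V :: "real^'d \<Rightarrow> real"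
    and D :: "(real^'d) set"
    and c0 :: "real^'d \<Rightarrow> real"
  assumes sigma_C3: "Ck_on 3 UNIV \<sigma>"
    and b_C3: "Ck_on 3 UNIV b"
    and sde: "solves_sde \<sigma> b M X"
    and elliptic: "uniformly_elliptic_on D (diff_mat \<sigma>)"
    and inv: "invariant_prob M X \<pi>"
    and V_meas: "V \<in> borel_measurable borel"
    and V_ge1: "\<forall>x. 1 \<le> V x"
    and ergodic: "geom_ergodic M X \<pi> V"
    and V2: "integrable \<pi> (\<lambda>x. (V x)\<^sup>2)"
    and D_open: "open D" and D_conn: "connected D" and D_ne: "D \<noteq> {}"
    and D_bdd: "bounded D" and D_C4: "C4_boundary D"
    and c0_C3: "Ck_on 3 UNIV c0"
    and a: "(\<integral>x. indicator D x * c0 x \<partial>\<pi>) < 0"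
    and F_bd: "\<forall>x. \<bar>c0 x * indicator D x - (\<integral>y. indicator D y * c0 y \<partial>\<pi>)\<bar> \<le> 1"
    and asvar: "\<exists>s2>0. \<forall>x. ((\<lambda>t. prob_space.variance (M x)
                 (\<lambda>\<omega>. (LINT s:{0..t}|lborel.
                     c0 (X x s \<omega>) * indicator D (X x s \<omega>) - (\<integral>y. indicator D y * c0 y \<partial>\<pi>))
                   / sqrt t)) \<longlongrightarrow> s2) at_top"
  shows "\<exists>\<alpha>0>0. \<forall>\<alpha> f \<psi>. 0 < \<alpha> \<and> \<alpha> < \<alpha>0 \<and>
            Ck_on 2 UNIV f \<and> bounded (range f) \<and> (\<forall>x. f x < 0) \<and>
            Ck_on 2 UNIV \<psi> \<and> (\<forall>x. 0 < \<psi> x) \<longrightarrow>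
            (\<exists>u::real^'d \<Rightarrow> real. Ck_on 2 D u \<and> continuous_on (closure D) u \<and>
               (\<forall>x\<in>D. gen \<sigma> b u x + \<alpha> * c0 x * u x = f x) \<and>
               (\<forall>x\<in>frontier D. u x = \<psi> x) \<and>
               (\<forall>x\<in>closure D. 0 < u x))"
proof -
  define A where "A x i j = diff_mat \<sigma> x $ i $ j" for x i j
  have A_eq: "A x i j = 1/2 * (\<Sum>k\<in>UNIV. \<sigma> x $ i $ k * \<sigma> x $ j $ k)" for x i j
    by (simp add: A_def diff_mat_def matrix_matrix_mult_def transpose_def)
  have "bounded_linear (\<lambda>M :: real^'m^'d. M $ i $ k)" for i k
    using bounded_linear_compose[OF bounded_linear_vec_nth bounded_linear_vec_nth] .
  then have sC: "Ck_on 3 UNIV (\<lambda>x. \<sigma> x $ i $ k)" for i k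
    by (rule Ck_on_linear_comp[OF _ open_UNIV sigma_C3])
  have AC: "Ck_on 3 UNIV (\<lambda>x. A x i j)" for i j
    unfolding A_eq by (intro Ck_on_mult Ck_on_const Ck_on_sum finite sC open_UNIV)
  have Asym: "A x i j = A x j i" for x i j by (simp add: A_eq mult.commute)
  have bC: "Ck_on 3 UNIV (\<lambda>x. b x $ i)" for i
    by (rule Ck_on_linear_comp[OF bounded_linear_vec_nth open_UNIV b_C3])
  have cD: "compact (closure D)" using D_bdd by simp
  have cDne: "closure D \<noteq> {}" using D_ne closure_subset by blast
  obtain \<mu> where \<mu>: "0 < \<mu>" and ellD: "\<And>x \<eta>. x \<in> D \<Longrightarrow> \<mu> * (norm \<eta>)\<^sup>2 \<le> (\<Sum>i\<in>UNIV. \<Sum>j\<in>UNIV. A x i j * \<eta> $ i * \<eta> $ j)"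
    using elliptic unfolding uniformly_elliptic_on_def A_def by blast
  \<comment> \<open>Ellipticity is given on \<open>D\<close>, whereas the decomposition needs a
    compact set on which the weights stay positive; the inequality passes to the closure by
    continuity.\<close>
  have ell: "\<mu> * (\<Sum>i\<in>UNIV. (\<eta> i)\<^sup>2) \<le> qform (A x) \<eta>" if x: "x \<in> closure D" for x \<eta>
  proof -
    have "continuous_on UNIV (\<lambda>x. A x i j)" for i j using Ck_on_continuous[OF AC open_UNIV] .
    then have "continuous_on UNIV (\<lambda>x. qform (A x) \<eta>)" unfolding qform_def by (intro continuous_intros)
    then have "closed {x. \<mu> * (\<Sum>i\<in>UNIV. (\<eta> i)\<^sup>2) \<le> qform (A x) \<eta>}"
      by (intro closed_Collect_le continuous_on_const)
    moreover have "D \<subseteq> {x. \<mu> * (\<Sum>i\<in>UNIV. (\<eta> i)\<^sup>2) \<le> qform (A x) \<eta>}"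
    proof
      fix x assume "x \<in> D"
      from ellD[OF this, of "\<chi> i. \<eta> i"] show "x \<in> {x. \<mu> * (\<Sum>i\<in>UNIV. (\<eta> i)\<^sup>2) \<le> qform (A x) \<eta>}"
        by (simp add: qform_def norm_vec_def L2_set_def sum_nonneg)
    qed
    ultimately show ?thesis using x closure_minimal by blast
  qed
  obtain \<Lambda> cc bb \<theta> where sch: "diff_scheme \<Lambda> cc bb" and "Basis \<subseteq> \<Lambda>" and \<theta>: "0 < \<theta>"
    and CC: "\<forall>l. Ck_on 3 UNIV (cc l) \<and> Ck_on 3 UNIV (bb l)" and low: "\<forall>l\<in>\<Lambda>. \<forall>x\<in>closure D. \<theta> \<le> cc l x"
    and dec: "\<forall>x\<in>closure D. (\<forall>i j. A x i j = (\<Sum>l\<in>\<Lambda>. 1 / 2 * cc l x * (l $ i * l $ j))) \<and> (\<forall>i. b x $ i = (\<Sum>l\<in>\<Lambda>. bb l x * l $ i))"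
  proof -
    have "\<exists>\<Lambda> cc bb \<theta>. diff_scheme \<Lambda> cc bb \<and> Basis \<subseteq> \<Lambda> \<and> 0 < \<theta> \<and>
      (\<forall>l. Ck_on 3 UNIV (cc l) \<and> Ck_on 3 UNIV (bb l)) \<and> (\<forall>l\<in>\<Lambda>. \<forall>x\<in>closure D. \<theta> \<le> cc l x) \<and>
      (\<forall>x\<in>closure D. (\<forall>i j. A x i j = (\<Sum>l\<in>\<Lambda>. 1 / 2 * cc l x * (l $ i * l $ j))) \<and> (\<forall>i. b x $ i = (\<Sum>l\<in>\<Lambda>. bb l x * l $ i)))"
      by (rule symmetric_scheme[OF AC Asym bC cD cDne \<mu>]) (rule ell)
    then show thesis by (elim exE conjE) (rule that)
  qed
  interpret diff_scheme \<Lambda> cc bb by (rule sch)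
  interpret dirichlet_scheme \<Lambda> cc bb D \<theta>
  proof
    show "Basis \<subseteq> \<Lambda>" "0 < \<theta>" "open D" "bounded D" by fact+
    show "Ck_on 3 UNIV (cc l)" "Ck_on 3 UNIV (bb l)" for l using CC by blast+
    show "\<theta> \<le> cc l x" if "l \<in> \<Lambda>" "x \<in> D" for l x using low that closure_subset by blast
    show "\<exists>r>0. \<exists>\<rho>::real^'d \<Rightarrow> real. Ck_on 2 (ball p r) \<rho> \<and> (\<exists>i\<in>Basis. dd i \<rho> p \<noteq> 0) \<and> D \<inter> ball p r = {x \<in> ball p r. \<rho> x < 0}"
      if p: "p \<in> frontier D" for p
    proof -
      obtain r and \<rho> :: "real^'d \<Rightarrow> real" where r: "0 < r" and \<rho>: "Ck_on 4 (ball p r) \<rho>"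
        and nz: "\<forall>x\<in>ball p r. frechet_derivative \<rho> (at x) \<noteq> (\<lambda>v. 0)" and eq: "D \<inter> ball p r = {x\<in>ball p r. \<rho> x < 0}"
        using D_C4 p unfolding C4_boundary_def by blast
      have \<rho>2: "Ck_on 2 (ball p r) \<rho>" by (rule Ck_on_le[OF \<rho> open_ball]) simp
      then have \<rho>2': "Ck_on (Suc 1) (ball p r) \<rho>" by (simp add: numeral_2_eq_2)
      have "\<exists>i\<in>Basis. dd i \<rho> p \<noteq> 0"
      proof (rule ccontr)
        assume "\<not> ?thesis"
        then have "frechet_derivative \<rho> (at p) = (\<lambda>v. 0)"
          using dd_linear[OF \<rho>2' open_ball, of p] r linear_eq_stdbasis[of "frechet_derivative \<rho> (at p)" "\<lambda>v. 0"]
          by (auto simp: linear_zero)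
        then show False using nz r by auto
      qed
      then show ?thesis using r \<rho>2 eq by blast
    qed
  qed
  obtain S s Sm where S: "0 < s" "\<forall>\<^sub>F h in at_right 0. \<forall>x\<in>D. Lh h S x \<le> -1 \<and> s \<le> S x \<and> S x \<le> Sm \<and>
     (\<forall>l\<in>\<Lambda>. s \<le> S (x + h *\<^sub>R l))" using supersolution by blast
  have "continuous_on (closure D) c0" using Ck_on_continuous[OF c0_C3] continuous_on_subset by blast
  then have "bounded (c0 ` closure D)" using cD by (intro compact_imp_bounded compact_continuous_image)
  then obtain Q where Q: "0 < Q" "\<And>x. x \<in> closure D \<Longrightarrow> \<bar>c0 x\<bar> \<le> Q" unfolding bounded_pos by auto
  \<comment> \<open>With \<open>Q\<close> a bound for \<open>\<bar>c0 x\<bar>\<close> on the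
    closure, \<open>\<alpha> < \<alpha>0\<close> gives
    \<open>\<bar>\<alpha> * c0 x\<bar> * Sm \<le> 1 / 2\<close>. The absolute value and the added 1
    avoid a case distinction on \<open>Sm\<close>.\<close>
  define \<alpha>0 where "\<alpha>0 = 1 / (2 * Q * (\<bar>Sm\<bar> + 1))"
  have \<alpha>0: "0 < \<alpha>0" using Q by (simp add: \<alpha>0_def add_nonneg_pos)
  show ?thesis
  proof (rule exI[of _ \<alpha>0], rule conjI[OF \<alpha>0], intro allI impI)
    fix \<alpha> and f \<psi> :: "real^'d \<Rightarrow> real"
    assume asm: "0 < \<alpha> \<and> \<alpha> < \<alpha>0 \<and> Ck_on 2 UNIV f \<and> bounded (range f) \<and> (\<forall>x. f x < 0) \<and>
            Ck_on 2 UNIV \<psi> \<and> (\<forall>x. 0 < \<psi> x)"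
    obtain Fb where Fb: "\<And>x. \<bar>f x\<bar> \<le> Fb" using asm unfolding bounded_iff by auto
    interpret dirichlet_problem \<Lambda> cc bb D \<theta> "\<lambda>x. \<alpha> * c0 x" f \<psi> S s Sm Fb
    proof
      show "Ck_on 3 UNIV (\<lambda>x. \<alpha> * c0 x)" by (intro Ck_on_mult Ck_on_const open_UNIV c0_C3)
      show "Ck_on 2 UNIV f" "f x < 0" "0 < \<psi> x" for x using asm by blast+
      show "continuous_on UNIV \<psi>" using asm Ck_on_continuous[OF _ open_UNIV] by blast
      show "- Fb \<le> f x" for x using Fb[of x] by linarith
      show "0 < s" by (rule S(1))
      show "\<forall>\<^sub>F h in at_right 0. \<forall>x\<in>D. Lh h S x \<le> -1 \<and> s \<le> S x \<and> S x \<le> Sm \<and>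
         (\<forall>l\<in>\<Lambda>. s \<le> S (x + h *\<^sub>R l))" by (rule S(2))
      fix x assume "x \<in> D"
      then have "\<bar>c0 x\<bar> \<le> Q" using Q closure_subset by blast
      then have "\<bar>\<alpha> * c0 x\<bar> * Sm \<le> \<alpha>0 * Q * (\<bar>Sm\<bar> + 1)"
        unfolding abs_mult using asm \<alpha>0 Q(1)
        by (intro order_trans[OF mult_left_mono[of Sm "\<bar>Sm\<bar> + 1"]] mult_right_mono mult_mono) auto
      also have "\<dots> = (2 * Q * (\<bar>Sm\<bar> + 1)) * \<alpha>0 / 2" by simp
      also have "\<dots> = 1 / 2" using \<alpha>0 unfolding \<alpha>0_def by (subst times_divide_eq_right) auto
      finally show "\<bar>\<alpha> * c0 x\<bar> * Sm \<le> 1 / 2" .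
    qed
    obtain u where u: "Ck_on 2 D u" "continuous_on (closure D) u" "\<forall>x\<in>D. limit_op u x + \<alpha> * c0 x * u x = f x"
      "\<forall>x\<in>frontier D. u x = \<psi> x" "\<forall>x\<in>closure D. 0 < u x" using classical_solution by blast
    have u2: "Ck_on (Suc (Suc 0)) D u" using u(1) by (simp add: numeral_2_eq_2)
    \<comment> \<open>The inner directional derivative is expanded into partial derivatives first,
      so that the order in \<open>pd i (pd j u)\<close> is the one of \<open>gen\<close> and mixed
      derivatives need not be interchanged. Exchanging the sums then inserts the decompositions of
      \<open>A\<close> and \<open>b\<close>.\<close>
    have "gen \<sigma> b u x = limit_op u x" if x: "x \<in> D" for x
    proof -
      have xc: "x \<in> closure D" using x closure_subset by blast
      have d1: "dd l u y = (\<Sum>i\<in>UNIV. l $ i * pd i u y)" if "y \<in> D" for l y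
        by (rule dd_eq_sum_pd[OF u2 D_open that])
      have d2: "dd l (\<lambda>y. dd l u y) x = (\<Sum>i\<in>UNIV. \<Sum>j\<in>UNIV. (l $ i * l $ j) * pd i (pd j u) x)" for l
      proof -
        have p1: "Ck_on (Suc 0) D (pd j u)" for j
          unfolding pd_def[abs_def] by (rule Ck_on_dd[OF u2])
        have der: "((\<lambda>y. \<Sum>j\<in>UNIV. l $ j * pd j u y) has_derivative (\<lambda>v. \<Sum>j\<in>UNIV. l $ j * dd v (pd j u) x)) (at x)"
          by (intro has_derivative_sum has_derivative_mult_right Ck_on_has_derivative[OF p1 D_open x])
        have "dd l (\<lambda>y. dd l u y) x = dd l (\<lambda>y. \<Sum>j\<in>UNIV. l $ j * pd j u y) x"
          by (rule dd_cong[OF D_open x]) (rule d1)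
        also have "\<dots> = (\<Sum>j\<in>UNIV. l $ j * dd l (pd j u) x)"
          using fun_cong[OF frechet_derivative_at[OF der], of l] by simp
        also have "\<dots> = (\<Sum>j\<in>UNIV. l $ j * (\<Sum>i\<in>UNIV. l $ i * pd i (pd j u) x))"
          by (simp only: dd_eq_sum_pd[OF p1 D_open x])
        also have "\<dots> = (\<Sum>i\<in>UNIV. \<Sum>j\<in>UNIV. (l $ i * l $ j) * pd i (pd j u) x)"
          unfolding sum_distrib_left by (subst sum.swap) (simp add: mult_ac)
        finally show ?thesis .
      qed
      have 1: "(\<Sum>i\<in>UNIV. \<Sum>j\<in>UNIV. A x i j * pd i (pd j u) x) = (\<Sum>l\<in>\<Lambda>. 1 / 2 * cc l x * dd l (\<lambda>y. dd l u y) x)"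
      proof -
        have "(\<Sum>l\<in>\<Lambda>. 1 / 2 * cc l x * dd l (\<lambda>y. dd l u y) x)
          = (\<Sum>l\<in>\<Lambda>. \<Sum>i\<in>UNIV. \<Sum>j\<in>UNIV. 1 / 2 * cc l x * (l $ i * l $ j) * pd i (pd j u) x)"
          unfolding d2 sum_distrib_left by (simp only: mult.assoc)
        also have "\<dots> = (\<Sum>i\<in>UNIV. \<Sum>j\<in>UNIV. \<Sum>l\<in>\<Lambda>. 1 / 2 * cc l x * (l $ i * l $ j) * pd i (pd j u) x)"
          by (subst sum.swap) (intro sum.cong refl sum.swap)
        also have "\<dots> = (\<Sum>i\<in>UNIV. \<Sum>j\<in>UNIV. A x i j * pd i (pd j u) x)"
          unfolding sum_distrib_right[symmetric] using dec xc by simp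
        finally show ?thesis ..
      qed
      have 2: "(\<Sum>i\<in>UNIV. b x $ i * pd i u x) = (\<Sum>l\<in>\<Lambda>. bb l x * dd l u x)"
      proof -
        have "(\<Sum>l\<in>\<Lambda>. bb l x * dd l u x) = (\<Sum>l\<in>\<Lambda>. \<Sum>i\<in>UNIV. bb l x * l $ i * pd i u x)"
          unfolding d1[OF x] sum_distrib_left by (simp only: mult.assoc)
        also have "\<dots> = (\<Sum>i\<in>UNIV. \<Sum>l\<in>\<Lambda>. bb l x * l $ i * pd i u x)" by (rule sum.swap)
        also have "\<dots> = (\<Sum>i\<in>UNIV. b x $ i * pd i u x)"
          unfolding sum_distrib_right[symmetric] using dec xc by simp
        finally show ?thesis ..
      qed
      show ?thesis unfolding gen_def A_def[symmetric] 1 2 limit_op_def sum.distrib ..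
    qed
    then show "\<exists>u::real^'d \<Rightarrow> real. Ck_on 2 D u \<and> continuous_on (closure D) u \<and>
               (\<forall>x\<in>D. gen \<sigma> b u x + \<alpha> * c0 x * u x = f x) \<and>
               (\<forall>x\<in>frontier D. u x = \<psi> x) \<and>
               (\<forall>x\<in>closure D. 0 < u x)"
      using u by (intro exI[of _ u]) simp
  qed
qed

end
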